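(* For a $7\times 7$ complex matrix $N=(n_{ij})$ let $A_N$ be the algebra over $\mathbb{C}$ with basis $\{x_1,\dots,x_8\}$ whose products are $[x_i,x_j]=n_{ij}x_8$ for $1\le i,j\le 7$ and $[x_8,x_i]=[x_i,x_8]=0$ for $1\le i\le 8$. Every non-split, non-Lie, nilpotent (left) Leibniz algebra $A$ over $\mathbb{C}$ of dimension $8$ with $\dim(A^2)=1$ is isomorphic to $A_N$ for some matrix $N$ in the following list of $74$ entries, and the $74$ entries give $74$ isomorphism classes of such algebras, one corresponding to each entry (where an entry containing blocks $B_{2k}$ stands for the family obtained by letting the parameter $c$ of each such block range independently over $\mathbb{C}\setminus\{1,-1\}$); that is, each $A_N$ with $N$ in the list is such an algebra, and algebras $A_N$ coming from different entries are not isomorphic. Here $1$ denotes the $1\times1$ matrix $(1)$, $1^{m}$ denotes $1\oplus\cdots\oplus 1$ ($m$ summands), and the matrices $A_{2k+1},B_{2k},C_{2k+1},D_{2k},E_{2k},F_{2k}$ are defined in the context. 7: $A_7,\ C_7$. 6+1: $B_6\oplus1,\ E_6\oplus1,\ F_6\oplus1$. 5+2: $A_5\oplus F_2,\ A_5\oplus E_2,\ A_5\oplus B_2,\ C_5\oplus F_2,\ C_5\oplus E_2,\ C_5\oplus B_2$. 5+1+1: $A_5\oplus1^2,\ C_5\oplus1^2$. 4+3: $B_4\oplus A_3,\ B_4\oplus C_3,\ D_4\oplus A_3,\ D_4\oplus C_3,\ E_4\oplus A_3,\ E_4\oplus C_3$. 4+2+1: $B_4\oplus F_2\oplus1,\ B_4\oplus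 E_2\oplus1,\ B_4\oplus B_2\oplus1,\ D_4\oplus F_2\oplus1,\ D_4\oplus E_2\oplus1,\ D_4\oplus B_2\oplus1,\ E_4\oplus F_2\oplus1,\ E_4\oplus E_2\oplus1,\ E_4\oplus B_2\oplus1$. 4+1+1+1: $B_4\oplus1^3,\ D_4\oplus1^3,\ E_4\oplus1^3$. 3+3+1: $A_3\oplus A_3\oplus1,\ A_3\oplus C_3\oplus1,\ C_3\oplus C_3\oplus1$. 3+2+2: $A_3\oplus F_2\oplus F_2,\ A_3\oplus F_2\oplus E_2,\ A_3\oplus F_2\oplus B_2,\ A_3\oplus E_2\oplus E_2,\ A_3\oplus E_2\oplus B_2,\ A_3\oplus B_2\oplus B_2,\ C_3\oplus F_2\oplus F_2,\ C_3\oplus F_2\oplus E_2,\ C_3\oplus F_2\oplus B_2,\ C_3\oplus E_2\oplus E_2,\ C_3\oplus E_2\oplus B_2,\ C_3\oplus B_2\oplus B_2$. 3+2+1+1: $A_3\oplus F_2\oplus1^2,\ A_3\oplus E_2\oplus1^2,\ A_3\oplus B_2\oplus1^2,\ C_3\oplus F_2\oplus1^2,\ C_3\oplus E_2\oplus1^2,\ C_3\oplus B_2\oplus1^2$. 3+1+1+1+1: $A_3\oplus1^4,\ C_3\oplus1^4$. 2+2+2+1: $F_2\oplus F_2\oplus F_2\oplus1,\ F_2\oplus F_2\oplus E_2\oplus1,\ F_2\oplus F_2\oplus B_2\oplus1,\ F_2\oplus E_2\oplus E_2\oplus1,\ F_2\oplus E_2\oplus B_2\oplus1,\ F_2\oplus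 B_2\oplus B_2\oplus1,\ E_2\oplus E_2\oplus E_2\oplus1,\ E_2\oplus E_2\oplus B_2\oplus1,\ E_2\oplus B_2\oplus B_2\oplus1,\ B_2\oplus B_2\oplus B_2\oplus1$. 2+2+1+1+1: $F_2\oplus F_2\oplus1^3,\ F_2\oplus E_2\oplus1^3,\ F_2\oplus B_2\oplus1^3,\ E_2\oplus E_2\oplus1^3,\ E_2\oplus B_2\oplus1^3,\ B_2\oplus B_2\oplus1^3$. 2+1+1+1+1+1: $F_2\oplus1^5,\ E_2\oplus1^5,\ B_2\oplus1^5$. 1+1+1+1+1+1+1: $1^7$.
   Context: All algebras are over $\mathbb{C}$. A (left) Leibniz algebra is a $\mathbb{C}$-vector space $A$ with a bilinear product $[\,,\,]:A\times A\to A$ such that $[a,[b,c]]=[[a,b],c]+[b,[a,c]]$ for all $a,b,c\in A$. $A$ is a Lie algebra iff $Leib(A)=\mathrm{span}\{[a,a]\mid a\in A\}$ is zero; non-Lie means $Leib(A)\neq 0$. Put $A^1=A$, $A^i=[A,A^{i-1}]$ (span of products) for $i\ge 2$; $A$ is nilpotent if $A^m=0$ for some positive integer $m$. $A$ is split if it is a direct sum of two nontrivial (nonzero) ideals (two-sided), and non-split otherwise. $\oplus$ of matrices is the block-diagonal sum. The matrices (all entries not listed are $0$; $(i,j)$ denotes row $i$, column $j$; $k\ge1$): $A_{2k+1}$ (size $2k+1$): entries $1$ at $(i,k+1+i)$ and at $(k+1+i,i+1)$ for $1\le i\le k$. $B_{2k}=B_{2k}(c)$ (size $2k$, $c\ne\pm1$):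 entries $1$ at $(i,2k+1-i)$ for $1\le i\le k$; $c$ at $(i,2k+2-i)$ for $2\le i\le k$; $c$ at $(k+i,k+1-i)$ for $1\le i\le k$; $1$ at $(k+i,k+2-i)$ for $2\le i\le k$. $C_{2k+1}$ (size $2k+1$): entries $1$ at $(i,2k+2-i)$ for $1\le i\le 2k+1$; at $(i,2k+3-i)$ the entry is $1$ for $2\le i\le k+1$ and $-1$ for $k+2\le i\le 2k+1$. $D_{2k}$ (size $2k$, $k$ even): entries $1$ at $(i,2k+1-i)$ for $1\le i\le 2k$; $1$ at $(i,2k+2-i)$ and $-1$ at $(k+i,k+2-i)$ for $2\le i\le k$. $E_{2k}$ (size $2k$): at $(i,2k+1-i)$ the entry is $1$ for $1\le i\le k$ and $-1$ for $k+1\le i\le 2k$; $1$ at $(i,2k+2-i)$ for $2\le i\le 2k$. $F_{2k}$ (size $2k$, $k$ odd): the same as $E_{2k}$ except that the $(k+1,k+1)$ entry is $0$. For instance $B_2(c)=\begin{pmatrix}0&1\\c&0\end{pmatrix}$, $E_2=\begin{pmatrix}0&1\\-1&1\end{pmatrix}$, $F_2=\begin{pmatrix}0&1\\-1&0\end{pmatrix}$, $A_3=\begin{pmatrix}0&0&1\\0&0&0\\0&1&0\end{pmatrix}$, $C_3=\begin{pmatrix}0&0&1\\0&1&1\\1&-1&0\end{pmatrix}$. *)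

theory Defs
  imports "Jordan_Normal_Form.Matrix" "HOL-Analysis.Analysis"
begin

locale leibniz_algebra = vector_space scl
  for scl :: "complex \<Rightarrow> 'a::ab_group_add \<Rightarrow> 'a" +
  fixes br :: "'a \<Rightarrow> 'a \<Rightarrow> 'a"
  assumes linear_right: "Vector_Spaces.linear scl scl (\<lambda>b. br a b)"
    and linear_left: "Vector_Spaces.linear scl scl (\<lambda>a. br a b)"
    and leibniz: "br a (br b c) = br (br a b) c + br b (br a c)"
begin

definition Leib :: "'a set" where
  "Leib = span {br a a | a. a \<in> UNIV}"

definition is_lie :: bool where
  "is_lie \<longleftrightarrow> Leib = {0}"

text \<open>Only the indices \<open>i \<ge> 1\<close> are meaningful: \<open>alg_power i\<close> is $A^i$, the
  value at \<open>0\<close> is a dummy.\<close>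
primrec alg_power :: "nat \<Rightarrow> 'a set" where
  "alg_power 0 = UNIV"
| "alg_power (Suc i) =
     (if i = 0 then UNIV else span {br a b | a b. a \<in> UNIV \<and> b \<in> alg_power i})"

definition is_nilpotent :: bool where
  "is_nilpotent \<longleftrightarrow> (\<exists>m>0. alg_power m = {0})"

definition is_ideal :: "'a set \<Rightarrow> bool" where
  "is_ideal I \<longleftrightarrow> subspace I \<and> (\<forall>a. \<forall>x\<in>I. br a x \<in> I \<and> br x a \<in> I)"

definition is_split :: bool where
  "is_split \<longleftrightarrow> (\<exists>I J. is_ideal I \<and> is_ideal J \<and> I \<noteq> {0} \<and> J \<noteq> {0} \<and>
     I \<inter> J = {0} \<and> {x + y | x y. x \<in> I \<and> y \<in> J} = UNIV)"

end

definition target_algebra :: "(complex \<Rightarrow> 'a::ab_group_add \<Rightarrow> 'a) \<Rightarrow> ('a \<Rightarrow> 'a \<Rightarrow> 'a) \<Rightarrow> bool" where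
  "target_algebra scl br \<longleftrightarrow>
     leibniz_algebra scl br \<and>
     \<not> leibniz_algebra.is_split scl br \<and>
     \<not> leibniz_algebra.is_lie scl br \<and>
     leibniz_algebra.is_nilpotent scl br \<and>
     vector_space.dim scl (UNIV :: 'a set) = 8 \<and>
     vector_space.dim scl (leibniz_algebra.alg_power scl br 2) = 1"

definition alg_isomorphic ::
  "(complex \<Rightarrow> 'a::ab_group_add \<Rightarrow> 'a) \<Rightarrow> ('a \<Rightarrow> 'a \<Rightarrow> 'a) \<Rightarrow>
   (complex \<Rightarrow> 'b::ab_group_add \<Rightarrow> 'b) \<Rightarrow> ('b \<Rightarrow> 'b \<Rightarrow> 'b) \<Rightarrow> bool" where
  "alg_isomorphic scl1 br1 scl2 br2 \<longleftrightarrow>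
     (\<exists>f. Vector_Spaces.linear scl1 scl2 f \<and> bij f \<and>
          (\<forall>a b. f (br1 a b) = br2 (f a) (f b)))"

text \<open>The elements of the index type \<open>8\<close> are the residues modulo 8, so the
  basis vectors with indices \<open>1, \<dots>, 8\<close> are distinct (index 8 is the residue 0).\<close>
definition x_basis :: "nat \<Rightarrow> complex ^ 8" where
  "x_basis i = axis (of_nat i) 1"

text \<open>Matrix indices of type \<open>mat\<close> start at 0, hence the shift.\<close>
definition alg_prod :: "complex Matrix.mat \<Rightarrow> complex ^ 8 \<Rightarrow> complex ^ 8 \<Rightarrow> complex ^ 8" where
  "alg_prod N u v =
     (\<Sum>i=1..7. \<Sum>j=1..7. N $$ (i - 1, j - 1) * vec_nth u (of_nat i) * vec_nth v (of_nat j))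
       *s x_basis 8"

lemma of_nat_8_eq_iff:
  assumes "i \<in> {1..8}" "j \<in> {1..8}"
  shows "(of_nat i :: 8) = of_nat j \<longleftrightarrow> i = j"
proof -
  have S: "{1..8} = {1, 2, 3, 4, 5, 6, 7, 8 :: nat}" by auto
  show ?thesis using assms unfolding S by auto
qed

lemma x_basis_inj: "inj_on x_basis {1..8}"
  by (intro inj_onI) (simp add: x_basis_def axis_eq_axis of_nat_8_eq_iff)

lemma x_basis_image: "x_basis ` {1..8} = cart_basis"
proof (rule card_subset_eq)
  show "finite (cart_basis :: (complex ^ 8) set)" by (rule finite_cart_basis)
  show "x_basis ` {1..8} \<subseteq> cart_basis" by (auto simp: x_basis_def cart_basis_def)
  show "card (x_basis ` {1..8}) = card (cart_basis :: (complex ^ 8) set)"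
    unfolding card_image[OF x_basis_inj] card_cart_basis by simp
qed

lemma x_basis_nth:
  assumes "i \<in> {1..8}" "j \<in> {1..8}"
  shows "vec_nth (x_basis i) (of_nat j) = (if j = i then 1 else 0)"
  using of_nat_8_eq_iff[OF assms] by (auto simp: x_basis_def axis_def)

lemma alg_prod_x_basis:
  assumes "p \<in> {1..8}" "q \<in> {1..8}"
  shows "alg_prod N (x_basis p) (x_basis q) =
    (if p \<le> 7 \<and> q \<le> 7 then N $$ (p - 1, q - 1) *s x_basis 8 else 0)"
proof -
  have "(\<Sum>i=1..7. \<Sum>j=1..7. N $$ (i - 1, j - 1) * vec_nth (x_basis p) (of_nat i) * vec_nth (x_basis q) (of_nat j))
     = (\<Sum>i=1..7. \<Sum>j=1..7. if j = q then (if i = p then N $$ (i - 1, j - 1) else 0) else 0)"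
    by (intro sum.cong refl) (use assms in \<open>auto simp: x_basis_nth\<close>)
  also have "\<dots> = (if p \<le> 7 \<and> q \<le> 7 then N $$ (p - 1, q - 1) else 0)"
    using assms by (cases "q \<le> 7") auto
  finally show ?thesis by (simp add: alg_prod_def)
qed

definition sq_mat :: "nat \<Rightarrow> (nat \<times> nat \<Rightarrow> complex) \<Rightarrow> complex Matrix.mat" where
  "sq_mat n f = Matrix.mat n n (\<lambda>(r, s). f (r + 1, s + 1))"

text \<open>The argument \<open>k\<close> is the one in the subscripts \<open>2k\<close> and \<open>2k + 1\<close>. Within each
  definition the index sets are pairwise disjoint, so the order of the tests is immaterial.\<close>

definition matA :: "nat \<Rightarrow> complex Matrix.mat" where
  "matA k = sq_mat (2*k+1) (\<lambda>p.
     if p \<in> (\<lambda>i. (i, k+1+i)) ` {1..k} \<union> (\<lambda>i. (k+1+i, i+1)) ` {1..k} then 1 else 0)"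

definition matB :: "nat \<Rightarrow> complex \<Rightarrow> complex Matrix.mat" where
  "matB k c = sq_mat (2*k) (\<lambda>p.
     if p \<in> (\<lambda>i. (i, 2*k+1-i)) ` {1..k} \<union> (\<lambda>i. (k+i, k+2-i)) ` {2..k} then 1
     else if p \<in> (\<lambda>i. (i, 2*k+2-i)) ` {2..k} \<union> (\<lambda>i. (k+i, k+1-i)) ` {1..k} then c
     else 0)"

definition matC :: "nat \<Rightarrow> complex Matrix.mat" where
  "matC k = sq_mat (2*k+1) (\<lambda>p.
     if p \<in> (\<lambda>i. (i, 2*k+2-i)) ` {1..2*k+1} \<union> (\<lambda>i. (i, 2*k+3-i)) ` {2..k+1} then 1
     else if p \<in> (\<lambda>i. (i, 2*k+3-i)) ` {k+2..2*k+1} then -1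
     else 0)"

definition matD :: "nat \<Rightarrow> complex Matrix.mat" where
  "matD k = sq_mat (2*k) (\<lambda>p.
     if p \<in> (\<lambda>i. (i, 2*k+1-i)) ` {1..2*k} \<union> (\<lambda>i. (i, 2*k+2-i)) ` {2..k} then 1
     else if p \<in> (\<lambda>i. (k+i, k+2-i)) ` {2..k} then -1
     else 0)"

definition matE :: "nat \<Rightarrow> complex Matrix.mat" where
  "matE k = sq_mat (2*k) (\<lambda>p.
     if p \<in> (\<lambda>i. (i, 2*k+1-i)) ` {1..k} \<union> (\<lambda>i. (i, 2*k+2-i)) ` {2..2*k} then 1
     else if p \<in> (\<lambda>i. (i, 2*k+1-i)) ` {k+1..2*k} then -1
     else 0)"

definition matF :: "nat \<Rightarrow> complex Matrix.mat" where
  "matF k = sq_mat (2*k) (\<lambda>(r, s).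
     if (r, s) = (k+1, k+1) then 0 else matE k $$ (r - 1, s - 1))"

datatype block =
  A3 | A5 | A7 | B2 | B4 | B6 | C3 | C5 | C7 | D4 | E2 | E4 | E6 | F2 | F6 | One

text \<open>A block with a parameter stands for all its admissible instances.\<close>
fun block_mats :: "block \<Rightarrow> complex Matrix.mat set" where
  "block_mats A3 = {matA 1}"
| "block_mats A5 = {matA 2}"
| "block_mats A7 = {matA 3}"
| "block_mats B2 = {matB 1 c | c. c \<noteq> 1 \<and> c \<noteq> -1}"
| "block_mats B4 = {matB 2 c | c. c \<noteq> 1 \<and> c \<noteq> -1}"
| "block_mats B6 = {matB 3 c | c. c \<noteq> 1 \<and> c \<noteq> -1}"
| "block_mats C3 = {matC 1}"
| "block_mats C5 = {matC 2}"
| "block_mats C7 = {matC 3}"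
| "block_mats D4 = {matD 2}"
| "block_mats E2 = {matE 1}"
| "block_mats E4 = {matE 2}"
| "block_mats E6 = {matE 3}"
| "block_mats F2 = {matF 1}"
| "block_mats F6 = {matF 3}"
| "block_mats One = {1\<^sub>m 1}"

text \<open>\<open>listset\<close> chooses the parameters of the blocks independently of each other.\<close>
definition entry_mats :: "block list \<Rightarrow> complex Matrix.mat set" where
  "entry_mats bs = diag_block_mat ` listset (map block_mats bs)"

definition entries :: "block list list" where
  "entries =
   [[A7], [C7],

    [B6, One], [E6, One], [F6, One],

    [A5, F2], [A5, E2], [A5, B2], [C5, F2], [C5, E2], [C5, B2],

    [A5, One, One], [C5, One, One],

    [B4, A3], [B4, C3], [D4, A3], [D4, C3], [E4, A3], [E4, C3],

    [B4, F2, One], [B4, E2, One], [B4, B2, One],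
    [D4, F2, One], [D4, E2, One], [D4, B2, One],
    [E4, F2, One], [E4, E2, One], [E4, B2, One],

    [B4, One, One, One], [D4, One, One, One], [E4, One, One, One],

    [A3, A3, One], [A3, C3, One], [C3, C3, One],

    [A3, F2, F2], [A3, F2, E2], [A3, F2, B2], [A3, E2, E2], [A3, E2, B2], [A3, B2, B2],
    [C3, F2, F2], [C3, F2, E2], [C3, F2, B2], [C3, E2, E2], [C3, E2, B2], [C3, B2, B2],

    [A3, F2, One, One], [A3, E2, One, One], [A3, B2, One, One],
    [C3, F2, One, One], [C3, E2, One, One], [C3, B2, One, One],

    [A3, One, One, One, One], [C3, One, One, One, One],

    [F2, F2, F2, One], [F2, F2, E2, One], [F2, F2, B2, One], [F2, E2, E2, One],
    [F2, E2, B2, One], [F2, B2, B2, One], [E2, E2, E2, One], [E2, E2, B2, One],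
    [E2, B2, B2, One], [B2, B2, B2, One],

    [F2, F2, One, One, One], [F2, E2, One, One, One], [F2, B2, One, One, One],
    [E2, E2, One, One, One], [E2, B2, One, One, One], [B2, B2, One, One, One],

    [F2, One, One, One, One, One], [E2, One, One, One, One, One],
    [B2, One, One, One, One, One],

    [One, One, One, One, One, One, One]]"

lemma matA_carrier: "matA k \<in> carrier_mat (2*k+1) (2*k+1)"
  and matB_carrier: "matB k c \<in> carrier_mat (2*k) (2*k)"
  and matC_carrier: "matC k \<in> carrier_mat (2*k+1) (2*k+1)"
  and matD_carrier: "matD k \<in> carrier_mat (2*k) (2*k)"
  and matE_carrier: "matE k \<in> carrier_mat (2*k) (2*k)"
  and matF_carrier: "matF k \<in> carrier_mat (2*k) (2*k)"
  by (simp_all add: matA_def matB_def matC_def matD_def matE_def matF_def sq_mat_def)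

fun block_size :: "block \<Rightarrow> nat" where
  "block_size A3 = 3"
| "block_size A5 = 5"
| "block_size A7 = 7"
| "block_size B2 = 2"
| "block_size B4 = 4"
| "block_size B6 = 6"
| "block_size C3 = 3"
| "block_size C5 = 5"
| "block_size C7 = 7"
| "block_size D4 = 4"
| "block_size E2 = 2"
| "block_size E4 = 4"
| "block_size E6 = 6"
| "block_size F2 = 2"
| "block_size F6 = 6"
| "block_size One = 1"

lemma block_mats_dim:
  "N \<in> block_mats b \<Longrightarrow> dim_row N = block_size b \<and> dim_col N = block_size b"
  by (cases b) (auto simp: matA_def matB_def matC_def matD_def matE_def matF_def sq_mat_def)

lemma listset_block_mats_dim:
  "Ns \<in> listset (map block_mats bs) \<Longrightarrow>
     map dim_row Ns = map block_size bs \<and> map dim_col Ns = map block_size bs"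
  by (induction bs arbitrary: Ns) (auto simp: set_Cons_def dest: block_mats_dim)

lemma entry_mats_carrier:
  assumes "bs \<in> set entries" "N \<in> entry_mats bs"
  shows "N \<in> carrier_mat 7 7"
proof -
  have "list_all (\<lambda>bs. sum_list (map block_size bs) = 7) entries"
    unfolding entries_def by simp
  then have size: "sum_list (map block_size bs) = 7"
    using assms(1) by (simp only: list_all_iff)
  obtain Ns where Ns: "Ns \<in> listset (map block_mats bs)" "N = diag_block_mat Ns"
    using assms(2) unfolding entry_mats_def by blast
  from listset_block_mats_dim[OF Ns(1)] size show ?thesis
    unfolding Ns(2) by (intro carrier_matI) (simp_all only: dim_diag_block_mat)
qed

end

theory Submission
  imports Defs "Jordan_Normal_Form.Jordan_Normal_Form_Uniqueness"
begin

text \<open>By nilpotency a generator \<open>z\<close> of \<open>[A, A]\<close> is central, so \<open>[a, b] = f(a, b) z\<close> for a bilinear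
  form \<open>f\<close> on \<open>A / \<complex>z\<close>. A vector in both kernels of \<open>f\<close> would split off, and an isomorphism is a
  congruence of the forms up to a scalar, which a square root absorbs. So the theorem is the
  congruence classification of the complex 7 by 7 matrices without common radical.

  Existence: a nondegenerate form is split along chains of generalised eigenvectors of its asymmetry
  \<open>\<sigma>\<close>, \<open>f(x, y) = f(\<sigma> y, x)\<close>, into forms whose asymmetry has a single Jordan block or two blocks
  with inverse eigenvalues; such a form is determined up to congruence by the Jordan form of the
  asymmetry. A singular form is an extension of a smaller one, which by induction separates nilpotent
  Jordan blocks from a nondegenerate form; the even nilpotent blocks are the \<open>B\<close> with \<open>c = 0\<close> and
  the odd ones are the \<open>A\<close>.

  Uniqueness: the kernels of \<open>N\<^sup>T - \<mu> N\<close> for generic \<open>\<mu>\<close> see only the \<open>A\<close> blocks, and once these are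
  removed the Jordan block sizes of the asymmetry distinguish the entries.\<close>

section \<open>Congruence and direct sums\<close>

text \<open>Why the asymmetry decides congruence: if the asymmetries of \<open>A\<close> and
  \<open>B\<close> are similar, one pair of invertible factors carries \<open>A\<close> to
  \<open>B\<close> and at the same time \<open>A^T\<close> to \<open>B^T\<close>. Such an
  equivalence is corrected to a congruence by a square root which, being a polynomial, inherits
  self-adjointness; over \<complex> it always exists. Why there are so many kinds of blocks: the
  asymmetry is an isometry, so the eigenvalue \<lambda> is paired with 1/\<lambda>. A chain of
  length k can pair with itself only if \<lambda> = (-1)^(k-1); this gives C for odd and E for even
  k. All other chains come in dual pairs: B in general, and D and F for \<lambda> = 1, -1 with the
  parity that a single chain cannot have. Why the singular case is an induction: a singular form has
  no asymmetry, but after a change of basis it consists of a smaller form and additional columns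
  that matter only modulo the column space of that form. A nondegenerate summand therefore absorbs
  its share of the columns, and a nilpotent block can be attached to at its end only, where it grows
  by two vectors. Even blocks start from size 0, odd ones from a vector in the common
  radical.\<close>

lemma mat_assoc:
  fixes A :: "'a :: semiring_0 Matrix.mat"
  shows "dim_col A = dim_row B \<Longrightarrow> dim_col B = dim_row C \<Longrightarrow> A * B * C = A * (B * C)"
  by (rule assoc_mult_mat[of A "dim_row A" "dim_row B" B "dim_row C" C "dim_col C"]) auto

lemma mat_transpose_mult:
  fixes A :: "'a :: comm_semiring_0 Matrix.mat"
  shows "dim_col A = dim_row B \<Longrightarrow> (A * B)\<^sup>T = B\<^sup>T * A\<^sup>T"
  by (rule transpose_mult[of A "dim_row A" "dim_row B" B "dim_col B"]) auto

lemma mat_add_distrib_right: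
  fixes A :: "'a :: semiring_0 Matrix.mat"
  shows "dim_row A = dim_row B \<Longrightarrow> dim_col A = dim_col B \<Longrightarrow> dim_col B = dim_row C \<Longrightarrow>
    (A + B) * C = A * C + B * C"
  by (rule add_mult_distrib_mat[of A "dim_row B" "dim_col B" B C "dim_col C"]) auto

lemma mat_add_distrib_left:
  fixes A :: "'a :: semiring_0 Matrix.mat"
  shows "dim_row B = dim_row C \<Longrightarrow> dim_col B = dim_col C \<Longrightarrow> dim_col A = dim_row C \<Longrightarrow>
    A * (B + C) = A * B + A * C"
  by (rule mult_add_distrib_mat[of A "dim_row A" "dim_row C" B "dim_col C" C]) auto

lemma mat_minus_distrib_right:
  fixes A :: "'a :: ring Matrix.mat"
  shows "dim_row A = dim_row B \<Longrightarrow> dim_col A = dim_col B \<Longrightarrow> dim_col B = dim_row C \<Longrightarrow>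
    (A - B) * C = A * C - B * C"
  by (rule minus_mult_distrib_mat[of A "dim_row B" "dim_col B" B C "dim_col C"]) auto

lemma mat_minus_distrib_left:
  fixes A :: "'a :: ring Matrix.mat"
  shows "dim_row B = dim_row C \<Longrightarrow> dim_col B = dim_col C \<Longrightarrow> dim_col A = dim_row C \<Longrightarrow>
    A * (B - C) = A * B - A * C"
  by (rule mult_minus_distrib_mat[of A "dim_row A" "dim_row C" B "dim_col C" C]) auto

text \<open>The inverse is carried along explicitly, so that inverse factors inside a long product
  can be cancelled by rewriting with \<open>inv_pair_cancel\<close>.\<close>

definition inv_pair :: "nat \<Rightarrow> complex Matrix.mat \<Rightarrow> complex Matrix.mat \<Rightarrow> bool" where
  "inv_pair n P P' \<longleftrightarrow> P \<in> carrier_mat n n \<and> P' \<in> carrier_mat n n \<and> P * P' = 1\<^sub>m n \<and> P' * P = 1\<^sub>m n"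

lemma inv_pairD:
  assumes "inv_pair n P P'"
  shows "P \<in> carrier_mat n n" "P' \<in> carrier_mat n n" "P * P' = 1\<^sub>m n" "P' * P = 1\<^sub>m n"
  using assms by (auto simp: inv_pair_def)

lemma inv_pair_dims:
  assumes "inv_pair n P P'"
  shows "dim_row P = n" "dim_col P = n" "dim_row P' = n" "dim_col P' = n"
  using assms by (auto simp: inv_pair_def)

lemma inv_pair_cancel:
  assumes "inv_pair n P P'" "dim_row X = n"
  shows "P * (P' * X) = X" "P' * (P * X) = X"
  using assms inv_pairD[OF assms(1)] inv_pair_dims[OF assms(1)]
  by (simp_all add: mat_assoc[symmetric])

lemma inv_pairI1:
  assumes "P \<in> carrier_mat n n" "P' \<in> carrier_mat n n" "P * P' = 1\<^sub>m n"
  shows "inv_pair n P P'"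
  using assms mat_mult_left_right_inverse[OF assms] by (auto simp: inv_pair_def)

lemma inv_pair_sym: "inv_pair n P P' \<Longrightarrow> inv_pair n P' P"
  by (auto simp: inv_pair_def)

lemma inv_pair_one: "inv_pair n (1\<^sub>m n) (1\<^sub>m n)"
  by (auto simp: inv_pair_def)

lemma inv_pair_transpose: "inv_pair n P P' \<Longrightarrow> inv_pair n (P\<^sup>T) (P'\<^sup>T)"
  unfolding inv_pair_def
  by (metis transpose_carrier_mat transpose_mult transpose_one)

lemma inv_pair_mult:
  assumes "inv_pair n P P'" "inv_pair n Q Q'"
  shows "inv_pair n (P * Q) (Q' * P')"
proof (rule inv_pairI1)
  note [simp] = inv_pair_dims[OF assms(1)] inv_pair_dims[OF assms(2)]
  show "P * Q * (Q' * P') = 1\<^sub>m n"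
    using inv_pairD(3)[OF assms(1)] by (simp add: mat_assoc inv_pair_cancel[OF assms(2)])
qed (use assms in \<open>auto simp: inv_pair_def\<close>)

lemma inv_pair_of_det:
  assumes "P \<in> carrier_mat n n" "Determinant.det P \<noteq> 0"
  shows "\<exists>P'. inv_pair n P P'"
proof -
  obtain P' where "P' \<in> carrier_mat n n" "P' * P = 1\<^sub>m n"
    using det_non_zero_imp_unit[OF assms, of undefined] 
    by (auto simp: Units_def ring_mat_simps)
  then show ?thesis using assms inv_pairI1 inv_pair_sym by blast
qed

lemma inv_pair_det:
  assumes "inv_pair n P P'" shows "Determinant.det P \<noteq> 0"
proof
  assume "Determinant.det P = 0"
  then have "Determinant.det (P * P') = 0"
    using det_mult[of P n P'] inv_pairD[OF assms] by simp
  then show False using inv_pairD(3)[OF assms] by simp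
qed

lemma inv_pair_of_kernel:
  assumes A: "A \<in> carrier_mat n n"
    and ker: "\<And>v. v \<in> carrier_vec n \<Longrightarrow> A *\<^sub>v v = 0\<^sub>v n \<Longrightarrow> v = 0\<^sub>v n"
  shows "\<exists>A'. inv_pair n A A'"
  using det_0_iff_vec_prod_zero_field[OF A] inv_pair_of_det[OF A] ker by blast

lemma inv_pair_kernel:
  assumes "inv_pair n A A'" "v \<in> carrier_vec n" "A *\<^sub>v v = 0\<^sub>v n"
  shows "v = 0\<^sub>v n"
  using inv_pair_det[OF assms(1)] det_0_iff_vec_prod_zero_field[OF inv_pairD(1)[OF assms(1)]] assms(2,3)
  by blast

section \<open>Congruence of bilinear forms\<close>

definition congr :: "nat \<Rightarrow> complex Matrix.mat \<Rightarrow> complex Matrix.mat \<Rightarrow> bool" where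
  "congr n A B \<longleftrightarrow> A \<in> carrier_mat n n \<and> (\<exists>P P'. inv_pair n P P' \<and> B = P\<^sup>T * A * P)"

lemma congrI: "A \<in> carrier_mat n n \<Longrightarrow> inv_pair n P P' \<Longrightarrow> B = P\<^sup>T * A * P \<Longrightarrow> congr n A B"
  by (auto simp: congr_def)

lemma congr_carrier: "congr n A B \<Longrightarrow> A \<in> carrier_mat n n \<and> B \<in> carrier_mat n n"
  by (auto simp: congr_def inv_pair_def)

lemma congr_refl: "A \<in> carrier_mat n n \<Longrightarrow> congr n A A"
  by (rule congrI[OF _ inv_pair_one]) auto

lemma congr_trans:
  assumes "congr n A B" "congr n B C"
  shows "congr n A C"
proof -
  obtain P P' where P: "inv_pair n P P'" "B = P\<^sup>T * A * P" and A: "A \<in> carrier_mat n n"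
    using assms(1) by (auto simp: congr_def)
  obtain Q Q' where Q: "inv_pair n Q Q'" "C = Q\<^sup>T * B * Q" using assms(2) by (auto simp: congr_def)
  note [simp] = inv_pair_dims[OF P(1)] inv_pair_dims[OF Q(1)]
  show ?thesis
    by (rule congrI[OF A inv_pair_mult[OF P(1) Q(1)]])
      (use A in \<open>simp add: P(2) Q(2) mat_transpose_mult mat_assoc\<close>)
qed

lemma congr_sym:
  assumes "congr n A B"
  shows "congr n B A"
proof -
  obtain P P' where P: "inv_pair n P P'" "B = P\<^sup>T * A * P" and A: "A \<in> carrier_mat n n"
    using assms(1) by (auto simp: congr_def)
  note [simp] = inv_pair_dims[OF P(1)]
  have "A = P'\<^sup>T * B * P'"
    using A inv_pairD(3)[OF P(1)]
    by (simp add: P(2) mat_assoc inv_pair_cancel[OF inv_pair_transpose[OF P(1)]])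
  then show ?thesis
    by (intro congrI[OF _ inv_pair_sym[OF P(1)]]) (auto simp: P(2))
qed

section \<open>Direct sums of forms and the order of the summands\<close>

definition dsum :: "complex Matrix.mat \<Rightarrow> complex Matrix.mat \<Rightarrow> complex Matrix.mat" where
  "dsum A B = four_block_mat A (0\<^sub>m (dim_row A) (dim_col B)) (0\<^sub>m (dim_row B) (dim_col A)) B"

lemma diag_block_Cons: "diag_block_mat (A # As) = dsum A (diag_block_mat As)"
  by (simp add: dsum_def Let_def)

declare diag_block_mat.simps(2) [simp del]

lemma dsum_carrier [simp]:
  "A \<in> carrier_mat n m \<Longrightarrow> B \<in> carrier_mat p q \<Longrightarrow> dsum A B \<in> carrier_mat (n + p) (m + q)"
  by (auto simp: dsum_def)

lemma dsum_dim [simp]: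
  "dim_row (dsum A B) = dim_row A + dim_row B" "dim_col (dsum A B) = dim_col A + dim_col B"
  by (auto simp: dsum_def)

lemma dsum_transpose: "(dsum A B)\<^sup>T = dsum (A\<^sup>T) (B\<^sup>T)"
  by (rule eq_matI) (auto simp: dsum_def)

lemma dsum_mult_carrier:
  assumes A: "A \<in> carrier_mat n m" and C: "C \<in> carrier_mat m l"
    and B: "B \<in> carrier_mat p q" and D: "D \<in> carrier_mat q r"
  shows "dsum A B * dsum C D = dsum (A * C) (B * D)"
proof -
  have "four_block_mat A (0\<^sub>m n q) (0\<^sub>m p m) B * four_block_mat C (0\<^sub>m m r) (0\<^sub>m q l) D =
    four_block_mat (A * C) (0\<^sub>m n r) (0\<^sub>m p l) (B * D)"
    by (subst mult_four_block_mat[OF A _ _ B C _ _ D]) (use A B C D in auto)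
  then show ?thesis using A B C D by (simp add: dsum_def)
qed

lemma dsum_mult:
  assumes "dim_col A = dim_row C" "dim_col B = dim_row D"
  shows "dsum A B * dsum C D = dsum (A * C) (B * D)"
  by (rule dsum_mult_carrier[of A "dim_row A" "dim_row C" C "dim_col C" B "dim_row B" "dim_row D" D "dim_col D"])
    (use assms in auto)

lemma dsum_add:
  assumes "A \<in> carrier_mat n m" "C \<in> carrier_mat n m" "B \<in> carrier_mat p q" "D \<in> carrier_mat p q"
  shows "dsum A B + dsum C D = dsum (A + C) (B + D)"
  by (rule eq_matI) (use assms in \<open>auto simp: dsum_def\<close>)

lemma dsum_minus:
  assumes "A \<in> carrier_mat n m" "C \<in> carrier_mat n m" "B \<in> carrier_mat p q" "D \<in> carrier_mat p q"
  shows "dsum A B - dsum C D = dsum (A - C) (B - D)"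
  by (rule eq_matI) (use assms in \<open>auto simp: dsum_def\<close>)

lemma dsum_smult: "c \<cdot>\<^sub>m dsum A B = dsum (c \<cdot>\<^sub>m A) (c \<cdot>\<^sub>m B)"
  by (rule eq_matI) (auto simp: dsum_def)

lemma dsum_one: "dsum (1\<^sub>m n) (1\<^sub>m m) = 1\<^sub>m (n + m)"
  by (rule eq_matI) (auto simp: dsum_def)

lemma dsum_assoc: "dsum (dsum A B) C = dsum A (dsum B C)"
  unfolding dsum_def by (rule assoc_four_block_mat[symmetric])

lemma dsum_empty_left [simp]: "dsum (0\<^sub>m 0 0) A = A"
  by (rule eq_matI) (auto simp: dsum_def)

lemma dsum_empty_right [simp]: "dsum A (0\<^sub>m 0 0) = A"
  by (rule eq_matI) (auto simp: dsum_def)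

lemma diag_block_append: "diag_block_mat (As @ Bs) = dsum (diag_block_mat As) (diag_block_mat Bs)"
  by (simp add: diag_block_mat_append dsum_def Let_def)

lemma inv_pair_dsum:
  assumes "inv_pair n P P'" "inv_pair m Q Q'"
  shows "inv_pair (n + m) (dsum P Q) (dsum P' Q')"
proof -
  note c = inv_pairD[OF assms(1)] inv_pairD[OF assms(2)]
  have d: "dim_row P = n" "dim_col P = n" "dim_row P' = n" "dim_col P' = n"
    "dim_row Q = m" "dim_col Q = m" "dim_row Q' = m" "dim_col Q' = m" using c by auto
  show ?thesis
    by (rule inv_pairI1) (use c in \<open>auto simp: dsum_mult d dsum_one\<close>)
qed

lemma congr_dsum:
  assumes "congr n A A'" "congr m B B'"
  shows "congr (n + m) (dsum A B) (dsum A' B')"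
proof -
  obtain P P' where P: "inv_pair n P P'" "A' = P\<^sup>T * A * P" and A: "A \<in> carrier_mat n n"
    using assms(1) by (auto simp: congr_def)
  obtain Q Q' where Q: "inv_pair m Q Q'" "B' = Q\<^sup>T * B * Q" and B: "B \<in> carrier_mat m m"
    using assms(2) by (auto simp: congr_def)
  have d: "dim_row P = n" "dim_col P = n" "dim_row Q = m" "dim_col Q = m"
     "dim_row A = n" "dim_col A = n" "dim_row B = m" "dim_col B = m"
    using A B inv_pairD[OF P(1)] inv_pairD[OF Q(1)] by auto
  show ?thesis
    by (rule congrI[OF _ inv_pair_dsum[OF P(1) Q(1)]])
      (use A B in \<open>auto simp: dsum_transpose dsum_mult d P(2) Q(2)\<close>)
qed

text \<open>Permutation matrices are orthogonal, so a simultaneous permutation of rows and columns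
  is a congruence. The regroupings of blocks and relabellings of basis vectors below all come from
  this.\<close>

lemma congr_reindex:
  assumes A: "A \<in> carrier_mat n n" and bij: "bij_betw p {..<n} {..<n}"
  shows "congr n A (Matrix.mat n n (\<lambda>(i,j). A $$ (p i, p j)))"
proof -
  define P :: "complex Matrix.mat" where "P = Matrix.mat n n (\<lambda>(i,j). if i = p j then 1 else 0)"
  have p: "\<And>i. i < n \<Longrightarrow> p i < n" using bij by (auto simp: bij_betw_def)
  have inj: "\<And>i j. i < n \<Longrightarrow> j < n \<Longrightarrow> p i = p j \<longleftrightarrow> i = j"
    using bij by (auto simp: bij_betw_def inj_on_def)
  have PP: "P\<^sup>T * P = 1\<^sub>m n"
    by (rule eq_matI)
      (auto simp: P_def scalar_prod_def p inj if_distrib[of "\<lambda>x. x * _"] cong: if_cong)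
  have c[simp]: "P \<in> carrier_mat n n" "P\<^sup>T \<in> carrier_mat n n" by (auto simp: P_def)
  have AP: "A * P = Matrix.mat n n (\<lambda>(i,j). A $$ (i, p j))"
    by (rule eq_matI)
      (use A in \<open>auto simp: P_def scalar_prod_def p if_distrib[of "\<lambda>x. _ * x"] cong: if_cong\<close>)
  have "P\<^sup>T * (A * P) = Matrix.mat n n (\<lambda>(i,j). A $$ (p i, p j))"
    unfolding AP
    by (rule eq_matI)
      (use A in \<open>auto simp: P_def scalar_prod_def p if_distrib[of "\<lambda>x. x * _"] cong: if_cong\<close>)
  then have "Matrix.mat n n (\<lambda>(i,j). A $$ (p i, p j)) = P\<^sup>T * A * P"
    using A by (simp add: assoc_mult_mat[of _ n n _ n _ n])
  then show ?thesis
    using A PP by (intro congrI[of A n P "P\<^sup>T"] inv_pair_sym[OF inv_pairI1]) auto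
qed

lemma congr_dsum_commute:
  assumes A: "A \<in> carrier_mat n n" and B: "B \<in> carrier_mat m m"
  shows "congr (n + m) (dsum A B) (dsum B A)"
proof -
  define p where "p i = (if i < m then i + n else i - m)" for i
  have "bij_betw p {..<n+m} {..<n+m}"
    by (rule bij_betw_byWitness[where f' = "\<lambda>i. if i < n then i + m else i - n"])
      (auto simp: p_def)
  from congr_reindex[OF dsum_carrier[OF A B] this]
  have "congr (n + m) (dsum A B) (Matrix.mat (n + m) (n + m) (\<lambda>(i,j). dsum A B $$ (p i, p j)))" .
  also have "Matrix.mat (n + m) (n + m) (\<lambda>(i,j). dsum A B $$ (p i, p j)) = dsum B A"
    by (rule eq_matI) (use A B in \<open>auto simp: dsum_def p_def\<close>)
  finally show ?thesis .
qed

lemma diag_block_carrier: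
  "\<forall>M\<in>set Ms. square_mat M \<Longrightarrow>
    diag_block_mat Ms \<in> carrier_mat (sum_list (map dim_row Ms)) (sum_list (map dim_row Ms))"
  by (intro carrier_matI) (auto simp: dim_diag_block_mat intro!: arg_cong[where f = sum_list])

lemma congr_diag_block_move:
  assumes "\<forall>M\<in>set (xs @ x # ys). square_mat M"
  shows "congr (sum_list (map dim_row (x # xs @ ys))) (diag_block_mat (xs @ x # ys)) (diag_block_mat (x # xs @ ys))"
proof -
  let ?d = "\<lambda>Ms. sum_list (map dim_row Ms)"
  have x: "x \<in> carrier_mat (dim_row x) (dim_row x)" using assms by auto
  have xs: "diag_block_mat xs \<in> carrier_mat (?d xs) (?d xs)" and
    ys: "diag_block_mat ys \<in> carrier_mat (?d ys) (?d ys)"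
    using assms by (auto intro!: diag_block_carrier)
  have "congr (?d xs + dim_row x + ?d ys) (dsum (dsum (diag_block_mat xs) x) (diag_block_mat ys))
     (dsum (dsum x (diag_block_mat xs)) (diag_block_mat ys))"
    by (intro congr_dsum congr_dsum_commute congr_refl x xs ys)
  then show ?thesis
    by (simp add: diag_block_append diag_block_Cons dsum_assoc add_ac)
qed

lemma congr_diag_block_mset:
  assumes "mset As = mset Bs" "\<forall>M\<in>set As. square_mat M"
  shows "congr (sum_list (map dim_row As)) (diag_block_mat As) (diag_block_mat Bs)"
  using assms
proof (induction As arbitrary: Bs)
  case Nil
  then show ?case by (simp add: congr_refl)
next
  case (Cons a As)
  have "a \<in> set Bs" using Cons.prems(1) by (metis list.set_intros(1) mset_eq_setD)
  then obtain xs ys where Bs: "Bs = xs @ a # ys" by (meson split_list)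
  have m: "mset As = mset (xs @ ys)" using Cons.prems(1) by (simp add: Bs)
  have sq: "\<forall>M\<in>set Bs. square_mat M" using Cons.prems by (metis mset_eq_setD)
  have 1: "congr (dim_row a + sum_list (map dim_row As)) (diag_block_mat (a # As)) (diag_block_mat (a # xs @ ys))"
    unfolding diag_block_Cons
    by (intro congr_dsum congr_refl Cons.IH m) (use Cons.prems in auto)
  have "sum_list (map dim_row As) = sum_list (map dim_row (xs @ ys))"
    using m by (metis mset_map sum_mset_sum_list)
  then have 2: "congr (dim_row a + sum_list (map dim_row As)) (diag_block_mat Bs) (diag_block_mat (a # xs @ ys))"
    using congr_diag_block_move[of xs a ys] sq by (simp add: Bs)
  show ?case using congr_trans[OF 1 congr_sym[OF 2]] by simp
qed

section \<open>Polynomials in a matrix and strict equivalence\<close>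

text \<open>Horner's scheme; the size \<open>n\<close> is an argument because it fixes the zero and
  the identity matrix.\<close>

definition polymat :: "nat \<Rightarrow> complex Matrix.mat \<Rightarrow> complex poly \<Rightarrow> complex Matrix.mat" where
  "polymat n M p = fold_coeffs (\<lambda>a X. a \<cdot>\<^sub>m 1\<^sub>m n + X * M) p (0\<^sub>m n n)"

lemma polymat_0 [simp]: "polymat n M 0 = 0\<^sub>m n n"
  by (simp add: polymat_def)

lemma smult_zero_mat [simp]: "(0 :: complex) \<cdot>\<^sub>m A = 0\<^sub>m (dim_row A) (dim_col A)"
  by (rule eq_matI) auto

lemma smult_one_mat [simp]: "(1 :: complex) \<cdot>\<^sub>m A = A"
  by (rule eq_matI) auto

lemma zero_add_mat [simp]:
  fixes X :: "complex Matrix.mat"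
  shows "dim_row X = n \<Longrightarrow> dim_col X = m \<Longrightarrow> 0\<^sub>m n m + X = X"
    "dim_row X = n \<Longrightarrow> dim_col X = m \<Longrightarrow> X + 0\<^sub>m n m = X"
  by (auto intro!: eq_matI)

lemma polymat_pCons:
  assumes "M \<in> carrier_mat n n"
  shows "polymat n M (pCons a p) = a \<cdot>\<^sub>m 1\<^sub>m n + polymat n M p * M"
proof (cases "a = 0 \<and> p = 0")
  case True
  then show ?thesis using assms by auto
next
  case False
  then show ?thesis
    by (cases "a = 0") (auto simp: polymat_def fold_coeffs_pCons_coeff_not_0_eq fold_coeffs_pCons_not_0_0_eq)
qed

lemma polymat_carrier [simp]:
  assumes "M \<in> carrier_mat n n"
  shows "polymat n M p \<in> carrier_mat n n"
  by (induction p) (use assms in \<open>auto simp: polymat_pCons\<close>)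

lemma polymat_dims [simp]:
  assumes "M \<in> carrier_mat n n"
  shows "dim_row (polymat n M p) = n" "dim_col (polymat n M p) = n"
  using polymat_carrier[OF assms, of p] by auto

lemma polymat_add:
  assumes M: "M \<in> carrier_mat n n"
  shows "polymat n M (p + q) = polymat n M p + polymat n M q"
proof (induction p q rule: poly_induct2)
  case 0
  then show ?case by simp
next
  case (pCons a p b q)
  have "(a + b) \<cdot>\<^sub>m 1\<^sub>m n + (X + Y) * M = (a \<cdot>\<^sub>m 1\<^sub>m n + X * M) + (b \<cdot>\<^sub>m 1\<^sub>m n + Y * M)"
    if "X \<in> carrier_mat n n" "Y \<in> carrier_mat n n" for X Y
    using that M
    by (intro eq_matI) (auto simp: scalar_prod_def sum.distrib algebra_simps)
  then show ?case using M by (simp add: polymat_pCons pCons.IH)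
qed

lemma polymat_smult:
  assumes M: "M \<in> carrier_mat n n"
  shows "polymat n M (Polynomial.smult c p) = c \<cdot>\<^sub>m polymat n M p"
proof (induction p)
  case 0
  then show ?case by auto
next
  case (pCons a p)
  have "(c * a) \<cdot>\<^sub>m 1\<^sub>m n + (c \<cdot>\<^sub>m X) * M = c \<cdot>\<^sub>m (a \<cdot>\<^sub>m 1\<^sub>m n + X * M)"
    if "X \<in> carrier_mat n n" for X
    using that M
    by (intro eq_matI) (auto simp: scalar_prod_def sum_distrib_left algebra_simps)
  then show ?case using M by (simp add: polymat_pCons pCons.IH)
qed

lemma polymat_const: "M \<in> carrier_mat n n \<Longrightarrow> polymat n M [:c:] = c \<cdot>\<^sub>m 1\<^sub>m n"
  by (auto simp: polymat_pCons)

lemma polymat_1 [simp]: "M \<in> carrier_mat n n \<Longrightarrow> polymat n M 1 = 1\<^sub>m n"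
  using polymat_const[of M n 1] by (simp add: one_pCons)

lemma polymat_linear: "M \<in> carrier_mat n n \<Longrightarrow> polymat n M [:c, 1:] = c \<cdot>\<^sub>m 1\<^sub>m n + M"
  by (auto simp: polymat_pCons)

lemma polymat_X: "M \<in> carrier_mat n n \<Longrightarrow> polymat n M [:0, 1:] = M"
  by (auto simp: polymat_pCons)

text \<open>The induction on \<open>p\<close> puts each new factor \<open>M\<close> on the right and
  so produces the reversed order. Since polynomials commute, this yields multiplicativity and also
  that any two polynomials in \<open>M\<close> commute.\<close>

lemma polymat_mult':
  assumes M: "M \<in> carrier_mat n n"
  shows "polymat n M (p * q) = polymat n M q * polymat n M p"
proof (induction p)
  case 0
  then show ?case using M by auto
next
  case (pCons a p)
  have "a \<cdot>\<^sub>m Y + Y * X * M = Y * (a \<cdot>\<^sub>m 1\<^sub>m n + X * M)"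
    if "X \<in> carrier_mat n n" "Y \<in> carrier_mat n n" for X Y
  proof -
    have "Y * (a \<cdot>\<^sub>m 1\<^sub>m n) = a \<cdot>\<^sub>m Y"
      using that mult_smult_distrib[of Y n n "1\<^sub>m n" n a] by simp
    then show ?thesis using that M by (simp add: mat_add_distrib_left mat_assoc)
  qed
  from this[OF polymat_carrier[OF M, of p] polymat_carrier[OF M, of q]] show ?case using M
    by (simp add: polymat_pCons pCons.IH polymat_add polymat_smult)
qed

lemma polymat_mult:
  assumes M: "M \<in> carrier_mat n n"
  shows "polymat n M (p * q) = polymat n M p * polymat n M q"
  using polymat_mult'[OF M, of q p] by (simp add: mult.commute)

lemma polymat_commute:
  assumes M: "M \<in> carrier_mat n n"
  shows "polymat n M p * M = M * polymat n M p"
  using polymat_mult[OF M, of p "[:0,1:]"] polymat_mult'[OF M, of p "[:0,1:]"] M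
  by (simp add: polymat_X)

text \<open>Taking adjoints reverses products, but polynomials in \<open>M\<close> commute with
  \<open>M\<close>, so self-adjointness is inherited. It will be applied to a square root that is a
  polynomial in a self-adjoint matrix.\<close>

lemma polymat_self_adjoint:
  assumes M: "M \<in> carrier_mat n n" and A: "A \<in> carrier_mat n n" and adj: "A * M = M\<^sup>T * A"
  shows "A * polymat n M p = (polymat n M p)\<^sup>T * A"
proof (induction p)
  case 0
  then show ?case using A by auto
next
  case (pCons a p)
  let ?P = "polymat n M p"
  note [simp] = polymat_carrier[OF M] polymat_dims[OF M]
  have d: "dim_row M = n" "dim_col M = n" "dim_row A = n" "dim_col A = n" using M A by auto
  note [simp] = d
  have tr: "(a \<cdot>\<^sub>m 1\<^sub>m n + ?P * M)\<^sup>T = a \<cdot>\<^sub>m 1\<^sub>m n + M\<^sup>T * ?P\<^sup>T"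
    using M by (subst transpose_add[of _ n n]) (auto simp: mat_transpose_mult intro!: arg_cong2[where f = "(+)"] eq_matI)
  have "A * (?P * M) = ?P\<^sup>T * (A * M)" by (simp add: mat_assoc[symmetric] pCons.IH)
  also have "\<dots> = (M * ?P)\<^sup>T * A" by (simp add: adj mat_transpose_mult mat_assoc)
  also have "\<dots> = (?P * M)\<^sup>T * A" by (simp only: polymat_commute[OF M])
  finally have 1: "A * (?P * M) = M\<^sup>T * (?P\<^sup>T * A)" by (simp add: mat_transpose_mult mat_assoc)
  have 2: "A * (a \<cdot>\<^sub>m 1\<^sub>m n) = (a \<cdot>\<^sub>m 1\<^sub>m n) * A"
    using A mult_smult_distrib[of A n n "1\<^sub>m n" n a] mult_smult_assoc_mat[of "1\<^sub>m n" n n A n a] by simp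
  show ?case
    by (simp add: polymat_pCons[OF M] tr mat_add_distrib_left mat_add_distrib_right 1 2 mat_assoc)
qed

lemma polymat_eigenvector:
  assumes M: "M \<in> carrier_mat n n" and x: "x \<in> carrier_vec n" and ev: "M *\<^sub>v x = l \<cdot>\<^sub>v x"
  shows "polymat n M p *\<^sub>v x = poly p l \<cdot>\<^sub>v x"
proof (induction p)
  case 0
  then show ?case using x by auto
next
  case (pCons a p)
  note [simp] = polymat_carrier[OF M] polymat_dims[OF M]
  have "polymat n M (pCons a p) *\<^sub>v x = (a \<cdot>\<^sub>m 1\<^sub>m n) *\<^sub>v x + (polymat n M p * M) *\<^sub>v x"
    unfolding polymat_pCons[OF M] by (rule add_mult_distrib_mat_vec[of _ n n]) (use M x in auto)
  also have "(polymat n M p * M) *\<^sub>v x = l \<cdot>\<^sub>v (polymat n M p *\<^sub>v x)"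
    using M x by (simp add: assoc_mult_mat_vec[of _ n n _ n] ev mult_mat_vec[of _ n n])
  also have "(a \<cdot>\<^sub>m 1\<^sub>m n) *\<^sub>v x = a \<cdot>\<^sub>v x"
    using x by (intro eq_vecI) (auto simp: smult_scalar_prod_distrib[of _ n])
  also have "a \<cdot>\<^sub>v x + l \<cdot>\<^sub>v (polymat n M p *\<^sub>v x) = poly (pCons a p) l \<cdot>\<^sub>v x"
    unfolding pCons.IH using x by (intro eq_vecI) (auto simp: algebra_simps)
  finally show ?case .
qed

lemma polymat_monom:
  assumes M: "M \<in> carrier_mat n n"
  shows "polymat n M (monom c l) = c \<cdot>\<^sub>m (M ^\<^sub>m l)"
proof (induction l)
  case 0
  then show ?case using M by (simp add: monom_0 polymat_const)
next
  case (Suc l)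
  have "M ^\<^sub>m l \<in> carrier_mat n n" using M by simp
  then show ?case using M mult_smult_assoc_mat[of "M ^\<^sub>m l" n n M n c]
    by (auto simp: monom_Suc polymat_pCons Suc.IH)
qed

lemma polymat_sum_index:
  assumes M: "M \<in> carrier_mat n n" and "finite I" "i < n" "j < n"
  shows "polymat n M (\<Sum>l\<in>I. f l) $$ (i, j) = (\<Sum>l\<in>I. polymat n M (f l) $$ (i, j))"
  using assms(2)
  by (induction I rule: finite_induct) (use assms in \<open>auto simp: polymat_add\<close>)

section \<open>Annihilating polynomials and square roots of matrices\<close>

lemma wide_kernel:
  fixes A :: "complex Matrix.mat"
  assumes A: "A \<in> carrier_mat r s" and rs: "r < s"
  shows "\<exists>x\<in>carrier_vec s. x \<noteq> 0\<^sub>v s \<and> A *\<^sub>v x = 0\<^sub>v r"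
proof -
  \<comment> \<open>Padding with zero rows gives a square matrix whose transpose annihilates a unit
    vector, hence one of determinant 0.\<close>
  define B where "B = Matrix.mat s s (\<lambda>(i, j). if i < r then A $$ (i, j) else 0)"
  have B: "B \<in> carrier_mat s s" by (simp add: B_def)
  have "B\<^sup>T *\<^sub>v unit_vec s r = 0\<^sub>v s"
    using rs by (intro eq_vecI) (auto simp: B_def Matrix.row_transpose)
  moreover have "unit_vec s r \<noteq> (0\<^sub>v s :: complex Matrix.vec)"
    using rs by (metis index_unit_vec(1) index_zero_vec(1) zero_neq_one)
  ultimately have "Determinant.det (B\<^sup>T) = 0"
    using det_0_iff_vec_prod_zero_field[of "B\<^sup>T" s] B
    by (metis transpose_carrier_mat unit_vec_carrier)
  then obtain x where x: "x \<in> carrier_vec s" "x \<noteq> 0\<^sub>v s" "B *\<^sub>v x = 0\<^sub>v s"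
    using det_transpose[OF B] det_0_iff_vec_prod_zero_field[OF B] by auto
  have "A *\<^sub>v x = 0\<^sub>v r"
  proof (rule eq_vecI)
    fix i assume "i < dim_vec (0\<^sub>v r :: complex Matrix.vec)"
    then have i: "i < r" by simp
    then have "i < s" using rs by simp
    with i have "(B *\<^sub>v x) $ i = (A *\<^sub>v x) $ i"
      using A x(1) by (simp add: B_def scalar_prod_def)
    then show "(A *\<^sub>v x) $ i = 0\<^sub>v r $ i" using x(3) i rs by simp
  qed (use A in auto)
  then show ?thesis using x by auto
qed

text \<open>The powers of \<open>M\<close> with exponents up to \<open>n * n\<close> are one too
  many to be linearly independent. Column \<open>l\<close> of \<open>A\<close> lists the entries of
  the \<open>l\<close>-th power, the position \<open>(i, j)\<close> being encoded as
  \<open>i * n + j\<close>.\<close>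

lemma polymat_annihilator:
  assumes M: "M \<in> carrier_mat n n"
  shows "\<exists>p. p \<noteq> 0 \<and> polymat n M p = 0\<^sub>m n n"
proof -
  let ?r = "n * n" let ?s = "Suc (n * n)"
  define A where "A = Matrix.mat ?r ?s (\<lambda>(e, l). (M ^\<^sub>m l) $$ (e div n, e mod n))"
  obtain x where x: "x \<in> carrier_vec ?s" "x \<noteq> 0\<^sub>v ?s" "A *\<^sub>v x = 0\<^sub>v ?r"
    using wide_kernel[of A ?r ?s] by (auto simp: A_def)
  define p where "p = (\<Sum>l<?s. monom (x $ l) l)"
  have coeff: "coeff p l = x $ l" if "l < ?s" for l
    using that by (simp add: p_def coeff_sum)
  obtain l where "l < ?s" "x $ l \<noteq> 0" using x(1,2)
    by (metis carrier_vecD eq_vecI index_zero_vec(1) index_zero_vec(2))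
  then have "p \<noteq> 0" using coeff by fastforce
  moreover have "polymat n M p = 0\<^sub>m n n"
  proof (rule eq_matI)
    fix i j assume "i < dim_row (0\<^sub>m n n :: complex Matrix.mat)" "j < dim_col (0\<^sub>m n n :: complex Matrix.mat)"
    then have ij: "i < n" "j < n" by auto
    let ?e = "i * n + j"
    have "?e < Suc i * n" using ij by simp
    also have "\<dots> \<le> ?r" using ij by (intro mult_le_mono1) simp
    finally have e: "?e < ?r" .
    have "polymat n M p $$ (i, j) = (\<Sum>l<?s. x $ l * (M ^\<^sub>m l) $$ (i, j))"
      unfolding p_def using ij M pow_carrier_mat[OF M]
      by (subst polymat_sum_index[OF M]) (auto simp: polymat_monom intro!: sum.cong)
    also have "\<dots> = (A *\<^sub>v x) $ ?e"
      using e ij x(1) by (auto simp: A_def scalar_prod_def atLeast0LessThan intro!: sum.cong)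
    also have "\<dots> = 0" using e x(3) by simp
    finally show "polymat n M p $$ (i, j) = 0\<^sub>m n n $$ (i, j)" using ij by simp
  qed (use M in auto)
  ultimately show ?thesis by blast
qed

text \<open>An annihilator of least degree has no root 0: a factor \<open>X\<close> could be
  cancelled by multiplying with the inverse of \<open>T\<close>.\<close>

lemma polymat_annihilator_invertible:
  assumes T: "inv_pair n T T'"
  shows "\<exists>p. poly p 0 \<noteq> 0 \<and> polymat n T p = 0\<^sub>m n n"
proof -
  note Tc = inv_pairD[OF T]
  obtain p where p: "p \<noteq> 0" "polymat n T p = 0\<^sub>m n n" "\<And>q. q \<noteq> 0 \<Longrightarrow> polymat n T q = 0\<^sub>m n n \<Longrightarrow> degree p \<le> degree q"
    using polymat_annihilator[OF Tc(1)]
      ex_has_least_nat[of "\<lambda>p. p \<noteq> 0 \<and> polymat n T p = 0\<^sub>m n n" _ degree]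
    by metis
  have "poly p 0 \<noteq> 0"
  proof
    assume "poly p 0 = 0"
    then obtain q where q: "p = pCons 0 q" by (cases p) auto
    then have "q \<noteq> 0" using p(1) by auto
    have "polymat n T q * T = 0\<^sub>m n n"
      using p(2) by (simp add: q polymat_pCons[OF Tc(1)] polymat_dims[OF Tc(1)] inv_pair_dims[OF T])
    then have "polymat n T q * (T * T') = 0\<^sub>m n n * T'"
      by (simp add: mat_assoc[symmetric] polymat_dims[OF Tc(1)] inv_pair_dims[OF T])
    then have "polymat n T q = 0\<^sub>m n n"
      unfolding Tc(3) using Tc(2) polymat_carrier[OF Tc(1), of q] by simp
    from p(3)[OF \<open>q \<noteq> 0\<close> this] show False using \<open>q \<noteq> 0\<close> by (simp add: q)
  qed
  then show ?thesis using p by blast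
qed

text \<open>A square root of \<open>x\<close> modulo a product of linear factors lifts along one further factor
  \<open>x - a\<close>: the correction by a multiple \<open>t\<close> of the old modulus has to satisfy an equation of
  degree at most two, which is never a nonzero constant because \<open>a \<noteq> 0\<close>.\<close>

lemma sqrt_modulo_linear_factors:
  fixes as :: "complex list"
  assumes "0 \<notin> set as"
  shows "\<exists>q. (\<Prod>a\<leftarrow>as. [:-a, 1:]) dvd q * q - [:0, 1:]"
  using assms
proof (induction as)
  case Nil
  then show ?case by auto
next
  case (Cons a as)
  let ?P = "\<Prod>a\<leftarrow>as. [:-a, 1:]"
  obtain q r where r: "q * q - [:0, 1:] = ?P * r" using Cons by (auto elim!: dvdE)
  have "\<exists>t. poly r a + 2 * t * poly q a + t^2 * poly ?P a = 0"
  proof (cases "poly ?P a = 0")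
    case True
    then have "poly (q * q - [:0, 1:]) a = 0" by (simp add: r)
    then have "poly q a * poly q a = a" by simp
    then have "poly q a \<noteq> 0" using Cons.prems by auto
    then show ?thesis using True
      by (intro exI[of _ "- poly r a / (2 * poly q a)"]) simp
  next
    case False
    let ?P' = "poly ?P a" and ?q = "poly q a" and ?r = "poly r a"
    \<comment> \<open>The quadratic formula, applied to the equation for \<open>t\<close> with
      leading coefficient \<open>?P'\<close>.\<close>
    let ?d = "csqrt (?q^2 - ?P' * ?r)"
    define t where "t = (?d - ?q) / ?P'"
    have t: "t * ?P' = ?d - ?q" using False by (simp add: t_def)
    have "?P' * (?r + 2 * t * ?q + t^2 * ?P') = ?P' * ?r + 2 * (t * ?P') * ?q + (t * ?P')^2"
      by (simp add: power2_eq_square algebra_simps)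
    also have "\<dots> = ?P' * ?r - ?q^2 + ?d^2" unfolding t by (simp add: power2_eq_square algebra_simps)
    also have "\<dots> = 0" by simp
    finally show ?thesis using False by auto
  qed
  then obtain t where t: "poly r a + 2 * t * poly q a + t^2 * poly ?P a = 0" by blast
  let ?q = "q + [:t:] * ?P"
  let ?r = "r + [:2 * t:] * q + [:t^2:] * ?P"
  have "poly ?r a = 0" using t by simp
  then obtain s where s: "?r = [:-a, 1:] * s" using poly_eq_0_iff_dvd by blast
  have two: "[:2 * t:] = 2 * [:t:]" "[:t^2:] = [:t:] * [:t:]"
    by (auto simp: power2_eq_square numeral_poly)
  have ring: "(q + T * P) * (q + T * P) - x = P * (r + 2 * T * q + T * T * P)"
    if "q * q - x = P * r" for x T P :: "complex poly"
  proof -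
    have "q * q = x + P * r" using that by (simp add: algebra_simps)
    then have "(q + T * P) * (q + T * P) = x + P * r + 2 * (T * P * q) + T * P * (T * P)"
      by (simp add: distrib_left distrib_right mult.commute)
    then show ?thesis by (simp add: algebra_simps)
  qed
  have "?q * ?q - [:0, 1:] = ?P * ?r" unfolding two using ring[OF r, of "[:t:]"] .
  also have "\<dots> = (\<Prod>a\<leftarrow>a # as. [:-a, 1:]) * s" unfolding s by (simp only: list.map prod_list.Cons ac_simps)
  finally show ?case by (metis dvd_triv_left)
qed

text \<open>\<open>X\<close> has a square root \<open>q\<close> modulo an annihilator
  \<open>p\<close> of \<open>T\<close> whose roots are all nonzero, and substituting
  \<open>T\<close> kills the multiple of \<open>p\<close>. That the root is a polynomial in
  \<open>T\<close> is the point: it allows \<open>polymat_self_adjoint\<close> to be used.\<close>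

lemma polymat_sqrt:
  assumes T: "inv_pair n T T'"
  shows "\<exists>q. polymat n T q * polymat n T q = T"
proof -
  note Tc = inv_pairD[OF T]
  obtain p where p: "poly p 0 \<noteq> 0" "polymat n T p = 0\<^sub>m n n"
    using polymat_annihilator_invertible[OF T] by blast
  obtain as where as: "Polynomial.smult (lead_coeff p) (\<Prod>a\<leftarrow>as. [:-a, 1:]) = p"
    using fundamental_theorem_algebra_factorized by blast
  have "poly (\<Prod>a\<leftarrow>as. [:-a, 1:]) 0 \<noteq> 0" using p(1) as by (metis mult_zero_right poly_smult)
  then have "0 \<notin> set as" by (auto simp: poly_prod_list prod_list_zero_iff)
  from sqrt_modulo_linear_factors[OF this] obtain q where
    q: "(\<Prod>a\<leftarrow>as. [:-a, 1:]) dvd q * q - [:0, 1:]" by blast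
  have "lead_coeff p \<noteq> 0" using p(1) by auto
  then have "p dvd q * q - [:0, 1:]" using q as by (metis smult_dvd_iff)
  then obtain r where "q * q - [:0, 1:] = p * r" by (elim dvdE)
  then have "q * q = [:0, 1:] + p * r" by (simp add: algebra_simps)
  then have "polymat n T (q * q) = T + 0\<^sub>m n n * polymat n T r"
    using Tc by (simp only: polymat_add[OF Tc(1)] polymat_mult[OF Tc(1)] polymat_X p)
  then show ?thesis using Tc by (auto simp: polymat_mult)
qed

text \<open>If \<open>R A S = B\<close> and \<open>R A\<^sup>T S = B\<^sup>T\<close>, then \<open>T = S (R\<^sup>T)\<^sup>-\<^sup>1\<close> is self-adjoint
  for \<open>A\<close>, and so is a square root of \<open>T\<close> which is a polynomial in \<open>T\<close>; this square root times
  \<open>R\<^sup>T\<close> is the required congruence.\<close>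

lemma congr_of_strict_equivalence:
  assumes A: "A \<in> carrier_mat n n" and R: "inv_pair n R R'" and S: "inv_pair n S S'"
    and 1: "R * A * S = B" and 2: "R * A\<^sup>T * S = B\<^sup>T"
  shows "congr n A B"
proof -
  note [simp] = inv_pair_dims[OF R] inv_pair_dims[OF S]
  have [simp]: "dim_row A = n" "dim_col A = n" using A by auto
  define T where "T = S * R'\<^sup>T"
  have T: "inv_pair n T (R\<^sup>T * S')"
    unfolding T_def using inv_pair_mult[OF S inv_pair_sym[OF inv_pair_transpose[OF R]]] .
  note Tc = inv_pairD[OF T]
  have [simp]: "dim_row T = n" "dim_col T = n" using Tc by auto
  have "(R * A\<^sup>T * S)\<^sup>T = (R * A * S)" using 1 2 by simp
  then have eq: "S\<^sup>T * A * R\<^sup>T = R * A * S" by (simp add: mat_transpose_mult mat_assoc)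
  have "T\<^sup>T * A = R' * (S\<^sup>T * A * R\<^sup>T) * R'\<^sup>T"
    by (simp add: T_def mat_transpose_mult mat_assoc inv_pair_cancel[OF R]
        inv_pair_cancel[OF inv_pair_transpose[OF R]] inv_pairD[OF inv_pair_transpose[OF R]] right_mult_one_mat')
  also have "\<dots> = A * T"
    unfolding eq by (simp add: T_def mat_assoc inv_pair_cancel[OF R])
  finally have adj: "A * T = T\<^sup>T * A" by simp
  obtain q where q: "polymat n T q * polymat n T q = T" using polymat_sqrt[OF T] by blast
  define Q where "Q = polymat n T q"
  have Q: "Q \<in> carrier_mat n n" "Q * Q = T" using Tc q by (auto simp: Q_def)
  have [simp]: "dim_row Q = n" "dim_col Q = n" using Q by auto
  have AQ: "A * Q = Q\<^sup>T * A" unfolding Q_def by (rule polymat_self_adjoint) (use Tc A adj in auto)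
  have "Q * (Q * (R\<^sup>T * S')) = (Q * Q) * (R\<^sup>T * S')" by (simp add: mat_assoc)
  then have "Q * (Q * (R\<^sup>T * S')) = 1\<^sub>m n" unfolding Q(2) Tc(3) .
  then have Qinv: "inv_pair n Q (Q * (R\<^sup>T * S'))"
    by (intro inv_pairI1[OF Q(1)] carrier_matI) simp_all
  have S_eq: "S = T * R\<^sup>T"
    by (simp add: T_def mat_assoc inv_pairD[OF inv_pair_transpose[OF R]] right_mult_one_mat')
  have "B = R * (A * (Q * (Q * R\<^sup>T)))" unfolding 1[symmetric] S_eq Q(2)[symmetric] by (simp add: mat_assoc)
  also have "\<dots> = R * (A * Q * (Q * R\<^sup>T))" by (simp add: mat_assoc)
  also have "\<dots> = (Q * R\<^sup>T)\<^sup>T * A * (Q * R\<^sup>T)" unfolding AQ by (simp add: mat_assoc mat_transpose_mult)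
  finally show ?thesis
    by (intro congrI[OF A inv_pair_mult[OF Qinv inv_pair_transpose[OF R]]])
qed

text \<open>The asymmetries are \<open>L\<close> and \<open>K\<close>, with
  \<open>L = P K P^-1\<close>. For \<open>R = B^T P^-1 (A^T)^-1\<close> one has
  \<open>R A^T P = B^T\<close> at once, and \<open>R A P = B\<close> follows by writing
  \<open>A = A^T L\<close> and \<open>B = B^T K\<close>.\<close>

lemma congr_of_similar_asymmetry:
  assumes A: "A \<in> carrier_mat n n" and B: "B \<in> carrier_mat n n"
    and Ai: "inv_pair n A A'" and Bi: "inv_pair n B B'"
    and L: "A\<^sup>T * L = A" and K: "B\<^sup>T * K = B" and sim: "similar_mat L K"
  shows "congr n A B"
proof -
  obtain m P Q where PQ: "{L, K, P, Q} \<subseteq> carrier_mat m m" "P * Q = 1\<^sub>m m" "Q * P = 1\<^sub>m m" "L = P * K * Q"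
    using similar_matD[OF sim] by blast
  have "dim_col (A\<^sup>T * L) = m" using PQ by auto
  then have m: "m = n" using L A by auto
  have P: "inv_pair n P Q" using PQ by (auto simp: inv_pair_def m)
  note At = inv_pair_transpose[OF Ai] note Bt = inv_pair_transpose[OF Bi]
  define R where "R = B\<^sup>T * (Q * A'\<^sup>T)"
  have R: "inv_pair n R (A\<^sup>T * P * B'\<^sup>T)"
    unfolding R_def
    using inv_pair_mult[OF Bt inv_pair_mult[OF inv_pair_sym[OF P] inv_pair_sym[OF At]]] .
  have [simp]: "dim_row L = n" "dim_col L = n" "dim_row K = n" "dim_col K = n"  using PQ m by auto
  note [simp] = inv_pair_dims[OF P] inv_pair_dims[OF Ai] inv_pair_dims[OF Bi]
  have "R * A * P = R * (A\<^sup>T * L) * P" using L by simp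
  also have "\<dots> = B\<^sup>T * (Q * (L * P))" by (simp add: R_def mat_assoc inv_pair_cancel[OF At])
  also have "Q * (L * P) = K" unfolding PQ(4)
    using inv_pairD[OF P] PQ(1) by (simp add: mat_assoc inv_pair_cancel[OF P])
  finally have 1: "R * A * P = B" using K by simp
  have 2: "R * A\<^sup>T * P = B\<^sup>T"
    using inv_pairD[OF P] inv_pairD[OF At] by (simp add: R_def mat_assoc inv_pair_cancel[OF At])
  show ?thesis by (rule congr_of_strict_equivalence[OF A R P 1 2])
qed

section \<open>Rank normal forms\<close>

lemma uminus_zero_mat [simp]: "- (0\<^sub>m n m :: complex Matrix.mat) = 0\<^sub>m n m"
  by (rule eq_matI) auto

lemma mult_mat_zero_vec [simp]:
  fixes A :: "complex Matrix.mat"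
  shows "dim_row A = n \<Longrightarrow> dim_col A = m \<Longrightarrow> A *\<^sub>v 0\<^sub>v m = 0\<^sub>v n"
  by (rule eq_vecI) auto

lemma inv_pair_upper:
  assumes X: "X \<in> carrier_mat k m"
  shows "inv_pair (k + m) (four_block_mat (1\<^sub>m k) X (0\<^sub>m m k) (1\<^sub>m m))
    (four_block_mat (1\<^sub>m k) (- X) (0\<^sub>m m k) (1\<^sub>m m))"
proof (rule inv_pairI1)
  have "four_block_mat (1\<^sub>m k) X (0\<^sub>m m k) (1\<^sub>m m) * four_block_mat (1\<^sub>m k) (- X) (0\<^sub>m m k) (1\<^sub>m m) =
    four_block_mat (1\<^sub>m k) (- X + X) (0\<^sub>m m k) (1\<^sub>m m)"
    by (subst mult_four_block_mat[of _ k k _ m _ m _ _ k _ m]) (use X in auto)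
  also have "- X + X = 0\<^sub>m k m" using X by auto
  finally show "four_block_mat (1\<^sub>m k) X (0\<^sub>m m k) (1\<^sub>m m) * four_block_mat (1\<^sub>m k) (- X) (0\<^sub>m m k) (1\<^sub>m m) = 1\<^sub>m (k + m)"
    by simp
qed (use X in auto)

lemma inv_pair_lower:
  assumes X: "X \<in> carrier_mat m k"
  shows "inv_pair (k + m) (four_block_mat (1\<^sub>m k) (0\<^sub>m k m) X (1\<^sub>m m))
    (four_block_mat (1\<^sub>m k) (0\<^sub>m k m) (- X) (1\<^sub>m m))"
proof -
  have "(four_block_mat (1\<^sub>m k) (X\<^sup>T) (0\<^sub>m m k) (1\<^sub>m m))\<^sup>T = four_block_mat (1\<^sub>m k) (0\<^sub>m k m) X (1\<^sub>m m)"
    "(four_block_mat (1\<^sub>m k) (- X\<^sup>T) (0\<^sub>m m k) (1\<^sub>m m))\<^sup>T = four_block_mat (1\<^sub>m k) (0\<^sub>m k m) (- X) (1\<^sub>m m)"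
    using X by (auto simp: transpose_four_block_mat[of _ k k _ m _ m] intro!: cong_four_block_mat eq_matI)
  then show ?thesis
    using inv_pair_transpose[OF inv_pair_upper[of "X\<^sup>T" k m]] X by simp
qed

text \<open>Block elimination with pivot \<open>a\<close>: the left factor clears \<open>c\<close>,
  the right factor clears \<open>b\<close>. If \<open>c a'\<close> is the transpose of
  \<open>a' b\<close>, the two factors are transposes of each other and the identity becomes a
  congruence.\<close>

lemma schur_complement:
  assumes a: "inv_pair k a a'" and b: "b \<in> carrier_mat k n" and c: "c \<in> carrier_mat m k"
    and d: "d \<in> carrier_mat m n"
  shows "four_block_mat (1\<^sub>m k) (0\<^sub>m k m) (- (c * a')) (1\<^sub>m m) * four_block_mat a b c d *
    four_block_mat (1\<^sub>m k) (- (a' * b)) (0\<^sub>m n k) (1\<^sub>m n) = dsum a (d - c * (a' * b))"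
proof -
  note ac = inv_pairD[OF a]
  have 1: "- (c * a') * a = - c"
    using ac c by (simp add: mat_assoc inv_pair_dims[OF a])
  have 2: "- (c * a') * b = - (c * (a' * b))"
    using ac b c by (simp add: mat_assoc inv_pair_dims[OF a])
  have 3: "a * (- (a' * b)) = - b"
    using ac b by (simp add: inv_pair_cancel[OF a])
  have "four_block_mat (1\<^sub>m k) (0\<^sub>m k m) (- (c * a')) (1\<^sub>m m) * four_block_mat a b c d =
    four_block_mat a b (- c + c) (- (c * (a' * b)) + d)"
    by (subst mult_four_block_mat[of _ k k _ m _ m _ _ k _ n]) (use ac b c d in \<open>auto simp: 1 2\<close>)
  also have "- c + c = 0\<^sub>m m k" using c by auto
  also have "- (c * (a' * b)) + d = d - c * (a' * b)" using b c d by (intro eq_matI) auto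
  finally have "four_block_mat (1\<^sub>m k) (0\<^sub>m k m) (- (c * a')) (1\<^sub>m m) * four_block_mat a b c d =
    four_block_mat a b (0\<^sub>m m k) (d - c * (a' * b))" .
  moreover have "four_block_mat a b (0\<^sub>m m k) (d - c * (a' * b)) *
    four_block_mat (1\<^sub>m k) (- (a' * b)) (0\<^sub>m n k) (1\<^sub>m n) = four_block_mat a (- b + b) (0\<^sub>m m k) (d - c * (a' * b))"
    by (subst mult_four_block_mat[of _ k k _ n _ m _ _ k _ n]) (use ac b c d in \<open>auto simp: 3\<close>)
  moreover have "- b + b = 0\<^sub>m k n" using b by auto
  ultimately show ?thesis using ac b c d by (simp add: dsum_def)
qed

definition rank_nf :: "nat \<Rightarrow> nat \<Rightarrow> nat \<Rightarrow> complex Matrix.mat" where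
  "rank_nf r s k = Matrix.mat r s (\<lambda>(i, j). if i = j \<and> i < k then 1 else 0)"

lemma rank_nf_dims [simp]: "dim_row (rank_nf r s k) = r" "dim_col (rank_nf r s k) = s"
    "rank_nf r s k \<in> carrier_mat r s"
  by (auto simp: rank_nf_def)

definition equivalent :: "nat \<Rightarrow> nat \<Rightarrow> complex Matrix.mat \<Rightarrow> complex Matrix.mat \<Rightarrow> bool" where
  "equivalent r s A B \<longleftrightarrow> (\<exists>P P' Q Q'. inv_pair r P P' \<and> inv_pair s Q Q' \<and> P * A * Q = B)"

lemma equivalent_refl: "A \<in> carrier_mat r s \<Longrightarrow> equivalent r s A A"
  unfolding equivalent_def
  by (rule exI[of _ "1\<^sub>m r"], rule exI[of _ "1\<^sub>m r"], rule exI[of _ "1\<^sub>m s"], rule exI[of _ "1\<^sub>m s"])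
    (simp add: inv_pair_one)

lemma equivalent_trans:
  assumes A: "A \<in> carrier_mat r s" and 1: "equivalent r s A B" and 2: "equivalent r s B C"
  shows "equivalent r s A C"
proof -
  obtain P P' Q Q' where P: "inv_pair r P P'" "inv_pair s Q Q'" "P * A * Q = B"
    using 1 by (auto simp: equivalent_def)
  obtain R R' S S' where R: "inv_pair r R R'" "inv_pair s S S'" "R * B * S = C"
    using 2 by (auto simp: equivalent_def)
  have "R * P * A * (Q * S) = C"
    unfolding R(3)[symmetric] P(3)[symmetric]
    using A by (simp add: mat_assoc inv_pair_dims[OF P(1)] inv_pair_dims[OF P(2)] inv_pair_dims[OF R(1)] inv_pair_dims[OF R(2)])
  then show ?thesis unfolding equivalent_def
    using inv_pair_mult[OF R(1) P(1)] inv_pair_mult[OF P(2) R(2)] by blast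
qed

lemma equivalent_pivot:
  assumes A: "A \<in> carrier_mat (Suc r) (Suc s)" and nz: "A \<noteq> 0\<^sub>m (Suc r) (Suc s)"
  shows "\<exists>B\<in>carrier_mat r s. equivalent (Suc r) (Suc s) A (dsum (1\<^sub>m 1) B)"
proof -
  obtain i j where ij: "i < Suc r" "j < Suc s" "A $$ (i, j) \<noteq> 0"
    using A nz by (metis carrier_matD eq_matI index_zero_mat)
  \<comment> \<open>A nonzero entry is brought to the corner to serve as pivot; columns are swapped
    as rows of the transpose.\<close>
  let ?P = "swaprows_mat (Suc r) i 0" and ?Q = "swaprows_mat (Suc s) j 0"
  have P: "inv_pair (Suc r) ?P ?P" and Q: "inv_pair (Suc s) ?Q ?Q"
    using ij by (auto intro!: inv_pairI1 swaprows_mat_inv)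
  define C where "C = ?P * A * ?Q\<^sup>T"
  have C: "C \<in> carrier_mat (Suc r) (Suc s)" using A by (auto simp: C_def)
  have AC: "equivalent (Suc r) (Suc s) A C"
    unfolding equivalent_def C_def using P inv_pair_transpose[OF Q] by blast
  have PA: "?P * A = swaprows i 0 A" using swaprows_mat[OF A ij(1), of 0] by simp
  have "C\<^sup>T = ?Q * (swaprows i 0 A)\<^sup>T"
    using A by (simp add: C_def PA mat_transpose_mult)
  also have "\<dots> = swaprows j 0 ((swaprows i 0 A)\<^sup>T)"
    using swaprows_mat[of "(swaprows i 0 A)\<^sup>T" "Suc s" "Suc r" j 0] A ij(2) by simp
  finally have "C = (swaprows j 0 ((swaprows i 0 A)\<^sup>T))\<^sup>T" by (metis Matrix.transpose_transpose)
  then have C00: "C $$ (0, 0) \<noteq> 0" using A ij by (auto simp: mat_swaprows_def)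
  obtain a b c d where sp: "split_block C 1 1 = (a, b, c, d)" by (metis prod_cases4)
  note sb = split_block[OF sp, of r s]
  have cs: "a \<in> carrier_mat 1 1" "b \<in> carrier_mat 1 s" "c \<in> carrier_mat r 1" "d \<in> carrier_mat r s"
    "C = four_block_mat a b c d" using sb C by auto
  have "a $$ (0, 0) \<noteq> 0" using C00 cs by auto
  then have "inv_pair 1 a (Matrix.mat 1 1 (\<lambda>_. 1 / a $$ (0, 0)))"
    using cs by (intro inv_pairI1) (auto simp: scalar_prod_def intro!: eq_matI)
  then obtain a' where a: "inv_pair 1 a a'" by blast
  let ?D = "d - c * (a' * b)"
  have D: "?D \<in> carrier_mat r s" using cs inv_pairD[OF a] by auto
  have 1: "equivalent (Suc r) (Suc s) C (dsum a ?D)"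
    unfolding equivalent_def
    using schur_complement[OF a cs(2,3,4)] inv_pair_lower[of "- (c * a')" r 1] inv_pair_upper[of "- (a' * b)" 1 s]
      cs inv_pairD[OF a] by (metis mult_carrier_mat plus_1_eq_Suc uminus_carrier_mat)
  have "dsum a' (1\<^sub>m r) * dsum a ?D * 1\<^sub>m (Suc s) = dsum (1\<^sub>m 1) ?D"
    using D cs inv_pairD[OF a] by (simp add: dsum_mult_carrier[of _ 1 1 _ 1 _ r r _ s])
  then have 2: "equivalent (Suc r) (Suc s) (dsum a ?D) (dsum (1\<^sub>m 1) ?D)"
    unfolding equivalent_def
    using inv_pair_dsum[OF inv_pair_sym[OF a] inv_pair_one[of r]] inv_pair_one[of "Suc s"]
    by (metis plus_1_eq_Suc)
  show ?thesis
    using equivalent_trans[OF A AC equivalent_trans[OF C 1 2]] D by blast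
qed

lemma rank_normal_form:
  "A \<in> carrier_mat r s \<Longrightarrow> \<exists>k\<le>min r s. equivalent r s A (rank_nf r s k)"
proof (induction r arbitrary: s A)
  case 0
  then have "A = rank_nf 0 s 0" by (auto simp: rank_nf_def intro!: eq_matI)
  then have "equivalent 0 s A (rank_nf 0 s 0)"
    using equivalent_refl[OF 0] by simp
  then show ?case by (intro exI[of _ 0]) auto
next
  case (Suc r)
  show ?case
  proof (cases "A = 0\<^sub>m (Suc r) s")
    case True
    then have "A = rank_nf (Suc r) s 0" by (auto simp: rank_nf_def intro!: eq_matI)
    then have "equivalent (Suc r) s A (rank_nf (Suc r) s 0)"
      using equivalent_refl[OF Suc.prems] by simp
    then show ?thesis by (intro exI[of _ 0]) auto
  next
    case False
    then obtain t where s: "s = Suc t"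
      using Suc.prems by (cases s) (auto intro!: eq_matI)
    obtain B where B: "B \<in> carrier_mat r t" "equivalent (Suc r) (Suc t) A (dsum (1\<^sub>m 1) B)"
      using equivalent_pivot[of A r t] Suc.prems False unfolding s by blast
    obtain k where k: "k \<le> min r t" "equivalent r t B (rank_nf r t k)"
      using Suc.IH[OF B(1)] by blast
    obtain P P' Q Q' where P: "inv_pair r P P'" "inv_pair t Q Q'" "P * B * Q = rank_nf r t k"
      using k(2) by (auto simp: equivalent_def)
    note Pc = inv_pairD(1)[OF P(1)] note Qc = inv_pairD(1)[OF P(2)]
    have "dsum (1\<^sub>m 1) P * dsum (1\<^sub>m 1) B * dsum (1\<^sub>m 1) Q = dsum (1\<^sub>m 1) (rank_nf r t k)"
      unfolding P(3)[symmetric] using Pc Qc B(1)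
      by (simp add: dsum_mult)
    also have "\<dots> = rank_nf (Suc r) (Suc t) (Suc k)"
      by (rule eq_matI) (auto simp: dsum_def rank_nf_def)
    finally have "equivalent (Suc r) (Suc t) (dsum (1\<^sub>m 1) B) (rank_nf (Suc r) (Suc t) (Suc k))"
      unfolding equivalent_def
      using inv_pair_dsum[OF inv_pair_one[of 1] P(1)] inv_pair_dsum[OF inv_pair_one[of 1] P(2)]
      by (metis plus_1_eq_Suc)
    from equivalent_trans[OF _ B(2) this] show ?thesis
      unfolding s using Suc.prems k(1) s by (intro exI[of _ "Suc k"]) auto
  qed
qed

text \<open>\<open>U * rank_nf r m m\<close> consists of the first \<open>m\<close> columns of
  \<open>U\<close>, so this is the completion of linearly independent columns to a basis.\<close>

lemma extend_to_basis:
  assumes V: "V \<in> carrier_mat r m"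
    and inj: "\<And>c. c \<in> carrier_vec m \<Longrightarrow> V *\<^sub>v c = 0\<^sub>v r \<Longrightarrow> c = 0\<^sub>v m"
  shows "m \<le> r \<and> (\<exists>U U'. inv_pair r U U' \<and> U * rank_nf r m m = V)"
proof -
  obtain k P P' Q Q' where k: "k \<le> min r m" and P: "inv_pair r P P'" and Q: "inv_pair m Q Q'"
    and eq: "P * V * Q = rank_nf r m k"
    using rank_normal_form[OF V] by (auto simp: equivalent_def)
  note Pc = inv_pairD[OF P] note Qc = inv_pairD[OF Q]
  have nfc: "rank_nf r m k \<in> carrier_mat r m" by (simp add: rank_nf_def)
  have PV: "P' * rank_nf r m k = V * Q"
    unfolding eq[symmetric] using V by (simp add: mat_assoc inv_pair_dims[OF P] inv_pair_dims[OF Q] inv_pair_cancel[OF P])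
  \<comment> \<open>Otherwise the unit vector number \<open>k\<close> is in the kernel of the normal
    form, and \<open>Q\<close> maps it to a nonzero vector in the kernel of
    \<open>V\<close>.\<close>
  have "k = m"
  proof (rule ccontr)
    assume "k \<noteq> m"
    then have km: "k < m" using k by auto
    let ?e = "unit_vec m k :: complex Matrix.vec"
    have "rank_nf r m k *\<^sub>v ?e = 0\<^sub>v r"
      using km by (intro eq_vecI) (auto simp: rank_nf_def)
    then have "P' *\<^sub>v (rank_nf r m k *\<^sub>v ?e) = 0\<^sub>v r" by (simp add: inv_pair_dims[OF P])
    then have "(V * Q) *\<^sub>v ?e = 0\<^sub>v r"
      unfolding PV[symmetric] by (subst assoc_mult_mat_vec[OF Pc(2) nfc]) auto
    then have "V *\<^sub>v (Q *\<^sub>v ?e) = 0\<^sub>v r"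
      by (subst (asm) assoc_mult_mat_vec[OF V Qc(1)]) auto
    then have "Q *\<^sub>v ?e = 0\<^sub>v m" using inj Qc by auto
    then have "?e = 0\<^sub>v m" using inv_pair_kernel[OF Q] by auto
    then show False using km by (metis index_unit_vec(1) index_zero_vec(1) zero_neq_one)
  qed
  then have mr: "m \<le> r" using k by auto
  \<comment> \<open>Padded by an identity, \<open>Q'\<close> can be moved from the right of the
    rectangular normal form to its left, so that a single square factor remains.\<close>
  define U where "U = P' * dsum Q' (1\<^sub>m (r - m))"
  have D: "inv_pair r (dsum Q' (1\<^sub>m (r - m))) (dsum Q (1\<^sub>m (r - m)))"
    using inv_pair_dsum[OF inv_pair_sym[OF Q] inv_pair_one[of "r - m"]] mr by simp
  have U: "inv_pair r U (dsum Q (1\<^sub>m (r - m)) * P)"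
    unfolding U_def using inv_pair_mult[OF inv_pair_sym[OF P] D] .
  have id: "rank_nf r m m = dsum (1\<^sub>m m) (0\<^sub>m (r - m) 0)"
    using mr by (intro eq_matI) (auto simp: rank_nf_def dsum_def)
  have Dn: "dsum Q' (1\<^sub>m (r - m)) * rank_nf r m m = rank_nf r m m * Q'"
  proof -
    have "dsum Q' (1\<^sub>m (r - m)) * rank_nf r m m = dsum (Q' * 1\<^sub>m m) (1\<^sub>m (r - m) * 0\<^sub>m (r - m) 0)"
      unfolding id using Qc by (intro dsum_mult) auto
    also have "\<dots> = dsum (1\<^sub>m m * Q') (0\<^sub>m (r - m) 0 * 0\<^sub>m 0 0)" using Qc by simp
    also have "\<dots> = dsum (1\<^sub>m m) (0\<^sub>m (r - m) 0) * dsum Q' (0\<^sub>m 0 0)"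
      using Qc by (intro dsum_mult[symmetric]) auto
    also have "\<dots> = rank_nf r m m * Q'" unfolding id by simp
    finally show ?thesis .
  qed
  have "U * rank_nf r m m = P' * (rank_nf r m m * Q')"
    unfolding U_def Dn[symmetric] using inv_pair_dims[OF P] inv_pair_dims[OF D] by (simp add: mat_assoc rank_nf_def)
  also have "\<dots> = (P' * rank_nf r m k) * Q'"
    using inv_pair_dims[OF P] inv_pair_dims[OF Q] by (simp add: mat_assoc rank_nf_def \<open>k = m\<close>)
  also have "\<dots> = V" unfolding PV using V Qc by (simp add: mat_assoc inv_pair_dims[OF Q])
  finally show ?thesis using U mr by blast
qed

text \<open>A right inverse of \<open>b\<close> makes the transpose of \<open>b\<close> injective,
  and completing its columns to a basis gives the column operations \<open>Q\<close> after
  transposition.\<close>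

lemma split_epi_normal_form:
  assumes b: "b \<in> carrier_mat q m" and C: "C \<in> carrier_mat m q" and bC: "b * C = 1\<^sub>m q"
  shows "q \<le> m \<and> (\<exists>Q Q'. inv_pair m Q Q' \<and> b * Q = rank_nf q m q)"
proof -
  have "c = 0\<^sub>v q" if c: "c \<in> carrier_vec q" "b\<^sup>T *\<^sub>v c = 0\<^sub>v m" for c
  proof -
    have "C\<^sup>T * b\<^sup>T = (b * C)\<^sup>T" using b C by (simp add: mat_transpose_mult)
    then have "C\<^sup>T * b\<^sup>T = 1\<^sub>m q" unfolding bC by simp
    then have "c = (C\<^sup>T * b\<^sup>T) *\<^sub>v c" using c(1) by simp
    also have "\<dots> = C\<^sup>T *\<^sub>v (b\<^sup>T *\<^sub>v c)" using b C c(1) by (intro assoc_mult_mat_vec) simp_all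
    also have "\<dots> = 0\<^sub>v q" unfolding c(2) using C by simp
    finally show ?thesis .
  qed
  then have "q \<le> m \<and> (\<exists>U U'. inv_pair m U U' \<and> U * rank_nf m q q = b\<^sup>T)"
    using b by (intro extend_to_basis) simp_all
  then obtain U U' where qm: "q \<le> m" and U: "inv_pair m U U'" "U * rank_nf m q q = b\<^sup>T" by blast
  have nf: "(rank_nf m q q)\<^sup>T = rank_nf q m q" by (intro eq_matI) (auto simp: rank_nf_def)
  have "b = (U * rank_nf m q q)\<^sup>T" unfolding U(2) by simp
  also have "\<dots> = rank_nf q m q * U\<^sup>T"
    using inv_pair_dims[OF U(1)] by (simp add: mat_transpose_mult nf)
  finally have "b * U'\<^sup>T = rank_nf q m q * (U\<^sup>T * U'\<^sup>T)"
    using inv_pair_dims[OF U(1)] by (simp add: mat_assoc)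
  also have "\<dots> = rank_nf q m q"
    using inv_pairD[OF inv_pair_transpose[OF U(1)]] by simp
  finally show ?thesis using qm inv_pair_sym[OF inv_pair_transpose[OF U(1)]] by blast
qed

section \<open>Asymmetries of the canonical blocks\<close>

lemma mat_smult_left:
  fixes A :: "complex Matrix.mat"
  shows "dim_col A = dim_row B \<Longrightarrow> (c \<cdot>\<^sub>m A) * B = c \<cdot>\<^sub>m (A * B)"
  by (rule mult_smult_assoc_mat[of A "dim_row A" "dim_row B" B "dim_col B"]) auto

lemma mat_smult_right:
  fixes A :: "complex Matrix.mat"
  shows "dim_col A = dim_row B \<Longrightarrow> A * (c \<cdot>\<^sub>m B) = c \<cdot>\<^sub>m (A * B)"
  by (rule mult_smult_distrib[of A "dim_row A" "dim_row B" B "dim_col B"]) auto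

text \<open>The nonzero superdiagonal makes the last unit vector cyclic for \<open>X\<close>:
  applying \<open>X\<close> to it \<open>n - 1 - t\<close> times gives a vector whose last nonzero
  coordinate is number \<open>t\<close>. In reversed order these vectors are the columns of the
  triangular matrix \<open>G\<close>, and \<open>X\<close> shifts each column to the previous
  one.\<close>

lemma jordan_nf_strict_upper:
  fixes X :: "complex Matrix.mat"
  assumes X: "X \<in> carrier_mat n n" and n: "n > 0"
    and zero: "\<And>i j. i < n \<Longrightarrow> j \<le> i \<Longrightarrow> X $$ (i, j) = 0"
    and sup: "\<And>i. Suc i < n \<Longrightarrow> X $$ (i, Suc i) \<noteq> 0"
  shows "jordan_nf (e \<cdot>\<^sub>m 1\<^sub>m n + X) [(n, e)]"
proof -
  define y where "y m = ((\<lambda>v. X *\<^sub>v v) ^^ m) (unit_vec n (n - 1))" for m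
  have yS: "y (Suc m) = X *\<^sub>v y m" for m by (simp add: y_def)
  have yc: "y m \<in> carrier_vec n" for m by (induction m) (use X in \<open>auto simp: yS y_def\<close>)
  have entry: "y (Suc m) $ i = (\<Sum>l<n. X $$ (i, l) * y m $ l)" if "i < n" for i m
    using that X yc[of m] by (simp add: yS scalar_prod_def atLeast0LessThan)
  have step0: "y (Suc m) $ i = 0" if "i < n" "\<And>l. l < n \<Longrightarrow> i < l \<Longrightarrow> y m $ l = 0" for i m
    unfolding entry[OF that(1)]
  proof (rule sum.neutral, intro ballI)
    fix l assume "l \<in> {..<n}"
    then show "X $$ (i, l) * y m $ l = 0" using zero[OF that(1), of l] that(2)[of l] by (cases "l \<le> i") auto
  qed
  have prof: "(\<forall>i<n. t < i \<longrightarrow> y (n - 1 - t) $ i = 0) \<and> y (n - 1 - t) $ t \<noteq> 0" if "t \<le> n - 1" for t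
    using that
  proof (induction t rule: inc_induct)
    case base
    then show ?case using n by (auto simp: y_def)
  next
    case (step t)
    then have S: "n - 1 - t = Suc (n - 1 - Suc t)" by auto
    have tn: "t < n" "Suc t < n" using step by auto
    have "\<forall>i<n. t < i \<longrightarrow> y (n - 1 - t) $ i = 0"
      unfolding S using step.IH by (intro allI impI step0) auto
    moreover have "y (n - 1 - t) $ t = X $$ (t, Suc t) * y (n - 1 - Suc t) $ Suc t"
    proof -
      have "y (n - 1 - t) $ t = (\<Sum>l<n. if l = Suc t then X $$ (t, Suc t) * y (n - 1 - Suc t) $ Suc t else 0)"
        unfolding S entry[OF tn(1)]
      proof (rule sum.cong[OF refl])
        fix l assume "l \<in> {..<n}"
        then show "X $$ (t, l) * y (n - 1 - Suc t) $ l = (if l = Suc t then X $$ (t, Suc t) * y (n - 1 - Suc t) $ Suc t else 0)"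
          using zero[OF tn(1), of l] step.IH by (cases "l \<le> t") auto
      qed
      then show ?thesis using tn by simp
    qed
    moreover have "y (n - 1 - Suc t) $ Suc t \<noteq> 0" using step.IH by blast
    ultimately show ?case using sup[OF tn(2)] by simp
  qed
  define G where "G = Matrix.mat n n (\<lambda>(i, j). y (n - 1 - j) $ i)"
  have G: "G \<in> carrier_mat n n" by (simp add: G_def)
  have "upper_triangular G" unfolding upper_triangular_def using prof by (auto simp: G_def)
  then have "Determinant.det G = prod_list (diag_mat G)" using G by (rule det_upper_triangular)
  moreover have "0 \<notin> set (diag_mat G)" using prof by (force simp: diag_mat_def G_def)
  ultimately have "Determinant.det G \<noteq> 0" by (simp add: prod_list_zero_iff)
  then obtain G' where G': "inv_pair n G G'" using inv_pair_of_det[OF G] by blast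
  have XG: "(X * G) $$ (i, j) = (if j = 0 then 0 else G $$ (i, j - 1))" if "i < n" "j < n" for i j
  proof -
    have "(X * G) $$ (i, j) = y (Suc (n - 1 - j)) $ i"
      unfolding entry[OF that(1)] using that X by (simp add: G_def scalar_prod_def atLeast0LessThan)
    also have "\<dots> = (if j = 0 then 0 else G $$ (i, j - 1))"
    proof (cases "j = 0")
      case True
      then show ?thesis using step0[OF that(1), of "n - 1"] prof[of 0] by auto
    next
      case False
      then have "Suc (n - 1 - j) = n - 1 - (j - 1)" using that by auto
      then show ?thesis using False that by (simp add: G_def)
    qed
    finally show ?thesis .
  qed
  have GJ: "(G * jordan_block n e) $$ (i, j) = e * G $$ (i, j) + (if j = 0 then 0 else G $$ (i, j - 1))"
    if "i < n" "j < n" for i j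
  proof -
    have "(G * jordan_block n e) $$ (i, j) = (\<Sum>l<n. G $$ (i, l) * jordan_block n e $$ (l, j))"
      using that G by (simp add: scalar_prod_def atLeast0LessThan)
    also have "\<dots> = (\<Sum>l<n. (if l = j then e * G $$ (i, j) else 0) + (if Suc l = j then G $$ (i, j - 1) else 0))"
      using that by (intro sum.cong) (auto simp: jordan_block_def)
    also have "\<dots> = e * G $$ (i, j) + (\<Sum>l<n. (if Suc l = j then G $$ (i, j - 1) else 0))"
      using that by (simp add: sum.distrib)
    also have "(\<Sum>l<n. (if Suc l = j then G $$ (i, j - 1) else 0)) = (if j = 0 then 0 else G $$ (i, j - 1))"
      using that by (cases j) auto
    finally show ?thesis .
  qed
  have "(e \<cdot>\<^sub>m 1\<^sub>m n + X) * G = e \<cdot>\<^sub>m G + X * G"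
    using X G by (simp add: mat_add_distrib_right mat_smult_left)
  also have "\<dots> = G * jordan_block n e"
    using X G by (intro eq_matI) (auto simp: XG GJ simp del: index_mult_mat(1))
  finally have eq: "(e \<cdot>\<^sub>m 1\<^sub>m n + X) * G = G * jordan_block n e" .
  have "(e \<cdot>\<^sub>m 1\<^sub>m n + X) * G * G' = e \<cdot>\<^sub>m 1\<^sub>m n + X"
    using X inv_pairD[OF G'] by (simp add: mat_assoc inv_pair_dims[OF G'])
  then have "similar_mat (e \<cdot>\<^sub>m 1\<^sub>m n + X) (jordan_block n e)"
    using X inv_pairD[OF G'] unfolding eq by (intro similar_matI[of _ _ G G' n]) auto
  then show ?thesis using n by (simp add: jordan_nf_def jordan_matrix_def)
qed

text \<open>This is \<open>r + s N\<close> for the weighted shift \<open>N\<close> with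
  superdiagonal \<open>d\<close>.\<close>

definition bidiag :: "nat \<Rightarrow> complex \<Rightarrow> complex \<Rightarrow> (nat \<Rightarrow> complex) \<Rightarrow> complex Matrix.mat" where
  "bidiag n r s d = Matrix.mat n n (\<lambda>(i, j). if i = j then r else if j = Suc i then s * d i else 0)"

lemma bidiag_carrier [simp]: "bidiag n r s d \<in> carrier_mat n n"
  "dim_row (bidiag n r s d) = n" "dim_col (bidiag n r s d) = n"
  by (auto simp: bidiag_def)

lemma bidiag_mult_index:
  assumes "X \<in> carrier_mat n m" "i < n" "j < m"
  shows "(bidiag n r s d * X) $$ (i, j) = r * X $$ (i, j) + (if Suc i < n then s * d i * X $$ (Suc i, j) else 0)"
proof -
  have "(bidiag n r s d * X) $$ (i, j) = (\<Sum>l<n. bidiag n r s d $$ (i, l) * X $$ (l, j))"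
    using assms by (simp add: scalar_prod_def atLeast0LessThan)
  also have "\<dots> =
    (\<Sum>l<n. (if l = i then r * X $$ (i, j) else 0) + (if l = Suc i then s * d i * X $$ (Suc i, j) else 0))"
    using assms by (intro sum.cong) (auto simp: bidiag_def)
  also have "\<dots> = r * X $$ (i, j) + (if Suc i < n then s * d i * X $$ (Suc i, j) else 0)"
    using assms by (simp add: sum.distrib)
  finally show ?thesis .
qed

lemma bidiag_invertible:
  assumes "r \<noteq> 0" shows "\<exists>U. inv_pair n (bidiag n r s d) U"
proof -
  have "upper_triangular (bidiag n r s d)" unfolding upper_triangular_def by (auto simp: bidiag_def)
  then have "Determinant.det (bidiag n r s d) = prod_list (diag_mat (bidiag n r s d))"
    by (rule det_upper_triangular[OF _ bidiag_carrier(1)])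
  moreover have "0 \<notin> set (diag_mat (bidiag n r s d))" using assms by (auto simp: diag_mat_def bidiag_def)
  ultimately show ?thesis by (intro inv_pair_of_det[OF bidiag_carrier(1)]) (simp add: prod_list_zero_iff)
qed

text \<open>The quotient \<open>(p + q N) / (r + s N)\<close> for a nilpotent \<open>N\<close> of maximal index is a single Jordan
  block as soon as the Moebius map \<open>N \<mapsto> (p + q N) / (r + s N)\<close> is nonconstant.\<close>

lemma bidiag_quotient:
  assumes r: "r \<noteq> 0" and pq: "q * r \<noteq> p * s" and d: "\<And>i. d i \<noteq> 0" and n: "n > 0"
  shows "\<exists>Y\<in>carrier_mat n n. bidiag n r s d * Y = bidiag n p q d \<and> jordan_nf Y [(n, p / r)]"
proof -
  obtain U where U: "inv_pair n (bidiag n r s d) U" using bidiag_invertible[OF r] by blast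
  define e where "e = p / r"
  \<comment> \<open>From \<open>p + q N = e (r + s N) + c N\<close> the quotient is \<open>e\<close>
    plus the solution \<open>X\<close> of \<open>(r + s N) X = c N\<close>. The hypothesis
    \<open>pq\<close> says that \<open>c\<close> is nonzero.\<close>
  define c where "c = q - e * s"
  have c: "c \<noteq> 0" using r pq by (auto simp: c_def e_def field_simps)
  define X where "X = U * bidiag n 0 c d"
  have X: "X \<in> carrier_mat n n" using inv_pairD[OF U] by (simp add: X_def)
  have UX: "bidiag n r s d * X = bidiag n 0 c d" by (simp add: X_def inv_pair_cancel[OF U])
  \<comment> \<open>Row \<open>i\<close> of the equation for \<open>X\<close>. Solved from the last
    row upwards, it shows that \<open>X\<close> is strictly upper triangular with nonzero
    superdiagonal.\<close>
  have rec: "r * X $$ (i, j) + (if Suc i < n then s * d i * X $$ (Suc i, j) else 0) = (if j = Suc i then c * d i else 0)"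
    if "i < n" "j < n" for i j
    using bidiag_mult_index[OF X that, of r s d] that unfolding UX by (auto simp: bidiag_def split: if_splits)
  have zero: "X $$ (i, j) = 0" if "i \<le> n - 1" "j \<le> i" for i j
    using that
  proof (induction i arbitrary: j rule: inc_induct)
    case base
    then show ?case using rec[of "n - 1" j] n r by auto
  next
    case (step i)
    then have "i < n" "Suc i < n" by auto
    then show ?case using step rec[of i j] r by auto
  qed
  have sup: "X $$ (i, Suc i) \<noteq> 0" if "Suc i < n" for i
    using rec[of i "Suc i"] zero[of "Suc i" "Suc i"] that c d[of i] by auto
  let ?Y = "e \<cdot>\<^sub>m 1\<^sub>m n + X"
  have "bidiag n r s d * ?Y = bidiag n r s d * (e \<cdot>\<^sub>m 1\<^sub>m n) + bidiag n r s d * X"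
    using X by (simp add: mat_add_distrib_left)
  also have "bidiag n r s d * (e \<cdot>\<^sub>m 1\<^sub>m n) = e \<cdot>\<^sub>m bidiag n r s d"
    by (simp add: mat_smult_right)
  also have "e \<cdot>\<^sub>m bidiag n r s d + bidiag n r s d * X = bidiag n p q d"
    unfolding UX using r by (intro eq_matI) (auto simp: bidiag_def e_def c_def algebra_simps)
  finally have "bidiag n r s d * ?Y = bidiag n p q d" .
  moreover have "jordan_nf ?Y [(n, e)]"
    by (rule jordan_nf_strict_upper[OF X n]) (use zero sup in auto)
  ultimately show ?thesis using X unfolding e_def by (intro bexI[of _ ?Y]) (auto simp: e_def)
qed

section \<open>Matrices supported on the antidiagonal and the diagonal next to it\<close>

definition antidiag :: "nat \<Rightarrow> complex \<Rightarrow> complex \<Rightarrow> (nat \<Rightarrow> complex) \<Rightarrow> (nat \<Rightarrow> complex) \<Rightarrow> complex Matrix.mat" where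
  "antidiag n r s u w = Matrix.mat n n (\<lambda>(i, j).
     if Suc (i + j) = n then r * u i else if i + j = n then s * u i * w i else 0)"

lemma antidiag_carrier [simp]: "antidiag n r s u w \<in> carrier_mat n n"
  "dim_row (antidiag n r s u w) = n" "dim_col (antidiag n r s u w) = n"
  by (auto simp: antidiag_def)

text \<open>The antidiagonal factor does not involve \<open>r\<close> and \<open>s\<close>, so it
  cancels in a quotient of two such matrices and leaves a quotient of bidiagonal ones.\<close>

lemma antidiag_factor:
  "antidiag n r s u w = antidiag n 1 0 u w * bidiag n r s (\<lambda>l. w (n - 1 - l))"
proof (rule eq_matI)
  fix i j assume "i < dim_row (antidiag n 1 0 u w * bidiag n r s (\<lambda>l. w (n - 1 - l)))"
    "j < dim_col (antidiag n 1 0 u w * bidiag n r s (\<lambda>l. w (n - 1 - l)))"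
  then have ij: "i < n" "j < n" by auto
  have "(antidiag n 1 0 u w * bidiag n r s (\<lambda>l. w (n - 1 - l))) $$ (i, j) =
    (\<Sum>l<n. antidiag n 1 0 u w $$ (i, l) * bidiag n r s (\<lambda>l. w (n - 1 - l)) $$ (l, j))"
    using ij by (simp add: scalar_prod_def atLeast0LessThan)
  also have "\<dots> = (\<Sum>l<n. if l = n - 1 - i then u i * bidiag n r s (\<lambda>l. w (n - 1 - l)) $$ (n - 1 - i, j) else 0)"
    using ij by (intro sum.cong) (auto simp: antidiag_def)
  also have "\<dots> = u i * bidiag n r s (\<lambda>l. w (n - 1 - l)) $$ (n - 1 - i, j)" using ij by simp
  also have "\<dots> = antidiag n r s u w $$ (i, j)" using ij by (auto simp: antidiag_def bidiag_def)
  finally show "antidiag n r s u w $$ (i, j) = (antidiag n 1 0 u w * bidiag n r s (\<lambda>l. w (n - 1 - l))) $$ (i, j)" by simp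
qed auto

lemma antidiag_pure_invertible:
  assumes u: "\<And>i. u i \<noteq> 0"
  shows "\<exists>F. inv_pair n (antidiag n 1 0 u w) F"
proof -
  define F where "F = Matrix.mat n n (\<lambda>(i, j). if Suc (i + j) = n then 1 / u j else 0)"
  have "antidiag n 1 0 u w * F = 1\<^sub>m n"
  proof (rule eq_matI)
    fix i j assume "i < dim_row (1\<^sub>m n :: complex Matrix.mat)" "j < dim_col (1\<^sub>m n :: complex Matrix.mat)"
    then have ij: "i < n" "j < n" by auto
    have "(antidiag n 1 0 u w * F) $$ (i, j) = (\<Sum>l<n. antidiag n 1 0 u w $$ (i, l) * F $$ (l, j))"
      using ij by (simp add: scalar_prod_def atLeast0LessThan F_def)
    also have "\<dots> = (\<Sum>l<n. if l = n - 1 - i then u i * F $$ (n - 1 - i, j) else 0)"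
      using ij by (intro sum.cong) (auto simp: antidiag_def)
    also have "\<dots> = u i * F $$ (n - 1 - i, j)" using ij by simp
    also have "\<dots> = 1\<^sub>m n $$ (i, j)" using ij u by (auto simp: F_def)
    finally show "(antidiag n 1 0 u w * F) $$ (i, j) = 1\<^sub>m n $$ (i, j)" .
  qed (auto simp: F_def)
  then show ?thesis by (intro exI[of _ F] inv_pairI1) (auto simp: F_def)
qed

lemma antidiag_quotient:
  assumes r: "r \<noteq> 0" and pq: "q * r \<noteq> p * s" and u: "\<And>i. u i \<noteq> 0" and w: "\<And>i. w i \<noteq> 0" and n: "n > 0"
  shows "\<exists>Y\<in>carrier_mat n n. antidiag n r s u w * Y = antidiag n p q u w \<and> jordan_nf Y [(n, p / r)]"
    "\<exists>U. inv_pair n (antidiag n r s u w) U"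
proof -
  let ?d = "\<lambda>l. w (n - 1 - l)"
  obtain Y where Y: "Y \<in> carrier_mat n n" "bidiag n r s ?d * Y = bidiag n p q ?d" "jordan_nf Y [(n, p / r)]"
    using bidiag_quotient[OF r pq, of ?d n] w n by blast
  have "antidiag n r s u w * Y = antidiag n 1 0 u w * (bidiag n r s ?d * Y)"
    unfolding antidiag_factor[of n r s] using Y(1) by (simp add: mat_assoc)
  also have "\<dots> = antidiag n p q u w" unfolding Y(2) antidiag_factor[of n p q] ..
  finally show "\<exists>Y\<in>carrier_mat n n. antidiag n r s u w * Y = antidiag n p q u w \<and> jordan_nf Y [(n, p / r)]"
    using Y by blast
  show "\<exists>U. inv_pair n (antidiag n r s u w) U"
    unfolding antidiag_factor[of n r s] using antidiag_pure_invertible[of u, OF u] bidiag_invertible[OF r] inv_pair_mult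
    by blast
qed

text \<open>For \<open>\<sigma> = (A\<^sup>T)\<^sup>-\<^sup>1 A\<close> the matrix \<open>Y\<close> is \<open>(1 - \<mu> \<sigma>)\<^sup>-\<^sup>1 \<sigma>\<close>, so an eigenvalue \<open>\<lambda>\<close> of the asymmetry
  becomes \<open>\<lambda> / (1 - \<mu> \<lambda>)\<close>. The parameter \<open>\<mu>\<close> admits the singular blocks \<open>B\<close> with \<open>c = 0\<close>, for which
  \<open>\<sigma>\<close> does not exist.\<close>

definition asym_nf :: "complex \<Rightarrow> complex Matrix.mat \<Rightarrow> (nat \<times> complex) list \<Rightarrow> bool" where
  "asym_nf \<mu> A js \<longleftrightarrow> (\<exists>n Z Y. A \<in> carrier_mat n n \<and> inv_pair n (A\<^sup>T - \<mu> \<cdot>\<^sub>m A) Z \<and>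
     Y \<in> carrier_mat n n \<and> (A\<^sup>T - \<mu> \<cdot>\<^sub>m A) * Y = A \<and> jordan_nf Y js)"

lemma asym_nf_dsum:
  assumes "asym_nf \<mu> A js" "asym_nf \<mu> B ks"
  shows "asym_nf \<mu> (dsum A B) (js @ ks)"
proof -
  obtain n Z Y where A: "A \<in> carrier_mat n n" "inv_pair n (A\<^sup>T - \<mu> \<cdot>\<^sub>m A) Z"
    "Y \<in> carrier_mat n n" "(A\<^sup>T - \<mu> \<cdot>\<^sub>m A) * Y = A" "jordan_nf Y js"
    using assms(1) by (auto simp: asym_nf_def)
  obtain m W X where B: "B \<in> carrier_mat m m" "inv_pair m (B\<^sup>T - \<mu> \<cdot>\<^sub>m B) W"
    "X \<in> carrier_mat m m" "(B\<^sup>T - \<mu> \<cdot>\<^sub>m B) * X = B" "jordan_nf X ks"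
    using assms(2) by (auto simp: asym_nf_def)
  have eq: "(dsum A B)\<^sup>T - \<mu> \<cdot>\<^sub>m dsum A B = dsum (A\<^sup>T - \<mu> \<cdot>\<^sub>m A) (B\<^sup>T - \<mu> \<cdot>\<^sub>m B)"
    using A(1) B(1) by (simp add: dsum_transpose dsum_smult dsum_minus[of _ n n _ _ m m])
  have 1: "inv_pair (n + m) ((dsum A B)\<^sup>T - \<mu> \<cdot>\<^sub>m dsum A B) (dsum Z W)"
    unfolding eq by (rule inv_pair_dsum[OF A(2) B(2)])
  have 2: "((dsum A B)\<^sup>T - \<mu> \<cdot>\<^sub>m dsum A B) * dsum Y X = dsum A B"
    unfolding eq using A B by (subst dsum_mult) auto
  have "jordan_nf (diag_block_mat (map fst [(Y, js), (X, ks)])) (concat (map snd [(Y, js), (X, ks)]))"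
    by (rule jordan_nf_diag_block_mat) (use A B in auto)
  then have 3: "jordan_nf (dsum Y X) (js @ ks)" by (simp add: diag_block_Cons)
  show ?thesis unfolding asym_nf_def
    using dsum_carrier[OF A(1) B(1)] dsum_carrier[OF A(3) B(3)] 1 2 3 by blast
qed

lemma asym_nf_empty: "asym_nf \<mu> (0\<^sub>m 0 0) []"
proof -
  have "similar_mat (0\<^sub>m 0 0 :: complex Matrix.mat) (0\<^sub>m 0 0)" by (rule similar_mat_refl[of _ 0]) simp
  then have "jordan_nf (0\<^sub>m 0 0 :: complex Matrix.mat) []" by (simp add: jordan_nf_def jordan_matrix_def)
  then show ?thesis unfolding asym_nf_def
    by (intro exI[of _ 0] exI[of _ "0\<^sub>m 0 0"]) (auto simp: inv_pair_def intro!: eq_matI)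
qed

text \<open>The matrices \<open>A\<close> and \<open>A^T - \<mu> A\<close> are both transformed by
  \<open>P^T _ P\<close>, so their quotient is conjugated by \<open>P\<close> and keeps its Jordan
  form.\<close>

lemma asym_nf_congr:
  assumes AB: "congr n A B" and "asym_nf \<mu> A js"
  shows "asym_nf \<mu> B js"
proof -
  obtain P P' where P: "inv_pair n P P'" "B = P\<^sup>T * A * P" and An: "A \<in> carrier_mat n n"
    using AB by (auto simp: congr_def)
  obtain m Z Y where A: "A \<in> carrier_mat m m" "inv_pair m (A\<^sup>T - \<mu> \<cdot>\<^sub>m A) Z"
    "Y \<in> carrier_mat m m" "(A\<^sup>T - \<mu> \<cdot>\<^sub>m A) * Y = A" "jordan_nf Y js"
    using assms(2) by (auto simp: asym_nf_def)
  have "m = n" using An A(1) by auto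
  note A = A[unfolded this]
  note [simp] = inv_pair_dims[OF P(1)]
  have d: "dim_row A = n" "dim_col A = n" "dim_row Y = n" "dim_col Y = n" using A by auto
  have "\<mu> \<cdot>\<^sub>m (P\<^sup>T * A * P) = P\<^sup>T * (\<mu> \<cdot>\<^sub>m A) * P"
    using d by (simp add: mat_smult_left mat_smult_right)
  then have eq: "B\<^sup>T - \<mu> \<cdot>\<^sub>m B = P\<^sup>T * (A\<^sup>T - \<mu> \<cdot>\<^sub>m A) * P"
    using d by (simp add: P(2) mat_transpose_mult mat_assoc mat_minus_distrib_left mat_minus_distrib_right)
  have 1: "inv_pair n (B\<^sup>T - \<mu> \<cdot>\<^sub>m B) (P' * (Z * P'\<^sup>T))"
    unfolding eq using inv_pair_mult[OF inv_pair_mult[OF inv_pair_transpose[OF P(1)] A(2)] P(1)]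
    by (simp add: mat_assoc)
  have "(B\<^sup>T - \<mu> \<cdot>\<^sub>m B) * (P' * Y * P) = P\<^sup>T * ((A\<^sup>T - \<mu> \<cdot>\<^sub>m A) * Y) * P"
    unfolding eq using d by (simp add: mat_assoc inv_pair_cancel[OF P(1)])
  then have 2: "(B\<^sup>T - \<mu> \<cdot>\<^sub>m B) * (P' * Y * P) = B" unfolding A(4) P(2) .
  have "similar_mat (P' * Y * P) Y"
    using A(3) inv_pairD[OF P(1)] by (intro similar_matI[of _ _ P' P n]) auto
  then have 3: "jordan_nf (P' * Y * P) js"
    using A(5) by (auto simp: jordan_nf_def intro: similar_mat_trans)
  have "B \<in> carrier_mat n n" "P' * Y * P \<in> carrier_mat n n"
    using AB congr_carrier A(3) inv_pairD[OF P(1)] by auto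
  then show ?thesis unfolding asym_nf_def using 1 2 3 by blast
qed

lemma asym_nf_unique:
  assumes "asym_nf \<mu> A js" "asym_nf \<mu> A ks"
  shows "mset js = mset ks"
proof -
  obtain n Z Y where A: "A \<in> carrier_mat n n" "inv_pair n (A\<^sup>T - \<mu> \<cdot>\<^sub>m A) Z"
    "Y \<in> carrier_mat n n" "(A\<^sup>T - \<mu> \<cdot>\<^sub>m A) * Y = A" "jordan_nf Y js"
    using assms(1) by (auto simp: asym_nf_def)
  obtain m W X where B: "A \<in> carrier_mat m m" "inv_pair m (A\<^sup>T - \<mu> \<cdot>\<^sub>m A) W"
    "X \<in> carrier_mat m m" "(A\<^sup>T - \<mu> \<cdot>\<^sub>m A) * X = A" "jordan_nf X ks"
    using assms(2) by (auto simp: asym_nf_def)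
  have "m = n" using A(1) B(1) by auto
  note B = B[unfolded this]
  have "Z * ((A\<^sup>T - \<mu> \<cdot>\<^sub>m A) * Y) = Y" by (rule inv_pair_cancel[OF A(2)]) (use A(3) in simp)
  moreover have "Z * ((A\<^sup>T - \<mu> \<cdot>\<^sub>m A) * X) = X" by (rule inv_pair_cancel[OF A(2)]) (use B(3) in simp)
  ultimately have "X = Y" unfolding A(4) B(4) by metis
  then have X: "jordan_nf Y ks" using B(5) by simp
  show ?thesis
  proof (rule multiset_eqI)
    fix x :: "nat \<times> complex"
    obtain k e where x: "x = (k, e)" by (cases x)
    have cnt: "count (mset xs) x = length (filter ((=) x) xs)" for xs
      by (induction xs) auto
    show "count (mset js) x = count (mset ks) x"
    proof (cases "k = 0")
      case True
      have "x \<notin> set js" "x \<notin> set ks" using A(5) X True by (force simp: jordan_nf_def x)+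
      then have c: "count (mset js) x = 0" "count (mset ks) x = 0" by (simp_all add: count_eq_zero_iff)
      show ?thesis unfolding c ..
    next
      case False
      then show ?thesis
        using compute_nr_of_jordan_blocks[OF A(5) False, of e] compute_nr_of_jordan_blocks[OF X False, of e]
          cnt[of js] cnt[of ks] by (simp add: x)
    qed
  qed
qed

text \<open>At \<mu> = 0 the quotient is the asymmetry itself, and invertibility of
  \<open>A^T\<close> is nondegeneracy of the form.\<close>

lemma congr_of_asym_nf:
  assumes A: "asym_nf 0 A js" and B: "asym_nf 0 B js"
    and An: "A \<in> carrier_mat n n" and Bn: "B \<in> carrier_mat n n"
  shows "congr n A B"
proof -
  have *: "\<exists>Y A'. C\<^sup>T * Y = C \<and> inv_pair n C A' \<and> similar_mat Y (jordan_matrix js)"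
    if C: "asym_nf 0 C js" "C \<in> carrier_mat n n" for C
  proof -
    obtain m Z Y where A: "C \<in> carrier_mat m m" "inv_pair m (C\<^sup>T - 0 \<cdot>\<^sub>m C) Z"
      "(C\<^sup>T - 0 \<cdot>\<^sub>m C) * Y = C" "jordan_nf Y js"
      using C(1) unfolding asym_nf_def by blast
    have "m = n" using A(1) C(2) by auto
    moreover have "C\<^sup>T - 0 \<cdot>\<^sub>m C = C\<^sup>T" using C(2) by (intro eq_matI) auto
    ultimately have "inv_pair n (C\<^sup>T) Z" "C\<^sup>T * Y = C" using A by auto
    then show ?thesis using A(4) inv_pair_transpose[of n "C\<^sup>T" Z] by (auto simp: jordan_nf_def)
  qed
  obtain L A' where L: "A\<^sup>T * L = A" "inv_pair n A A'" "similar_mat L (jordan_matrix js)" using *[OF A An] by blast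
  obtain K B' where K: "B\<^sup>T * K = B" "inv_pair n B B'" "similar_mat K (jordan_matrix js)" using *[OF B Bn] by blast
  show ?thesis
    using congr_of_similar_asymmetry[OF An Bn L(2) K(2) L(1) K(1)] L(3) K(3) similar_mat_trans similar_mat_sym by blast
qed

text \<open>Up to the factor \<epsilon>, transposition only changes the sign of the secondary
  diagonal. Hence \<open>A\<close> and \<open>A^T - \<mu> A\<close> are two members of the same
  family \<open>antidiag\<close>, and their quotient is a single Jordan block.\<close>

lemma asym_nf_antidiag:
  assumes eps: "\<epsilon> \<noteq> (0 :: complex)" and tr: "(antidiag n 1 1 u w)\<^sup>T = antidiag n \<epsilon> (-\<epsilon>) u w"
    and u: "\<And>i. u i \<noteq> 0" and w: "\<And>i. w i \<noteq> 0" and n: "n > 0" and mu: "\<mu> \<noteq> \<epsilon>"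
  shows "asym_nf \<mu> (antidiag n 1 1 u w) [(n, 1 / (\<epsilon> - \<mu>))]"
proof -
  let ?A = "antidiag n 1 1 u w"
  have eq: "?A\<^sup>T - \<mu> \<cdot>\<^sub>m ?A = antidiag n (\<epsilon> - \<mu>) (- \<epsilon> - \<mu>) u w"
    unfolding tr by (rule eq_matI) (auto simp: antidiag_def algebra_simps)
  have ne: "1 * (\<epsilon> - \<mu>) \<noteq> 1 * (- \<epsilon> - \<mu>)" using eps by (simp add: eq_neg_iff_add_eq_0 flip: mult_2)
  show ?thesis unfolding asym_nf_def eq
    using antidiag_quotient[of "\<epsilon> - \<mu>" 1 1 "- \<epsilon> - \<mu>" u w n, OF _ ne u w n] mu antidiag_carrier(1) by fastforce
qed

section \<open>Off-diagonal pairs of Hankel blocks\<close>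

definition hankel :: "nat \<Rightarrow> complex \<Rightarrow> complex \<Rightarrow> complex Matrix.mat" where
  "hankel k x y = antidiag k x y (\<lambda>_. 1) (\<lambda>_. 1)"

definition offdiag :: "nat \<Rightarrow> complex Matrix.mat \<Rightarrow> complex Matrix.mat \<Rightarrow> complex Matrix.mat" where
  "offdiag k P Q = four_block_mat (0\<^sub>m k k) P Q (0\<^sub>m k k)"

lemma hankel_carrier [simp]: "hankel k x y \<in> carrier_mat k k"
  "dim_row (hankel k x y) = k" "dim_col (hankel k x y) = k"
  by (auto simp: hankel_def)

lemma hankel_transpose [simp]: "(hankel k x y)\<^sup>T = hankel k x y"
  by (rule eq_matI) (auto simp: hankel_def antidiag_def)

lemma hankel_combination: "hankel k x y - c \<cdot>\<^sub>m hankel k x' y' = hankel k (x - c * x') (y - c * y')"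
  by (rule eq_matI) (auto simp: hankel_def antidiag_def)

lemma offdiag_carrier [simp]:
  "P \<in> carrier_mat k k \<Longrightarrow> Q \<in> carrier_mat k k \<Longrightarrow> offdiag k P Q \<in> carrier_mat (k + k) (k + k)"
  by (auto simp: offdiag_def)

lemma offdiag_mult_dsum:
  assumes "P \<in> carrier_mat k k" "Q \<in> carrier_mat k k" "X \<in> carrier_mat k k" "Y \<in> carrier_mat k k"
  shows "offdiag k P Q * dsum X Y = offdiag k (P * Y) (Q * X)"
proof -
  have "dsum X Y = four_block_mat X (0\<^sub>m k k) (0\<^sub>m k k) Y" using assms by (simp add: dsum_def)
  then show ?thesis unfolding offdiag_def
    by (simp only:) (subst mult_four_block_mat[of _ k k _ k _ k _ _ k _ k], use assms in auto)
qed

lemma offdiag_mult_offdiag: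
  assumes "P \<in> carrier_mat k k" "Q \<in> carrier_mat k k" "X \<in> carrier_mat k k" "Y \<in> carrier_mat k k"
  shows "offdiag k P Q * offdiag k X Y = dsum (P * Y) (Q * X)"
proof -
  have "dsum (P * Y) (Q * X) = four_block_mat (P * Y) (0\<^sub>m k k) (0\<^sub>m k k) (Q * X)" using assms by (simp add: dsum_def)
  then show ?thesis unfolding offdiag_def
    by (simp only:) (subst mult_four_block_mat[of _ k k _ k _ k _ _ k _ k], use assms in auto)
qed

text \<open>Hankel blocks are symmetric, so transposition just exchanges the two of them. The
  quotient is then block diagonal, with blocks that are Moebius images of a nilpotent matrix;
  \<open>b \<noteq> l * a\<close> says that these images are nonconstant. At \<mu> = 0 the
  eigenvalues are \<open>l\<close> and \<open>1 / l\<close>.\<close>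

lemma asym_nf_offdiag_hankel:
  assumes k: "k > 0" and 1: "\<mu> * l \<noteq> 1" and 2: "\<mu> \<noteq> l" and 3: "b \<noteq> l * a"
  shows "asym_nf \<mu> (offdiag k (hankel k 1 a) (hankel k l b)) [(k, l / (1 - \<mu> * l)), (k, 1 / (l - \<mu>))]"
proof -
  let ?P = "hankel k 1 a" and ?Q = "hankel k l b"
  let ?U = "hankel k (l - \<mu>) (b - \<mu> * a)" and ?V = "hankel k (1 - \<mu> * l) (a - \<mu> * b)"
  let ?A = "offdiag k ?P ?Q"
  have tr: "?A\<^sup>T = offdiag k ?Q ?P"
    unfolding offdiag_def by (subst transpose_four_block_mat[of _ k k _ k _ k]) auto
  have "?A\<^sup>T - \<mu> \<cdot>\<^sub>m ?A = offdiag k (?Q - \<mu> \<cdot>\<^sub>m ?P) (?P - \<mu> \<cdot>\<^sub>m ?Q)"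
    unfolding tr by (rule eq_matI) (auto simp: offdiag_def)
  then have eq: "?A\<^sup>T - \<mu> \<cdot>\<^sub>m ?A = offdiag k ?U ?V" by (simp add: hankel_combination)
  have r1: "1 - \<mu> * l \<noteq> 0" "b * (1 - \<mu> * l) \<noteq> l * (a - \<mu> * b)" using 1 3 by (auto simp: algebra_simps)
  have r2: "l - \<mu> \<noteq> 0" "a * (l - \<mu>) \<noteq> 1 * (b - \<mu> * a)" using 2 3 by (auto simp: algebra_simps)
  obtain Y1 where Y1: "Y1 \<in> carrier_mat k k" "?V * Y1 = ?Q" "jordan_nf Y1 [(k, l / (1 - \<mu> * l))]"
    using antidiag_quotient(1)[OF r1, of "\<lambda>_. 1" "\<lambda>_. 1" k] k unfolding hankel_def by auto
  obtain Y2 where Y2: "Y2 \<in> carrier_mat k k" "?U * Y2 = ?P" "jordan_nf Y2 [(k, 1 / (l - \<mu>))]"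
    using antidiag_quotient(1)[OF r2, of "\<lambda>_. 1" "\<lambda>_. 1" k] k unfolding hankel_def by auto
  obtain V' where V': "inv_pair k ?V V'"
    using antidiag_quotient(2)[OF r1, of "\<lambda>_. 1" "\<lambda>_. 1" k] k unfolding hankel_def by auto
  obtain U' where U': "inv_pair k ?U U'"
    using antidiag_quotient(2)[OF r2, of "\<lambda>_. 1" "\<lambda>_. 1" k] k unfolding hankel_def by auto
  note c = inv_pairD[OF U'] inv_pairD[OF V']
  have i: "inv_pair (k + k) (offdiag k ?U ?V) (offdiag k V' U')"
    by (rule inv_pairI1) (use c in \<open>simp_all add: offdiag_mult_offdiag dsum_one\<close>)
  have m: "offdiag k ?U ?V * dsum Y1 Y2 = ?A"
    using Y1 Y2 by (simp add: offdiag_mult_dsum)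
  have "jordan_nf (diag_block_mat (map fst [(Y1, [(k, l / (1 - \<mu> * l))]), (Y2, [(k, 1 / (l - \<mu>))])]))
    (concat (map snd [(Y1, [(k, l / (1 - \<mu> * l))]), (Y2, [(k, 1 / (l - \<mu>))])]))"
    by (rule jordan_nf_diag_block_mat) (use Y1 Y2 in auto)
  then have j: "jordan_nf (dsum Y1 Y2) [(k, l / (1 - \<mu> * l)), (k, 1 / (l - \<mu>))]"
    by (simp add: diag_block_Cons)
  have "?A \<in> carrier_mat (k + k) (k + k)" "dsum Y1 Y2 \<in> carrier_mat (k + k) (k + k)"
    using Y1 Y2 by (auto intro!: dsum_carrier)
  then show ?thesis unfolding asym_nf_def eq using i m j by blast
qed

section \<open>The canonical blocks as antidiagonal and Hankel forms\<close>

lemma mem_graph: "(a, b) \<in> (\<lambda>i. (i, h i)) ` S \<longleftrightarrow> a \<in> S \<and> b = h a"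
  by auto

lemma mem_shifted_graph: "(a, b) \<in> (\<lambda>i. (k + i, h i)) ` S \<longleftrightarrow> k \<le> a \<and> a - k \<in> S \<and> b = h (a - k)"
  for a k :: nat
  by (auto simp: image_iff) (metis le_add_diff_inverse)

lemma matC_eq: "matC k = antidiag (2 * k + 1) 1 1 (\<lambda>_. 1) (\<lambda>i. if i \<le> k then 1 else -1)" (is "_ = ?R")
proof (rule eq_matI)
  fix i j assume "i < dim_row ?R" "j < dim_col ?R"
  then have ij: "i < 2 * k + 1" "j < 2 * k + 1" by auto
  have 1: "(i + 1, j + 1) \<in> (\<lambda>i. (i, 2 * k + 2 - i)) ` {1..2 * k + 1} \<longleftrightarrow> Suc (i + j) = 2 * k + 1"
    unfolding mem_graph using ij by auto
  have 2: "(i + 1, j + 1) \<in> (\<lambda>i. (i, 2 * k + 3 - i)) ` {2..k + 1} \<longleftrightarrow> i + j = 2 * k + 1 \<and> i \<le> k"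
    unfolding mem_graph using ij by auto
  have 3: "(i + 1, j + 1) \<in> (\<lambda>i. (i, 2 * k + 3 - i)) ` {k + 2..2 * k + 1} \<longleftrightarrow> i + j = 2 * k + 1 \<and> \<not> i \<le> k"
    unfolding mem_graph using ij by auto
  have "matC k $$ (i, j) = (if Suc (i + j) = 2 * k + 1 \<or> i + j = 2 * k + 1 \<and> i \<le> k then 1
      else if i + j = 2 * k + 1 \<and> \<not> i \<le> k then -1 else 0)"
    using ij by (simp only: matC_def sq_mat_def index_mat prod.case Un_iff 1 2 3)
  then show "matC k $$ (i, j) = ?R $$ (i, j)" using ij by (simp add: antidiag_def)
qed (simp_all add: matC_def sq_mat_def)

lemma matE_eq: "matE k = antidiag (2 * k) 1 1 (\<lambda>i. if i < k then 1 else -1) (\<lambda>i. if i < k then 1 else -1)"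
  (is "_ = ?R")
proof (rule eq_matI)
  fix i j assume "i < dim_row ?R" "j < dim_col ?R"
  then have ij: "i < 2 * k" "j < 2 * k" by auto
  have 1: "(i + 1, j + 1) \<in> (\<lambda>i. (i, 2 * k + 1 - i)) ` {1..k} \<longleftrightarrow> Suc (i + j) = 2 * k \<and> i < k"
    unfolding mem_graph using ij by auto
  have 2: "(i + 1, j + 1) \<in> (\<lambda>i. (i, 2 * k + 2 - i)) ` {2..2 * k} \<longleftrightarrow> i + j = 2 * k"
    unfolding mem_graph using ij by auto
  have 3: "(i + 1, j + 1) \<in> (\<lambda>i. (i, 2 * k + 1 - i)) ` {k + 1..2 * k} \<longleftrightarrow> Suc (i + j) = 2 * k \<and> \<not> i < k"
    unfolding mem_graph using ij by auto
  have "matE k $$ (i, j) = (if (Suc (i + j) = 2 * k \<and> i < k) \<or> i + j = 2 * k then 1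
      else if Suc (i + j) = 2 * k \<and> \<not> i < k then -1 else 0)"
    using ij by (simp only: matE_def sq_mat_def index_mat prod.case Un_iff 1 2 3)
  then show "matE k $$ (i, j) = ?R $$ (i, j)" using ij by (simp add: antidiag_def)
qed (simp_all add: matE_def sq_mat_def)

lemma offdiag_hankel_index:
  assumes "i < 2 * k" "j < 2 * k"
  shows "offdiag k (hankel k x y) (hankel k x' y') $$ (i, j) =
    (if i < k then if Suc (i + j) = 2 * k then x else if i + j = 2 * k then y else 0
     else if Suc (i + j) = 2 * k then x' else if i + j = 2 * k \<and> i \<noteq> k then y' else 0)"
proof -
  have e: "offdiag k (hankel k x y) (hankel k x' y') $$ (i, j) =
    (if i < k then if j < k then 0 else hankel k x y $$ (i, j - k)
     else if j < k then hankel k x' y' $$ (i - k, j) else 0)"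
    using assms by (simp add: offdiag_def)
  consider "i < k" "j < k" | "i < k" "\<not> j < k" | "\<not> i < k" "j < k" | "\<not> i < k" "\<not> j < k" by blast
  then show ?thesis
    using assms unfolding e by cases (auto simp: hankel_def antidiag_def)
qed

lemma matB_eq: "matB k c = offdiag k (hankel k 1 c) (hankel k c 1)" (is "_ = ?R")
proof (rule eq_matI)
  fix i j assume "i < dim_row ?R" "j < dim_col ?R"
  then have ij: "i < 2 * k" "j < 2 * k" by (auto simp: offdiag_def)
  have 1: "(i + 1, j + 1) \<in> (\<lambda>i. (i, 2 * k + 1 - i)) ` {1..k} \<longleftrightarrow> Suc (i + j) = 2 * k \<and> i < k"
    unfolding mem_graph using ij by auto
  have 2: "(i + 1, j + 1) \<in> (\<lambda>i. (k + i, k + 2 - i)) ` {2..k} \<longleftrightarrow> i + j = 2 * k \<and> i > k"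
    unfolding mem_shifted_graph using ij by auto
  have 3: "(i + 1, j + 1) \<in> (\<lambda>i. (i, 2 * k + 2 - i)) ` {2..k} \<longleftrightarrow> i + j = 2 * k \<and> i < k"
    unfolding mem_graph using ij by auto
  have 4: "(i + 1, j + 1) \<in> (\<lambda>i. (k + i, k + 1 - i)) ` {1..k} \<longleftrightarrow> Suc (i + j) = 2 * k \<and> \<not> i < k"
    unfolding mem_shifted_graph using ij by auto
  have "matB k c $$ (i, j) = (if Suc (i + j) = 2 * k \<and> i < k \<or> i + j = 2 * k \<and> i > k then 1
      else if i + j = 2 * k \<and> i < k \<or> Suc (i + j) = 2 * k \<and> \<not> i < k then c else 0)"
    using ij by (simp only: matB_def sq_mat_def index_mat prod.case Un_iff 1 2 3 4)
  then show "matB k c $$ (i, j) = ?R $$ (i, j)"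
    unfolding offdiag_hankel_index[OF ij] by auto
qed (simp_all add: matB_def sq_mat_def offdiag_def)

lemma matD_eq: "matD k = offdiag k (hankel k 1 1) (hankel k 1 (-1))" (is "_ = ?R")
proof (rule eq_matI)
  fix i j assume "i < dim_row ?R" "j < dim_col ?R"
  then have ij: "i < 2 * k" "j < 2 * k" by (auto simp: offdiag_def)
  have 1: "(i + 1, j + 1) \<in> (\<lambda>i. (i, 2 * k + 1 - i)) ` {1..2 * k} \<longleftrightarrow> Suc (i + j) = 2 * k"
    unfolding mem_graph using ij by auto
  have 2: "(i + 1, j + 1) \<in> (\<lambda>i. (i, 2 * k + 2 - i)) ` {2..k} \<longleftrightarrow> i + j = 2 * k \<and> i < k"
    unfolding mem_graph using ij by auto
  have 3: "(i + 1, j + 1) \<in> (\<lambda>i. (k + i, k + 2 - i)) ` {2..k} \<longleftrightarrow> i + j = 2 * k \<and> i > k"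
    unfolding mem_shifted_graph using ij by auto
  have "matD k $$ (i, j) = (if Suc (i + j) = 2 * k \<or> i + j = 2 * k \<and> i < k then 1
      else if i + j = 2 * k \<and> i > k then -1 else 0)"
    using ij by (simp only: matD_def sq_mat_def index_mat prod.case Un_iff 1 2 3)
  then show "matD k $$ (i, j) = ?R $$ (i, j)"
    unfolding offdiag_hankel_index[OF ij] by auto
qed (simp_all add: matD_def sq_mat_def offdiag_def)

text \<open>The deleted middle entry is the only entry of the block E in the two diagonal quarters.
  Without it the single Jordan block of size \<open>2 * k\<close> breaks into two of size
  \<open>k\<close>.\<close>

lemma matF_eq: "matF k = offdiag k (hankel k 1 1) (hankel k (-1) 1)" (is "_ = ?R")
proof (rule eq_matI)
  fix i j assume "i < dim_row ?R" "j < dim_col ?R"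
  then have ij: "i < 2 * k" "j < 2 * k" by (auto simp: offdiag_def)
  have "matF k $$ (i, j) = (if i = k \<and> j = k then 0 else matE k $$ (i, j))"
    using ij by (simp add: matF_def sq_mat_def)
  then show "matF k $$ (i, j) = ?R $$ (i, j)"
    unfolding offdiag_hankel_index[OF ij] matE_eq using ij by (auto simp: antidiag_def)
qed (simp_all add: matF_def sq_mat_def offdiag_def)

section \<open>Jordan data of the canonical blocks\<close>

lemma asym_nf_matC:
  assumes "\<mu> \<noteq> 1" shows "asym_nf \<mu> (matC k) [(2 * k + 1, 1 / (1 - \<mu>))]"
proof -
  let ?w = "\<lambda>i. if i \<le> k then 1 else -1 :: complex"
  have "(antidiag (2 * k + 1) 1 1 (\<lambda>_. 1) ?w)\<^sup>T = antidiag (2 * k + 1) 1 (- 1) (\<lambda>_. 1) ?w"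
    by (rule eq_matI) (simp_all add: antidiag_def)
  then show ?thesis unfolding matC_eq using assms by (intro asym_nf_antidiag) simp_all
qed

lemma asym_nf_matE:
  assumes "k > 0" "\<mu> \<noteq> -1" shows "asym_nf \<mu> (matE k) [(2 * k, 1 / (- 1 - \<mu>))]"
proof -
  let ?w = "\<lambda>i. if i < k then 1 else -1 :: complex"
  have "(antidiag (2 * k) 1 1 ?w ?w)\<^sup>T = antidiag (2 * k) (- 1) (- (- 1)) ?w ?w"
    by (rule eq_matI) (simp_all add: antidiag_def)
  then show ?thesis unfolding matE_eq using assms by (intro asym_nf_antidiag) simp_all
qed

lemma asym_nf_matB:
  assumes "k > 0" "c \<noteq> 1" "c \<noteq> -1" "\<mu> * c \<noteq> 1" "\<mu> \<noteq> c"
  shows "asym_nf \<mu> (matB k c) [(k, c / (1 - \<mu> * c)), (k, 1 / (c - \<mu>))]"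
proof -
  \<comment> \<open>The condition \<open>b \<noteq> l * a\<close> for \<open>l = a = c\<close> and
    \<open>b = 1\<close>; it is the reason why \<open>c\<close> must differ from 1 and -1.\<close>
  have "1 \<noteq> c * c" using assms(2,3) by (metis square_eq_1_iff)
  then show ?thesis unfolding matB_eq using assms by (intro asym_nf_offdiag_hankel) auto
qed

lemma asym_nf_matD:
  assumes "k > 0" "\<mu> \<noteq> 1"
  shows "asym_nf \<mu> (matD k) [(k, 1 / (1 - \<mu>)), (k, 1 / (1 - \<mu>))]"
  unfolding matD_eq using asym_nf_offdiag_hankel[of k \<mu> 1 "-1" 1] assms by simp

lemma asym_nf_matF:
  assumes "k > 0" "\<mu> \<noteq> -1"
  shows "asym_nf \<mu> (matF k) [(k, 1 / (- 1 - \<mu>)), (k, 1 / (- 1 - \<mu>))]"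
proof -
  have "\<mu> * -1 \<noteq> 1" using assms by (metis minus_minus mult_minus_right mult.right_neutral)
  moreover have "- 1 / (1 + \<mu>) = 1 / (- 1 - \<mu>)"
    by (metis minus_add_distrib minus_divide_divide minus_minus uminus_add_conv_diff add.commute)
  ultimately show ?thesis
    unfolding matF_eq using asym_nf_offdiag_hankel[of k \<mu> "-1" 1 1] assms by simp
qed

section \<open>Splitting nondegenerate forms\<close>

lemma polymat_transpose:
  assumes M: "M \<in> carrier_mat n n"
  shows "(polymat n M p)\<^sup>T = polymat n (M\<^sup>T) p"
proof (induction p)
  case 0
  then show ?case by simp
next
  case (pCons a p)
  note [simp] = polymat_dims[OF M] polymat_dims[of "M\<^sup>T" n]
  have d: "dim_row M = n" "dim_col M = n" "M\<^sup>T \<in> carrier_mat n n" using M by auto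
  have "(a \<cdot>\<^sub>m 1\<^sub>m n + X)\<^sup>T = a \<cdot>\<^sub>m 1\<^sub>m n + X\<^sup>T" if "X \<in> carrier_mat n n" for X
    using that by (intro eq_matI) auto
  from this[of "polymat n M p * M"]
  have "(polymat n M (pCons a p))\<^sup>T = a \<cdot>\<^sub>m 1\<^sub>m n + M\<^sup>T * polymat n (M\<^sup>T) p"
    using M d polymat_carrier[OF M, of p] by (simp add: polymat_pCons mat_transpose_mult pCons.IH)
  also have "\<dots> = polymat n (M\<^sup>T) (pCons a p)"
    using d by (simp add: polymat_pCons polymat_commute)
  finally show ?case .
qed

lemma mult_mat_vec_minus:
  fixes M :: "complex Matrix.mat"
  assumes "M \<in> carrier_mat n m" "x \<in> carrier_vec m" "y \<in> carrier_vec m"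
  shows "M *\<^sub>v (x - y) = M *\<^sub>v x - M *\<^sub>v y"
  using assms by (intro eq_vecI) (auto simp: scalar_prod_def right_diff_distrib sum_subtractf)

text \<open>The linear factors of an annihilating polynomial are applied to \<open>z\<close> one
  after the other. The results stay in \<open>K\<close> and end in 0, and the last nonzero one is an
  eigenvector.\<close>

lemma eigenvector_in_invariant_set:
  fixes M :: "complex Matrix.mat"
  assumes M: "M \<in> carrier_mat m m" and K: "K \<subseteq> carrier_vec m"
    and step: "\<And>z c. z \<in> K \<Longrightarrow> M *\<^sub>v z - c \<cdot>\<^sub>v z \<in> K"
    and z: "z \<in> K" "z \<noteq> 0\<^sub>v m"
  shows "\<exists>z\<in>K. \<exists>e. z \<noteq> 0\<^sub>v m \<and> M *\<^sub>v z = e \<cdot>\<^sub>v z"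
proof -
  obtain p where p: "p \<noteq> 0" "polymat m M p = 0\<^sub>m m m" using polymat_annihilator[OF M] by blast
  obtain es where es: "Polynomial.smult (lead_coeff p) (\<Prod>a\<leftarrow>es. [:-a, 1:]) = p"
    using fundamental_theorem_algebra_factorized by blast
  have "lead_coeff p \<cdot>\<^sub>m polymat m M (\<Prod>a\<leftarrow>es. [:-a, 1:]) = 0\<^sub>m m m"
    using p(2) by (subst (asm) es[symmetric]) (simp add: polymat_smult[OF M])
  then have "inverse (lead_coeff p) \<cdot>\<^sub>m (lead_coeff p \<cdot>\<^sub>m polymat m M (\<Prod>a\<leftarrow>es. [:-a, 1:])) = 0\<^sub>m m m"
    by simp
  moreover have "inverse c \<cdot>\<^sub>m (c \<cdot>\<^sub>m X) = X" if "c \<noteq> 0" for c :: complex and X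
    using that by (intro eq_matI) auto
  ultimately have "polymat m M (\<Prod>a\<leftarrow>es. [:-a, 1:]) = 0\<^sub>m m m" using p(1) by simp
  then have "polymat m M (\<Prod>a\<leftarrow>es. [:-a, 1:]) *\<^sub>v z = 0\<^sub>v m"
    using z K by (intro eq_vecI) auto
  then show ?thesis using z
  proof (induction es arbitrary: z)
    case Nil
    then have "z \<in> carrier_vec m" using K by auto
    then show ?case using Nil M by simp
  next
    case (Cons e es)
    have zc: "z \<in> carrier_vec m" using Cons.prems K by auto
    let ?z = "M *\<^sub>v z - e \<cdot>\<^sub>v z"
    have "polymat m M [:-e, 1:] *\<^sub>v z = ?z"
      using zc M by (intro eq_vecI) (auto simp: polymat_linear add_scalar_prod_distrib[of _ m])
    moreover have "polymat m M (\<Prod>a\<leftarrow>e # es. [:-a, 1:]) = polymat m M (\<Prod>a\<leftarrow>es. [:-a, 1:]) * polymat m M [:-e, 1:]"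
      by (simp only: list.map prod_list.Cons polymat_mult'[OF M])
    ultimately have "polymat m M (\<Prod>a\<leftarrow>es. [:-a, 1:]) *\<^sub>v ?z = 0\<^sub>v m"
      using Cons.prems(1) assoc_mult_mat_vec[OF polymat_carrier[OF M] polymat_carrier[OF M] zc] by metis
    show ?case
    proof (cases "?z = 0\<^sub>v m")
      case True
      have "M *\<^sub>v z = e \<cdot>\<^sub>v z"
      proof (rule eq_vecI)
        fix i assume "i < dim_vec (e \<cdot>\<^sub>v z)"
        then have "i < m" using zc by simp
        then have "?z $ i = 0" unfolding True by simp
        then show "(M *\<^sub>v z) $ i = (e \<cdot>\<^sub>v z) $ i" using \<open>i < m\<close> zc M by simp
      qed (use zc M in auto)
      then show ?thesis using Cons.prems by blast
    next
      case False
      from Cons.IH[OF \<open>polymat m M (\<Prod>a\<leftarrow>es. [:-a, 1:]) *\<^sub>v ?z = 0\<^sub>v m\<close> step[OF Cons.prems(2)] False]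
      show ?thesis .
    qed
  qed
qed

lemma det_dsum:
  assumes "A \<in> carrier_mat n n" "B \<in> carrier_mat m m"
  shows "Determinant.det (dsum A B) = Determinant.det A * Determinant.det B"
  using assms det_four_block_mat_lower_left_zero[of A n "0\<^sub>m n m" m "0\<^sub>m m n" B]
  by (simp add: dsum_def)

lemma congr_det_nonzero:
  assumes "congr n A B" "Determinant.det A \<noteq> 0"
  shows "Determinant.det B \<noteq> 0"
proof -
  obtain P P' where P: "inv_pair n P P'" "B = P\<^sup>T * A * P" and A: "A \<in> carrier_mat n n"
    using assms(1) by (auto simp: congr_def)
  show ?thesis
    using assms(2) A inv_pairD[OF P(1)] inv_pair_det[OF P(1)]
    by (simp add: P(2) det_mult[of _ n] det_transpose[of _ n])
qed

text \<open>The orthogonal complement of a nondegenerate subspace (with basis \<open>V\<close> and Gram matrix \<open>G\<close>)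
  which is invariant under the asymmetry \<open>\<sigma>\<close> is two-sided.\<close>

lemma split_off_invariant_subspace:
  assumes A: "A \<in> carrier_mat n n" and S: "S \<in> carrier_mat n n" and AS: "A\<^sup>T * S = A"
    and V: "V \<in> carrier_mat n m" and L: "L \<in> carrier_mat m m" and SV: "S * V = V * L"
    and G: "inv_pair m (V\<^sup>T * A * V) G'"
  shows "m \<le> n \<and> (\<exists>A'\<in>carrier_mat (n - m) (n - m). congr n A (dsum (V\<^sup>T * A * V) A'))"
proof -
  define G where "G = V\<^sup>T * A * V"
  have [simp]: "dim_row A = n" "dim_col A = n" "dim_row S = n" "dim_col S = n"
    "dim_row V = n" "dim_col V = m" "dim_row L = m" "dim_col L = m" using A S V L by auto
  have "c = 0\<^sub>v m" if c: "c \<in> carrier_vec m" "V *\<^sub>v c = 0\<^sub>v n" for c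
  proof -
    have "G *\<^sub>v c = (V\<^sup>T * A) *\<^sub>v (V *\<^sub>v c)"
      unfolding G_def using A V c(1) by (intro assoc_mult_mat_vec[of _ m n]) auto
    also have "\<dots> = 0\<^sub>v m" unfolding c(2) by simp
    finally show ?thesis using inv_pair_kernel[OF G c(1)] by (simp add: G_def)
  qed
  from extend_to_basis[OF V this] obtain U U' where
    mn: "m \<le> n" and U: "inv_pair n U U'" and UV: "U * rank_nf n m m = V" by blast
  note [simp] = inv_pair_dims[OF U]
  define B where "B = U\<^sup>T * A * U"
  have Bc: "B \<in> carrier_mat n n" using A inv_pairD[OF U] by (simp add: B_def)
  have AB: "congr n A B" by (rule congrI[OF A U B_def])
  let ?E = "rank_nf n m m"
  have "B * ?E = U\<^sup>T * A * V" unfolding B_def UV[symmetric] by (simp add: mat_assoc)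
  also have "\<dots> = U\<^sup>T * (A\<^sup>T * S) * V" unfolding AS ..
  also have "\<dots> = U\<^sup>T * (A\<^sup>T * (S * V))" by (simp add: mat_assoc)
  also have "\<dots> = U\<^sup>T * (A\<^sup>T * (V * L))" unfolding SV ..
  also have "\<dots> = U\<^sup>T * (A\<^sup>T * (U * (?E * L)))" unfolding UV[symmetric] by (simp add: mat_assoc)
  also have "\<dots> = B\<^sup>T * (?E * L)" unfolding B_def by (simp add: mat_assoc mat_transpose_mult)
  \<comment> \<open>Blockwise this reads \<open>a = a^T L\<close> and \<open>c = b^T L\<close>:
    invariance under the asymmetry ties the left and the right orthogonality relations to each
    other.\<close>
  finally have BE: "B * ?E = B\<^sup>T * (?E * L)" .
  obtain a b c d where sp: "split_block B m m = (a, b, c, d)" by (metis prod_cases4)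
  have dimB: "dim_row B = m + (n - m)" "dim_col B = m + (n - m)" using Bc mn by auto
  note sb = split_block[OF sp dimB]
  let ?r = "n - m"
  \<comment> \<open>Right-hand blocks without columns allow the product formula for two by two block
    matrices to be used for tall matrices.\<close>
  have E: "?E = four_block_mat (1\<^sub>m m) (0\<^sub>m m 0) (0\<^sub>m ?r m) (0\<^sub>m ?r 0)"
    using mn by (intro eq_matI) (auto simp: rank_nf_def)
  have "B * ?E = four_block_mat a (0\<^sub>m m 0) c (0\<^sub>m ?r 0)"
    unfolding E sb(5) by (subst mult_four_block_mat[of _ m m _ ?r _ ?r _ _ m _ 0]) (use sb in auto)
  moreover have "B\<^sup>T = four_block_mat (a\<^sup>T) (c\<^sup>T) (b\<^sup>T) (d\<^sup>T)"
    unfolding sb(5) by (rule transpose_four_block_mat) (use sb in auto)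
  moreover have "?E * L = four_block_mat L (0\<^sub>m m 0) (0\<^sub>m ?r m) (0\<^sub>m ?r 0)"
  proof -
    have "L = four_block_mat L (0\<^sub>m m 0) (0\<^sub>m 0 m) (0\<^sub>m 0 0)" by (rule eq_matI) auto
    then have "?E * L = four_block_mat (1\<^sub>m m) (0\<^sub>m m 0) (0\<^sub>m ?r m) (0\<^sub>m ?r 0) *
      four_block_mat L (0\<^sub>m m 0) (0\<^sub>m 0 m) (0\<^sub>m 0 0)" using E by metis
    also have "\<dots> = four_block_mat L (0\<^sub>m m 0) (0\<^sub>m ?r m) (0\<^sub>m ?r 0)"
      by (subst mult_four_block_mat[of _ m m _ 0 _ ?r _ _ m _ 0]) (use L in auto)
    finally show ?thesis .
  qed
  moreover have "four_block_mat (a\<^sup>T) (c\<^sup>T) (b\<^sup>T) (d\<^sup>T) * four_block_mat L (0\<^sub>m m 0) (0\<^sub>m ?r m) (0\<^sub>m ?r 0) =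
    four_block_mat (a\<^sup>T * L) (0\<^sub>m m 0) (b\<^sup>T * L) (0\<^sub>m ?r 0)"
    by (subst mult_four_block_mat[of _ m m _ ?r _ ?r _ _ m _ 0]) (use sb L in auto)
  ultimately have eq: "four_block_mat a (0\<^sub>m m 0) c (0\<^sub>m ?r 0) =
    four_block_mat (a\<^sup>T * L) (0\<^sub>m m 0) (b\<^sup>T * L) (0\<^sub>m ?r 0)" using BE by metis
  have a: "a = a\<^sup>T * L"
  proof (rule eq_matI)
    fix i j assume "i < dim_row (a\<^sup>T * L)" "j < dim_col (a\<^sup>T * L)"
    then have ij: "i < m" "j < m" using sb by auto
    have "four_block_mat a (0\<^sub>m m 0) c (0\<^sub>m ?r 0) $$ (i, j) = a $$ (i, j)" using ij sb(1) by simp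
    moreover have "four_block_mat (a\<^sup>T * L) (0\<^sub>m m 0) (b\<^sup>T * L) (0\<^sub>m ?r 0) $$ (i, j) = (a\<^sup>T * L) $$ (i, j)"
      using ij sb(1) by (simp del: index_mult_mat(1))
    ultimately show "a $$ (i, j) = (a\<^sup>T * L) $$ (i, j)" using eq by simp
  qed (use sb in auto)
  have c: "c = b\<^sup>T * L"
  proof (rule eq_matI)
    fix i j assume "i < dim_row (b\<^sup>T * L)" "j < dim_col (b\<^sup>T * L)"
    then have ij: "i < ?r" "j < m" using sb by auto
    have "four_block_mat a (0\<^sub>m m 0) c (0\<^sub>m ?r 0) $$ (m + i, j) = c $$ (i, j)" using ij sb by simp
    moreover have "four_block_mat (a\<^sup>T * L) (0\<^sub>m m 0) (b\<^sup>T * L) (0\<^sub>m ?r 0) $$ (m + i, j) = (b\<^sup>T * L) $$ (i, j)"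
      using ij sb by (simp del: index_mult_mat(1))
    ultimately show "c $$ (i, j) = (b\<^sup>T * L) $$ (i, j)" using eq by simp
  qed (use sb in auto)
  have "G = ?E\<^sup>T * (B * ?E)"
    unfolding G_def B_def UV[symmetric] by (simp add: mat_assoc mat_transpose_mult)
  also have "B * ?E = four_block_mat a (0\<^sub>m m 0) c (0\<^sub>m ?r 0)" by fact
  also have "?E\<^sup>T = four_block_mat (1\<^sub>m m) (0\<^sub>m m ?r) (0\<^sub>m 0 m) (0\<^sub>m 0 ?r)"
    using mn by (intro eq_matI) (auto simp: rank_nf_def)
  also have "four_block_mat (1\<^sub>m m) (0\<^sub>m m ?r) (0\<^sub>m 0 m) (0\<^sub>m 0 ?r) * four_block_mat a (0\<^sub>m m 0) c (0\<^sub>m ?r 0) =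
    four_block_mat a (0\<^sub>m m 0) (0\<^sub>m 0 m) (0\<^sub>m 0 0)"
    by (subst mult_four_block_mat[of _ m m _ ?r _ 0 _ _ m _ 0]) (use sb in auto)
  also have "\<dots> = a" using sb(1) by (intro eq_matI) auto
  finally have Ga: "G = a" .
  have ai: "inv_pair m a G'" using G Ga by (simp add: G_def)
  note aT = inv_pair_transpose[OF ai]
  have [simp]: "dim_row a = m" "dim_col a = m" "dim_row b = m" "dim_col b = ?r"
    "dim_row c = ?r" "dim_col c = m" "dim_row d = ?r" "dim_col d = ?r" using sb by auto
  note [simp] = inv_pair_dims[OF ai]
  have "a\<^sup>T * (L * G') = a\<^sup>T * G'\<^sup>T"
    using inv_pairD[OF ai] inv_pairD[OF aT] a by (simp add: mat_assoc[symmetric])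
  then have "G'\<^sup>T * (a\<^sup>T * (L * G')) = G'\<^sup>T * (a\<^sup>T * G'\<^sup>T)" by simp
  \<comment> \<open>By \<open>a = a^T L\<close> the matrix \<open>L\<close> is the asymmetry of
    \<open>a\<close>. Consequently \<open>c a^-1\<close> is the transpose of \<open>a^-1 b\<close>,
    and the Schur complement is a congruence.\<close>
  then have LG: "L * G' = G'\<^sup>T" by (simp add: inv_pair_cancel[OF aT])
  have "c * G' = b\<^sup>T * G'\<^sup>T" unfolding c by (simp add: mat_assoc LG)
  then have cG: "c * G' = (G' * b)\<^sup>T" by (simp add: mat_transpose_mult)
  let ?P = "four_block_mat (1\<^sub>m m) (- (G' * b)) (0\<^sub>m ?r m) (1\<^sub>m ?r)"
  have Gb: "- (G' * b) \<in> carrier_mat m ?r" using inv_pairD[OF ai] sb by simp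
  have PT: "?P\<^sup>T = four_block_mat (1\<^sub>m m) (0\<^sub>m m ?r) (- (c * G')) (1\<^sub>m ?r)"
    unfolding cG using Gb
    by (subst transpose_four_block_mat[of _ m m _ ?r _ ?r]) (auto intro!: cong_four_block_mat eq_matI)
  have "?P\<^sup>T * B * ?P = dsum a (d - c * (G' * b))"
    unfolding PT sb(5) by (rule schur_complement[OF ai]) (use sb in auto)
  then have "congr n B (dsum a (d - c * (G' * b)))"
    using inv_pair_upper[OF Gb] mn Bc by (intro congrI[of B n ?P]) auto
  then have "congr n A (dsum (V\<^sup>T * A * V) (d - c * (G' * b)))"
    using congr_trans[OF AB] Ga by (simp add: G_def)
  moreover have "d - c * (G' * b) \<in> carrier_mat ?r ?r" by (intro carrier_matI) auto
  ultimately show ?thesis using mn by blast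
qed


text \<open>The hypothesis is the eigenvector equation of a Jordan block. If \<open>c = l\<close>,
  equation \<open>i\<close> kills coordinate \<open>i + 1\<close>; otherwise the last coordinate
  vanishes and the vanishing propagates downwards through the equations.\<close>

lemma jordan_eigenvector_coords:
  fixes z :: "nat \<Rightarrow> complex"
  assumes "\<And>j. j < k \<Longrightarrow> l * z j + (if Suc j < k then z (Suc j) else 0) = c * z j"
    and "1 \<le> j" "j < k"
  shows "z j = 0"
proof (cases "c = l")
  case True
  obtain i where "j = Suc i" using assms(2) by (cases j) auto
  then show ?thesis using assms(1)[of i] assms(3) True by auto
next
  case False
  have "j \<le> k - 1" using assms by simp
  then show ?thesis
  proof (induction j rule: inc_induct)
    case base
    then show ?case using assms(1)[of "k - 1"] assms(2,3) False by auto
  next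
    case (step i)
    then have "i < k" "Suc i < k" by auto
    then show ?case using assms(1)[of i] step False by auto
  qed
qed

section \<open>The asymmetry of a nondegenerate form and its chains\<close>

locale nondegenerate_form =
  fixes n :: nat and A A' :: "complex Matrix.mat"
  assumes inv: "inv_pair n A A'"
begin

definition S :: "complex Matrix.mat" where "S = A'\<^sup>T * A"

definition f :: "complex Matrix.vec \<Rightarrow> complex Matrix.vec \<Rightarrow> complex" where
  "f x y = scalar_prod x (A *\<^sub>v y)"

definition N :: "complex \<Rightarrow> complex Matrix.vec \<Rightarrow> complex Matrix.vec" where
  "N l x = S *\<^sub>v x - l \<cdot>\<^sub>v x"

definition chain :: "complex \<Rightarrow> nat \<Rightarrow> complex Matrix.vec \<Rightarrow> complex Matrix.vec" where
  "chain l i v = (N l ^^ i) v"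

lemma A_carrier: "A \<in> carrier_mat n n" using inv by (simp add: inv_pair_def)

lemma A_dims [simp]: "dim_row A = n" "dim_col A = n" using A_carrier by auto

lemma S_carrier: "S \<in> carrier_mat n n"
  using inv_pairD[OF inv] by (simp add: S_def)

lemma S_dims [simp]: "dim_row S = n" "dim_col S = n" using S_carrier by auto

lemma AS: "A\<^sup>T * S = A"
  unfolding S_def by (simp add: inv_pair_cancel[OF inv_pair_transpose[OF inv]])

lemma Sx_carrier [simp]: "x \<in> carrier_vec n \<Longrightarrow> S *\<^sub>v x \<in> carrier_vec n"
  using S_carrier by auto

lemma N_carrier [simp]: "x \<in> carrier_vec n \<Longrightarrow> N l x \<in> carrier_vec n"
  by (simp add: N_def)

lemma chain_carrier [simp]: "x \<in> carrier_vec n \<Longrightarrow> chain l i x \<in> carrier_vec n"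
  by (induction i) (auto simp: chain_def)

lemma chain_Suc: "chain l (Suc i) v = N l (chain l i v)"
  by (simp add: chain_def)

lemma chain_0 [simp]: "chain l 0 v = v"
  by (simp add: chain_def)

lemma f_swap:
  assumes "x \<in> carrier_vec n" "y \<in> carrier_vec n"
  shows "f x y = f (S *\<^sub>v y) x"
proof -
  have "A *\<^sub>v y = A\<^sup>T *\<^sub>v (S *\<^sub>v y)"
    using assoc_mult_mat_vec[of "A\<^sup>T" n n S n y] A_carrier S_carrier assms by (simp add: AS)
  then have "f x y = scalar_prod (A\<^sup>T *\<^sub>v (S *\<^sub>v y)) x"
    unfolding f_def using assms A_carrier by (simp add: comm_scalar_prod[of x n])
  also have "\<dots> = f (S *\<^sub>v y) x"
    unfolding f_def by (rule transpose_vec_mult_scalar[OF A_carrier assms(1)]) (use assms in simp)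
  finally show ?thesis .
qed

lemma f_isometry:
  assumes "x \<in> carrier_vec n" "y \<in> carrier_vec n"
  shows "f (S *\<^sub>v x) (S *\<^sub>v y) = f x y"
  using f_swap[of x y] f_swap[of "S *\<^sub>v y" x] assms by simp

lemma f_linear:
  assumes "x \<in> carrier_vec n" "y \<in> carrier_vec n" "z \<in> carrier_vec n"
  shows "f x (y - c \<cdot>\<^sub>v z) = f x y - c * f x z" "f (y - c \<cdot>\<^sub>v z) x = f y x - c * f z x"
proof -
  have "A *\<^sub>v (y - c \<cdot>\<^sub>v z) = A *\<^sub>v y - c \<cdot>\<^sub>v (A *\<^sub>v z)"
    using assms A_carrier by (simp add: mult_mat_vec_minus[of _ n n] mult_mat_vec[of _ n n])
  then show "f x (y - c \<cdot>\<^sub>v z) = f x y - c * f x z"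
    unfolding f_def using assms A_carrier by (simp add: scalar_prod_minus_distrib[of _ n])
  show "f (y - c \<cdot>\<^sub>v z) x = f y x - c * f z x"
    unfolding f_def using assms A_carrier by (simp add: minus_scalar_prod_distrib[of _ n])
qed

lemma f_smult:
  assumes "x \<in> carrier_vec n" "y \<in> carrier_vec n"
  shows "f x (c \<cdot>\<^sub>v y) = c * f x y" "f (c \<cdot>\<^sub>v x) y = c * f x y"
  unfolding f_def using assms A_carrier by (simp_all add: mult_mat_vec[of _ n n])

lemma f_zero [simp]: "x \<in> carrier_vec n \<Longrightarrow> f x (0\<^sub>v n) = 0"
  by (simp add: f_def)

text \<open>Because \<open>S\<close> is an isometry, \<open>S - 1 / l\<close> is adjoint to
  \<open>S - l\<close> up to a scalar and a twist by \<open>S\<close>. This is how the eigenvalues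
  \<open>l\<close> and \<open>1 / l\<close> become paired.\<close>

lemma f_N:
  assumes "x \<in> carrier_vec n" "y \<in> carrier_vec n" "l \<noteq> 0"
  shows "f (N (1 / l) x) (S *\<^sub>v y) = - (1 / l) * f x (N l y)"
proof -
  have "f (N (1 / l) x) (S *\<^sub>v y) = f x y - (1 / l) * f x (S *\<^sub>v y)"
    unfolding N_def using assms by (subst f_linear(2)) (simp_all add: f_isometry)
  moreover have "f x (N l y) = f x (S *\<^sub>v y) - l * f x y"
    unfolding N_def using assms by (subst f_linear(1)) simp_all
  ultimately show ?thesis using assms(3) by (simp add: right_diff_distrib)
qed

lemma N_S_commute:
  assumes "y \<in> carrier_vec n"
  shows "N l (S *\<^sub>v y) = S *\<^sub>v (N l y)"
  unfolding N_def using assms S_carrier by (simp add: mult_mat_vec_minus[of _ n n] mult_mat_vec[of _ n n])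

lemma N_funpow_S_commute:
  assumes "y \<in> carrier_vec n"
  shows "((*\<^sub>v) S ^^ i) y \<in> carrier_vec n \<and> N l (((*\<^sub>v) S ^^ i) y) = ((*\<^sub>v) S ^^ i) (N l y)"
  by (induction i) (use assms in \<open>auto simp: N_S_commute\<close>)

lemma f_chain:
  assumes "x \<in> carrier_vec n" "y \<in> carrier_vec n" "l \<noteq> 0"
  shows "f (chain (1 / l) i x) (((*\<^sub>v) S ^^ i) y) = (- (1 / l)) ^ i * f x (chain l i y)"
  using assms(2)
proof (induction i arbitrary: y)
  case 0
  then show ?case by simp
next
  case (Suc i)
  have "f (chain (1 / l) (Suc i) x) (((*\<^sub>v) S ^^ Suc i) y) =
    - (1 / l) * f (chain (1 / l) i x) (N l (((*\<^sub>v) S ^^ i) y))"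
    using N_funpow_S_commute[OF Suc.prems] assms by (simp add: chain_Suc f_N)
  also have "\<dots> = - (1 / l) * ((- (1 / l)) ^ i * f x (chain l i (N l y)))"
    using N_funpow_S_commute[OF Suc.prems] Suc.IH[of "N l y"] Suc.prems by simp
  also have "chain l i (N l y) = chain l (Suc i) y" by (simp add: chain_def funpow_swap1)
  finally show ?case by simp
qed

lemma f_eigen_S:
  assumes "z \<in> carrier_vec n" "y \<in> carrier_vec n" "S *\<^sub>v z = e \<cdot>\<^sub>v z" "e \<noteq> 0"
  shows "f z (S *\<^sub>v y) = (1 / e) * f z y"
proof -
  have "f z y = e * f z (S *\<^sub>v y)"
    using f_isometry[OF assms(1,2)] assms f_smult(2)[of z "S *\<^sub>v y" e] by simp
  then show ?thesis using assms(4) by simp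
qed

lemma f_eigen_funpow:
  assumes "z \<in> carrier_vec n" "y \<in> carrier_vec n" "S *\<^sub>v z = e \<cdot>\<^sub>v z" "e \<noteq> 0"
  shows "f z (((*\<^sub>v) S ^^ i) y) = (1 / e) ^ i * f z y"
  by (induction i) (use assms N_funpow_S_commute[OF assms(2)] in \<open>auto simp: f_eigen_S[OF assms(1) _ assms(3,4)]\<close>)

lemma chain_polymat:
  assumes "v \<in> carrier_vec n"
  shows "polymat n S ([:-l, 1:] ^ i) *\<^sub>v v = chain l i v"
proof (induction i)
  case 0
  then show ?case using assms S_carrier by simp
next
  case (Suc i)
  have "polymat n S ([:-l, 1:] ^ Suc i) *\<^sub>v v = polymat n S [:-l, 1:] *\<^sub>v (polymat n S ([:-l, 1:] ^ i) *\<^sub>v v)"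
    by (simp only: power_Suc polymat_mult[OF S_carrier]
        assoc_mult_mat_vec[OF polymat_carrier[OF S_carrier] polymat_carrier[OF S_carrier] assms])
  also have "\<dots> = N l (chain l i v)"
    unfolding Suc.IH N_def polymat_linear[OF S_carrier]
    using chain_carrier[OF assms, of l i] S_carrier
    by (intro eq_vecI) (auto simp: add_scalar_prod_distrib[of _ n])
  finally show ?case by (simp add: chain_Suc)
qed

lemma eigen_of_chain:
  assumes "v \<in> carrier_vec n" "chain l k v = 0\<^sub>v n" "k > 0"
  shows "S *\<^sub>v chain l (k - 1) v = l \<cdot>\<^sub>v chain l (k - 1) v"
proof -
  let ?u = "chain l (k - 1) v"
  have u: "?u \<in> carrier_vec n" using assms by simp
  have "N l ?u = 0\<^sub>v n" using assms chain_Suc[of l "k - 1" v] by simp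
  then have "(S *\<^sub>v ?u - l \<cdot>\<^sub>v ?u) $ i = 0" if "i < n" for i using that by (simp add: N_def)
  then show ?thesis using u S_carrier by (intro eq_vecI) auto
qed

text \<open>Take \<open>\<lambda>\<close> of maximal multiplicity \<open>k\<close> in the minimal polynomial of the asymmetry. Maximality
  ensures that the vector \<open>w\<close> dual to the end of a longest \<open>\<lambda>\<close>-chain can be chosen in
  \<open>ker (\<sigma> - 1/\<lambda>)\<^sup>k\<close>.\<close>

lemma exists_dual_chains:
  assumes n: "n > 0"
  shows "\<exists>l k v w. l \<noteq> 0 \<and> k > 0 \<and> v \<in> carrier_vec n \<and> w \<in> carrier_vec n \<and>
    chain l k v = 0\<^sub>v n \<and> chain (1 / l) k w = 0\<^sub>v n \<and> f (chain l (k - 1) v) w \<noteq> 0"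
proof -
  note Sc = S_carrier
  note pc = polymat_carrier[OF Sc]
  obtain p where p: "p \<noteq> 0" "polymat n S p = 0\<^sub>m n n"
    and min: "\<And>q. q \<noteq> 0 \<Longrightarrow> polymat n S q = 0\<^sub>m n n \<Longrightarrow> degree p \<le> degree q"
    using polymat_annihilator[OF Sc]
      ex_has_least_nat[of "\<lambda>p. p \<noteq> 0 \<and> polymat n S p = 0\<^sub>m n n" _ degree]
    by metis
  have kill: "polymat n S (q * p) *\<^sub>v x = 0\<^sub>v n" if "x \<in> carrier_vec n" for q x
  proof -
    have "polymat n S (q * p) = 0\<^sub>m n n" using p pc[of q] by (simp add: polymat_mult[OF Sc])
    then show ?thesis using that by (intro eq_vecI) auto
  qed
  have "Polynomial.order x p < Suc (degree p)" for x using order_degree[OF p(1), of x] by simp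
  then obtain l where l: "\<And>x. Polynomial.order x p \<le> Polynomial.order l p"
    using ex_has_greatest_nat[of "\<lambda>_. True" 0 "\<lambda>x. Polynomial.order x p" "Suc (degree p)"] by blast
  define k where "k = Polynomial.order l p"
  obtain q where q: "p = [:- l, 1:] ^ k * q" "\<not> [:- l, 1:] dvd q"
    using order_decomp[OF p(1), of l] unfolding k_def by blast
  have k: "k > 0"
  proof (rule ccontr)
    assume "\<not> k > 0"
    then have "poly p x \<noteq> 0" for x using l[of x] order_root[of p x] p(1) by (simp add: k_def)
    then have "constant (poly p)" using fundamental_theorem_of_algebra by blast
    then obtain c where c: "p = [:c:]" using constant_degree by (metis degree_eq_zeroE)
    have "(c \<cdot>\<^sub>m 1\<^sub>m n) $$ (0, 0) = 0" using p(2) n unfolding c polymat_const[OF Sc] by simp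
    then have "c = 0" using n by simp
    then show False using p(1) c by simp
  qed
  \<comment> \<open>\<open>p\<close> divided by \<open>X - l\<close> does not annihilate
    \<open>S\<close>, as \<open>p\<close> has least degree. A nonzero entry of its value at
    \<open>S\<close> picks a unit vector from which \<open>q\<close> produces a chain of exact
    length \<open>k\<close>.\<close>
  define r where "r = [:- l, 1:] ^ (k - 1) * q"
  have pr: "p = [:- l, 1:] * r" unfolding q(1) r_def using power_Suc[of "[:- l, 1:]" "k - 1"] k by (simp only: mult.assoc Suc_diff_1)
  then have "r \<noteq> 0" using p(1) by auto
  then have "degree p = Suc (degree r)" unfolding pr by (subst degree_mult_eq) auto
  then have "polymat n S r \<noteq> 0\<^sub>m n n" using min[OF \<open>r \<noteq> 0\<close>] by auto
  then obtain i j where ij: "i < n" "j < n" "polymat n S r $$ (i, j) \<noteq> 0"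
    using pc[of r] by (metis carrier_matD eq_matI index_zero_mat)
  define v where "v = polymat n S q *\<^sub>v unit_vec n j"
  have v: "v \<in> carrier_vec n" unfolding v_def using pc by (intro mult_mat_vec_carrier) auto
  define u where "u = chain l (k - 1) v"
  have "u = polymat n S r *\<^sub>v unit_vec n j"
    unfolding u_def chain_polymat[OF v, symmetric] unfolding v_def r_def polymat_mult[OF Sc]
    using pc by (intro assoc_mult_mat_vec[symmetric, of _ n n _ n]) auto
  then have ui: "u $ i \<noteq> 0" using ij pc[of r] by simp
  have u: "u \<in> carrier_vec n" using v by (simp add: u_def)
  have "chain l k v = polymat n S (1 * p) *\<^sub>v unit_vec n j"
    unfolding chain_polymat[OF v, symmetric] unfolding v_def mult_1 q(1) polymat_mult[OF Sc]
    using pc by (intro assoc_mult_mat_vec[symmetric, of _ n n _ n]) auto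
  also have "\<dots> = 0\<^sub>v n" by (rule kill) simp
  finally have vk: "chain l k v = 0\<^sub>v n" .
  have Su: "S *\<^sub>v u = l \<cdot>\<^sub>v u" unfolding u_def by (rule eigen_of_chain[OF v vk k])
  have Sinv: "inv_pair n S (A' * A\<^sup>T)"
    unfolding S_def using inv_pair_mult[OF inv_pair_sym[OF inv_pair_transpose[OF inv]] inv] .
  have l0: "l \<noteq> 0"
  proof
    assume "l = 0"
    then have "S *\<^sub>v u = 0\<^sub>v n" using Su u by auto
    then have "u = 0\<^sub>v n" using inv_pair_kernel[OF Sinv u] by simp
    then show False using ui ij by simp
  qed
  \<comment> \<open>The vector representing the functional \<open>f u\<close>. Since
    \<open>u\<close> is an eigenvector of \<open>S\<close> for \<open>l\<close>, it is an
    eigenvector of the transpose of \<open>S\<close> for \<open>1 / l\<close>.\<close>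
  define x where "x = A\<^sup>T *\<^sub>v u"
  have x: "x \<in> carrier_vec n" using u A_carrier by (simp add: x_def)
  have fx: "f u y = scalar_prod x y" if "y \<in> carrier_vec n" for y
    unfolding f_def x_def using transpose_vec_mult_scalar[OF A_carrier that u] by simp
  have "x \<noteq> 0\<^sub>v n"
    using inv_pair_kernel[OF inv_pair_transpose[OF inv] u] ui ij unfolding x_def by auto
  then obtain j' where j': "j' < n" "x $ j' \<noteq> 0"
    using x by (metis carrier_vecD eq_vecI index_zero_vec(1,2))
  have "S\<^sup>T *\<^sub>v x = (1 / l) \<cdot>\<^sub>v x"
  proof -
    have "A = (A\<^sup>T * S)\<^sup>T\<^sup>T" using AS by simp
    also have "\<dots> = (S\<^sup>T * A)\<^sup>T" by (simp add: mat_transpose_mult)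
    finally have "A\<^sup>T = S\<^sup>T * A" by (metis Matrix.transpose_transpose)
    then have "A\<^sup>T = S\<^sup>T * (A\<^sup>T * S)" unfolding AS .
    then have "x = (S\<^sup>T * (A\<^sup>T * S)) *\<^sub>v u" unfolding x_def by simp
    also have "\<dots> = S\<^sup>T *\<^sub>v (A\<^sup>T *\<^sub>v (S *\<^sub>v u))"
      using A_carrier Sc u by (simp add: assoc_mult_mat_vec[of _ n n _ n])
    also have "\<dots> = l \<cdot>\<^sub>v (S\<^sup>T *\<^sub>v x)"
      using A_carrier Sc u by (simp add: Su x_def mult_mat_vec[of _ n n])
    finally have xl: "x = l \<cdot>\<^sub>v (S\<^sup>T *\<^sub>v x)" .
    have "(1 / l) \<cdot>\<^sub>v x = (1 / l) \<cdot>\<^sub>v (l \<cdot>\<^sub>v (S\<^sup>T *\<^sub>v x))" using xl by simp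
    then show ?thesis using l0 by (simp add: smult_smult_assoc)
  qed
  then have ev: "(polymat n S q')\<^sup>T *\<^sub>v x = poly q' (1 / l) \<cdot>\<^sub>v x" for q'
    unfolding polymat_transpose[OF Sc] using x Sc by (intro polymat_eigenvector) auto
  obtain q' where q': "p = [:- (1 / l), 1:] ^ Polynomial.order (1 / l) p * q'" "\<not> [:- (1 / l), 1:] dvd q'"
    using order_decomp[OF p(1), of "1 / l"] by blast
  \<comment> \<open>\<open>q'\<close> is the part of \<open>p\<close> prime to
    \<open>X - 1 / l\<close>. It acts on \<open>x\<close> by the nonzero scalar
    \<open>poly q' (1 / l)\<close>, whence \<open>f u w\<close> is nonzero; and \<open>k\<close>
    steps annihilate \<open>w\<close> because \<open>k\<close> bounds the multiplicity of
    \<open>1 / l\<close>.\<close>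
  define w where "w = polymat n S q' *\<^sub>v unit_vec n j'"
  have w: "w \<in> carrier_vec n" unfolding w_def using pc by (intro mult_mat_vec_carrier) auto
  have le: "Polynomial.order (1 / l) p \<le> k" using l by (simp add: k_def)
  have "chain (1 / l) k w = polymat n S ([:- (1 / l), 1:] ^ k * q') *\<^sub>v unit_vec n j'"
    unfolding chain_polymat[OF w, symmetric] unfolding w_def polymat_mult[OF Sc]
    using pc by (intro assoc_mult_mat_vec[symmetric, of _ n n _ n]) auto
  also have "[:- (1 / l), 1:] ^ k * q' = [:- (1 / l), 1:] ^ (k - Polynomial.order (1 / l) p) * p"
  proof -
    have "[:- (1 / l), 1:] ^ k = [:- (1 / l), 1:] ^ (k - Polynomial.order (1 / l) p) * [:- (1 / l), 1:] ^ Polynomial.order (1 / l) p"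
      using le by (simp only: power_add[symmetric] le_add_diff_inverse2)
    then show ?thesis using q'(1) by (simp only: mult.assoc)
  qed
  also have "polymat n S \<dots> *\<^sub>v unit_vec n j' = 0\<^sub>v n" by (rule kill) simp
  finally have wk: "chain (1 / l) k w = 0\<^sub>v n" .
  have "f u w = scalar_prod (poly q' (1 / l) \<cdot>\<^sub>v x) (unit_vec n j')"
    unfolding fx[OF w] ev[symmetric] unfolding w_def
    by (rule transpose_vec_mult_scalar[symmetric]) (use pc x in auto)
  also have "\<dots> = poly q' (1 / l) * x $ j'" using x j' by simp
  also have "\<dots> \<noteq> 0" using q'(2) j' by (simp add: poly_eq_0_iff_dvd)
  finally have "f u w \<noteq> 0" .
  then show ?thesis using l0 k v w vk wk unfolding u_def by blast
qed

end

section \<open>Splitting off one chain or two dual chains\<close>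

lemma smult_zero_vec_complex [simp]: "(c :: complex) \<cdot>\<^sub>v 0\<^sub>v m = 0\<^sub>v m"
  by (rule eq_vecI) auto

text \<open>The asymmetry in a basis of chains: \<open>e j\<close> is the eigenvalue at vector
  \<open>j\<close>, and \<open>s j\<close> is 1 if vector \<open>j\<close> continues a chain and 0
  if it starts a new one.\<close>

definition jordan_chains :: "nat \<Rightarrow> (nat \<Rightarrow> complex) \<Rightarrow> (nat \<Rightarrow> complex) \<Rightarrow> complex Matrix.mat" where
  "jordan_chains m e s = Matrix.mat m m (\<lambda>(i, j). if i = j then e j else if Suc i = j then s j else 0)"

lemma jordan_chains_carrier [simp]: "jordan_chains m e s \<in> carrier_mat m m"
  "dim_row (jordan_chains m e s) = m" "dim_col (jordan_chains m e s) = m"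
  by (auto simp: jordan_chains_def)

lemma mult_jordan_chains_index:
  assumes "V \<in> carrier_mat n m" "i < n" "j < m"
  shows "(V * jordan_chains m e s) $$ (i, j) = e j * V $$ (i, j) + (if j = 0 then 0 else s j * V $$ (i, j - 1))"
proof -
  have "(V * jordan_chains m e s) $$ (i, j) = (\<Sum>l<m. V $$ (i, l) * jordan_chains m e s $$ (l, j))"
    using assms by (simp add: scalar_prod_def atLeast0LessThan)
  also have "\<dots> = (\<Sum>l<m. (if l = j then e j * V $$ (i, j) else 0) + (if Suc l = j then s j * V $$ (i, j - 1) else 0))"
    using assms by (intro sum.cong) (auto simp: jordan_chains_def)
  also have "\<dots> = e j * V $$ (i, j) + (\<Sum>l<m. (if Suc l = j then s j * V $$ (i, j - 1) else 0))"
    using assms by (simp add: sum.distrib)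
  also have "(\<Sum>l<m. (if Suc l = j then s j * V $$ (i, j - 1) else 0)) = (if j = 0 then 0 else s j * V $$ (i, j - 1))"
    using assms by (cases j) auto
  finally show ?thesis .
qed

lemma jordan_chains_vec_index:
  assumes "z \<in> carrier_vec m" "i < m"
  shows "(jordan_chains m e s *\<^sub>v z) $ i = e i * z $ i + (if Suc i < m then s (Suc i) * z $ Suc i else 0)"
proof -
  have "(jordan_chains m e s *\<^sub>v z) $ i = (\<Sum>l<m. jordan_chains m e s $$ (i, l) * z $ l)"
    using assms by (simp add: scalar_prod_def atLeast0LessThan)
  also have "\<dots> = (\<Sum>l<m. (if l = i then e i * z $ i else 0) + (if l = Suc i then s (Suc i) * z $ Suc i else 0))"
    using assms by (intro sum.cong) (auto simp: jordan_chains_def)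
  also have "\<dots> = e i * z $ i + (if Suc i < m then s (Suc i) * z $ Suc i else 0)"
    using assms by (simp add: sum.distrib)
  finally show ?thesis .
qed

lemma jordan_chains_invertible:
  assumes "\<And>j. j < m \<Longrightarrow> e j \<noteq> 0"
  shows "\<exists>L'. inv_pair m (jordan_chains m e s) L'"
proof -
  have "upper_triangular (jordan_chains m e s)" unfolding upper_triangular_def by (auto simp: jordan_chains_def)
  then have "Determinant.det (jordan_chains m e s) = prod_list (diag_mat (jordan_chains m e s))"
    by (rule det_upper_triangular[OF _ jordan_chains_carrier(1)])
  moreover have "0 \<notin> set (diag_mat (jordan_chains m e s))" using assms by (auto simp: diag_mat_def jordan_chains_def)
  ultimately show ?thesis by (intro inv_pair_of_det[OF jordan_chains_carrier(1)]) (simp add: prod_list_zero_iff)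
qed

lemma similar_jordan_nf_self:
  assumes "0 \<notin> fst ` set js" "J = jordan_matrix js"
  shows "jordan_nf J js"
proof -
  have "J \<in> carrier_mat (sum_list (map fst js)) (sum_list (map fst js))" unfolding assms(2) by (rule jordan_matrix_carrier)
  from similar_mat_refl[OF this] show ?thesis using assms by (simp add: jordan_nf_def)
qed

context nondegenerate_form
begin

text \<open>The Gram matrix \<open>G\<close> of the chains satisfies \<open>L^T G L = G\<close> with
  \<open>L\<close> invertible, so its kernel is invariant under \<open>L\<close> and, unless it is
  zero, contains an eigenvector of \<open>L\<close>. Nondegeneracy thus needs checking on
  eigenvectors alone, which is the hypothesis \<open>nondeg\<close>; it also makes the chains
  linearly independent.\<close>

lemma split_off_chains:
  assumes y: "\<And>j. j < m \<Longrightarrow> y j \<in> carrier_vec n" and e: "\<And>j. j < m \<Longrightarrow> e j \<noteq> 0"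
    and Sy: "\<And>j. j < m \<Longrightarrow> S *\<^sub>v y j = e j \<cdot>\<^sub>v y j + (if j = 0 then 0\<^sub>v n else s j \<cdot>\<^sub>v y (j - 1))"
    and nondeg: "\<And>z c. z \<in> carrier_vec m \<Longrightarrow> jordan_chains m e s *\<^sub>v z = c \<cdot>\<^sub>v z \<Longrightarrow>
      (\<And>i. i < m \<Longrightarrow> (\<Sum>j<m. f (y i) (y j) * z $ j) = 0) \<Longrightarrow> z = 0\<^sub>v m"
    and js: "jordan_nf (jordan_chains m e s) js"
  shows "m \<le> n \<and> (\<exists>G\<in>carrier_mat m m. \<exists>B\<in>carrier_mat (n - m) (n - m).
    asym_nf 0 G js \<and> congr n A (dsum G B) \<and> Determinant.det B \<noteq> 0)"
proof -
  let ?L = "jordan_chains m e s"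
  define V where "V = Matrix.mat n m (\<lambda>(i, j). y j $ i)"
  have V: "V \<in> carrier_mat n m" and [simp]: "dim_row V = n" "dim_col V = m" by (auto simp: V_def)
  have col: "col V j = y j" if "j < m" for j
    using that y[OF that] by (intro eq_vecI) (auto simp: V_def)
  have SV: "S * V = V * ?L"
  proof (rule eq_matI)
    fix i j assume "i < dim_row (V * ?L)" "j < dim_col (V * ?L)"
    then have ij: "i < n" "j < m" by auto
    have "(S * V) $$ (i, j) = (S *\<^sub>v y j) $ i"
      using ij col[OF ij(2)] by simp
    also have "\<dots> = (V * ?L) $$ (i, j)"
      unfolding mult_jordan_chains_index[OF V ij] Sy[OF ij(2)]
      using ij y[OF ij(2)] y[OF less_imp_diff_less[OF ij(2), of 1]] by (auto simp: V_def)
    finally show "(S * V) $$ (i, j) = (V * ?L) $$ (i, j)" .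
  qed auto
  define G where "G = V\<^sup>T * A * V"
  have Gc: "G \<in> carrier_mat m m" using V A_carrier by (simp add: G_def)
  have Gij: "G $$ (i, j) = f (y i) (y j)" if "i < m" "j < m" for i j
  proof -
    have "G = V\<^sup>T * (A * V)" unfolding G_def by (simp add: mat_assoc)
    then have "G $$ (i, j) = scalar_prod (y i) (col (A * V) j)"
      using that by (simp add: col)
    also have "col (A * V) j = A *\<^sub>v y j"
      using that A_carrier V by (intro eq_vecI) (auto simp: col)
    finally show ?thesis by (simp add: f_def)
  qed
  obtain L' where L': "inv_pair m ?L L'" using jordan_chains_invertible[of m e] e by blast
  have StA: "S\<^sup>T * A = A\<^sup>T"
  proof -
    have "(A\<^sup>T * S)\<^sup>T = S\<^sup>T * A" by (simp add: mat_transpose_mult)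
    then show ?thesis by (simp add: AS)
  qed
  have LGL: "?L\<^sup>T * (G * ?L) = G"
  proof -
    have "?L\<^sup>T * (G * ?L) = (V * ?L)\<^sup>T * (A * (V * ?L))"
      unfolding G_def by (simp add: mat_assoc mat_transpose_mult)
    also have "\<dots> = V\<^sup>T * ((S\<^sup>T * A) * (S * V))"
      unfolding SV[symmetric] by (simp add: mat_assoc mat_transpose_mult)
    also have "\<dots> = V\<^sup>T * ((A\<^sup>T * S) * V)" unfolding StA by (simp add: mat_assoc)
    also have "\<dots> = G" unfolding AS G_def by (simp add: mat_assoc)
    finally show ?thesis .
  qed
  have GtL: "G\<^sup>T * ?L = G"
  proof -
    have "G\<^sup>T * ?L = V\<^sup>T * (A\<^sup>T * (V * ?L))" unfolding G_def by (simp add: mat_assoc mat_transpose_mult)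
    also have "\<dots> = V\<^sup>T * ((A\<^sup>T * S) * V)" unfolding SV[symmetric] by (simp add: mat_assoc)
    also have "\<dots> = G" unfolding AS G_def by (simp add: mat_assoc)
    finally show ?thesis .
  qed
  have "\<exists>G'. inv_pair m G G'"
  proof (rule inv_pair_of_kernel[OF Gc], rule ccontr)
    fix z assume z: "z \<in> carrier_vec m" "G *\<^sub>v z = 0\<^sub>v m" "z \<noteq> 0\<^sub>v m"
    let ?K = "{z \<in> carrier_vec m. G *\<^sub>v z = 0\<^sub>v m}"
    have "\<exists>z\<in>?K. \<exists>c. z \<noteq> 0\<^sub>v m \<and> ?L *\<^sub>v z = c \<cdot>\<^sub>v z"
    proof (rule eigenvector_in_invariant_set[where m = m and z = z])
      fix z c assume "z \<in> ?K"
      then have z: "z \<in> carrier_vec m" "G *\<^sub>v z = 0\<^sub>v m" by auto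
      have Lz: "?L *\<^sub>v z \<in> carrier_vec m" using z by (intro mult_mat_vec_carrier[of _ m m]) auto
      have "?L\<^sup>T *\<^sub>v (G *\<^sub>v (?L *\<^sub>v z)) = (?L\<^sup>T * (G * ?L)) *\<^sub>v z"
        using Gc z Lz by (simp add: assoc_mult_mat_vec[of _ m m _ m])
      also have "\<dots> = 0\<^sub>v m" unfolding LGL z(2) ..
      finally have LGLz: "?L\<^sup>T *\<^sub>v (G *\<^sub>v (?L *\<^sub>v z)) = 0\<^sub>v m" .
      have "G *\<^sub>v (?L *\<^sub>v z) = 0\<^sub>v m"
        by (rule inv_pair_kernel[OF inv_pair_transpose[OF L'] mult_mat_vec_carrier[OF Gc Lz] LGLz])
      then have "G *\<^sub>v (?L *\<^sub>v z - c \<cdot>\<^sub>v z) = 0\<^sub>v m"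
        using Gc z Lz by (simp add: mult_mat_vec_minus[of _ m m] mult_mat_vec[of _ m m])
      then show "?L *\<^sub>v z - c \<cdot>\<^sub>v z \<in> ?K" using z Lz by simp
    qed (use z in simp_all)
    then obtain z c where z: "z \<in> carrier_vec m" "G *\<^sub>v z = 0\<^sub>v m" "z \<noteq> 0\<^sub>v m" "?L *\<^sub>v z = c \<cdot>\<^sub>v z"
      by blast
    have "(\<Sum>j<m. f (y i) (y j) * z $ j) = 0" if "i < m" for i
    proof -
      have "(\<Sum>j<m. f (y i) (y j) * z $ j) = (\<Sum>j<m. G $$ (i, j) * z $ j)"
        using that by (intro sum.cong) (auto simp: Gij)
      also have "\<dots> = (G *\<^sub>v z) $ i" using Gc z(1) that by (simp add: scalar_prod_def atLeast0LessThan)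
      finally show ?thesis using z(2) that by simp
    qed
    from nondeg[OF z(1,4) this] z(3) show False by blast
  qed
  then obtain G' where G': "inv_pair m G G'" by blast
  have "inv_pair m (V\<^sup>T * A * V) G'" using G' unfolding G_def .
  from split_off_invariant_subspace[OF A_carrier S_carrier AS V jordan_chains_carrier(1) SV this]
  obtain B where mn: "m \<le> n" and B: "B \<in> carrier_mat (n - m) (n - m)" "congr n A (dsum G B)"
    unfolding G_def[symmetric] by (elim conjE bexE)
  have "Determinant.det A \<noteq> 0" by (rule inv_pair_det[OF inv])
  then have "Determinant.det (dsum G B) \<noteq> 0" by (rule congr_det_nonzero[OF B(2)])
  then have dB: "Determinant.det B \<noteq> 0" using det_dsum[OF Gc B(1)] by simp
  have G0: "G\<^sup>T - 0 \<cdot>\<^sub>m G = G\<^sup>T" using Gc by (intro eq_matI) auto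
  have "asym_nf 0 G js"
    unfolding asym_nf_def G0 using Gc inv_pair_transpose[OF G'] GtL js jordan_chains_carrier(1) by blast
  then show ?thesis using mn Gc B dB by blast
qed

text \<open>Pairing with the eigenvector \<open>?u\<close> turns \<open>N l\<close> into the scalar
  \<open>1 / l - l\<close>. After \<open>k\<close> steps the chain is zero while the pairing of
  \<open>?u\<close> with \<open>v\<close> is not, so \<open>l\<close> is its own inverse. Moving
  \<open>k - 1\<close> operators across the form then compares the pairing of \<open>?u\<close> and
  \<open>v\<close> with its swapped version and fixes the sign of \<open>l\<close>.\<close>

lemma split_off_single_chain:
  assumes l: "l \<noteq> 0" and k: "k > 0" and v: "v \<in> carrier_vec n" and vk: "chain l k v = 0\<^sub>v n"
    and nz: "f (chain l (k - 1) v) v \<noteq> 0"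
  shows "l = (-1) ^ (k - 1) \<and> k \<le> n \<and> (\<exists>G\<in>carrier_mat k k. \<exists>B\<in>carrier_mat (n - k) (n - k).
    asym_nf 0 G [(k, l)] \<and> congr n A (dsum G B) \<and> Determinant.det B \<noteq> 0)"
proof
  let ?u = "chain l (k - 1) v"
  have u: "?u \<in> carrier_vec n" using v by simp
  have Su: "S *\<^sub>v ?u = l \<cdot>\<^sub>v ?u" by (rule eigen_of_chain[OF v vk k])
  have fuS: "f ?u (S *\<^sub>v y) = (1 / l) * f ?u y" if "y \<in> carrier_vec n" for y
    by (rule f_eigen_S[OF u that Su l])
  have "f ?u (N l y) = (1 / l - l) * f ?u y" if "y \<in> carrier_vec n" for y
    unfolding N_def using f_linear(1)[OF u _ that, of "S *\<^sub>v y" l] fuS[OF that] that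
    by (simp add: left_diff_distrib)
  then have "f ?u (chain l i v) = (1 / l - l) ^ i * f ?u v" for i
    by (induction i) (use v in \<open>auto simp: chain_Suc\<close>)
  from this[of k] have "(1 / l - l) ^ k * f ?u v = 0" using u by (simp add: vk)
  then have ll: "1 / l = l" using nz by simp
  have "f (chain (1 / l) (k - 1) v) (((*\<^sub>v) S ^^ (k - 1)) v) = (- (1 / l)) ^ (k - 1) * f v ?u"
    by (rule f_chain[OF v v l])
  then have "l ^ (k - 1) * f ?u v = (- l) ^ (k - 1) * f v ?u"
    using f_eigen_funpow[OF u v Su l, of "k - 1"] unfolding ll by simp
  also have vu: "f v ?u = l * f ?u v"
    using f_swap[OF v u, unfolded Su] f_smult(2)[OF u v, of l] by simp
  finally have "l ^ (k - 1) = (- 1) ^ (k - 1) * l ^ (k - 1) * l"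
    using nz by (simp add: power_minus[of l])
  then have "1 = (- 1) ^ (k - 1) * l" using l by simp
  then have "(- 1) ^ (k - 1) * 1 = (- 1) ^ (k - 1) * ((- 1) ^ (k - 1) * l)" by metis
  also have "\<dots> = l" by (simp add: mult.assoc[symmetric] flip: power_mult_distrib)
  finally show "l = (-1) ^ (k - 1)" by simp
  \<comment> \<open>The chain is listed backwards, from the eigenvector to \<open>v\<close>, so that
    the asymmetry becomes upper bidiagonal.\<close>
  define y where "y j = chain l (k - 1 - j) v" for j
  have L: "jordan_chains k (\<lambda>_. l) (\<lambda>_. 1) = jordan_matrix [(k, l)]"
    by (rule eq_matI) (auto simp: jordan_chains_def jordan_matrix_def jordan_block_def)
  show "k \<le> n \<and> (\<exists>G\<in>carrier_mat k k. \<exists>B\<in>carrier_mat (n - k) (n - k).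
    asym_nf 0 G [(k, l)] \<and> congr n A (dsum G B) \<and> Determinant.det B \<noteq> 0)"
  proof (rule split_off_chains[where y = y and e = "\<lambda>_. l" and s = "\<lambda>_. 1"])
    show "y j \<in> carrier_vec n" for j using v by (simp add: y_def)
    show "S *\<^sub>v y j = l \<cdot>\<^sub>v y j + (if j = 0 then 0\<^sub>v n else 1 \<cdot>\<^sub>v y (j - 1))" if "j < k" for j
    proof (cases j)
      case 0
      then show ?thesis using Su u by (simp add: y_def)
    next
      case (Suc i)
      then have "y (j - 1) = N l (y j)" using that by (simp add: y_def chain_Suc[symmetric] Suc_diff_Suc)
      moreover have "y j \<in> carrier_vec n" using v by (simp add: y_def)
      ultimately show ?thesis using Suc S_carrier by (intro eq_vecI) (auto simp: N_def)
    qed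
  next
    fix z c
    assume z: "z \<in> carrier_vec k" and ev: "jordan_chains k (\<lambda>_. l) (\<lambda>_. 1) *\<^sub>v z = c \<cdot>\<^sub>v z"
      and ker: "\<And>i. i < k \<Longrightarrow> (\<Sum>j<k. f (y i) (y j) * z $ j) = 0"
    have co: "l * z $ j + (if Suc j < k then z $ Suc j else 0) = c * z $ j" if "j < k" for j
      using jordan_chains_vec_index[OF z that, of "\<lambda>_. l" "\<lambda>_. 1"] that z unfolding ev by simp
    have zj: "z $ j = 0" if "1 \<le> j" "j < k" for j by (rule jordan_eigenvector_coords[OF co that])
    \<comment> \<open>An eigenvector has only coordinate 0, and pairing with \<open>v\<close>, the
      last basis vector, detects it.\<close>
    have "(\<Sum>j<k. f (y (k - 1)) (y j) * z $ j) = (\<Sum>j<k. if j = 0 then f (y (k - 1)) (y 0) * z $ 0 else 0)"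
      by (intro sum.cong) (auto simp: zj)
    then have "f v ?u * z $ 0 = 0" using ker[of "k - 1"] k by (simp add: y_def)
    then have "z $ 0 = 0" using nz vu l by simp
    then have "z $ j = 0" if "j < k" for j using zj[of j] that by (cases "j = 0") auto
    then show "z = 0\<^sub>v k" using z by (intro eq_vecI) auto
  next
    show "jordan_nf (jordan_chains k (\<lambda>_. l) (\<lambda>_. 1)) [(k, l)]"
      by (rule similar_jordan_nf_self[OF _ L]) (use k in auto)
  qed (use l in auto)
qed

text \<open>An eigenvector of the chain matrix has at most the coordinates 0 and \<open>k\<close>,
  belonging to the ends \<open>?u\<close> and \<open>?t\<close> of the two chains. Pairing with
  \<open>v\<close> and with \<open>w\<close> gives a linear system for them that is triangular by
  \<open>zv\<close>, with nonzero diagonal by \<open>tv\<close> and \<open>nz\<close>.\<close>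

lemma split_off_dual_chains:
  assumes l: "l \<noteq> 0" and k: "k > 0" and v: "v \<in> carrier_vec n" and w: "w \<in> carrier_vec n"
    and vk: "chain l k v = 0\<^sub>v n" and wk: "chain (1 / l) k w = 0\<^sub>v n"
    and nz: "f (chain l (k - 1) v) w \<noteq> 0"
    and zv: "f (chain l (k - 1) v) v = 0"
  shows "k + k \<le> n \<and> (\<exists>G\<in>carrier_mat (k + k) (k + k). \<exists>B\<in>carrier_mat (n - (k + k)) (n - (k + k)).
    asym_nf 0 G [(k, l), (k, 1 / l)] \<and> congr n A (dsum G B) \<and> Determinant.det B \<noteq> 0)"
proof -
  let ?u = "chain l (k - 1) v" and ?t = "chain (1 / l) (k - 1) w"
  have l': "1 / l \<noteq> 0" using l by simp
  have u: "?u \<in> carrier_vec n" and t: "?t \<in> carrier_vec n" using v w by auto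
  have Su: "S *\<^sub>v ?u = l \<cdot>\<^sub>v ?u" by (rule eigen_of_chain[OF v vk k])
  have St: "S *\<^sub>v ?t = (1 / l) \<cdot>\<^sub>v ?t" by (rule eigen_of_chain[OF w wk k])
  have fu: "f x ?u = l * f ?u x" if "x \<in> carrier_vec n" for x
    using f_swap[OF that u, unfolded Su] f_smult(2)[OF u that, of l] by simp
  have ft: "f x ?t = (1 / l) * f ?t x" if "x \<in> carrier_vec n" for x
    using f_swap[OF that t, unfolded St] f_smult(2)[OF t that, of "1 / l"] by simp
  have "f ?t (((*\<^sub>v) S ^^ (k - 1)) v) = (- (1 / l)) ^ (k - 1) * f w ?u"
    by (rule f_chain[OF w v l])
  then have "(1 / (1 / l)) ^ (k - 1) * f ?t v = (- (1 / l)) ^ (k - 1) * (l * f ?u w)"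
    using f_eigen_funpow[OF t v St l', of "k - 1"] fu[OF w] by simp
  \<comment> \<open>The nonzero pairing of \<open>?u\<close> with \<open>w\<close> is carried over
    to \<open>?t\<close> and \<open>v\<close> by moving \<open>k - 1\<close> operators from one
    chain to the other.\<close>
  then have tv: "f ?t v \<noteq> 0" using nz l by auto
  define y where "y j = (if j < k then chain l (k - 1 - j) v else chain (1 / l) (k - 1 - (j - k)) w)" for j
  define e where "e j = (if j < k then l else 1 / l)" for j
  define s :: "nat \<Rightarrow> complex" where "s j = (if j = k then 0 else 1)" for j
  have L: "jordan_chains (k + k) e s = jordan_matrix [(k, l), (k, 1 / l)]"
    unfolding jordan_matrix_def
    by (rule eq_matI) (auto simp: jordan_chains_def diag_block_Cons dsum_def jordan_block_def e_def s_def)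
  show ?thesis
  proof (rule split_off_chains[where y = y and e = e and s = s])
    show "y j \<in> carrier_vec n" for j using v w by (simp add: y_def)
    show "S *\<^sub>v y j = e j \<cdot>\<^sub>v y j + (if j = 0 then 0\<^sub>v n else s j \<cdot>\<^sub>v y (j - 1))" if "j < k + k" for j
    proof -
      have yc: "y j \<in> carrier_vec n" "y (j - 1) \<in> carrier_vec n" using v w by (auto simp: y_def)
      consider "j = 0" | "j = k" | "0 < j" "j < k" | "k < j" by linarith
      then show ?thesis
      proof cases
        case 1
        then show ?thesis using Su u k by (simp add: y_def e_def)
      next
        case 2
        then show ?thesis using St t k v by (intro eq_vecI) (auto simp: y_def e_def s_def)
      next
        case 3
        then have "k - 1 - (j - 1) = Suc (k - 1 - j)" "j - 1 < k" by auto
        then have "y (j - 1) = N l (y j)" using 3 by (simp add: y_def chain_Suc)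
        then show ?thesis using 3 S_carrier yc by (intro eq_vecI) (auto simp: N_def e_def s_def)
      next
        case 4
        then have "k - 1 - (j - 1 - k) = Suc (k - 1 - (j - k))" "\<not> j - 1 < k" using that by auto
        then have "y (j - 1) = N (1 / l) (y j)" using 4 that by (simp add: y_def chain_Suc)
        then show ?thesis using 4 S_carrier yc by (intro eq_vecI) (auto simp: N_def e_def s_def)
      qed
    qed
  next
    fix z c
    assume z: "z \<in> carrier_vec (k + k)" and ev: "jordan_chains (k + k) e s *\<^sub>v z = c \<cdot>\<^sub>v z"
      and ker: "\<And>i. i < k + k \<Longrightarrow> (\<Sum>j<k + k. f (y i) (y j) * z $ j) = 0"
    have co1: "l * z $ j + (if Suc j < k then z $ Suc j else 0) = c * z $ j" if "j < k" for j
      using jordan_chains_vec_index[OF z, of j e s] that z unfolding ev by (auto simp: e_def s_def)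
    have co2: "1 / l * z $ (k + j) + (if Suc j < k then z $ (k + Suc j) else 0) = c * z $ (k + j)" if "j < k" for j
      using jordan_chains_vec_index[OF z, of "k + j" e s] that z unfolding ev by (auto simp: e_def s_def)
    have z1: "z $ j = 0" if "1 \<le> j" "j < k" for j by (rule jordan_eigenvector_coords[OF co1 that])
    have z2: "z $ (k + j) = 0" if "1 \<le> j" "j < k" for j
      by (rule jordan_eigenvector_coords[where z = "\<lambda>j. z $ (k + j)", OF co2 that])
    have z3: "z $ j = 0" if "j \<noteq> 0" "j \<noteq> k" "j < k + k" for j
      using z1[of j] z2[of "j - k"] that by (cases "j < k") auto
    have sum: "(\<Sum>j<k + k. f (y i) (y j) * z $ j) = f (y i) ?u * z $ 0 + f (y i) ?t * z $ k" for i
    proof -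
      have "(\<Sum>j<k + k. f (y i) (y j) * z $ j) = (\<Sum>j<k + k. (if j = 0 then f (y i) (y 0) * z $ 0 else 0)
          + (if j = k then f (y i) (y k) * z $ k else 0))"
        using k by (intro sum.cong) (auto simp: z3)
      then show ?thesis using k by (simp add: sum.distrib y_def)
    qed
    have "f v ?u * z $ 0 + f v ?t * z $ k = 0"
      using ker[of "k - 1"] k unfolding sum by (simp add: y_def)
    then have zk: "z $ k = 0" using fu[OF v] ft[OF v] zv tv l by simp
    have "\<not> k + k - 1 < k" "k - 1 - (k + k - 1 - k) = 0" using k by auto
    then have "y (k + k - 1) = w" by (simp only: y_def if_False chain_0)
    then have "f w ?u * z $ 0 + f w ?t * z $ k = 0"
      using ker[of "k + k - 1"] k unfolding sum by simp
    then have z0: "z $ 0 = 0" using fu[OF w] zk nz l by simp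
    have "z $ j = 0" if "j < k + k" for j using z0 zk z3[of j] that by (cases "j = 0"; cases "j = k") auto
    then show "z = 0\<^sub>v (k + k)" using z by (intro eq_vecI) auto
  next
    show "jordan_nf (jordan_chains (k + k) e s) [(k, l), (k, 1 / l)]"
      by (rule similar_jordan_nf_self[OF _ L]) (use k in auto)
  qed (use l in \<open>auto simp: e_def\<close>)
qed

end

text \<open>The index 0 is included for A and C: \<open>matA 0\<close> is the zero matrix of size 1,
  a summand in the radical, and \<open>matC 0\<close> is the matrix (1).\<close>

definition canonical :: "complex Matrix.mat set" where
  "canonical = range matA \<union> {matB k c | k c. k > 0 \<and> c \<noteq> 1 \<and> c \<noteq> -1} \<union> range matC \<union>
    {matD k | k. k > 0 \<and> even k} \<union> {matE k | k. k > 0} \<union> {matF k | k. odd k}"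

lemma canonical_square:
  assumes "M \<in> canonical"
  shows "square_mat M"
proof -
  have sq: "square_mat N" if "N \<in> carrier_mat n n" for n and N :: "complex Matrix.mat" using that by auto
  show ?thesis
    using assms sq[OF matA_carrier] sq[OF matB_carrier] sq[OF matC_carrier] sq[OF matD_carrier]
      sq[OF matE_carrier] sq[OF matF_carrier]
    unfolding canonical_def by blast
qed

lemma single_block_canonical:
  assumes G: "G \<in> carrier_mat k k" and k: "k > 0" and nf: "asym_nf 0 G [(k, l)]" and l: "l = (-1) ^ (k - 1)"
  shows "\<exists>M\<in>canonical. congr k G M"
proof (cases "even k")
  case False
  then obtain j where j: "k = 2 * j + 1" by (elim oddE)
  have "asym_nf 0 (matC j) [(k, l)]" using asym_nf_matC[of 0 j] by (simp add: j l)
  then have "congr k G (matC j)" by (rule congr_of_asym_nf[OF nf _ G]) (use matC_carrier[of j] j in simp)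
  then show ?thesis by (auto simp: canonical_def)
next
  case True
  then obtain j where j: "k = 2 * j" by (elim evenE)
  have "odd (k - 1)" using j k by simp
  then have "l = -1" by (simp add: l)
  then have "asym_nf 0 (matE j) [(k, l)]" using asym_nf_matE[of j 0] k by (simp add: j)
  then have "congr k G (matE j)" by (rule congr_of_asym_nf[OF nf _ G]) (use matE_carrier[of j] j in simp)
  then show ?thesis using j k by (auto simp: canonical_def)
qed

text \<open>For \<open>l\<close> equal to 1 or -1 the parity of \<open>k\<close> decides. Where
  \<open>split_off_single_chain\<close> permits single blocks, two copies of C or of E have the
  required Jordan form; for the other parity D and F supply it.\<close>

lemma dual_blocks_canonical:
  assumes G: "G \<in> carrier_mat (k + k) (k + k)" and k: "k > 0" and nf: "asym_nf 0 G [(k, l), (k, 1 / l)]"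
    and l: "l \<noteq> 0"
  shows "\<exists>Ms. set Ms \<subseteq> canonical \<and> congr (k + k) G (diag_block_mat Ms)"
proof -
  have one: ?thesis if "asym_nf 0 M [(k, l), (k, 1 / l)]" "M \<in> carrier_mat (2 * k) (2 * k)" "M \<in> canonical" for M
  proof -
    have "congr (k + k) G M" by (rule congr_of_asym_nf[OF nf that(1) G]) (use that(2) in \<open>simp add: mult_2\<close>)
    then show ?thesis using that(3) by (intro exI[of _ "[M]"]) simp
  qed
  have two: ?thesis if "asym_nf 0 M [(k, l)]" "1 / l = l" "M \<in> carrier_mat k k" "M \<in> canonical" for M
  proof -
    have "asym_nf 0 (dsum M M) [(k, l), (k, 1 / l)]" using asym_nf_dsum[OF that(1,1)] that(2) by simp
    then have "congr (k + k) G (dsum M M)"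
      by (rule congr_of_asym_nf[OF nf _ G]) (use that(3) in \<open>intro dsum_carrier\<close>)
    then show ?thesis using that(4) by (intro exI[of _ "[M, M]"]) (simp add: diag_block_Cons)
  qed
  consider "l \<noteq> 1" "l \<noteq> -1" | "l = 1" "even k" | "l = 1" "odd k" | "l = -1" "even k" | "l = -1" "odd k" by blast
  then show ?thesis
  proof cases
    case 1
    show ?thesis
      by (rule one[OF _ matB_carrier[of k l]]) (use asym_nf_matB[of k l 0] 1 k l in \<open>auto simp: canonical_def\<close>)
  next
    case 2
    show ?thesis
      by (rule one[OF _ matD_carrier[of k]]) (use asym_nf_matD[of k 0] 2 k in \<open>auto simp: canonical_def\<close>)
  next
    case 3
    then obtain j where j: "k = 2 * j + 1" by (elim oddE)
    show ?thesis
      by (rule two[of "matC j"]) (use asym_nf_matC[of 0 j] matC_carrier[of j] 3 j in \<open>auto simp: canonical_def\<close>)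
  next
    case 4
    then obtain j where j: "k = 2 * j" by (elim evenE)
    show ?thesis
      by (rule two[of "matE j"]) (use asym_nf_matE[of j 0] matE_carrier[of j] 4 j k in \<open>auto simp: canonical_def\<close>)
  next
    case 5
    show ?thesis
      by (rule one[OF _ matF_carrier[of k]]) (use asym_nf_matF[of k 0] 5 k in \<open>auto simp: canonical_def\<close>)
  qed
qed

text \<open>A chain that pairs with itself is split off alone, any other one together with a dual
  chain. The complement is again nondegenerate, so the induction continues.\<close>

theorem nondegenerate_canonical:
  assumes "A \<in> carrier_mat n n" "Determinant.det A \<noteq> 0"
  shows "\<exists>Ms. set Ms \<subseteq> canonical \<and> congr n A (diag_block_mat Ms)"
  using assms
proof (induction n arbitrary: A rule: less_induct)
  case (less n)
  show ?case
  proof (cases "n = 0")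
    case True
    then have "A = diag_block_mat []" using less.prems by (intro eq_matI) auto
    then show ?thesis using less.prems True congr_refl by (intro exI[of _ "[]"]) auto
  next
    case False
    obtain A' where A': "inv_pair n A A'" using inv_pair_of_det less.prems by blast
    interpret nondegenerate_form n A A' by unfold_locales (rule A')
    obtain l k v w where c: "l \<noteq> 0" "k > 0" "v \<in> carrier_vec n" "w \<in> carrier_vec n"
      "chain l k v = 0\<^sub>v n" "chain (1 / l) k w = 0\<^sub>v n" "f (chain l (k - 1) v) w \<noteq> 0"
      using exists_dual_chains False by blast
    have "\<exists>m G B. 0 < m \<and> m \<le> n \<and> B \<in> carrier_mat (n - m) (n - m) \<and> congr n A (dsum G B) \<and>
       Determinant.det B \<noteq> 0 \<and> G \<in> carrier_mat m m \<and> (\<exists>Ms. set Ms \<subseteq> canonical \<and> congr m G (diag_block_mat Ms))"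
    proof -
      consider "f (chain l (k - 1) v) v \<noteq> 0" | "f (chain l (k - 1) v) v = 0" by blast
      then show ?thesis
      proof cases
        case 1
        obtain G B where G: "l = (-1) ^ (k - 1)" "k \<le> n" "G \<in> carrier_mat k k" "B \<in> carrier_mat (n - k) (n - k)"
          "asym_nf 0 G [(k, l)]" "congr n A (dsum G B)" "Determinant.det B \<noteq> 0"
          using split_off_single_chain[OF c(1,2,3,5) 1] by blast
        obtain M where "M \<in> canonical" "congr k G M" using single_block_canonical[OF G(3) c(2) G(5,1)] by blast
        then have "set [M] \<subseteq> canonical \<and> congr k G (diag_block_mat [M])" by simp
        then show ?thesis using G c(2) by blast
      next
        case 2
        obtain G B where G: "k + k \<le> n" "G \<in> carrier_mat (k + k) (k + k)" "B \<in> carrier_mat (n - (k + k)) (n - (k + k))"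
          "asym_nf 0 G [(k, l), (k, 1 / l)]" "congr n A (dsum G B)" "Determinant.det B \<noteq> 0"
          using split_off_dual_chains[OF c 2] by blast
        have "0 < k + k" using c(2) by simp
        then show ?thesis using G dual_blocks_canonical[OF G(2) c(2) G(4) c(1)] by blast
      qed
    qed
    then obtain m G B Ms where m: "0 < m" "m \<le> n" and B: "B \<in> carrier_mat (n - m) (n - m)" "congr n A (dsum G B)"
       "Determinant.det B \<noteq> 0" "G \<in> carrier_mat m m" and Ms: "set Ms \<subseteq> canonical" "congr m G (diag_block_mat Ms)"
      by blast
    obtain Ms' where Ms': "set Ms' \<subseteq> canonical" "congr (n - m) B (diag_block_mat Ms')"
      using less.IH[of "n - m" B] m B by auto
    have "congr n (dsum G B) (diag_block_mat (Ms @ Ms'))"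
      using congr_dsum[OF Ms(2) Ms'(2)] m(2) by (simp add: diag_block_append)
    then show ?thesis using congr_trans[OF B(2)] Ms(1) Ms'(1) by (intro exI[of _ "Ms @ Ms'"]) auto
  qed
qed

section \<open>Singular forms\<close>

text \<open>The block matrix \<open>[[M, B, 0], [0, 0, 1], [0, 0, 0]]\<close> with block sizes \<open>p\<close>, \<open>m\<close>, \<open>m\<close>.\<close>

definition ext_form :: "nat \<Rightarrow> nat \<Rightarrow> complex Matrix.mat \<Rightarrow> complex Matrix.mat \<Rightarrow> complex Matrix.mat" where
  "ext_form p m M B = Matrix.mat (p + m + m) (p + m + m) (\<lambda>(i, j).
     if i < p then if j < p then M $$ (i, j) else if j < p + m then B $$ (i, j - p) else 0
     else if i < p + m \<and> j = i + m then 1 else 0)"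

definition bottom_unit :: "nat \<Rightarrow> nat \<Rightarrow> complex Matrix.mat" where
  "bottom_unit p m = Matrix.mat (p + m) m (\<lambda>(i, j). if i = p + j then 1 else 0)"

lemma bottom_unit_carrier [simp]: "bottom_unit p m \<in> carrier_mat (p + m) m"
  "dim_row (bottom_unit p m) = p + m" "dim_col (bottom_unit p m) = m"
  by (auto simp: bottom_unit_def)

lemma ext_form_carrier [simp]: "ext_form p m M B \<in> carrier_mat (p + m + m) (p + m + m)"
  "dim_row (ext_form p m M B) = p + m + m" "dim_col (ext_form p m M B) = p + m + m"
  by (auto simp: ext_form_def)

lemma ext_form_four_block:
  assumes "M \<in> carrier_mat p p" "B \<in> carrier_mat p m"
  shows "ext_form p m M B = four_block_mat (four_block_mat M B (0\<^sub>m m p) (0\<^sub>m m m)) (bottom_unit p m)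
    (0\<^sub>m m (p + m)) (0\<^sub>m m m)"
  by (rule eq_matI) (use assms in \<open>auto simp: ext_form_def bottom_unit_def\<close>)

lemma bottom_unit_four_block:
  "bottom_unit p m = four_block_mat (0\<^sub>m p m) (0\<^sub>m p 0) (1\<^sub>m m) (0\<^sub>m m 0)"
  by (rule eq_matI) (auto simp: bottom_unit_def)

text \<open>The last \<open>m\<close> basis vectors are in the left kernel. Adding multiples of them
  to the other basis vectors, by means of \<open>Y\<close>, changes the upper left block by
  combinations of the columns of \<open>N\<close> only.\<close>

lemma congr_two_block:
  assumes M: "M \<in> carrier_mat r r" and N: "N \<in> carrier_mat r m"
    and X: "inv_pair r X X'" and Q: "inv_pair m Q Q'" and Y: "Y \<in> carrier_mat m r"
  shows "congr (r + m) (four_block_mat M N (0\<^sub>m m r) (0\<^sub>m m m))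
    (four_block_mat (X\<^sup>T * M * X + X\<^sup>T * N * Y) (X\<^sup>T * N * Q) (0\<^sub>m m r) (0\<^sub>m m m))"
proof -
  note Xc = inv_pairD[OF X] note Qc = inv_pairD[OF Q]
  have [simp]: "dim_row M = r" "dim_col M = r" "dim_row N = r" "dim_col N = m" "dim_row Y = m" "dim_col Y = r"
    using M N Y by auto
  note [simp] = inv_pair_dims[OF X] inv_pair_dims[OF Q]
  let ?W = "Y * X'"
  have W: "?W \<in> carrier_mat m r" using Y Xc by simp
  let ?P = "four_block_mat X (0\<^sub>m r m) Y Q"
  have "four_block_mat (1\<^sub>m r) (0\<^sub>m r m) ?W (1\<^sub>m m) * four_block_mat X (0\<^sub>m r m) (0\<^sub>m m r) Q = four_block_mat X (0\<^sub>m r m) (?W * X) Q"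
    by (subst mult_four_block_mat[of _ r r _ m _ m _ _ r _ m]) (use W Xc Qc in auto)
  also have "?W * X = Y" using Xc Y by (simp add: mat_assoc)
  finally have "four_block_mat (1\<^sub>m r) (0\<^sub>m r m) ?W (1\<^sub>m m) * dsum X Q = ?P" by (simp add: dsum_def)
  then obtain P' where P: "inv_pair (r + m) ?P P'"
    using inv_pair_mult[OF inv_pair_lower[OF W] inv_pair_dsum[OF X Q]] by metis
  have PT: "?P\<^sup>T = four_block_mat (X\<^sup>T) (Y\<^sup>T) (0\<^sub>m m r) (Q\<^sup>T)"
    using Xc Qc Y by (subst transpose_four_block_mat[of _ r r _ m _ m]) auto
  let ?A = "four_block_mat M N (0\<^sub>m m r) (0\<^sub>m m m)"
  have 1: "?P\<^sup>T * ?A = four_block_mat (X\<^sup>T * M) (X\<^sup>T * N) (0\<^sub>m m r) (0\<^sub>m m m)"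
    unfolding PT by (subst mult_four_block_mat[of _ r r _ m _ m _ _ r _ m]) (use Xc Qc M N Y in auto)
  have 2: "four_block_mat (X\<^sup>T * M) (X\<^sup>T * N) (0\<^sub>m m r) (0\<^sub>m m m) * ?P =
    four_block_mat (X\<^sup>T * M * X + X\<^sup>T * N * Y) (X\<^sup>T * N * Q) (0\<^sub>m m r) (0\<^sub>m m m)"
    by (subst mult_four_block_mat[of _ r r _ m _ m _ _ r _ m]) (use Xc Qc M N Y in auto)
  show ?thesis
    by (rule congrI[OF _ P]) (use M in \<open>simp_all add: 1 2\<close>)
qed

text \<open>The columns \<open>B\<close> count only modulo the column space of \<open>M\<close>, up
  to base changes: this is the term \<open>M * W\<close>. What \<open>W\<close> spoils in the middle
  rows is cancelled against the unit block.\<close>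

lemma ext_form_congr:
  assumes M: "M \<in> carrier_mat p p" and B: "B \<in> carrier_mat p m"
    and P: "inv_pair p P P'" and Q: "inv_pair m Q Q'" and W: "W \<in> carrier_mat p m"
  shows "congr (p + m + m) (ext_form p m M B) (ext_form p m (P\<^sup>T * M * P) (P\<^sup>T * (M * W + B * Q)))"
proof -
  note Pc = inv_pairD[OF P] note Qc = inv_pairD[OF Q]
  have d [simp]: "dim_row M = p" "dim_col M = p" "dim_row B = p" "dim_col B = m" "dim_row W = p" "dim_col W = m"
    using M B W by auto
  note [simp] = inv_pair_dims[OF P] inv_pair_dims[OF Q]
  let ?X = "four_block_mat P W (0\<^sub>m m p) Q" and ?M1 = "four_block_mat M B (0\<^sub>m m p) (0\<^sub>m m m)"
  have W': "P' * W \<in> carrier_mat p m" using Pc W by simp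
  have "four_block_mat P (0\<^sub>m p m) (0\<^sub>m m p) Q * four_block_mat (1\<^sub>m p) (P' * W) (0\<^sub>m m p) (1\<^sub>m m) = four_block_mat P (P * (P' * W)) (0\<^sub>m m p) Q"
    by (subst mult_four_block_mat[of _ p p _ m _ m _ _ p _ m]) (use W' Pc Qc in auto)
  then have "dsum P Q * four_block_mat (1\<^sub>m p) (P' * W) (0\<^sub>m m p) (1\<^sub>m m) = ?X"
    by (simp add: dsum_def inv_pair_cancel[OF P])
  then obtain X' where X: "inv_pair (p + m) ?X X'"
    using inv_pair_mult[OF inv_pair_dsum[OF P Q] inv_pair_upper[OF W']] by metis
  have XT: "?X\<^sup>T = four_block_mat (P\<^sup>T) (0\<^sub>m p m) (W\<^sup>T) (Q\<^sup>T)"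
    using Pc Qc W by (subst transpose_four_block_mat[of _ p p _ m _ m]) auto
  let ?b = "M * W + B * Q"
  have b: "?b \<in> carrier_mat p m" using M B W Qc by simp
  have 1: "?M1 * ?X = four_block_mat (M * P) ?b (0\<^sub>m m p) (0\<^sub>m m m)"
    by (subst mult_four_block_mat[of _ p p _ m _ m _ _ p _ m]) (use M B W Pc Qc in auto)
  have 2: "?X\<^sup>T * four_block_mat (M * P) ?b (0\<^sub>m m p) (0\<^sub>m m m) =
    four_block_mat (P\<^sup>T * (M * P)) (P\<^sup>T * ?b) (W\<^sup>T * (M * P)) (W\<^sup>T * ?b)"
    unfolding XT by (subst mult_four_block_mat[of _ p p _ m _ m _ _ p _ m]) (use M b W Pc Qc in auto)
  \<comment> \<open>The unwanted middle rows; \<open>Y\<close> is chosen so that the unit block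
    removes exactly these.\<close>
  define Z where "Z = four_block_mat (W\<^sup>T * (M * P)) (W\<^sup>T * ?b) (0\<^sub>m 0 p) (0\<^sub>m 0 m)"
  have Zc: "Z \<in> carrier_mat m (p + m)" by (rule carrier_matI) (simp_all add: Z_def)
  define Y where "Y = - (Q'\<^sup>T * Z)"
  have Yc: "Y \<in> carrier_mat m (p + m)" unfolding Y_def using Zc Qc by simp
  have XN: "?X\<^sup>T * bottom_unit p m = bottom_unit p m * Q\<^sup>T"
  proof -
    have "?X\<^sup>T * bottom_unit p m = four_block_mat (0\<^sub>m p m) (0\<^sub>m p 0) (Q\<^sup>T) (0\<^sub>m m 0)"
      unfolding XT bottom_unit_four_block
      by (subst mult_four_block_mat[of _ p p _ m _ m _ _ m _ 0]) (use W Pc Qc in auto)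
    moreover have "bottom_unit p m * four_block_mat (Q\<^sup>T) (0\<^sub>m m 0) (0\<^sub>m 0 m) (0\<^sub>m 0 0) = four_block_mat (0\<^sub>m p m) (0\<^sub>m p 0) (Q\<^sup>T) (0\<^sub>m m 0)"
      unfolding bottom_unit_four_block
      by (subst mult_four_block_mat[of _ p m _ 0 _ m _ _ m _ 0]) (use Qc in auto)
    moreover have "four_block_mat (Q\<^sup>T) (0\<^sub>m m 0) (0\<^sub>m 0 m) (0\<^sub>m 0 0) = Q\<^sup>T"
      using Qc by (intro eq_matI) auto
    ultimately show ?thesis by simp
  qed
  have NZ: "bottom_unit p m * Z = four_block_mat (0\<^sub>m p p) (0\<^sub>m p m) (W\<^sup>T * (M * P)) (W\<^sup>T * ?b)"
    unfolding bottom_unit_four_block Z_def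
    by (subst mult_four_block_mat[of _ p m _ 0 _ m _ _ p _ m]) (use M b W Pc in auto)
  have "?X\<^sup>T * bottom_unit p m * Y = - (bottom_unit p m * (Q\<^sup>T * (Q'\<^sup>T * Z)))"
    unfolding XN Y_def using Zc by (simp add: mat_assoc)
  also have "Q\<^sup>T * (Q'\<^sup>T * Z) = Z" using Zc by (intro inv_pair_cancel[OF inv_pair_transpose[OF Q]]) auto
  finally have 3: "?X\<^sup>T * bottom_unit p m * Y = - four_block_mat (0\<^sub>m p p) (0\<^sub>m p m) (W\<^sup>T * (M * P)) (W\<^sup>T * ?b)"
    unfolding NZ .
  have M1c: "?M1 \<in> carrier_mat (p + m) (p + m)" using M by auto
  have "?X\<^sup>T * ?M1 * ?X + ?X\<^sup>T * bottom_unit p m * Y =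
    four_block_mat (P\<^sup>T * (M * P)) (P\<^sup>T * ?b) (W\<^sup>T * (M * P)) (W\<^sup>T * ?b) +
    - four_block_mat (0\<^sub>m p p) (0\<^sub>m p m) (W\<^sup>T * (M * P)) (W\<^sup>T * ?b)"
    unfolding 3 using 1 2 M1c inv_pairD(1)[OF X] by (simp add: mat_assoc)
  also have "\<dots> = four_block_mat (P\<^sup>T * M * P) (P\<^sup>T * ?b) (0\<^sub>m m p) (0\<^sub>m m m)"
    by (rule eq_matI) (auto simp: mat_assoc simp del: index_mult_mat(1))
  finally have 4: "?X\<^sup>T * ?M1 * ?X + ?X\<^sup>T * bottom_unit p m * Y = four_block_mat (P\<^sup>T * M * P) (P\<^sup>T * ?b) (0\<^sub>m m p) (0\<^sub>m m m)" .
  have 5: "?X\<^sup>T * bottom_unit p m * Q'\<^sup>T = bottom_unit p m"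
    unfolding XN using inv_pairD[OF inv_pair_transpose[OF Q]] by (simp add: mat_assoc)
  have "congr (p + m + m) (four_block_mat ?M1 (bottom_unit p m) (0\<^sub>m m (p + m)) (0\<^sub>m m m))
    (four_block_mat (?X\<^sup>T * ?M1 * ?X + ?X\<^sup>T * bottom_unit p m * Y) (?X\<^sup>T * bottom_unit p m * Q'\<^sup>T) (0\<^sub>m m (p + m)) (0\<^sub>m m m))"
    by (rule congr_two_block[OF M1c _ X inv_pair_sym[OF inv_pair_transpose[OF Q]] Yc]) simp
  then show ?thesis
    unfolding 4 5 using M B b Pc by (simp add: ext_form_four_block)
qed

lemma six_ranges:
  fixes i :: nat
  assumes "i < p + q + (m + k) + (m + k)"
  obtains "i < p" | a where "i = p + a" "a < m"
    | a where "i = p + m + a" "a < m"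
    | a where "i = p + m + m + a" "a < q"
    | a where "i = p + m + m + q + a" "a < k"
    | a where "i = p + m + m + q + k + a" "a < k"
   
proof -
    consider "i < p" | "p \<le> i" "i < p + m" | "p + m \<le> i" "i < p + m + m" |
      "p + m + m \<le> i" "i < p + m + m + q" | "p + m + m + q \<le> i" "i < p + m + m + q + k" | "p + m + m + q + k \<le> i"
      by linarith
  then show thesis
  proof cases
    case 1
    then show thesis by (rule that(1))
  next
    case 2
    then show thesis using that(2)[of "i - (p)"] assms by simp
  next
    case 3
    then show thesis using that(3)[of "i - (p + m)"] assms by simp
  next
    case 4
    then show thesis using that(4)[of "i - (p + m + m)"] assms by simp
  next
    case 5
    then show thesis using that(5)[of "i - (p + m + m + q)"] assms by simp
  next
    case 6
    then show thesis using that(6)[of "i - (p + m + m + q + k)"] assms by simp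
  qed
qed

lemma ext_form_dsum:
  assumes M: "M \<in> carrier_mat p p" "B \<in> carrier_mat p m" and N: "N \<in> carrier_mat q q" "C \<in> carrier_mat q k"
  shows "congr (p + q + (m + k) + (m + k)) (ext_form (p + q) (m + k) (dsum M N) (dsum B C))
    (dsum (ext_form p m M B) (ext_form q k N C))"
proof -
  \<comment> \<open>\<open>\<pi>\<close> takes a position in the sum of two extensions, with ranges
    of lengths p, m, m, q, k, k, to the position in the extension of the sums, with order p, q, m,
    k, m, k. Its inverse is \<open>\<rho>\<close>.\<close>
  define \<pi> where "\<pi> i = (if i < p then i else if i < p + m then q + i else if i < p + m + m then q + k + i
    else if i < p + m + m + q then i - (m + m) else if i < p + m + m + q + k then i - m else i)" for i
  define \<rho> where "\<rho> i = (if i < p then i else if i < p + q then i + (m + m) else if i < p + q + m then i - q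
    else if i < p + q + m + k then i + m else if i < p + q + m + k + m then i - (q + k) else i)" for i
  let ?n = "p + q + (m + k) + (m + k)"
  have 1: "\<rho> (\<pi> i) = i \<and> \<pi> i < ?n" if "i < ?n" for i
  proof -
    consider "i < p" | "p \<le> i" "i < p + m" | "p + m \<le> i" "i < p + m + m" |
      "p + m + m \<le> i" "i < p + m + m + q" | "p + m + m + q \<le> i" "i < p + m + m + q + k" | "p + m + m + q + k \<le> i"
      by linarith
    then show ?thesis by cases (use that in \<open>auto simp: \<pi>_def \<rho>_def\<close>)
  qed
  have 2: "\<pi> (\<rho> i) = i \<and> \<rho> i < ?n" if "i < ?n" for i
  proof -
    consider "i < p" | "p \<le> i" "i < p + q" | "p + q \<le> i" "i < p + q + m" |
      "p + q + m \<le> i" "i < p + q + m + k" | "p + q + m + k \<le> i" "i < p + q + m + k + m" | "p + q + m + k + m \<le> i"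
      by linarith
    then show ?thesis by cases (use that in \<open>auto simp: \<pi>_def \<rho>_def\<close>)
  qed
  have "bij_betw \<pi> {..<?n} {..<?n}"
    by (rule bij_betw_byWitness[where f' = \<rho>]) (use 1 2 in blast)+
  from congr_reindex[OF ext_form_carrier(1) this, of "dsum M N" "dsum B C"]
  have "congr ?n (ext_form (p + q) (m + k) (dsum M N) (dsum B C))
    (Matrix.mat ?n ?n (\<lambda>(i, j). ext_form (p + q) (m + k) (dsum M N) (dsum B C) $$ (\<pi> i, \<pi> j)))" .
  also have "Matrix.mat ?n ?n (\<lambda>(i, j). ext_form (p + q) (m + k) (dsum M N) (dsum B C) $$ (\<pi> i, \<pi> j)) =
    dsum (ext_form p m M B) (ext_form q k N C)" (is "?L = ?R")
  proof (rule eq_matI)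
    fix i j assume "i < dim_row ?R" "j < dim_col ?R"
    then have ij: "i < ?n" "j < ?n" by auto
    have d: "dim_row M = p" "dim_col M = p" "dim_row B = p" "dim_col B = m" "dim_row N = q" "dim_col N = q"
      "dim_row C = q" "dim_col C = k" using M N by auto
    have R: "?R $$ (i, j) = (if i < p + m + m then if j < p + m + m then ext_form p m M B $$ (i, j) else 0
      else if j < p + m + m then 0 else ext_form q k N C $$ (i - (p + m + m), j - (p + m + m)))"
      using ij by (simp add: dsum_def)
    have pi: "\<pi> i < ?n" "\<pi> j < ?n" using ij by (auto simp: \<pi>_def)
    have L: "ext_form (p + q) (m + k) (dsum M N) (dsum B C) $$ (\<pi> i, \<pi> j) = (if \<pi> i < p + q then if \<pi> j < p + q then dsum M N $$ (\<pi> i, \<pi> j)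
       else if \<pi> j < p + q + (m + k) then dsum B C $$ (\<pi> i, \<pi> j - (p + q)) else 0
       else if \<pi> i < p + q + (m + k) \<and> \<pi> j = \<pi> i + (m + k) then 1 else 0)"
      using pi by (simp add: ext_form_def)
    have DM: "dsum M N $$ (a, b) = (if a < p then if b < p then M $$ (a, b) else 0 else if b < p then 0 else N $$ (a - p, b - p))"
      if "a < p + q" "b < p + q" for a b using that d by (simp add: dsum_def)
    have DB: "dsum B C $$ (a, b) = (if a < p then if b < m then B $$ (a, b) else 0 else if b < m then 0 else C $$ (a - p, b - m))"
      if "a < p + q" "b < m + k" for a b using that d by (simp add: dsum_def)
    have E1: "ext_form p m M B $$ (a, b) = (if a < p then if b < p then M $$ (a, b) else if b < p + m then B $$ (a, b - p) else 0
     else if a < p + m \<and> b = a + m then 1 else 0)" if "a < p + m + m" "b < p + m + m" for a b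
      using that by (simp add: ext_form_def)
    have E2: "ext_form q k N C $$ (a, b) = (if a < q then if b < q then N $$ (a, b) else if b < q + k then C $$ (a, b - q) else 0
     else if a < q + k \<and> b = a + k then 1 else 0)" if "a < q + k + k" "b < q + k + k" for a b
      using that by (simp add: ext_form_def)
    have "ext_form (p + q) (m + k) (dsum M N) (dsum B C) $$ (\<pi> i, \<pi> j) = ?R $$ (i, j)"
    proof (cases rule: six_ranges[OF ij(2)])
      case 1
      then show ?thesis unfolding L R by - (rule six_ranges[OF ij(1)]; simp add: \<pi>_def DM DB E1 E2)
    next
      case (2 b)
      then show ?thesis unfolding L R by - (rule six_ranges[OF ij(1)]; simp add: \<pi>_def DM DB E1 E2)
    next
      case (3 b)
      then show ?thesis unfolding L R by - (rule six_ranges[OF ij(1)]; simp add: \<pi>_def DM DB E1 E2)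
    next
      case (4 b)
      then show ?thesis unfolding L R by - (rule six_ranges[OF ij(1)]; simp add: \<pi>_def DM DB E1 E2)
    next
      case (5 b)
      then show ?thesis unfolding L R by - (rule six_ranges[OF ij(1)]; simp add: \<pi>_def DM DB E1 E2)
    next
      case (6 b)
      then show ?thesis unfolding L R by - (rule six_ranges[OF ij(1)]; simp add: \<pi>_def DM DB E1 E2)
    qed
    then show "?L $$ (i, j) = ?R $$ (i, j)" using ij by simp
  qed (auto simp: dsum_def)
  finally show ?thesis .
qed


lemma four_block_inject:
  assumes "four_block_mat A B C D = four_block_mat A' B' C' D'"
    and "A \<in> carrier_mat n m" "B \<in> carrier_mat n q" "C \<in> carrier_mat p m" "D \<in> carrier_mat p q"
    and "A' \<in> carrier_mat n m" "B' \<in> carrier_mat n q" "C' \<in> carrier_mat p m" "D' \<in> carrier_mat p q"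
  shows "A = A'" "B = B'" "C = C'" "D = D'"
proof -
  have e: "four_block_mat A B C D $$ (i, j) = four_block_mat A' B' C' D' $$ (i, j)" for i j using assms(1) by simp
  show "A = A'"
  proof (rule eq_matI)
    fix i j assume "i < dim_row A'" "j < dim_col A'"
    then show "A $$ (i, j) = A' $$ (i, j)" using e[of i j] assms(2-) by simp
  qed (use assms in auto)
  show "B = B'"
  proof (rule eq_matI)
    fix i j assume "i < dim_row B'" "j < dim_col B'"
    then show "B $$ (i, j) = B' $$ (i, j)" using e[of i "m + j"] assms(2-) by simp
  qed (use assms in auto)
  show "C = C'"
  proof (rule eq_matI)
    fix i j assume "i < dim_row C'" "j < dim_col C'"
    then show "C $$ (i, j) = C' $$ (i, j)" using e[of "n + i" j] assms(2-) by simp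
  qed (use assms in auto)
  show "D = D'"
  proof (rule eq_matI)
    fix i j assume "i < dim_row D'" "j < dim_col D'"
    then show "D $$ (i, j) = D' $$ (i, j)" using e[of "n + i" "m + j"] assms(2-) by simp
  qed (use assms in auto)
qed

lemma move_to_bottom:
  assumes N: "N \<in> carrier_mat r m"
    and inj: "\<And>c. c \<in> carrier_vec m \<Longrightarrow> N *\<^sub>v c = 0\<^sub>v r \<Longrightarrow> c = 0\<^sub>v m"
  shows "m \<le> r \<and> (\<exists>X X'. inv_pair r X X' \<and> X * N = bottom_unit (r - m) m)"
proof -
  obtain U U' where mr: "m \<le> r" and U: "inv_pair r U U'" "U * rank_nf r m m = N"
    using extend_to_basis[OF N inj] by blast
  define p where "p = r - m"
  have r: "r = p + m" using mr by (simp add: p_def)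
  \<comment> \<open>The cyclic shift of the rows that takes a unit block from the top to the
    bottom.\<close>
  define W where "W = Matrix.mat r r (\<lambda>(i, j). if j = (if i < p then i + m else i - p) then 1 else 0 :: complex)"
  have Wc: "W \<in> carrier_mat r r" by (simp add: W_def)
  have WX: "(W * X) $$ (i, j) = X $$ (if i < p then i + m else i - p, j)"
    if "X \<in> carrier_mat r t" "i < r" "j < t" for X i j t
  proof -
    let ?a = "if i < p then i + m else i - p"
    have "(W * X) $$ (i, j) = (\<Sum>l<r. W $$ (i, l) * X $$ (l, j))"
      using that by (simp add: W_def scalar_prod_def atLeast0LessThan)
    also have "\<dots> = (\<Sum>l<r. if l = ?a then X $$ (?a, j) else 0)"
      using that by (intro sum.cong) (auto simp: W_def)
    also have "\<dots> = X $$ (?a, j)" using that r by auto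
    finally show ?thesis .
  qed
  have "W * W\<^sup>T = 1\<^sub>m r"
    by (rule eq_matI) (simp_all add: WX[OF transpose_carrier_mat[THEN iffD2, OF Wc]] Wc del: index_mult_mat(1), auto simp: W_def r)
  then have W: "inv_pair r W (W\<^sup>T)" using Wc by (intro inv_pairI1) auto
  have "W * rank_nf r m m = bottom_unit p m"
  proof (rule eq_matI)
    fix i j assume "i < dim_row (bottom_unit p m)" "j < dim_col (bottom_unit p m)"
    then have ij: "i < r" "j < m" by (auto simp: r)
    show "(W * rank_nf r m m) $$ (i, j) = bottom_unit p m $$ (i, j)"
      unfolding WX[OF rank_nf_dims(3) ij] using ij r by (auto simp: rank_nf_def bottom_unit_def)
  qed (use Wc r in auto)
  moreover have "W * U' * N = W * rank_nf r m m"
    using U(2)[symmetric] Wc by (simp add: mat_assoc inv_pair_dims[OF U(1)] inv_pair_cancel[OF U(1)])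
  ultimately show ?thesis
    using mr inv_pair_mult[OF W inv_pair_sym[OF U(1)]] unfolding p_def by metis
qed

text \<open>Row operations of a rank normal form, used as a congruence, make the last
  \<open>m\<close> rows zero and leave a rectangle \<open>(M N)\<close> of full row rank. A vector
  annihilated by \<open>N\<close> would be in the common radical, so \<open>N\<close> is injective
  and can be moved to a unit block at the bottom, which clears the rows of \<open>M\<close> next to
  it. The right inverse of \<open>(M N)\<close> survives as the equation
  \<open>M * C + B * D = 1\<close>, the condition under which \<open>B\<close> can be normalised
  later; \<open>m > 0\<close> makes the induction descend.\<close>

lemma ext_form_of_singular:
  assumes A: "A \<in> carrier_mat n n" and sing: "Determinant.det A = 0"
    and norad: "\<And>x. x \<in> carrier_vec n \<Longrightarrow> A *\<^sub>v x = 0\<^sub>v n \<Longrightarrow> A\<^sup>T *\<^sub>v x = 0\<^sub>v n \<Longrightarrow> x = 0\<^sub>v n"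
  shows "\<exists>p m. \<exists>M\<in>carrier_mat p p. \<exists>B\<in>carrier_mat p m. \<exists>C\<in>carrier_mat p p. \<exists>D\<in>carrier_mat m p.
    n = p + m + m \<and> m > 0 \<and> M * C + B * D = 1\<^sub>m p \<and> congr n A (ext_form p m M B)"
proof -
  obtain r P P' Q Q' where rn: "r \<le> n" and P: "inv_pair n P P'" and Q: "inv_pair n Q Q'"
    and PAQ: "P * A * Q = rank_nf n n r"
    using rank_normal_form[OF A] by (auto simp: equivalent_def)
  have [simp]: "dim_row A = n" "dim_col A = n" using A by auto
  note [simp] = inv_pair_dims[OF P] inv_pair_dims[OF Q]
  have "r \<noteq> n"
  proof
    assume "r = n"
    then have "rank_nf n n r = 1\<^sub>m n" by (intro eq_matI) (auto simp: rank_nf_def)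
    then have "Determinant.det (P * A * Q) = 1" using PAQ by simp
    moreover have "Determinant.det (P * A * Q) = Determinant.det (P * A) * Determinant.det Q"
      using A inv_pairD[OF P] inv_pairD[OF Q] by (intro det_mult[of _ n]) auto
    moreover have "Determinant.det (P * A) = Determinant.det P * Determinant.det A"
      using A inv_pairD[OF P] by (intro det_mult[of _ n]) auto
    ultimately show False using sing by simp
  qed
  then obtain m where n: "n = r + m" and m: "m > 0" using rn by (metis le_Suc_ex le_neq_implies_less less_add_eq_less add.right_neutral neq0_conv)
  \<comment> \<open>With this matrix \<open>P A P^T\<close> equals the normal form times
    \<open>Y\<close>, so it keeps the zero rows of the normal form and its other rows are the first
    \<open>r\<close> rows of an invertible matrix.\<close>
  define Y where "Y = Q' * P\<^sup>T"
  obtain Y' where Y: "inv_pair n Y Y'"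
    unfolding Y_def using inv_pair_mult[OF inv_pair_sym[OF Q] inv_pair_transpose[OF P]] by blast
  define A2 where "A2 = P * A * P\<^sup>T"
  have AA2: "congr n A A2" by (rule congrI[OF A inv_pair_transpose[OF P]]) (simp add: A2_def)
  have "A2 = (P * A * Q) * Y"
    unfolding A2_def Y_def by (simp add: mat_assoc inv_pair_cancel[OF Q])
  then have A2Y: "A2 = rank_nf n n r * Y" unfolding PAQ .
  obtain M N y3 y4 where sp: "split_block Y r r = (M, N, y3, y4)" by (metis prod_cases4)
  have dY: "dim_row Y = r + m" "dim_col Y = r + m" using inv_pairD[OF Y] n by auto
  note sY = split_block[OF sp dY]
  obtain c1 c2 c3 c4 where sp': "split_block Y' r r = (c1, c2, c3, c4)" by (metis prod_cases4)
  have dY': "dim_row Y' = r + m" "dim_col Y' = r + m" using inv_pairD[OF Y] n by auto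
  note sY' = split_block[OF sp' dY']
  have nf: "rank_nf n n r = four_block_mat (1\<^sub>m r) (0\<^sub>m r m) (0\<^sub>m m r) (0\<^sub>m m m)"
    by (rule eq_matI) (auto simp: rank_nf_def n)
  have A2: "A2 = four_block_mat M N (0\<^sub>m m r) (0\<^sub>m m m)"
    unfolding A2Y nf sY(5) by (subst mult_four_block_mat[of _ r r _ m _ m _ _ r _ m]) (use sY in auto)
  have A2T: "A2\<^sup>T = four_block_mat (M\<^sup>T) (0\<^sub>m r m) (N\<^sup>T) (0\<^sub>m m m)"
    unfolding A2 by (subst transpose_four_block_mat[of _ r r _ m _ m]) (use sY in auto)
  have "Y * Y' = four_block_mat (M * c1 + N * c3) (M * c2 + N * c4) (y3 * c1 + y4 * c3) (y3 * c2 + y4 * c4)"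
    unfolding sY(5) sY'(5) by (subst mult_four_block_mat[of _ r r _ m _ m _ _ r _ m]) (use sY sY' in auto)
  moreover have "Y * Y' = four_block_mat (1\<^sub>m r) (0\<^sub>m r m) (0\<^sub>m m r) (1\<^sub>m m)" using inv_pairD(3)[OF Y] n by simp
  ultimately have "four_block_mat (M * c1 + N * c3) (M * c2 + N * c4) (y3 * c1 + y4 * c3) (y3 * c2 + y4 * c4) =
    four_block_mat (1\<^sub>m r) (0\<^sub>m r m) (0\<^sub>m m r) (1\<^sub>m m)" by simp
  \<comment> \<open>\<open>M\<close> and \<open>N\<close> form the first \<open>r\<close> rows of
    the invertible \<open>Y\<close>, so the first \<open>r\<close> columns of \<open>Y'\<close> are
    a right inverse.\<close>
  from four_block_inject(1)[OF this, of r r m m] have MN1: "M * c1 + N * c3 = 1\<^sub>m r" using sY sY' by simp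
  have Ninj: "c = 0\<^sub>v m" if c: "c \<in> carrier_vec m" "N *\<^sub>v c = 0\<^sub>v r" for c
  proof -
    let ?x = "0\<^sub>v r @\<^sub>v c"
    have x: "?x \<in> carrier_vec n" using c n by simp
    have z: "X *\<^sub>v 0\<^sub>v r = 0\<^sub>v q" if "X \<in> carrier_mat q r" for X :: "complex Matrix.mat" and q using that by simp
    have z2: "0\<^sub>m q m *\<^sub>v c = 0\<^sub>v q" for q using c(1) by (intro eq_vecI) auto
    have zz: "0\<^sub>v r @\<^sub>v 0\<^sub>v m = (0\<^sub>v n :: complex Matrix.vec)" by (intro eq_vecI) (auto simp: n)
    have 1: "A2 *\<^sub>v ?x = 0\<^sub>v n"
      unfolding A2 using c sY by (subst four_block_mat_mult_vec[of _ r r _ m _ m]) (auto simp: z z2 zz)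
    have 2: "A2\<^sup>T *\<^sub>v ?x = 0\<^sub>v n"
      unfolding A2T using c sY by (subst four_block_mat_mult_vec[of _ r r _ m _ m]) (auto simp: z z2 zz)
    let ?y = "P\<^sup>T *\<^sub>v ?x"
    have y: "?y \<in> carrier_vec n" using x inv_pairD[OF P] by (intro mult_mat_vec_carrier[of _ n n]) auto
    have "A2 *\<^sub>v ?x = P *\<^sub>v (A *\<^sub>v ?y)"
      unfolding A2_def using A x y inv_pairD[OF P] by (simp add: assoc_mult_mat_vec[of _ n n _ n])
    then have "A *\<^sub>v ?y = 0\<^sub>v n"
      using 1 inv_pair_kernel[OF P mult_mat_vec_carrier[OF A y]] by simp
    moreover have "A2\<^sup>T = P * A\<^sup>T * P\<^sup>T" unfolding A2_def by (simp add: mat_transpose_mult mat_assoc)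
    then have "A2\<^sup>T *\<^sub>v ?x = P *\<^sub>v (A\<^sup>T *\<^sub>v ?y)"
      using A x y inv_pairD[OF P] by (simp add: assoc_mult_mat_vec[of _ n n _ n])
    then have "A\<^sup>T *\<^sub>v ?y = 0\<^sub>v n"
      using 2 inv_pair_kernel[OF P mult_mat_vec_carrier[OF transpose_carrier_mat[THEN iffD2, OF A] y]] by simp
    ultimately have "?y = 0\<^sub>v n" using norad y by blast
    then have x0: "?x = 0\<^sub>v n" using inv_pair_kernel[OF inv_pair_transpose[OF P] x] by simp
    show ?thesis
    proof (rule eq_vecI)
      fix i assume "i < dim_vec (0\<^sub>v m :: complex Matrix.vec)"
      then have i: "i < m" by simp
      have "?x $ (r + i) = c $ i" using i c(1) by simp
      then show "c $ i = 0\<^sub>v m $ i" unfolding x0 using i n by simp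
    qed (use c in auto)
  qed
  obtain Z Z' where mr: "m \<le> r" and Z: "inv_pair r Z Z'" "Z * N = bottom_unit (r - m) m"
    using move_to_bottom[OF sY(2) Ninj] by blast
  define p where "p = r - m"
  have r: "r = p + m" using mr by (simp add: p_def)
  define X where "X = Z\<^sup>T"
  have X: "inv_pair r X (Z'\<^sup>T)" and XN: "X\<^sup>T * N = bottom_unit p m"
    using inv_pair_transpose[OF Z(1)] Z(2) by (simp_all add: X_def p_def)
  note [simp] = inv_pair_dims[OF Z(1)] inv_pair_dims[OF X]
  have [simp]: "dim_row M = r" "dim_col M = r" "dim_row N = r" "dim_col N = m" "dim_row c1 = r" "dim_col c1 = r"
    "dim_row c3 = m" "dim_col c3 = r" using sY sY' by auto
  define M' where "M' = X\<^sup>T * M * X"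
  have dM: "dim_row M' = p + m" "dim_col M' = p + m" by (simp_all add: M'_def r[symmetric])
  obtain m1 m2 m3 m4 where spM: "split_block M' p p = (m1, m2, m3, m4)" by (metis prod_cases4)
  note sM = split_block[OF spM dM]
  \<comment> \<open>Chosen to cancel the lower blocks \<open>m3\<close> and \<open>m4\<close> by
    means of the unit block.\<close>
  define Y2 where "Y2 = four_block_mat (- m3) (- m4) (0\<^sub>m 0 p) (0\<^sub>m 0 m)"
  have Y2: "Y2 \<in> carrier_mat m r" using sM by (intro carrier_matI) (simp_all add: Y2_def r)
  have "bottom_unit p m * Y2 = four_block_mat (0\<^sub>m p p) (0\<^sub>m p m) (- m3) (- m4)"
    unfolding bottom_unit_four_block Y2_def
    by (subst mult_four_block_mat[of _ p m _ 0 _ m _ _ p _ m]) (use sM in auto)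
  then have "M' + X\<^sup>T * N * Y2 = four_block_mat m1 m2 m3 m4 + four_block_mat (0\<^sub>m p p) (0\<^sub>m p m) (- m3) (- m4)"
    unfolding XN sM(5)[symmetric] by simp
  also have "\<dots> = four_block_mat m1 m2 (0\<^sub>m m p) (0\<^sub>m m m)"
    using sM(1-4) by (intro eq_matI) auto
  finally have top: "X\<^sup>T * M * X + X\<^sup>T * N * Y2 = four_block_mat m1 m2 (0\<^sub>m m p) (0\<^sub>m m m)" unfolding M'_def .
  have "congr (r + m) A2 (four_block_mat (X\<^sup>T * M * X + X\<^sup>T * N * Y2) (X\<^sup>T * N * 1\<^sub>m m) (0\<^sub>m m r) (0\<^sub>m m m))"
    unfolding A2 by (rule congr_two_block[OF sY(1,2) X inv_pair_one Y2])
  also have "four_block_mat (X\<^sup>T * M * X + X\<^sup>T * N * Y2) (X\<^sup>T * N * 1\<^sub>m m) (0\<^sub>m m r) (0\<^sub>m m m) = ext_form p m m1 m2"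
    unfolding top unfolding XN using sM by (simp add: ext_form_four_block r)
  finally have c: "congr n A (ext_form p m m1 m2)" using congr_trans[OF AA2] n by simp
  define d1 where "d1 = Z'\<^sup>T * c1 * Z'"
  define d3 where "d3 = c3 * Z'"
  have "Z * (M * c1 + N * c3) * Z' = Z * 1\<^sub>m r * Z'" unfolding MN1 ..
  moreover have "Z * (M * c1 + N * c3) * Z' = M' * d1 + bottom_unit p m * d3"
    unfolding M'_def d1_def d3_def XN[symmetric] X_def
    by (simp add: mat_assoc mat_add_distrib_left mat_add_distrib_right inv_pair_cancel[OF inv_pair_transpose[OF Z(1)]])
  ultimately have Md: "M' * d1 + bottom_unit p m * d3 = 1\<^sub>m r"
    using inv_pairD[OF Z(1)] by simp
  have dd: "dim_row d1 = p + m" "dim_col d1 = p + m" "d3 \<in> carrier_mat m (p + m)" by (auto simp: d1_def d3_def r[symmetric])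
  obtain e1 e2 e3 e4 where spd: "split_block d1 p p = (e1, e2, e3, e4)" by (metis prod_cases4)
  note sd = split_block[OF spd dd(1,2)]
  have Md1: "M' * d1 = four_block_mat (m1 * e1 + m2 * e3) (m1 * e2 + m2 * e4) (m3 * e1 + m4 * e3) (m3 * e2 + m4 * e4)"
    unfolding sM(5) sd(5) by (subst mult_four_block_mat[of _ p p _ m _ m _ _ p _ m]) (use sM sd in auto)
  \<comment> \<open>The first \<open>p\<close> rows of \<open>bottom_unit\<close> are zero, so the
    transported right inverse restricts to the blocks \<open>m1\<close> and
    \<open>m2\<close>.\<close>
  have "m1 * e1 + m2 * e3 = 1\<^sub>m p"
  proof (rule eq_matI)
    fix i j assume "i < dim_row (1\<^sub>m p :: complex Matrix.mat)" "j < dim_col (1\<^sub>m p :: complex Matrix.mat)"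
    then have ij: "i < p" "j < p" by auto
    have "(bottom_unit p m * d3) $$ (i, j) = 0"
      using ij dd(3) by (auto simp: scalar_prod_def bottom_unit_def intro!: sum.neutral)
    moreover have "(M' * d1 + bottom_unit p m * d3) $$ (i, j) = (M' * d1) $$ (i, j) + (bottom_unit p m * d3) $$ (i, j)"
      using ij dd(3) by (intro index_add_mat(1)) auto
    moreover have "(M' * d1) $$ (i, j) = (m1 * e1 + m2 * e3) $$ (i, j)"
      unfolding Md1 using ij sM sd by (subst index_mat_four_block) auto
    ultimately show "(m1 * e1 + m2 * e3) $$ (i, j) = 1\<^sub>m p $$ (i, j)" using ij Md r by simp
  qed (use sM sd in auto)
  moreover have "n = p + m + m" using n r by simp
  ultimately show ?thesis using m c sM(1,2) sd(1,3) by blast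
qed

section \<open>Nilpotent Jordan blocks as matrices of bilinear forms\<close>

definition nil_block :: "nat \<Rightarrow> complex Matrix.mat" where "nil_block k = jordan_block k 0"

text \<open>The last unit vector, which spans a complement of the column space of
  \<open>nil_block k\<close>. For \<open>k = 0\<close> it is a column of height 0, which serves as
  padding in \<open>singular_part\<close>.\<close>

definition end_col :: "nat \<Rightarrow> complex Matrix.mat" where
  "end_col k = Matrix.mat k 1 (\<lambda>(i, j). if Suc i = k then 1 else 0)"

definition nil_blocks :: "nat list \<Rightarrow> complex Matrix.mat" where
  "nil_blocks ks = diag_block_mat (map nil_block ks)"

definition end_cols :: "nat list \<Rightarrow> complex Matrix.mat" where
  "end_cols ks = diag_block_mat (map end_col ks)"

lemma nil_block_carrier [simp]: "nil_block k \<in> carrier_mat k k"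
  "dim_row (nil_block k) = k" "dim_col (nil_block k) = k"
  by (auto simp: nil_block_def)

lemma end_col_carrier [simp]: "end_col k \<in> carrier_mat k 1"
  "dim_row (end_col k) = k" "dim_col (end_col k) = 1"
  by (auto simp: end_col_def)

lemma nil_blocks_Cons: "nil_blocks (k # ks) = dsum (nil_block k) (nil_blocks ks)"
  and end_cols_Cons: "end_cols (k # ks) = dsum (end_col k) (end_cols ks)"
  by (simp_all add: nil_blocks_def end_cols_def diag_block_Cons)

lemma nil_blocks_Nil: "nil_blocks [] = 0\<^sub>m 0 0" and end_cols_Nil: "end_cols [] = 0\<^sub>m 0 0"
  by (simp_all add: nil_blocks_def end_cols_def)

lemma nil_blocks_dims [simp]: "dim_row (nil_blocks ks) = sum_list ks" "dim_col (nil_blocks ks) = sum_list ks"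
  by (induction ks) (simp_all add: nil_blocks_Cons nil_blocks_Nil)

lemma end_cols_dims [simp]: "dim_row (end_cols ks) = sum_list ks" "dim_col (end_cols ks) = length ks"
  by (induction ks) (simp_all add: end_cols_Cons end_cols_Nil)

lemma nil_blocks_carrier [simp]: "nil_blocks ks \<in> carrier_mat (sum_list ks) (sum_list ks)"
  by (rule carrier_matI) simp_all

lemma end_cols_carrier [simp]: "end_cols ks \<in> carrier_mat (sum_list ks) (length ks)"
  by (rule carrier_matI) simp_all

text \<open>The transpose inverts \<open>nil_block k\<close> up to the projection onto the last
  coordinate, and that coordinate vanishes on the column space. So the end column measures exactly
  what the block does not reach.\<close>

lemma nil_block_identities:
  "nil_block k * (nil_block k)\<^sup>T + end_col k * (end_col k)\<^sup>T = 1\<^sub>m k"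
  "(end_col k)\<^sup>T * nil_block k = 0\<^sub>m 1 k"
  "k > 0 \<Longrightarrow> (end_col k)\<^sup>T * end_col k = 1\<^sub>m 1"
proof -
  have J: "(nil_block k * (nil_block k)\<^sup>T) $$ (i, j) = (if i = j \<and> Suc i < k then 1 else 0)" if "i < k" "j < k" for i j
  proof -
    have "(nil_block k * (nil_block k)\<^sup>T) $$ (i, j) = (\<Sum>l<k. nil_block k $$ (i, l) * nil_block k $$ (j, l))"
      using that by (simp add: scalar_prod_def atLeast0LessThan)
    also have "\<dots> = (\<Sum>l<k. if l = Suc i then (if i = j then 1 else 0) else 0)"
      using that by (intro sum.cong) (auto simp: nil_block_def jordan_block_def)
    finally have "(nil_block k * (nil_block k)\<^sup>T) $$ (i, j) = (\<Sum>l<k. if l = Suc i then (if i = j then 1 else 0) else 0)" .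
    then show ?thesis by simp
  qed
  have E: "(end_col k * (end_col k)\<^sup>T) $$ (i, j) = (if i = j \<and> Suc i = k then 1 else 0)" if "i < k" "j < k" for i j
    using that by (auto simp: scalar_prod_def end_col_def)
  show "nil_block k * (nil_block k)\<^sup>T + end_col k * (end_col k)\<^sup>T = 1\<^sub>m k"
    by (rule eq_matI) (auto simp: J E simp del: index_mult_mat(1))
  show "(end_col k)\<^sup>T * nil_block k = 0\<^sub>m 1 k"
    by (rule eq_matI) (auto simp: scalar_prod_def end_col_def nil_block_def jordan_block_def intro!: sum.neutral)
  show "(end_col k)\<^sup>T * end_col k = 1\<^sub>m 1" if k: "k > 0"
  proof (rule eq_matI)
    fix i j assume "i < dim_row (1\<^sub>m 1 :: complex Matrix.mat)" "j < dim_col (1\<^sub>m 1 :: complex Matrix.mat)"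
    then have ij: "i = 0" "j = 0" by auto
    have "((end_col k)\<^sup>T * end_col k) $$ (0, 0) = (\<Sum>l<k. end_col k $$ (l, 0) * end_col k $$ (l, 0))"
      by (simp add: scalar_prod_def atLeast0LessThan)
    also have "\<dots> = (\<Sum>l<k. if l = k - 1 then 1 else 0)"
      using k by (intro sum.cong) (auto simp: end_col_def)
    finally have "((end_col k)\<^sup>T * end_col k) $$ (0, 0) = (\<Sum>l<k. if l = k - 1 then 1 else 0)" .
    then show "((end_col k)\<^sup>T * end_col k) $$ (i, j) = 1\<^sub>m 1 $$ (i, j)" using k ij by simp
  qed auto
qed

lemma nil_blocks_identities:
  "nil_blocks ks * (nil_blocks ks)\<^sup>T + end_cols ks * (end_cols ks)\<^sup>T = 1\<^sub>m (sum_list ks)"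
  "(end_cols ks)\<^sup>T * nil_blocks ks = 0\<^sub>m (length ks) (sum_list ks)"
  "0 \<notin> set ks \<Longrightarrow> (end_cols ks)\<^sup>T * end_cols ks = 1\<^sub>m (length ks)"
proof (induction ks)
  case Nil
  {
    case 1 show ?case by (rule eq_matI) (simp_all add: nil_blocks_Nil)
  next
    case 2 show ?case by (rule eq_matI) (simp_all add: nil_blocks_Nil end_cols_Nil)
  next
    case 3 show ?case by (rule eq_matI) (simp_all add: end_cols_Nil)
  }
next
  case (Cons k ks)
  let ?s = "sum_list ks"
  {
    case 1
    have "nil_blocks (k # ks) * (nil_blocks (k # ks))\<^sup>T + end_cols (k # ks) * (end_cols (k # ks))\<^sup>T =
      dsum (nil_block k * (nil_block k)\<^sup>T) (nil_blocks ks * (nil_blocks ks)\<^sup>T) +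
      dsum (end_col k * (end_col k)\<^sup>T) (end_cols ks * (end_cols ks)\<^sup>T)"
      by (simp add: nil_blocks_Cons end_cols_Cons dsum_transpose dsum_mult)
    also have "\<dots> = dsum (nil_block k * (nil_block k)\<^sup>T + end_col k * (end_col k)\<^sup>T)
        (nil_blocks ks * (nil_blocks ks)\<^sup>T + end_cols ks * (end_cols ks)\<^sup>T)"
      by (rule dsum_add[of _ k k _ _ ?s ?s]) (auto intro!: carrier_matI)
    also have "\<dots> = dsum (1\<^sub>m k) (1\<^sub>m ?s)"
      unfolding Cons.IH(1) nil_block_identities(1) ..
    finally show ?case by (simp add: dsum_one)
  next
    case 2
    have "dsum (0\<^sub>m 1 k) (0\<^sub>m (length ks) ?s) = (0\<^sub>m (length (k # ks)) (sum_list (k # ks)) :: complex Matrix.mat)"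
      by (rule eq_matI) (auto simp: dsum_def)
    then show ?case
      by (simp add: nil_blocks_Cons end_cols_Cons dsum_transpose dsum_mult nil_block_identities Cons.IH)
  next
    case 3
    then show ?case using Cons.IH(3)
      by (simp add: end_cols_Cons dsum_transpose dsum_mult nil_block_identities dsum_one)
  }
qed

text \<open>The end column attaches one new vector to the last one of the chain, and the unit block
  attaches a second vector to the new one. For \<open>k = 0\<close> this starts a block of size
  2.\<close>

lemma ext_form_nil_block: "ext_form k 1 (nil_block k) (end_col k) = nil_block (k + 2)"
  by (rule eq_matI) (auto simp: ext_form_def nil_block_def jordan_block_def end_col_def)

lemma ext_form_nil_blocks:
  "congr (sum_list ks + length ks + length ks)
    (ext_form (sum_list ks) (length ks) (nil_blocks ks) (end_cols ks)) (nil_blocks (map (\<lambda>k. k + 2) ks))"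
proof (induction ks)
  case Nil
  have "ext_form 0 0 (nil_blocks []) (end_cols []) = nil_blocks []"
    by (rule eq_matI) (auto simp: ext_form_def nil_blocks_Nil)
  then show ?case by (simp add: congr_refl nil_blocks_Nil)
next
  case (Cons k ks)
  let ?s = "sum_list ks" and ?l = "length ks"
  have "congr (k + ?s + (1 + ?l) + (1 + ?l)) (ext_form (k + ?s) (1 + ?l) (nil_blocks (k # ks)) (end_cols (k # ks)))
    (dsum (ext_form k 1 (nil_block k) (end_col k)) (ext_form ?s ?l (nil_blocks ks) (end_cols ks)))"
    unfolding nil_blocks_Cons end_cols_Cons
    by (rule ext_form_dsum[OF nil_block_carrier(1) end_col_carrier(1) nil_blocks_carrier end_cols_carrier])
  note 1 = this
  have 2: "congr ((k + 2) + (?s + ?l + ?l))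
    (dsum (ext_form k 1 (nil_block k) (end_col k)) (ext_form ?s ?l (nil_blocks ks) (end_cols ks)))
    (dsum (nil_block (k + 2)) (nil_blocks (map (\<lambda>k. k + 2) ks)))"
    unfolding ext_form_nil_block by (intro congr_dsum congr_refl Cons.IH) simp
  have e: "(k + 2) + (?s + ?l + ?l) = k + ?s + (1 + ?l) + (1 + ?l)" by simp
  have "congr (k + ?s + (1 + ?l) + (1 + ?l)) (ext_form (k + ?s) (1 + ?l) (nil_blocks (k # ks)) (end_cols (k # ks)))
    (dsum (nil_block (k + 2)) (nil_blocks (map (\<lambda>k. k + 2) ks)))"
    by (rule congr_trans[OF 1 2[unfolded e]])
  then show ?case by (simp add: nil_blocks_Cons)
qed

lemma split_off_common_radical:
  assumes A: "A \<in> carrier_mat n n" and x: "x \<in> carrier_vec n" "x \<noteq> 0\<^sub>v n"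
    and Ax: "A *\<^sub>v x = 0\<^sub>v n" "A\<^sup>T *\<^sub>v x = 0\<^sub>v n"
  shows "n > 0 \<and> (\<exists>B\<in>carrier_mat (n - 1) (n - 1). congr n A (dsum (0\<^sub>m 1 1) B))"
proof -
  define V where "V = Matrix.mat n 1 (\<lambda>(i, j). x $ i)"
  have V: "V \<in> carrier_mat n 1" by (simp add: V_def)
  have "c = 0\<^sub>v 1" if c: "c \<in> carrier_vec 1" "V *\<^sub>v c = 0\<^sub>v n" for c
  proof -
    obtain i where i: "i < n" "x $ i \<noteq> 0" using x by (metis carrier_vecD eq_vecI index_zero_vec(1,2))
    have "(V *\<^sub>v c) $ i = x $ i * c $ 0" using i c(1) by (simp add: V_def scalar_prod_def)
    then have "c $ 0 = 0" using c(2) i by simp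
    then show ?thesis using c(1) by (intro eq_vecI) auto
  qed
  from extend_to_basis[OF V this] obtain U U' where n: "1 \<le> n" and U: "inv_pair n U U'" "U * rank_nf n 1 1 = V" by blast
  note Uc = inv_pairD[OF U(1)]
  have Ue: "U *\<^sub>v unit_vec n 0 = x"
  proof (rule eq_vecI)
    fix i assume "i < dim_vec x"
    then have i: "i < n" using x by simp
    have "V $$ (i, 0) = (\<Sum>l<n. U $$ (i, l) * (if l = 0 then 1 else 0))"
      unfolding U(2)[symmetric] using i n Uc(1) by (simp add: scalar_prod_def rank_nf_def atLeast0LessThan)
    also have "\<dots> = U $$ (i, 0)" using n by (simp add: if_distrib cong: if_cong)
    finally show "(U *\<^sub>v unit_vec n 0) $ i = x $ i" using i n Uc(1) by (simp add: V_def)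
  qed (use Uc x in auto)
  define B where "B = U\<^sup>T * A * U"
  have Bc: "B \<in> carrier_mat n n" using A Uc by (simp add: B_def)
  have "B *\<^sub>v unit_vec n 0 = U\<^sup>T *\<^sub>v (A *\<^sub>v x)"
    unfolding B_def Ue[symmetric] using A Uc by (simp add: assoc_mult_mat_vec[of _ n n _ n])
  then have B0: "B *\<^sub>v unit_vec n 0 = 0\<^sub>v n" using Ax Uc by simp
  have "B\<^sup>T = U\<^sup>T * A\<^sup>T * U" unfolding B_def using A inv_pair_dims[OF U(1)] by (simp add: mat_transpose_mult mat_assoc)
  then have "B\<^sup>T *\<^sub>v unit_vec n 0 = U\<^sup>T *\<^sub>v (A\<^sup>T *\<^sub>v x)"
    unfolding Ue[symmetric] using A Uc by (simp add: assoc_mult_mat_vec[of _ n n _ n])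
  then have BT0: "B\<^sup>T *\<^sub>v unit_vec n 0 = 0\<^sub>v n" using Ax Uc by simp
  have col0: "B $$ (i, 0) = 0" if "i < n" for i
    using arg_cong[OF B0, of "\<lambda>v. v $ i"] that n Bc by simp
  have row0: "B $$ (0, j) = 0" if "j < n" for j
    using arg_cong[OF BT0, of "\<lambda>v. v $ j"] that n Bc by simp
  define B' where "B' = Matrix.mat (n - 1) (n - 1) (\<lambda>(i, j). B $$ (Suc i, Suc j))"
  have "B = dsum (0\<^sub>m 1 1) B'"
    by (rule eq_matI) (use Bc n in \<open>auto simp: dsum_def B'_def col0 row0\<close>)
  moreover have "congr n A B" by (rule congrI[OF A U(1) B_def])
  moreover have "B' \<in> carrier_mat (n - 1) (n - 1)" by (simp add: B'_def)
  moreover have "0 < n" using n by simp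
  ultimately show ?thesis by metis
qed

text \<open>A vector in the common radical is a block of size 1. Without such vectors the form
  extends a smaller one, \<open>D = nil_blocks ks\<close> plus an invertible \<open>R\<close> by
  induction, and \<open>B\<close> is reduced modulo the column space of \<open>D\<close>. Only its
  components at the ends of the nilpotent blocks survive, and these can be made a rectangular
  identity by column operations. So every old block grows by two, and each remaining zero column
  starts a block of size 2.\<close>

lemma singular_part:
  assumes "A \<in> carrier_mat n n"
  shows "\<exists>ks r. \<exists>R\<in>carrier_mat r r. Determinant.det R \<noteq> 0 \<and> 0 \<notin> set ks \<and> sum_list ks + r = n \<and>
    congr n A (dsum (nil_blocks ks) R)"
  using assms
proof (induction n arbitrary: A rule: less_induct)
  case (less n)
  note A = less.prems
  consider "Determinant.det A \<noteq> 0"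
    | x where "x \<in> carrier_vec n" "x \<noteq> 0\<^sub>v n" "A *\<^sub>v x = 0\<^sub>v n" "A\<^sup>T *\<^sub>v x = 0\<^sub>v n"
    | "Determinant.det A = 0" "\<And>x. x \<in> carrier_vec n \<Longrightarrow> A *\<^sub>v x = 0\<^sub>v n \<Longrightarrow> A\<^sup>T *\<^sub>v x = 0\<^sub>v n \<Longrightarrow> x = 0\<^sub>v n"
    by blast
  then show ?case
  proof cases
    case 1
    then show ?thesis
      by (intro exI[of _ "[]"] exI[of _ n] bexI[of _ A]) (auto simp: nil_blocks_Nil A intro: congr_refl)
  next
    case (2 x)
    from split_off_common_radical[OF A 2] obtain B where n: "n > 0" and B: "B \<in> carrier_mat (n - 1) (n - 1)"
      "congr n A (dsum (0\<^sub>m 1 1) B)" by blast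
    obtain ks r R where R: "R \<in> carrier_mat r r" "Determinant.det R \<noteq> 0" "0 \<notin> set ks" "sum_list ks + r = n - 1"
      "congr (n - 1) B (dsum (nil_blocks ks) R)" using less.IH[OF _ B(1)] n by auto
    have "nil_block 1 = 0\<^sub>m 1 1" by (rule eq_matI) (auto simp: nil_block_def jordan_block_def)
    then have e: "dsum (0\<^sub>m 1 1) (dsum (nil_blocks ks) R) = dsum (nil_blocks (1 # ks)) R"
      by (simp add: nil_blocks_Cons dsum_assoc)
    have "congr (1 + (n - 1)) (dsum (0\<^sub>m 1 1) B) (dsum (nil_blocks (1 # ks)) R)"
      unfolding e[symmetric] by (intro congr_dsum congr_refl R(5)) simp
    then have "congr n A (dsum (nil_blocks (1 # ks)) R)" using congr_trans[OF B(2)] n by simp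
    then show ?thesis
      using R n by (intro exI[of _ "1 # ks"] exI[of _ r] bexI[of _ R]) auto
  next
    case 3
    obtain p m M B C1 C2 where M: "M \<in> carrier_mat p p" and B: "B \<in> carrier_mat p m"
      and C: "C1 \<in> carrier_mat p p" "C2 \<in> carrier_mat m p"
      and n: "n = p + m + m" "m > 0" and MB: "M * C1 + B * C2 = 1\<^sub>m p" and AF: "congr n A (ext_form p m M B)"
      using ext_form_of_singular[OF A 3] by blast
    obtain ks r R where R: "R \<in> carrier_mat r r" "Determinant.det R \<noteq> 0" and ks: "0 \<notin> set ks" "sum_list ks + r = p"
      "congr p M (dsum (nil_blocks ks) R)" using less.IH[OF _ M] n by auto
    define D where "D = dsum (nil_blocks ks) R"
    obtain P P' where P: "inv_pair p P P'" "D = P\<^sup>T * M * P" using ks(3) by (auto simp: congr_def D_def)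
    obtain R' where R': "inv_pair r R R'" using inv_pair_of_det R by blast
    note [simp] = inv_pair_dims[OF P(1)] inv_pair_dims[OF R']
    have Dc: "D \<in> carrier_mat p p" unfolding D_def using R(1) ks(2) by (auto intro!: carrier_matI)
    have [simp]: "dim_row M = p" "dim_col M = p" "dim_row B = p" "dim_col B = m" "dim_row D = p" "dim_col D = p"
      "dim_row C1 = p" "dim_col C1 = p" "dim_row C2 = m" "dim_col C2 = p" "dim_row R = r" "dim_col R = r"
      using M B Dc C R by auto
    define B2 where "B2 = P\<^sup>T * B"
    have B2: "B2 \<in> carrier_mat p m" by (rule carrier_matI) (simp_all add: B2_def)
    have [simp]: "dim_row B2 = p" "dim_col B2 = m" using B2 by auto
    have "congr n (ext_form p m M B) (ext_form p m (P\<^sup>T * M * P) (P\<^sup>T * (M * 0\<^sub>m p m + B * 1\<^sub>m m)))"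
      unfolding n(1) by (rule ext_form_congr[OF M B P(1) inv_pair_one]) simp
    then have c1: "congr n A (ext_form p m D B2)" using congr_trans[OF AF] M B by (simp add: P(2) B2_def)
    define G1 where "G1 = P' * C1 * P'\<^sup>T"
    define G2 where "G2 = C2 * P'\<^sup>T"
    have [simp]: "dim_row G1 = p" "dim_col G1 = p" "dim_row G2 = m" "dim_col G2 = p" by (simp_all add: G1_def G2_def)
    have "P\<^sup>T * (M * C1 + B * C2) * P'\<^sup>T = D * G1 + B2 * G2"
      unfolding P(2) G1_def G2_def B2_def
      by (simp add: mat_assoc mat_add_distrib_left mat_add_distrib_right inv_pair_cancel[OF P(1)])
    then have DB: "D * G1 + B2 * G2 = 1\<^sub>m p"
      unfolding MB using inv_pairD[OF inv_pair_transpose[OF P(1)]] by simp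
    let ?q = "length ks" and ?s = "sum_list ks"
    define E where "E = dsum (end_cols ks) (0\<^sub>m r 0)"
    have E: "E \<in> carrier_mat p ?q" by (rule carrier_matI) (simp_all add: E_def ks(2))
    have [simp]: "dim_row E = p" "dim_col E = ?q" using E by auto
    \<comment> \<open>A generalised inverse of \<open>D\<close>: the equation
      \<open>D * Dp + E * E^T = 1\<close> splits every column into a part in the column space of
      \<open>D\<close> and a part spanned by the end columns.\<close>
    define Dp where "Dp = dsum ((nil_blocks ks)\<^sup>T) R'"
    have [simp]: "dim_row Dp = p" "dim_col Dp = p" by (simp_all add: Dp_def ks(2))
    have DE: "D * Dp + E * E\<^sup>T = 1\<^sub>m p"
    proof -
      have "D * Dp + E * E\<^sup>T = dsum (nil_blocks ks * (nil_blocks ks)\<^sup>T) (R * R') +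
        dsum (end_cols ks * (end_cols ks)\<^sup>T) (0\<^sub>m r 0 * 0\<^sub>m 0 r)"
        by (simp add: D_def Dp_def E_def dsum_transpose dsum_mult)
      also have "\<dots> = dsum (nil_blocks ks * (nil_blocks ks)\<^sup>T + end_cols ks * (end_cols ks)\<^sup>T) (R * R' + 0\<^sub>m r 0 * 0\<^sub>m 0 r)"
        by (rule dsum_add[of _ ?s ?s _ _ r r]) (auto intro!: carrier_matI)
      also have "R * R' + 0\<^sub>m r 0 * 0\<^sub>m 0 r = 1\<^sub>m r"
        using inv_pairD[OF R'] by (intro eq_matI) (simp_all add: scalar_prod_def)
      finally show ?thesis by (simp add: nil_blocks_identities dsum_one ks(2))
    qed
    have ED: "E\<^sup>T * D = 0\<^sub>m ?q p"
    proof -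
      have "E\<^sup>T * D = dsum (0\<^sub>m ?q ?s) (0\<^sub>m 0 r * R)"
        by (simp add: D_def E_def dsum_transpose dsum_mult nil_blocks_identities)
      also have "\<dots> = 0\<^sub>m ?q p" by (rule eq_matI) (auto simp: dsum_def ks(2))
      finally show ?thesis .
    qed
    have EE: "E\<^sup>T * E = 1\<^sub>m ?q"
    proof -
      have "E\<^sup>T * E = dsum (1\<^sub>m ?q) (0\<^sub>m 0 r * 0\<^sub>m r 0)"
        using ks(1) by (simp add: E_def dsum_transpose dsum_mult nil_blocks_identities)
      also have "\<dots> = 1\<^sub>m ?q" by (rule eq_matI) (auto simp: dsum_def)
      finally show ?thesis .
    qed
    have "E\<^sup>T * (D * G1 + B2 * G2) * E = E\<^sup>T * E" unfolding DB by simp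
    then have "E\<^sup>T * D * G1 * E + E\<^sup>T * B2 * (G2 * E) = 1\<^sub>m ?q"
      unfolding EE by (simp add: mat_assoc mat_add_distrib_left mat_add_distrib_right)
    \<comment> \<open>The end coordinates \<open>E^T\<close> annihilate \<open>D\<close>, so only
      the second term of the right-inverse equation remains.\<close>
    then have bC: "(E\<^sup>T * B2) * (G2 * E) = 1\<^sub>m ?q"
      unfolding ED by (simp add: mat_assoc)
    obtain Q Q' where qm: "?q \<le> m" and Q: "inv_pair m Q Q'" "E\<^sup>T * B2 * Q = rank_nf ?q m ?q"
      using split_epi_normal_form[OF carrier_matI carrier_matI bC, of m] by auto
    note [simp] = inv_pair_dims[OF Q(1)]
    \<comment> \<open>Removes from \<open>B2 * Q\<close> its part in the column space of
      \<open>D\<close>; what is left is \<open>E\<close> times the end coordinates of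
      \<open>B2 * Q\<close>, which are in normal form.\<close>
    define W where "W = - (Dp * (B2 * Q))"
    have W: "W \<in> carrier_mat p m" by (rule carrier_matI) (simp_all add: W_def)
    have "(D * Dp + E * E\<^sup>T) * (B2 * Q) = B2 * Q" unfolding DE by simp
    then have "D * (Dp * (B2 * Q)) + E * rank_nf ?q m ?q = B2 * Q"
      unfolding Q(2)[symmetric] by (simp add: mat_assoc mat_add_distrib_right)
    moreover have "D * W = - (D * (Dp * (B2 * Q)))" unfolding W_def by simp
    moreover have "- X + (X + Y) = Y" if "X \<in> carrier_mat p m" "Y \<in> carrier_mat p m" for X Y :: "complex Matrix.mat"
      using that by (intro eq_matI) auto
    from this[of "D * (Dp * (B2 * Q))" "E * rank_nf ?q m ?q"]
    have "- (D * (Dp * (B2 * Q))) + (D * (Dp * (B2 * Q)) + E * rank_nf ?q m ?q) = E * rank_nf ?q m ?q"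
      by (auto intro!: carrier_matI)
    ultimately have DW: "D * W + B2 * Q = E * rank_nf ?q m ?q" by simp
    have "congr n (ext_form p m D B2) (ext_form p m ((1\<^sub>m p)\<^sup>T * D * 1\<^sub>m p) ((1\<^sub>m p)\<^sup>T * (D * W + B2 * Q)))"
      unfolding n(1) by (rule ext_form_congr[OF Dc B2 inv_pair_one Q(1) W])
    then have c2: "congr n A (ext_form p m D (E * rank_nf ?q m ?q))"
      using congr_trans[OF c1] Dc by (simp add: DW)
    \<comment> \<open>Empty blocks are appended until there is one block for each of the
      \<open>m\<close> columns; the surplus zero columns are the end columns of these empty
      blocks.\<close>
    define ks' where "ks' = ks @ replicate (m - ?q) 0"
    have s': "sum_list ks' = ?s" "length ks' = m" using qm by (simp_all add: ks'_def sum_list_replicate)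
    have nil0: "nil_block 0 = 0\<^sub>m 0 0" by (rule eq_matI) auto
    have "nil_blocks (ks @ replicate t 0) = nil_blocks ks" for t
    proof (induction ks)
      case Nil
      then show ?case by (induction t) (simp_all add: nil_blocks_Cons nil0)
    qed (simp add: nil_blocks_Cons)
    then have D': "D = dsum (nil_blocks ks') R" by (simp add: D_def ks'_def)
    have z: "end_cols (replicate t 0) = 0\<^sub>m 0 t" for t
      by (rule eq_matI) (simp_all add: sum_list_replicate)
    have "end_cols ks' = dsum (end_cols ks) (0\<^sub>m 0 (m - ?q))"
      unfolding ks'_def end_cols_def map_append diag_block_append z[unfolded end_cols_def] ..
    then have "dsum (end_cols ks') (0\<^sub>m r 0) = E * rank_nf ?q m ?q"
    proof -
      assume e: "end_cols ks' = dsum (end_cols ks) (0\<^sub>m 0 (m - ?q))"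
      have ER: "(E * rank_nf ?q m ?q) $$ (i, j) = (if j < ?q then E $$ (i, j) else 0)" if "i < p" "j < m" for i j
      proof -
        have "(E * rank_nf ?q m ?q) $$ (i, j) = (\<Sum>l<?q. E $$ (i, l) * rank_nf ?q m ?q $$ (l, j))"
          using that by (simp add: scalar_prod_def atLeast0LessThan)
        also have "\<dots> = (\<Sum>l<?q. if l = j then E $$ (i, j) else 0)"
          using that by (intro sum.cong) (auto simp: rank_nf_def)
        finally have "(E * rank_nf ?q m ?q) $$ (i, j) = (\<Sum>l<?q. if l = j then E $$ (i, j) else 0)" .
        then show ?thesis by simp
      qed
      show ?thesis
      proof (rule eq_matI)
        fix i j assume "i < dim_row (E * rank_nf ?q m ?q)" "j < dim_col (E * rank_nf ?q m ?q)"
        then have ij: "i < p" "j < m" by simp_all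
        show "dsum (end_cols ks') (0\<^sub>m r 0) $$ (i, j) = (E * rank_nf ?q m ?q) $$ (i, j)"
          unfolding ER[OF ij] e using ij qm ks(2) by (auto simp: E_def dsum_def)
      qed (use qm ks(2) in \<open>simp_all add: e\<close>)
    qed
    then have c3: "congr n A (ext_form (?s + r) (m + 0) (dsum (nil_blocks ks') R) (dsum (end_cols ks') (0\<^sub>m r 0)))"
      using c2 D' ks(2) by simp
    have c4: "congr (?s + r + (m + 0) + (m + 0)) (ext_form (?s + r) (m + 0) (dsum (nil_blocks ks') R) (dsum (end_cols ks') (0\<^sub>m r 0)))
      (dsum (ext_form ?s m (nil_blocks ks') (end_cols ks')) (ext_form r 0 R (0\<^sub>m r 0)))"
      by (rule ext_form_dsum) (use R(1) s' in \<open>auto intro!: carrier_matI\<close>)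
    have ER: "ext_form r 0 R (0\<^sub>m r 0) = R" by (rule eq_matI) (auto simp: ext_form_def)
    have c5: "congr (?s + m + m + r) (dsum (ext_form ?s m (nil_blocks ks') (end_cols ks')) R)
      (dsum (nil_blocks (map (\<lambda>k. k + 2) ks')) R)"
      using ext_form_nil_blocks[of ks'] R(1) unfolding s' by (intro congr_dsum congr_refl)
    have "?s + r + (m + 0) + (m + 0) = n" "?s + m + m + r = n" using n ks(2) by auto
    then have "congr n A (dsum (nil_blocks (map (\<lambda>k. k + 2) ks')) R)"
      using congr_trans[OF c3] congr_trans c4 c5 unfolding ER by metis
    moreover have "sum_list (map (\<lambda>k. k + 2) ks') + r = n"
    proof -
      have "sum_list (map (\<lambda>k. k + 2) xs) = sum_list xs + 2 * length xs" for xs :: "nat list"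
        by (induction xs) simp_all
      then show ?thesis using s' n ks(2) by simp
    qed
    moreover have "0 \<notin> set (map (\<lambda>k. k + 2) ks')" by auto
    ultimately show ?thesis using R by blast
  qed
qed

section \<open>Nilpotent blocks in the form of A and of B with c = 0\<close>

lemma matA_index:
  assumes "i < 2 * k + 1" "j < 2 * k + 1"
  shows "matA k $$ (i, j) = (if i < k \<and> j = k + 1 + i \<or> k < i \<and> i = k + j then 1 else 0)"
proof -
  have 1: "(i + 1, j + 1) \<in> (\<lambda>i. (i, k + 1 + i)) ` {1..k} \<longleftrightarrow> i < k \<and> j = k + 1 + i"
    unfolding mem_graph using assms by auto
  have 2: "(i + 1, j + 1) \<in> (\<lambda>i. (k + 1 + i, i + 1)) ` {1..k} \<longleftrightarrow> k < i \<and> i = k + j"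
    unfolding mem_shifted_graph using assms by auto
  show ?thesis using assms by (simp only: matA_def sq_mat_def index_mat prod.case Un_iff 1 2)
qed

lemma nil_block_odd: "congr (2 * k + 1) (nil_block (2 * k + 1)) (matA k)"
proof -
  \<comment> \<open>The form pairs each vertex of the path 0, ..., 2k with the next one. The
    relabelling lists the even vertices first and then the odd ones, both increasing.\<close>
  define \<pi> where "\<pi> a = (if a \<le> k then 2 * a else 2 * (a - k) - 1)" for a
  define \<rho> where "\<rho> b = (if even b then b div 2 else k + (b + 1) div 2)" for b
  have 1: "\<rho> (\<pi> a) = a \<and> \<pi> a < 2 * k + 1" if "a < 2 * k + 1" for a
  proof (cases "a \<le> k")
    case False
    then obtain d where "a = k + Suc d" using less_imp_Suc_add[of k a] by auto
    then show ?thesis using that by (simp add: \<pi>_def \<rho>_def)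
  qed (simp add: \<pi>_def \<rho>_def)
  have 2: "\<pi> (\<rho> b) = b \<and> \<rho> b < 2 * k + 1" if "b < 2 * k + 1" for b
  proof (cases "even b")
    case True
    then obtain c where "b = 2 * c" by (elim evenE)
    then show ?thesis using that by (simp add: \<pi>_def \<rho>_def)
  next
    case False
    then obtain c where "b = 2 * c + 1" by (elim oddE)
    then show ?thesis using that by (simp add: \<pi>_def \<rho>_def)
  qed
  have "bij_betw \<pi> {..<2 * k + 1} {..<2 * k + 1}"
    by (rule bij_betw_byWitness[where f' = \<rho>]) (use 1 2 in blast)+
  from congr_reindex[OF nil_block_carrier(1) this]
  have "congr (2 * k + 1) (nil_block (2 * k + 1))
    (Matrix.mat (2 * k + 1) (2 * k + 1) (\<lambda>(i, j). nil_block (2 * k + 1) $$ (\<pi> i, \<pi> j)))" .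
  also have "Matrix.mat (2 * k + 1) (2 * k + 1) (\<lambda>(i, j). nil_block (2 * k + 1) $$ (\<pi> i, \<pi> j)) = matA k" (is "?L = _")
  proof (rule eq_matI)
    fix i j assume "i < dim_row (matA k)" "j < dim_col (matA k)"
    then have ij: "i < 2 * k + 1" "j < 2 * k + 1" by (auto simp: matA_def sq_mat_def)
    have "\<pi> i < 2 * k + 1" "\<pi> j < 2 * k + 1" using ij by (auto simp: \<pi>_def)
    then have "?L $$ (i, j) = (if Suc (\<pi> i) = \<pi> j then 1 else 0)"
      using ij by (simp add: nil_block_def jordan_block_def)
    moreover have "Suc (\<pi> i) = \<pi> j \<longleftrightarrow> (i < k \<and> j = k + 1 + i \<or> k < i \<and> i = k + j)"
    proof -
      have low: "\<pi> a = 2 * a" if "a \<le> k" for a using that by (simp add: \<pi>_def)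
      have high: "\<exists>d. a = k + Suc d \<and> \<pi> a = 2 * d + 1" if "\<not> a \<le> k" for a
        using that less_imp_Suc_add[of k a] by (auto simp: \<pi>_def)
      show ?thesis
      proof (cases "i \<le> k")
        case i: True
        show ?thesis
        proof (cases "j \<le> k")
          case True
          have "Suc (2 * i) \<noteq> 2 * j" by presburger
          then show ?thesis using i True low by simp
        next
          case False
          then obtain d where "j = k + Suc d" "\<pi> j = 2 * d + 1" using high by blast
          then show ?thesis using i low[OF i] ij by auto
        qed
      next
        case i: False
        then obtain d where d: "i = k + Suc d" "\<pi> i = 2 * d + 1" using high by blast
        show ?thesis
        proof (cases "j \<le> k")
          case True
          then show ?thesis using d low[OF True] by auto
        next
          case False
          then obtain e where e: "j = k + Suc e" "\<pi> j = 2 * e + 1" using high by blast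
          have "Suc (2 * d + 1) \<noteq> 2 * e + 1" by presburger
          then show ?thesis using d e ij by simp
        qed
      qed
    qed
    ultimately show "?L $$ (i, j) = matA k $$ (i, j)" using matA_index[OF ij] by simp
  qed (simp_all add: matA_def sq_mat_def)
  finally show ?thesis .
qed

lemma nil_block_even: "congr (2 * k) (nil_block (2 * k)) (matB k 0)"
proof -
  \<comment> \<open>Here the even vertices are listed increasingly and then the odd ones
    decreasingly, which puts the pairs on antidiagonals.\<close>
  define \<pi> where "\<pi> a = (if a < k then 2 * a else 4 * k - 1 - 2 * a)" for a
  define \<rho> where "\<rho> b = (if even b then b div 2 else 2 * k - (b + 1) div 2)" for b
  have 1: "\<rho> (\<pi> a) = a \<and> \<pi> a < 2 * k" if "a < 2 * k" for a
  proof (cases "a < k")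
    case False
    define d where "d = 2 * k - 1 - a"
    then have "\<pi> a = 2 * d + 1" "a = 2 * k - Suc d" "d < k" using False that by (auto simp: \<pi>_def)
    then show ?thesis by (simp add: \<rho>_def)
  qed (simp add: \<pi>_def \<rho>_def)
  have 2: "\<pi> (\<rho> b) = b \<and> \<rho> b < 2 * k" if "b < 2 * k" for b
  proof (cases "even b")
    case True
    then obtain c where "b = 2 * c" by (elim evenE)
    then show ?thesis using that by (simp add: \<pi>_def \<rho>_def)
  next
    case False
    then obtain c where c: "b = 2 * c + 1" by (elim oddE)
    then have "\<rho> b = 2 * k - Suc c" by (simp add: \<rho>_def)
    then show ?thesis using that c by (auto simp: \<pi>_def)
  qed
  have "bij_betw \<pi> {..<2 * k} {..<2 * k}"
    by (rule bij_betw_byWitness[where f' = \<rho>]) (use 1 2 in blast)+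
  from congr_reindex[OF nil_block_carrier(1) this]
  have "congr (2 * k) (nil_block (2 * k))
    (Matrix.mat (2 * k) (2 * k) (\<lambda>(i, j). nil_block (2 * k) $$ (\<pi> i, \<pi> j)))" .
  also have "Matrix.mat (2 * k) (2 * k) (\<lambda>(i, j). nil_block (2 * k) $$ (\<pi> i, \<pi> j)) = matB k 0" (is "?L = _")
  proof (rule eq_matI)
    fix i j assume "i < dim_row (matB k 0)" "j < dim_col (matB k 0)"
    then have ij: "i < 2 * k" "j < 2 * k" by (auto simp: matB_def sq_mat_def)
    have B: "matB k 0 $$ (i, j) = (if i < k \<and> Suc (i + j) = 2 * k \<or> k < i \<and> i + j = 2 * k then 1 else 0)"
      unfolding matB_eq offdiag_hankel_index[OF ij] by auto
    have "\<pi> i < 2 * k" "\<pi> j < 2 * k" using ij by (auto simp: \<pi>_def)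
    then have "?L $$ (i, j) = (if Suc (\<pi> i) = \<pi> j then 1 else 0)"
      using ij by (simp add: nil_block_def jordan_block_def)
    moreover have "Suc (\<pi> i) = \<pi> j \<longleftrightarrow> (i < k \<and> Suc (i + j) = 2 * k \<or> k < i \<and> i + j = 2 * k)"
    proof -
      have low: "\<pi> a = 2 * a" if "a < k" for a using that by (simp add: \<pi>_def)
      have high: "\<exists>d. a + Suc d = 2 * k \<and> \<pi> a = 2 * d + 1" if "\<not> a < k" "a < 2 * k" for a
        using that by (intro exI[of _ "2 * k - 1 - a"]) (auto simp: \<pi>_def)
      show ?thesis
      proof (cases "i < k")
        case i: True
        show ?thesis
        proof (cases "j < k")
          case True
          have "Suc (2 * i) \<noteq> 2 * j" by presburger
          then show ?thesis using i True low by simp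
        next
          case False
          then obtain d where "j + Suc d = 2 * k" "\<pi> j = 2 * d + 1" using high ij by blast
          then show ?thesis using i low[OF i] ij by auto
        qed
      next
        case i: False
        then obtain d where d: "i + Suc d = 2 * k" "\<pi> i = 2 * d + 1" using high ij by blast
        show ?thesis
        proof (cases "j < k")
          case True
          then show ?thesis using d low[OF True] i by auto
        next
          case False
          then obtain e where e: "j + Suc e = 2 * k" "\<pi> j = 2 * e + 1" using high ij by blast
          have "Suc (2 * d + 1) \<noteq> 2 * e + 1" by presburger
          then show ?thesis using d e ij i False by auto
        qed
      qed
    qed
    ultimately show "?L $$ (i, j) = matB k 0 $$ (i, j)" using B by simp
  qed (simp_all add: matB_def sq_mat_def)
  finally show ?thesis .
qed

lemma nil_blocks_canonical:
  "0 \<notin> set ks \<Longrightarrow> \<exists>Ms. set Ms \<subseteq> canonical \<and> congr (sum_list ks) (nil_blocks ks) (diag_block_mat Ms)"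
proof (induction ks)
  case Nil
  then show ?case by (intro exI[of _ "[]"]) (simp add: nil_blocks_Nil congr_refl)
next
  case (Cons k ks)
  then obtain Ms where Ms: "set Ms \<subseteq> canonical" "congr (sum_list ks) (nil_blocks ks) (diag_block_mat Ms)" by auto
  have "\<exists>M\<in>canonical. congr k (nil_block k) M"
  proof (cases "even k")
    case True
    then obtain j where j: "k = 2 * j" by (elim evenE)
    then have "j > 0" using Cons.prems by auto
    then have "matB j 0 \<in> {matB k c | k c. k > 0 \<and> c \<noteq> 1 \<and> c \<noteq> -1}"
      by (intro CollectI exI[of _ j] exI[of _ "0 :: complex"]) simp
    then have "matB j 0 \<in> canonical" unfolding canonical_def by blast
    then show ?thesis using nil_block_even[of j] j by blast
  next
    case False
    then obtain j where j: "k = 2 * j + 1" by (elim oddE)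
    have "matA j \<in> canonical" by (auto simp: canonical_def)
    then show ?thesis using nil_block_odd[of j] j by blast
  qed
  then obtain M where M: "M \<in> canonical" "congr k (nil_block k) M" by blast
  have "congr (k + sum_list ks) (nil_blocks (k # ks)) (diag_block_mat (M # Ms))"
    unfolding nil_blocks_Cons diag_block_Cons by (rule congr_dsum[OF M(2) Ms(2)])
  then show ?case using M(1) Ms(1) by (intro exI[of _ "M # Ms"]) simp
qed

theorem canonical_form:
  assumes "A \<in> carrier_mat n n"
  shows "\<exists>Ms. set Ms \<subseteq> canonical \<and> congr n A (diag_block_mat Ms)"
proof -
  obtain ks r R where R: "R \<in> carrier_mat r r" "Determinant.det R \<noteq> 0" and ks: "0 \<notin> set ks" "sum_list ks + r = n"
    "congr n A (dsum (nil_blocks ks) R)"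
    using singular_part[OF assms] by blast
  obtain Ms where Ms: "set Ms \<subseteq> canonical" "congr (sum_list ks) (nil_blocks ks) (diag_block_mat Ms)"
    using nil_blocks_canonical[OF ks(1)] by blast
  obtain Ms' where Ms': "set Ms' \<subseteq> canonical" "congr r R (diag_block_mat Ms')"
    using nondegenerate_canonical[OF R] by blast
  have "congr n (dsum (nil_blocks ks) R) (diag_block_mat (Ms @ Ms'))"
    using congr_dsum[OF Ms(2) Ms'(2)] ks(2) by (simp add: diag_block_append)
  then show ?thesis using congr_trans[OF ks(3)] Ms(1) Ms'(1) by (intro exI[of _ "Ms @ Ms'"]) auto
qed

section \<open>Completeness of the list\<close>

lemma listset_iff: "xs \<in> listset As \<longleftrightarrow> list_all2 (\<in>) xs As"
  by (induction As arbitrary: xs) (auto simp: set_Cons_def list_all2_Cons2)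

lemma matA_0: "matA 0 = 0\<^sub>m 1 1"
  by (rule eq_matI) (auto simp: matA_def sq_mat_def)

lemma matC_0: "matC 0 = 1\<^sub>m 1"
  by (rule eq_matI) (auto simp: matC_eq antidiag_def)

lemma canonical_block:
  assumes M: "M \<in> canonical" and size: "dim_row M \<le> 7" and nz: "M \<noteq> 0\<^sub>m 1 1"
  shows "\<exists>b. M \<in> block_mats b"
proof -
  consider k where "M = matA k" | k c where "M = matB k c" "k > 0" "c \<noteq> 1" "c \<noteq> -1" | k where "M = matC k"
    | k where "M = matD k" "k > 0" "even k" | k where "M = matE k" "k > 0" | k where "M = matF k" "odd k"
    using M unfolding canonical_def by blast
  then show ?thesis
  proof cases
    case (1 k)
    then have "k \<in> {0, 1, 2, 3}" using size matA_carrier[of k] by auto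
    moreover have "k \<noteq> 0" using 1 nz matA_0 by auto
    moreover have "matA 1 \<in> block_mats A3" "matA 2 \<in> block_mats A5" "matA 3 \<in> block_mats A7" by auto
    ultimately show ?thesis unfolding 1 by blast
  next
    case (2 k c)
    then have "k \<in> {1, 2, 3}" using size matB_carrier[of k c] by auto
    moreover have "matB 1 c \<in> block_mats B2" "matB 2 c \<in> block_mats B4" "matB 3 c \<in> block_mats B6" using 2 by auto
    ultimately show ?thesis unfolding 2(1) by blast
  next
    case (3 k)
    then have "k \<in> {0, 1, 2, 3}" using size matC_carrier[of k] by auto
    moreover have "matC 0 \<in> block_mats One" "matC 1 \<in> block_mats C3" "matC 2 \<in> block_mats C5" "matC 3 \<in> block_mats C7"
      by (auto simp: matC_0)
    ultimately show ?thesis unfolding 3 by blast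
  next
    case (4 k)
    then have "2 * k \<le> 7" using size matD_carrier[of k] by auto
    then have "k = 2" using 4 by (auto elim!: evenE)
    moreover have "matD 2 \<in> block_mats D4" by simp
    ultimately show ?thesis unfolding 4(1) by blast
  next
    case (5 k)
    then have "k \<in> {1, 2, 3}" using size matE_carrier[of k] by auto
    moreover have "matE 1 \<in> block_mats E2" "matE 2 \<in> block_mats E4" "matE 3 \<in> block_mats E6" by auto
    ultimately show ?thesis unfolding 5(1) by blast
  next
    case (6 k)
    then have "2 * k \<le> 7" using size matF_carrier[of k] by auto
    then have "k = 1 \<or> k = 3" using 6 by (auto elim!: oddE)
    moreover have "matF 1 \<in> block_mats F2" "matF 3 \<in> block_mats F6" by auto
    ultimately show ?thesis unfolding 6(1) by blast
  qed
qed

definition trivial_radical :: "nat \<Rightarrow> complex Matrix.mat \<Rightarrow> bool" where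
  "trivial_radical n A \<longleftrightarrow> (\<forall>x\<in>carrier_vec n. A *\<^sub>v x = 0\<^sub>v n \<longrightarrow> A\<^sup>T *\<^sub>v x = 0\<^sub>v n \<longrightarrow> x = 0\<^sub>v n)"

lemma trivial_radical_congr:
  assumes AB: "congr n A B" and A: "trivial_radical n A"
  shows "trivial_radical n B"
  unfolding trivial_radical_def
proof (intro ballI impI)
  fix x assume x: "x \<in> carrier_vec n" "B *\<^sub>v x = 0\<^sub>v n" "B\<^sup>T *\<^sub>v x = 0\<^sub>v n"
  obtain P P' where P: "inv_pair n P P'" "B = P\<^sup>T * A * P" and Ac: "A \<in> carrier_mat n n"
    using AB by (auto simp: congr_def)
  note Pc = inv_pairD[OF P(1)]
  have BT: "B\<^sup>T = P\<^sup>T * A\<^sup>T * P" unfolding P(2) using Ac inv_pair_dims[OF P(1)] by (simp add: mat_transpose_mult mat_assoc)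
  have Px: "P *\<^sub>v x \<in> carrier_vec n" using Pc x by (intro mult_mat_vec_carrier) auto
  have z: "X *\<^sub>v (P *\<^sub>v x) = 0\<^sub>v n" if "X \<in> carrier_mat n n" "(P\<^sup>T * X * P) *\<^sub>v x = 0\<^sub>v n" for X
  proof -
    have "P\<^sup>T *\<^sub>v (X *\<^sub>v (P *\<^sub>v x)) = 0\<^sub>v n"
      using that Pc x by (simp add: assoc_mult_mat_vec[of _ n n _ n])
    then show ?thesis
      by (rule inv_pair_kernel[OF inv_pair_transpose[OF P(1)] mult_mat_vec_carrier[OF that(1) Px]])
  qed
  have "A *\<^sub>v (P *\<^sub>v x) = 0\<^sub>v n" using z[OF Ac] x(2) P(2) by simp
  moreover have "A\<^sup>T *\<^sub>v (P *\<^sub>v x) = 0\<^sub>v n" using z[of "A\<^sup>T"] x(3) BT Ac by simp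
  ultimately have "P *\<^sub>v x = 0\<^sub>v n" using A Px unfolding trivial_radical_def by blast
  then show "x = 0\<^sub>v n" by (rule inv_pair_kernel[OF P(1) x(1)])
qed

lemma dsum_mult_vec:
  assumes "A \<in> carrier_mat n m" "B \<in> carrier_mat p q" "x \<in> carrier_vec m" "y \<in> carrier_vec q"
  shows "dsum A B *\<^sub>v (x @\<^sub>v y) = (A *\<^sub>v x) @\<^sub>v (B *\<^sub>v y)"
proof -
  have z: "0\<^sub>m k l *\<^sub>v v = 0\<^sub>v k" if "v \<in> carrier_vec l" for k l and v :: "complex Matrix.vec"
    using that by (intro eq_vecI) auto
  have "dsum A B = four_block_mat A (0\<^sub>m n q) (0\<^sub>m p m) B" using assms by (simp add: dsum_def)
  then have "dsum A B *\<^sub>v (x @\<^sub>v y) = (A *\<^sub>v x + 0\<^sub>m n q *\<^sub>v y) @\<^sub>v (0\<^sub>m p m *\<^sub>v x + B *\<^sub>v y)"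
    using assms by (simp only:) (rule four_block_mat_mult_vec, auto)
  then show ?thesis using assms by (simp add: z)
qed

lemma append_zero_vec: "0\<^sub>v n @\<^sub>v 0\<^sub>v m = (0\<^sub>v (n + m) :: complex Matrix.vec)"
  by (rule eq_vecI) auto

lemma trivial_radical_no_zero_block:
  assumes Ms: "\<forall>M\<in>set Ms. square_mat M" and n: "sum_list (map dim_row Ms) = n"
    and rad: "trivial_radical n (diag_block_mat Ms)"
  shows "0\<^sub>m 1 1 \<notin> set Ms"
proof
  assume "0\<^sub>m 1 1 \<in> set Ms"
  then obtain xs ys where s: "Ms = xs @ 0\<^sub>m 1 1 # ys" by (meson split_list)
  let ?B = "diag_block_mat (xs @ ys)" and ?m = "sum_list (map dim_row (xs @ ys))"
  have sq: "\<forall>M\<in>set (xs @ 0\<^sub>m 1 1 # ys). square_mat M" using Ms s by simp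
  have nm: "n = 1 + ?m" using n s by simp
  have B: "?B \<in> carrier_mat ?m ?m" by (rule diag_block_carrier) (use Ms s in auto)
  have "congr n (diag_block_mat Ms) (dsum (0\<^sub>m 1 1) ?B)"
    using congr_diag_block_move[OF sq] nm unfolding s diag_block_Cons by simp
  then have r: "trivial_radical n (dsum (0\<^sub>m 1 1) ?B)" using rad by (rule trivial_radical_congr)
  let ?x = "unit_vec 1 0 @\<^sub>v 0\<^sub>v ?m :: complex Matrix.vec"
  have z: "0\<^sub>m 1 1 *\<^sub>v unit_vec 1 0 = (0\<^sub>v 1 :: complex Matrix.vec)" by (rule eq_vecI) auto
  have 1: "dsum (0\<^sub>m 1 1) X *\<^sub>v ?x = 0\<^sub>v n" if "X \<in> carrier_mat ?m ?m" for X
    using that by (subst dsum_mult_vec[of _ 1 1 _ ?m ?m]) (auto simp: z append_zero_vec nm)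
  have "(dsum (0\<^sub>m 1 1) ?B)\<^sup>T = dsum (0\<^sub>m 1 1) (?B\<^sup>T)" by (simp add: dsum_transpose)
  then have "?x = 0\<^sub>v n" using r 1[OF B] 1[of "?B\<^sup>T"] B nm unfolding trivial_radical_def
    by (metis append_carrier_vec transpose_carrier_mat unit_vec_carrier zero_carrier_vec)
  then have "?x $ 0 = 0" using nm by simp
  then show False by simp
qed

section \<open>Enumeration of the multisets of blocks of total size 7\<close>

lemma block_size_pos: "0 < block_size b"
  by (cases b) auto

text \<open>The first block is either used once more or dropped for good, so each multiset of blocks
  is listed in the order of the first argument.\<close>

function (sequential) block_partitions :: "block list \<Rightarrow> nat \<Rightarrow> block list list" where
  "block_partitions [] n = (if n = 0 then [[]] else [])"
| "block_partitions (b # bs) n =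
    (if block_size b \<le> n then map ((#) b) (block_partitions (b # bs) (n - block_size b)) else []) @ block_partitions bs n"
  by pat_completeness auto
termination
proof (relation "Wellfounded.measure (\<lambda>(bs, n). length bs + n)")
  fix b and bs :: "block list" and n assume "block_size b \<le> n"
  then show "((b # bs, n - block_size b), b # bs, n) \<in> Wellfounded.measure (\<lambda>(bs, n). length bs + n)"
    using block_size_pos[of b] by auto
qed auto

lemma block_partitions_complete:
  assumes "set_mset X \<subseteq> set bs" "sum_mset (image_mset block_size X) = n"
  shows "\<exists>xs\<in>set (block_partitions bs n). mset xs = X"
  using assms
proof (induction bs n arbitrary: X rule: block_partitions.induct)
  case (1 n)
  then show ?case by auto
next
  case (2 b bs n)
  show ?case
  proof (cases "b \<in># X")
    case True
    then obtain Y where Y: "X = add_mset b Y" by (meson multi_member_split)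
    have le: "block_size b \<le> n" using 2(4) by (auto simp: Y)
    have s1: "set_mset Y \<subseteq> set (b # bs)" using 2(3) by (simp add: Y)
    have s2: "sum_mset (image_mset block_size Y) = n - block_size b" using 2(4) by (simp add: Y)
    obtain ys where ys: "ys \<in> set (block_partitions (b # bs) (n - block_size b))" "mset ys = Y"
      using 2(1)[OF le s1 s2] by (elim bexE)
    have "b # ys \<in> set (block_partitions (b # bs) n)"
      by (subst block_partitions.simps) (use le ys(1) in \<open>simp del: block_partitions.simps\<close>)
    moreover have "mset (b # ys) = X" using ys(2) by (simp add: Y)
    ultimately show ?thesis by blast
  next
    case False
    then have "set_mset X \<subseteq> set bs" using 2(3) by auto
    then obtain xs where "xs \<in> set (block_partitions bs n)" "mset xs = X" using 2(2)[of X] 2(4) by blast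
    then show ?thesis by (intro bexI[of _ xs], simp) (subst block_partitions.simps, simp del: block_partitions.simps)
  qed
qed

lemma entries_complete:
  assumes "sum_list (map block_size bs) = 7"
  shows "\<exists>es\<in>set entries. mset es = mset bs"
proof -
  \<comment> \<open>This order of the blocks is the one followed inside each member of
    \<open>entries\<close>, so evaluation finds every enumerated list literally in
    \<open>entries\<close>.\<close>
  let ?ord = "[A7, C7, B6, E6, F6, A5, C5, B4, D4, E4, A3, C3, F2, E2, B2, One]"
  have "list_all (\<lambda>xs. xs \<in> set entries) (block_partitions ?ord 7)"
    by code_simp
  then have 1: "xs \<in> set entries" if "xs \<in> set (block_partitions ?ord 7)" for xs
    using that by (simp only: list_all_iff)
  have 2: "set_mset (mset bs) \<subseteq> set ?ord"
  proof
    fix b show "b \<in> set ?ord" by (cases b) auto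
  qed
  have 3: "sum_mset (image_mset block_size (mset bs)) = 7"
    using assms by (metis mset_map sum_mset_sum_list)
  show ?thesis
    using block_partitions_complete[OF 2 3] 1 by (elim bexE) (rule bexI)
qed

theorem entry_form:
  assumes A: "A \<in> carrier_mat 7 7" and rad: "trivial_radical 7 A"
  shows "\<exists>es\<in>set entries. \<exists>N\<in>entry_mats es. congr 7 A N"
proof -
  obtain Ms where Ms: "set Ms \<subseteq> canonical" "congr 7 A (diag_block_mat Ms)" using canonical_form[OF A] by blast
  have sq: "\<forall>M\<in>set Ms. square_mat M" using Ms(1) canonical_square by blast
  have "diag_block_mat Ms \<in> carrier_mat 7 7" using congr_carrier[OF Ms(2)] by simp
  then have size: "sum_list (map dim_row Ms) = 7" using diag_block_carrier[OF sq] by (metis carrier_matD(1))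
  have nz: "0\<^sub>m 1 1 \<notin> set Ms"
    by (rule trivial_radical_no_zero_block[OF sq size trivial_radical_congr[OF Ms(2) rad]])
  have "\<exists>b. M \<in> block_mats b" if "M \<in> set Ms" for M
  proof (rule canonical_block)
    show "dim_row M \<le> 7" using that size member_le_sum_list[of "dim_row M" "map dim_row Ms"] by auto
  qed (use that Ms(1) nz in auto)
  then obtain \<beta> where \<beta>: "\<And>M. M \<in> set Ms \<Longrightarrow> M \<in> block_mats (\<beta> M)" by metis
  define bs where "bs = map \<beta> Ms"
  have "block_size (\<beta> M) = dim_row M" if "M \<in> set Ms" for M
    using block_mats_dim[OF \<beta>[OF that]] by simp
  then have "map block_size bs = map dim_row Ms" by (simp add: bs_def)
  then obtain es where es: "es \<in> set entries" "mset es = mset bs" using entries_complete[of bs] size by auto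
  \<comment> \<open>\<open>es\<close> is only a permutation of \<open>bs\<close>; zipping carries
    the matrices along, so that each keeps its block name.\<close>
  obtain Ns where Ns: "length Ns = length es" "mset (zip es Ns) = mset (zip bs Ms)"
    using ex_mset_zip_left[of bs Ms es] es(2) by (auto simp: bs_def)
  have "mset Ns = mset (map snd (zip es Ns))" using Ns(1) by simp
  also have "\<dots> = mset (map snd (zip bs Ms))" using Ns(2) by (metis mset_map)
  also have "\<dots> = mset Ms" by (simp add: bs_def)
  finally have mN: "mset Ms = mset Ns" by simp
  have "list_all2 (\<in>) Ns (map block_mats es)"
  proof (rule list_all2_all_nthI)
    fix i assume i: "i < length Ns"
    then have "(es ! i, Ns ! i) \<in> set (zip es Ns)" using Ns(1) by (auto simp: set_zip)
    then have "(es ! i, Ns ! i) \<in> set (zip bs Ms)" using Ns(2) by (metis mset_eq_setD)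
    then have "Ns ! i \<in> block_mats (es ! i)" using \<beta> by (auto simp: bs_def set_zip)
    then show "Ns ! i \<in> map block_mats es ! i" using i Ns(1) by simp
  qed (use Ns in simp)
  then have "diag_block_mat Ns \<in> entry_mats es" unfolding entry_mats_def by (intro imageI) (simp add: listset_iff)
  moreover have "congr 7 A (diag_block_mat Ns)"
    using congr_trans[OF Ms(2)] congr_diag_block_mset[OF mN sq] size by simp
  ultimately show ?thesis using es(1) by blast
qed

section \<open>Uniqueness\<close>

text \<open>A block without singular part is described by the sizes of the Jordan blocks of its
  asymmetry, shifted by 0, 10 and 20 for the eigenvalues 1, -1 and all others.\<close>

definition jordan_code :: "complex \<Rightarrow> nat \<times> complex \<Rightarrow> nat" where
  "jordan_code \<mu> p = fst p + (if snd p = 1 / (1 - \<mu>) then 0 else if snd p = 1 / (- 1 - \<mu>) then 10 else 20)"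

fun singular_block :: "block \<Rightarrow> bool" where
  "singular_block A3 = True"
| "singular_block A5 = True"
| "singular_block A7 = True"
| "singular_block _ = False"

fun block_profile :: "block \<Rightarrow> nat list" where
  "block_profile One = [1]"
| "block_profile C3 = [3]"
| "block_profile C5 = [5]"
| "block_profile C7 = [7]"
| "block_profile D4 = [2, 2]"
| "block_profile E2 = [12]"
| "block_profile E4 = [14]"
| "block_profile E6 = [16]"
| "block_profile F2 = [11, 11]"
| "block_profile F6 = [13, 13]"
| "block_profile B2 = [21, 21]"
| "block_profile B4 = [22, 22]"
| "block_profile B6 = [23, 23]"
| "block_profile _ = []"

lemma block_profile_asym_nf:
  assumes b: "\<not> singular_block b" and M: "M \<in> block_mats b"
  shows "\<exists>F. finite F \<and> (\<forall>\<mu>. \<mu> \<notin> F \<longrightarrow> (\<exists>js. asym_nf \<mu> M js \<and> map (jordan_code \<mu>) js = block_profile b))"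
proof -
  have inj: "1 / (1 - \<mu>) \<noteq> 1 / (- 1 - \<mu>)" if "\<mu> \<noteq> 1" "\<mu> \<noteq> -1" for \<mu> :: complex
  proof
    assume "1 / (1 - \<mu>) = 1 / (- 1 - \<mu>)"
    then have "1 - \<mu> = - 1 - \<mu>" by (metis inverse_eq_divide inverse_eq_iff_eq)
    then show False by (simp add: algebra_simps)
  qed
  have single: ?thesis if "\<And>\<mu>. \<mu> \<noteq> 1 \<Longrightarrow> \<mu> \<noteq> -1 \<Longrightarrow> \<exists>js. asym_nf \<mu> M js \<and> map (jordan_code \<mu>) js = block_profile b"
    using that by (intro exI[of _ "{1, -1}"]) auto
  have E: ?thesis if "M = matE k" "k > 0" "block_profile b = [2 * k + 10]" for k
    using asym_nf_matE[OF that(2)] inj by (intro single) (fastforce simp: that jordan_code_def)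
  have C: ?thesis if "M = matC k" "block_profile b = [2 * k + 1]" for k
    using asym_nf_matC[of _ k] by (intro single) (fastforce simp: that jordan_code_def)
  have F: ?thesis if "M = matF k" "k > 0" "block_profile b = [k + 10, k + 10]" for k
    using asym_nf_matF[OF that(2)] inj by (intro single) (fastforce simp: that jordan_code_def)
  have D: ?thesis if "M = matD k" "k > 0" "block_profile b = [k, k]" for k
    using asym_nf_matD[OF that(2)] by (intro single) (fastforce simp: that jordan_code_def)
  have B: ?thesis if "M = matB k c" "c \<noteq> 1" "c \<noteq> -1" "k > 0" "block_profile b = [k + 20, k + 20]" for k c
  \<comment> \<open>At \<open>c\<close> and \<open>1 / c\<close> the matrix
    \<open>A^T - \<mu> A\<close> is singular; at 1 and -1 the code is not meaningful. For
    \<open>c = 0\<close> the value \<open>1 / c\<close> is again 0.\<close>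
  proof (intro exI[of _ "{1, -1, c, 1 / c}"] conjI allI impI)
    fix \<mu> assume mu: "\<mu> \<notin> {1, -1, c, 1 / c}"
    then have mc: "\<mu> * c \<noteq> 1" by (metis insert_iff nonzero_eq_divide_eq mult_zero_right zero_neq_one)
    have mc': "1 - \<mu> * c \<noteq> 0" "c - \<mu> \<noteq> 0" "1 - \<mu> \<noteq> 0" "- 1 - \<mu> \<noteq> 0"
      using mu mc by (auto simp: eq_neg_iff_add_eq_0 add.commute)
    have "c / (1 - \<mu> * c) \<noteq> 1 / (1 - \<mu>)"
      using mc' that(2) by (simp add: frac_eq_eq) (simp add: algebra_simps)
    moreover have "c / (1 - \<mu> * c) \<noteq> 1 / (- 1 - \<mu>)"
    proof
      assume "c / (1 - \<mu> * c) = 1 / (- 1 - \<mu>)"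
      then have "c * (- 1 - \<mu>) = 1 * (1 - \<mu> * c)" using mc' by (simp add: frac_eq_eq)
      then have "- c = 1" by (simp add: algebra_simps)
      then show False using that(3) by (metis minus_minus)
    qed
    moreover have "1 / (c - \<mu>) \<noteq> 1 / (1 - \<mu>)" "1 / (c - \<mu>) \<noteq> 1 / (- 1 - \<mu>)"
      using mc' that(2,3) by (simp_all add: frac_eq_eq)
    ultimately show "\<exists>js. asym_nf \<mu> M js \<and> map (jordan_code \<mu>) js = block_profile b"
      using asym_nf_matB[OF that(4,2,3) mc] mu
      by (intro exI[of _ "[(k, c / (1 - \<mu> * c)), (k, 1 / (c - \<mu>))]"]) (simp add: that(1,5) jordan_code_def)
  qed simp
  show ?thesis
  proof (cases b)
    case B2 then show ?thesis using M B[of 1] by auto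
  next
    case B4 then show ?thesis using M B[of 2] by auto
  next
    case B6 then show ?thesis using M B[of 3] by auto
  next
    case C3 then show ?thesis using M C[of 1] by auto
  next
    case C5 then show ?thesis using M C[of 2] by auto
  next
    case C7 then show ?thesis using M C[of 3] by auto
  next
    case D4 then show ?thesis using M D[of 2] by auto
  next
    case E2 then show ?thesis using M E[of 1] by auto
  next
    case E4 then show ?thesis using M E[of 2] by auto
  next
    case E6 then show ?thesis using M E[of 3] by auto
  next
    case F2 then show ?thesis using M F[of 1] by auto
  next
    case F6 then show ?thesis using M F[of 3] by auto
  next
    case One then show ?thesis using M C[of 0] by (auto simp: matC_0)
  qed (use b in auto)
qed

lemma blocks_profile_asym_nf:
  assumes "\<forall>p\<in>set ps. \<not> singular_block (fst p) \<and> snd p \<in> block_mats (fst p)"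
  shows "\<exists>F. finite F \<and> (\<forall>\<mu>. \<mu> \<notin> F \<longrightarrow> (\<exists>js. asym_nf \<mu> (diag_block_mat (map snd ps)) js \<and>
    map (jordan_code \<mu>) js = concat (map (block_profile \<circ> fst) ps)))"
  using assms
proof (induction ps)
  case Nil
  show ?case by (intro exI[of _ "{}"]) (auto intro: asym_nf_empty)
next
  case (Cons p ps)
  obtain F where F: "finite F" "\<And>\<mu>. \<mu> \<notin> F \<Longrightarrow> \<exists>js. asym_nf \<mu> (diag_block_mat (map snd ps)) js \<and>
    map (jordan_code \<mu>) js = concat (map (block_profile \<circ> fst) ps)" using Cons.IH Cons.prems by (meson list.set_intros(2))
  obtain G where G: "finite G" "\<And>\<mu>. \<mu> \<notin> G \<Longrightarrow> \<exists>js. asym_nf \<mu> (snd p) js \<and> map (jordan_code \<mu>) js = block_profile (fst p)"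
    using block_profile_asym_nf[of "fst p" "snd p"] Cons.prems by auto
  show ?case
  proof (intro exI[of _ "F \<union> G"] conjI allI impI)
    fix \<mu> assume "\<mu> \<notin> F \<union> G"
    then obtain js ks where "asym_nf \<mu> (snd p) js" "map (jordan_code \<mu>) js = block_profile (fst p)"
      "asym_nf \<mu> (diag_block_mat (map snd ps)) ks" "map (jordan_code \<mu>) ks = concat (map (block_profile \<circ> fst) ps)"
      using F(2) G(2) by (metis UnI1 UnI2)
    then show "\<exists>js. asym_nf \<mu> (diag_block_mat (map snd (p # ps))) js \<and>
        map (jordan_code \<mu>) js = concat (map (block_profile \<circ> fst) (p # ps))"
      using asym_nf_dsum by (intro exI[of _ "js @ ks"]) (auto simp: diag_block_Cons)
  qed (use F G in simp)
qed

text \<open>For generic \<open>\<mu>\<close> the kernel of \<open>A\<^sup>T - \<mu> A\<close> lies in the singular part of \<open>A\<close>; its orthogonal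
  complement, taken over all generic \<open>\<mu>\<close>, carries the regular part.\<close>

definition generic_kernel_perp :: "complex set \<Rightarrow> nat \<Rightarrow> complex Matrix.mat \<Rightarrow> complex Matrix.vec set" where
  "generic_kernel_perp F n A = {y \<in> carrier_vec n. \<forall>\<mu>. \<mu> \<notin> F \<longrightarrow> (\<forall>x\<in>carrier_vec n.
     A\<^sup>T *\<^sub>v x = \<mu> \<cdot>\<^sub>v (A *\<^sub>v x) \<longrightarrow> scalar_prod x (A *\<^sub>v y) = 0)}"

text \<open>If the form vanishes on this complement, the summand contributes nothing to the values
  of the form there. This is what allows it to be cancelled.\<close>

definition perp_isotropic :: "complex set \<Rightarrow> nat \<Rightarrow> complex Matrix.mat \<Rightarrow> bool" where
  "perp_isotropic F n A \<longleftrightarrow> A \<in> carrier_mat n n \<and>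
     (\<forall>y\<in>generic_kernel_perp F n A. \<forall>z\<in>generic_kernel_perp F n A. scalar_prod y (A *\<^sub>v z) = 0)"

lemma smult_append_vec: "c \<cdot>\<^sub>v (x @\<^sub>v y) = (c \<cdot>\<^sub>v x) @\<^sub>v (c \<cdot>\<^sub>v (y :: complex Matrix.vec))"
  by (rule eq_vecI) auto

lemma generic_kernel_perp_dsum:
  assumes A: "A \<in> carrier_mat n n" and B: "B \<in> carrier_mat m m"
    and y: "y \<in> carrier_vec n" "z \<in> carrier_vec m"
    and yz: "y @\<^sub>v z \<in> generic_kernel_perp F (n + m) (dsum A B)"
  shows "y \<in> generic_kernel_perp F n A" "z \<in> generic_kernel_perp F m B"
proof -
  have At: "A\<^sup>T \<in> carrier_mat n n" and Bt: "B\<^sup>T \<in> carrier_mat m m" using A B by auto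
  have test: "scalar_prod (x1 @\<^sub>v x2) (dsum A B *\<^sub>v (y @\<^sub>v z)) = 0"
    if "\<mu> \<notin> F" "x1 \<in> carrier_vec n" "x2 \<in> carrier_vec m" "A\<^sup>T *\<^sub>v x1 = \<mu> \<cdot>\<^sub>v (A *\<^sub>v x1)" "B\<^sup>T *\<^sub>v x2 = \<mu> \<cdot>\<^sub>v (B *\<^sub>v x2)" for \<mu> x1 x2
  proof -
    have "(dsum A B)\<^sup>T *\<^sub>v (x1 @\<^sub>v x2) = \<mu> \<cdot>\<^sub>v (dsum A B *\<^sub>v (x1 @\<^sub>v x2))"
      unfolding dsum_transpose dsum_mult_vec[OF A B that(2,3)] dsum_mult_vec[OF At Bt that(2,3)] smult_append_vec that(4,5) ..
    then show ?thesis using yz that(1,2,3) unfolding generic_kernel_perp_def by auto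
  qed
  have Ay: "A *\<^sub>v y \<in> carrier_vec n" "B *\<^sub>v z \<in> carrier_vec m" using A B y by auto
  have split: "scalar_prod (x1 @\<^sub>v x2) (dsum A B *\<^sub>v (y @\<^sub>v z)) = scalar_prod x1 (A *\<^sub>v y) + scalar_prod x2 (B *\<^sub>v z)"
    if "x1 \<in> carrier_vec n" "x2 \<in> carrier_vec m" for x1 x2
    unfolding dsum_mult_vec[OF A B y] using that Ay by (intro scalar_prod_append) auto
  show "y \<in> generic_kernel_perp F n A"
    unfolding generic_kernel_perp_def
  proof (intro CollectI conjI allI impI ballI y)
    fix \<mu> x assume "\<mu> \<notin> F" "x \<in> carrier_vec n" "A\<^sup>T *\<^sub>v x = \<mu> \<cdot>\<^sub>v (A *\<^sub>v x)"
    then show "scalar_prod x (A *\<^sub>v y) = 0"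
      using test[of \<mu> x "0\<^sub>v m"] split[of x "0\<^sub>v m"] Ay B by simp
  qed
  show "z \<in> generic_kernel_perp F m B"
    unfolding generic_kernel_perp_def
  proof (intro CollectI conjI allI impI ballI y)
    fix \<mu> x assume "\<mu> \<notin> F" "x \<in> carrier_vec m" "B\<^sup>T *\<^sub>v x = \<mu> \<cdot>\<^sub>v (B *\<^sub>v x)"
    then show "scalar_prod x (B *\<^sub>v z) = 0"
      using test[of \<mu> "0\<^sub>v n" x] split[of "0\<^sub>v n" x] Ay A by simp
  qed
qed

lemma perp_isotropic_dsum:
  assumes A: "perp_isotropic F n A" and B: "perp_isotropic F m B"
  shows "perp_isotropic F (n + m) (dsum A B)"
  unfolding perp_isotropic_def
proof (intro conjI ballI)
  have Ac: "A \<in> carrier_mat n n" and Bc: "B \<in> carrier_mat m m" using A B by (auto simp: perp_isotropic_def)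
  show "dsum A B \<in> carrier_mat (n + m) (n + m)" by (rule dsum_carrier[OF Ac Bc])
  fix y z assume yz: "y \<in> generic_kernel_perp F (n + m) (dsum A B)" "z \<in> generic_kernel_perp F (n + m) (dsum A B)"
  have dec: "\<exists>v1 v2. v1 \<in> carrier_vec n \<and> v2 \<in> carrier_vec m \<and> v = v1 @\<^sub>v v2"
    if "v \<in> generic_kernel_perp F (n + m) (dsum A B)" for v
    using that vec_first_last_append[of v n m] unfolding generic_kernel_perp_def
    by (metis (no_types, lifting) mem_Collect_eq vec_first_carrier vec_last_carrier)
  obtain y1 y2 where y: "y1 \<in> carrier_vec n" "y2 \<in> carrier_vec m" "y = y1 @\<^sub>v y2" using dec[OF yz(1)] by blast
  obtain z1 z2 where z: "z1 \<in> carrier_vec n" "z2 \<in> carrier_vec m" "z = z1 @\<^sub>v z2" using dec[OF yz(2)] by blast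
  note y' = generic_kernel_perp_dsum[OF Ac Bc y(1,2) yz(1)[unfolded y(3)]]
  note z' = generic_kernel_perp_dsum[OF Ac Bc z(1,2) yz(2)[unfolded z(3)]]
  have "scalar_prod y (dsum A B *\<^sub>v z) = scalar_prod y1 (A *\<^sub>v z1) + scalar_prod y2 (B *\<^sub>v z2)"
    unfolding y(3) z(3) dsum_mult_vec[OF Ac Bc z(1,2)] using Ac Bc y z by (intro scalar_prod_append) auto
  also have "\<dots> = 0" using A B y' z' by (simp add: perp_isotropic_def)
  finally show "scalar_prod y (dsum A B *\<^sub>v z) = 0" .
qed

lemma matA_mult_vec:
  assumes y: "y \<in> carrier_vec (2 * k + 1)" and i: "i < 2 * k + 1"
  shows "(matA k *\<^sub>v y) $ i = (if i < k then y $ (k + 1 + i) else if i = k then 0 else y $ (i - k))"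
    "((matA k)\<^sup>T *\<^sub>v y) $ i = (if i = 0 then 0 else if i \<le> k then y $ (k + i) else y $ (i - k - 1))"
proof -
  let ?n = "2 * k + 1"
  have c: "matA k \<in> carrier_mat ?n ?n" by (rule matA_carrier)
  let ?a = "if i < k then k + 1 + i else i - k"
  have "(matA k *\<^sub>v y) $ i = (\<Sum>l<?n. matA k $$ (i, l) * y $ l)"
    using c y i by (simp add: scalar_prod_def atLeast0LessThan)
  also have "\<dots> = (\<Sum>l<?n. if l = ?a then (if i = k then 0 else y $ ?a) else 0)"
    using i by (intro sum.cong) (auto simp: matA_index)
  also have "\<dots> = (if i = k then 0 else y $ ?a)" using i by auto
  finally show "(matA k *\<^sub>v y) $ i = (if i < k then y $ (k + 1 + i) else if i = k then 0 else y $ (i - k))" by simp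
  let ?b = "if i \<le> k then k + i else i - k - 1"
  have "((matA k)\<^sup>T *\<^sub>v y) $ i = (\<Sum>l<?n. matA k $$ (l, i) * y $ l)"
    using c y i by (simp add: scalar_prod_def atLeast0LessThan)
  also have "\<dots> = (\<Sum>l<?n. if l = ?b then (if i = 0 then 0 else y $ ?b) else 0)"
    using i by (intro sum.cong) (auto simp: matA_index)
  also have "\<dots> = (if i = 0 then 0 else y $ ?b)" using i by auto
  finally show "((matA k)\<^sup>T *\<^sub>v y) $ i = (if i = 0 then 0 else if i \<le> k then y $ (k + i) else y $ (i - k - 1))" by simp
qed

text \<open>For every \<mu> the vector with coordinates \<mu>^k, ..., \<mu>, 1 followed by zeros
  lies in the kernel of \<open>A^T - \<mu> A\<close>. If \<open>y\<close> is orthogonal to all of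
  these outside a finite set, a polynomial in \<mu> has infinitely many roots, so the last
  \<open>k\<close> coordinates of \<open>y\<close> vanish. In the form every term involves one of
  these coordinates of either \<open>y\<close> or \<open>z\<close>.\<close>

lemma perp_isotropic_matA:
  assumes F: "finite F"
  shows "perp_isotropic F (2 * k + 1) (matA k)"
  unfolding perp_isotropic_def
proof (intro conjI ballI matA_carrier)
  let ?n = "2 * k + 1"
  have c: "matA k \<in> carrier_mat ?n ?n" by (rule matA_carrier)
  have van: "y $ (k + 1 + a) = 0" if y: "y \<in> generic_kernel_perp F ?n (matA k)" and a: "a < k" for y a
  proof -
    have yc: "y \<in> carrier_vec ?n" using y by (simp add: generic_kernel_perp_def)
    define p where "p = (\<Sum>a<k. monom (y $ (k + 1 + a)) (k - a))"
    have "poly p \<mu> = 0" if mu: "\<mu> \<notin> F" for \<mu>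
    proof -
      define x where "x = Matrix.vec ?n (\<lambda>i. if i \<le> k then \<mu> ^ (k - i) else 0)"
      have x: "x \<in> carrier_vec ?n" by (simp add: x_def)
      have "(matA k)\<^sup>T *\<^sub>v x = \<mu> \<cdot>\<^sub>v (matA k *\<^sub>v x)"
      proof (rule eq_vecI)
        fix i assume "i < dim_vec (\<mu> \<cdot>\<^sub>v (matA k *\<^sub>v x))"
        then have i: "i < ?n" using c by simp
        have "((matA k)\<^sup>T *\<^sub>v x) $ i = \<mu> * (matA k *\<^sub>v x) $ i"
        proof (cases "i \<le> k")
          case True
          then show ?thesis unfolding matA_mult_vec[OF x i] by (auto simp: x_def)
        next
          case False
          then have "k - (i - k - 1) = Suc (k - (i - k))" using i by auto
          then show ?thesis unfolding matA_mult_vec[OF x i] using False i by (auto simp: x_def)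
        qed
        then show "((matA k)\<^sup>T *\<^sub>v x) $ i = (\<mu> \<cdot>\<^sub>v (matA k *\<^sub>v x)) $ i" using i c by simp
      qed (use c in auto)
      then have "scalar_prod x (matA k *\<^sub>v y) = 0"
        using y x mu by (auto simp: generic_kernel_perp_def)
      then have "0 = (\<Sum>i<?n. x $ i * (matA k *\<^sub>v y) $ i)"
        using c by (simp add: scalar_prod_def atLeast0LessThan)
      also have "\<dots> = (\<Sum>i<k. \<mu> ^ (k - i) * y $ (k + 1 + i))"
        by (rule sum.mono_neutral_cong_right) (auto simp: matA_mult_vec(1)[OF yc] x_def)
      also have "\<dots> = poly p \<mu>" by (simp add: p_def poly_sum poly_monom mult.commute)
      finally show ?thesis by simp
    qed
    then have "UNIV - F \<subseteq> {\<mu>. poly p \<mu> = 0}" by auto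
    moreover have "infinite (UNIV - F :: complex set)" using F by (simp add: infinite_UNIV_char_0 Diff_infinite_finite)
    ultimately have "p = 0" using poly_roots_finite[of p] finite_subset by blast
    have "coeff p (k - a) = (\<Sum>b<k. if b = a then y $ (k + 1 + a) else 0)"
      unfolding p_def coeff_sum using a by (intro sum.cong) auto
    then show ?thesis using \<open>p = 0\<close> a by simp
  qed
  fix y z assume y: "y \<in> generic_kernel_perp F ?n (matA k)" and z: "z \<in> generic_kernel_perp F ?n (matA k)"
  have zc: "z \<in> carrier_vec ?n" using z by (simp add: generic_kernel_perp_def)
  have "scalar_prod y (matA k *\<^sub>v z) = (\<Sum>i<?n. y $ i * (matA k *\<^sub>v z) $ i)"
    using c by (simp add: scalar_prod_def atLeast0LessThan)
  also have "\<dots> = 0"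
  proof (rule sum.neutral, intro ballI)
    fix i assume "i \<in> {..<?n}"
    then have i: "i < ?n" by simp
    show "y $ i * (matA k *\<^sub>v z) $ i = 0"
    proof (cases "i \<le> k")
      case True
      then show ?thesis unfolding matA_mult_vec[OF zc i] using van[OF z, of i] by auto
    next
      case False
      then have "y $ i = 0" using van[OF y, of "i - k - 1"] i by simp
      then show ?thesis by simp
    qed
  qed
  finally show "scalar_prod y (matA k *\<^sub>v z) = 0" .
qed

lemma perp_isotropic_singular_blocks:
  assumes F: "finite F" and ps: "\<forall>p\<in>set ps. singular_block (fst p) \<and> snd p \<in> block_mats (fst p)"
  shows "perp_isotropic F (sum_list (map (block_size \<circ> fst) ps)) (diag_block_mat (map snd ps))"
  using ps
proof (induction ps)
  case Nil
  have "x \<in> carrier_vec 0 \<Longrightarrow> scalar_prod y (0\<^sub>m 0 0 *\<^sub>v x) = 0" for x y :: "complex Matrix.vec"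
    by (simp add: scalar_prod_def)
  then show ?case by (auto simp: perp_isotropic_def generic_kernel_perp_def)
next
  case (Cons p ps)
  have "\<exists>k. snd p = matA k \<and> block_size (fst p) = 2 * k + 1"
  proof (cases "fst p")
    case A3
    then show ?thesis using Cons.prems by (intro exI[of _ 1]) auto
  next
    case A5
    then show ?thesis using Cons.prems by (intro exI[of _ 2]) auto
  next
    case A7
    then show ?thesis using Cons.prems by (intro exI[of _ 3]) auto
  qed (use Cons.prems in auto)
  then have "perp_isotropic F (block_size (fst p)) (snd p)" using perp_isotropic_matA[OF F] by auto
  from perp_isotropic_dsum[OF this Cons.IH] show ?case using Cons.prems by (simp add: diag_block_Cons)
qed

section \<open>Cancelling the singular part\<close>

definition regular_at :: "complex \<Rightarrow> nat \<Rightarrow> complex Matrix.mat \<Rightarrow> bool" where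
  "regular_at \<mu> n A \<longleftrightarrow> A \<in> carrier_mat n n \<and> Determinant.det (A\<^sup>T - \<mu> \<cdot>\<^sub>m A) \<noteq> 0"

lemma regular_at_asym_nf: "asym_nf \<mu> A js \<Longrightarrow> A \<in> carrier_mat n n \<Longrightarrow> regular_at \<mu> n A"
  unfolding regular_at_def asym_nf_def using inv_pair_det by blast

lemma regular_at_kernel:
  assumes A: "regular_at \<mu> n A" and x: "x \<in> carrier_vec n" "A\<^sup>T *\<^sub>v x = \<mu> \<cdot>\<^sub>v (A *\<^sub>v x)"
  shows "x = 0\<^sub>v n"
proof -
  have Ac: "A \<in> carrier_mat n n" using A by (simp add: regular_at_def)
  have "(A\<^sup>T - \<mu> \<cdot>\<^sub>m A) *\<^sub>v x = A\<^sup>T *\<^sub>v x - \<mu> \<cdot>\<^sub>v (A *\<^sub>v x)"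
  proof (rule eq_vecI)
    fix i assume "i < dim_vec (A\<^sup>T *\<^sub>v x - \<mu> \<cdot>\<^sub>v (A *\<^sub>v x))"
    then have i: "i < n" using Ac by simp
    show "((A\<^sup>T - \<mu> \<cdot>\<^sub>m A) *\<^sub>v x) $ i = (A\<^sup>T *\<^sub>v x - \<mu> \<cdot>\<^sub>v (A *\<^sub>v x)) $ i"
      using i Ac x(1) by (simp add: scalar_prod_def sum_distrib_left left_diff_distrib sum_subtractf mult.assoc)
  qed (use Ac in simp)
  also have "\<dots> = 0\<^sub>v n" unfolding x(2) using Ac x(1) by (intro eq_vecI) auto
  finally show ?thesis
    using A minus_carrier_mat[of "\<mu> \<cdot>\<^sub>m A" n n "A\<^sup>T"] det_0_iff_vec_prod_zero_field[of "A\<^sup>T - \<mu> \<cdot>\<^sub>m A" n] Ac x(1) unfolding regular_at_def by auto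
qed

text \<open>The congruence \<open>P\<close> embeds the summand \<open>R'\<close> into the first
  space. A generic kernel vector of \<open>H\<close> corresponds to a kernel vector of the second
  form, which by regularity has no component at \<open>R'\<close> and so is orthogonal to that
  summand. Hence the \<open>H\<close>-components of the embedded vectors lie where \<open>H\<close>
  vanishes, and \<open>R'\<close> is the pull-back of \<open>R\<close> along the block
  \<open>Q\<close> of \<open>P\<close>. A nonzero kernel of \<open>Q\<close> would contradict
  regularity of \<open>R'\<close>, which gives both the inequality and the invertibility.\<close>

lemma regular_part_reduction:
  assumes H: "perp_isotropic F a H" and H': "H' \<in> carrier_mat a' a'"
    and R: "R \<in> carrier_mat r r" and R': "R' \<in> carrier_mat r' r'" and n: "a + r = n" "a' + r' = n"
    and c: "congr n (dsum H R) (dsum H' R')"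
    and reg: "\<And>\<mu>. \<mu> \<notin> F \<Longrightarrow> regular_at \<mu> r' R'" and F: "finite F"
  shows "r' \<le> r \<and> (r' = r \<longrightarrow> congr r R R')"
proof -
  have Hc: "H \<in> carrier_mat a a" using H by (simp add: perp_isotropic_def)
  let ?N = "dsum H R" and ?M = "dsum H' R'"
  have Nc: "?N \<in> carrier_mat n n" using dsum_carrier[OF Hc R] n by simp
  obtain P P' where P: "inv_pair n P P'" "?M = P\<^sup>T * ?N * P" using c by (auto simp: congr_def)
  note Pc = inv_pairD[OF P(1)]
  have form: "scalar_prod x (?M *\<^sub>v y) = scalar_prod (P *\<^sub>v x) (?N *\<^sub>v (P *\<^sub>v y))"
    if "x \<in> carrier_vec n" "y \<in> carrier_vec n" for x y
  proof -
    have Py: "P *\<^sub>v y \<in> carrier_vec n" using Pc that by (intro mult_mat_vec_carrier) auto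
    have w: "?N *\<^sub>v (P *\<^sub>v y) \<in> carrier_vec n" by (rule mult_mat_vec_carrier[OF Nc Py])
    have "?M *\<^sub>v y = (P\<^sup>T * ?N) *\<^sub>v (P *\<^sub>v y)"
      unfolding P(2) by (rule assoc_mult_mat_vec[of _ n n]) (use Pc Nc that in auto)
    also have "\<dots> = P\<^sup>T *\<^sub>v (?N *\<^sub>v (P *\<^sub>v y))"
      by (rule assoc_mult_mat_vec[of _ n n]) (use Pc Nc Py in auto)
    finally have "?M *\<^sub>v y = P\<^sup>T *\<^sub>v (?N *\<^sub>v (P *\<^sub>v y))" .
    then have "scalar_prod x (?M *\<^sub>v y) = scalar_prod (P\<^sup>T *\<^sub>v (?N *\<^sub>v (P *\<^sub>v y))) x"
      using that Pc w by (simp add: comm_scalar_prod[of x n])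
    also have "\<dots> = scalar_prod (?N *\<^sub>v (P *\<^sub>v y)) (P *\<^sub>v x)"
      by (rule transpose_vec_mult_scalar[OF Pc(1) that(1) w])
    also have "\<dots> = scalar_prod (P *\<^sub>v x) (?N *\<^sub>v (P *\<^sub>v y))"
      by (rule comm_scalar_prod[OF w mult_mat_vec_carrier[OF Pc(1) that(1)]])
    finally show ?thesis .
  qed
  define w where "w y = P *\<^sub>v (0\<^sub>v a' @\<^sub>v y)" for y
  have yn: "0\<^sub>v a' @\<^sub>v y \<in> carrier_vec n" if "y \<in> carrier_vec r'" for y
    using append_carrier_vec[OF zero_carrier_vec that, of a'] n(2) by metis
  have wc: "w y \<in> carrier_vec n" if "y \<in> carrier_vec r'" for y
    unfolding w_def using Pc yn[OF that] by (intro mult_mat_vec_carrier) auto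
  define w1 where "w1 y = vec_first (w y) a" for y
  define w2 where "w2 y = vec_last (w y) r" for y
  have w12: "w y = w1 y @\<^sub>v w2 y" "w1 y \<in> carrier_vec a" "w2 y \<in> carrier_vec r" if "y \<in> carrier_vec r'" for y
    using vec_first_last_append[of "w y" a r] wc[OF that] n by (auto simp: w1_def w2_def)
  have w1perp: "w1 y \<in> generic_kernel_perp F a H" if y: "y \<in> carrier_vec r'" for y
    unfolding generic_kernel_perp_def
  proof (intro CollectI conjI allI impI ballI w12(2)[OF y])
    fix \<mu> x assume mu: "\<mu> \<notin> F" and x: "x \<in> carrier_vec a" "H\<^sup>T *\<^sub>v x = \<mu> \<cdot>\<^sub>v (H *\<^sub>v x)"
    let ?x = "x @\<^sub>v 0\<^sub>v r"
    have xc: "?x \<in> carrier_vec n" using x n by auto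
    have Ht: "H\<^sup>T \<in> carrier_mat a a" "R\<^sup>T \<in> carrier_mat r r" using Hc R by auto
    have R0: "R *\<^sub>v 0\<^sub>v r = 0\<^sub>v r" "R\<^sup>T *\<^sub>v 0\<^sub>v r = 0\<^sub>v r" using R by auto
    have Nx: "?N\<^sup>T *\<^sub>v ?x = \<mu> \<cdot>\<^sub>v (?N *\<^sub>v ?x)"
      unfolding dsum_transpose dsum_mult_vec[OF Hc R x(1) zero_carrier_vec] dsum_mult_vec[OF Ht x(1) zero_carrier_vec]
        smult_append_vec x(2) R0 by simp
    define x' where "x' = P' *\<^sub>v ?x"
    have x'c: "x' \<in> carrier_vec n" unfolding x'_def using Pc xc by (intro mult_mat_vec_carrier) auto
    have Px': "P *\<^sub>v x' = ?x"
      unfolding x'_def using Pc xc by (simp flip: assoc_mult_mat_vec[of _ n n _ n])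
    have "(P\<^sup>T * X * P)\<^sup>T = P\<^sup>T * X\<^sup>T * P" if "X \<in> carrier_mat n n" for X
      using that inv_pair_dims[OF P(1)] by (simp add: mat_transpose_mult mat_assoc)
    from this[OF Nc] have Mt: "?M\<^sup>T = P\<^sup>T * ?N\<^sup>T * P" unfolding P(2) .
    have Mv: "(P\<^sup>T * X * P) *\<^sub>v x' = P\<^sup>T *\<^sub>v (X *\<^sub>v ?x)" if "X \<in> carrier_mat n n" for X
      using that Pc x'c by (simp add: assoc_mult_mat_vec[of _ n n _ n] Px')
    have "?M\<^sup>T *\<^sub>v x' = P\<^sup>T *\<^sub>v (?N\<^sup>T *\<^sub>v ?x)" unfolding Mt by (rule Mv) (use Nc in simp)
    also have "\<dots> = \<mu> \<cdot>\<^sub>v (P\<^sup>T *\<^sub>v (?N *\<^sub>v ?x))"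
      unfolding Nx using Pc Nc xc by (intro mult_mat_vec[of _ n n]) auto
    also have "\<dots> = \<mu> \<cdot>\<^sub>v (?M *\<^sub>v x')" using Mv[OF Nc] P(2) by simp
    finally have Mx': "?M\<^sup>T *\<^sub>v x' = \<mu> \<cdot>\<^sub>v (?M *\<^sub>v x')" .
    obtain u v where uv: "x' = u @\<^sub>v v" "u \<in> carrier_vec a'" "v \<in> carrier_vec r'"
      using vec_first_last_append[of x' a' r'] x'c n by (metis vec_first_carrier vec_last_carrier)
    have H't: "H'\<^sup>T \<in> carrier_mat a' a'" "R'\<^sup>T \<in> carrier_mat r' r'" using H' R' by auto
    have "(H'\<^sup>T *\<^sub>v u) @\<^sub>v (R'\<^sup>T *\<^sub>v v) = (\<mu> \<cdot>\<^sub>v (H' *\<^sub>v u)) @\<^sub>v (\<mu> \<cdot>\<^sub>v (R' *\<^sub>v v))"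
      using Mx' unfolding uv(1) dsum_transpose dsum_mult_vec[OF H' R' uv(2,3)] dsum_mult_vec[OF H't uv(2,3)] smult_append_vec .
    moreover have "H'\<^sup>T *\<^sub>v u \<in> carrier_vec a'" "\<mu> \<cdot>\<^sub>v (H' *\<^sub>v u) \<in> carrier_vec a'" using H' uv by auto
    ultimately have "R'\<^sup>T *\<^sub>v v = \<mu> \<cdot>\<^sub>v (R' *\<^sub>v v)" using append_vec_eq by blast
    \<comment> \<open>Regularity of \<open>R'\<close> at \<mu> removes the second component of the
      kernel vector.\<close>
    then have v0: "v = 0\<^sub>v r'" using regular_at_kernel[OF reg[OF mu] uv(3)] by simp
    have "scalar_prod ?x (?N *\<^sub>v w y) = scalar_prod x' (?M *\<^sub>v (0\<^sub>v a' @\<^sub>v y))"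
      unfolding form[OF x'c yn[OF y]] Px' w_def ..
    also have "\<dots> = scalar_prod u (H' *\<^sub>v 0\<^sub>v a') + scalar_prod v (R' *\<^sub>v y)"
      unfolding uv(1) dsum_mult_vec[OF H' R' zero_carrier_vec y] using uv H' R' y by (intro scalar_prod_append) auto
    also have "\<dots> = 0" unfolding v0 using H' R' y uv by simp
    finally have "scalar_prod ?x (?N *\<^sub>v w y) = 0" .
    moreover have "scalar_prod ?x (?N *\<^sub>v w y) = scalar_prod x (H *\<^sub>v w1 y) + scalar_prod (0\<^sub>v r) (R *\<^sub>v w2 y)"
      unfolding w12(1)[OF y] dsum_mult_vec[OF Hc R w12(2,3)[OF y]]
      by (rule scalar_prod_append[OF x(1) zero_carrier_vec]) (use Hc R w12(2,3)[OF y] in auto)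
    ultimately show "scalar_prod x (H *\<^sub>v w1 y) = 0" using R w12(3)[OF y] by simp
  qed
  have R'form: "scalar_prod y (R' *\<^sub>v z) = scalar_prod (w2 y) (R *\<^sub>v w2 z)"
    if y: "y \<in> carrier_vec r'" and z: "z \<in> carrier_vec r'" for y z
  proof -
    have "scalar_prod (0\<^sub>v a' @\<^sub>v y) (?M *\<^sub>v (0\<^sub>v a' @\<^sub>v z)) = scalar_prod (0\<^sub>v a') (H' *\<^sub>v 0\<^sub>v a') + scalar_prod y (R' *\<^sub>v z)"
      unfolding dsum_mult_vec[OF H' R' zero_carrier_vec z] by (rule scalar_prod_append[OF zero_carrier_vec y]) (use H' R' z in auto)
    moreover have "scalar_prod (0\<^sub>v a' @\<^sub>v y) (?M *\<^sub>v (0\<^sub>v a' @\<^sub>v z)) = scalar_prod (w y) (?N *\<^sub>v w z)"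
      unfolding form[OF yn[OF y] yn[OF z]] w_def ..
    moreover have "scalar_prod (w y) (?N *\<^sub>v w z) = scalar_prod (w1 y) (H *\<^sub>v w1 z) + scalar_prod (w2 y) (R *\<^sub>v w2 z)"
      unfolding w12(1)[OF y] w12(1)[OF z] dsum_mult_vec[OF Hc R w12(2,3)[OF z]]
      using Hc R w12(2,3)[OF y] w12(2,3)[OF z] by (intro scalar_prod_append) auto
    moreover have "scalar_prod (w1 y) (H *\<^sub>v w1 z) = 0"
      using H w1perp[OF y] w1perp[OF z] by (simp add: perp_isotropic_def)
    ultimately show ?thesis using H' by simp
  qed
  \<comment> \<open>The map \<open>w2\<close>, from the second summand to the second summand, is the
    lower right block of \<open>P\<close>.\<close>
  obtain p11 p12 p21 Q where sp: "split_block P a a' = (p11, p12, p21, Q)" by (metis prod_cases4)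
  note sb = split_block[OF sp, of r r']
  have dP: "dim_row P = a + r" "dim_col P = a' + r'" using Pc n by auto
  note sb = sb[OF dP]
  have w2Q: "w2 y = Q *\<^sub>v y" if y: "y \<in> carrier_vec r'" for y
  proof -
    have "w y = (p11 *\<^sub>v 0\<^sub>v a' + p12 *\<^sub>v y) @\<^sub>v (p21 *\<^sub>v 0\<^sub>v a' + Q *\<^sub>v y)"
      unfolding w_def by (subst sb(5)) (rule four_block_mat_mult_vec, use sb y in auto)
    then have "w1 y @\<^sub>v w2 y = (p11 *\<^sub>v 0\<^sub>v a' + p12 *\<^sub>v y) @\<^sub>v (p21 *\<^sub>v 0\<^sub>v a' + Q *\<^sub>v y)"
      using w12(1)[OF y] by simp
    moreover have "p11 *\<^sub>v 0\<^sub>v a' + p12 *\<^sub>v y \<in> carrier_vec a" using sb y by auto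
    ultimately have "w2 y = p21 *\<^sub>v 0\<^sub>v a' + Q *\<^sub>v y" using append_vec_eq[OF w12(2)[OF y]] by blast
    also have "\<dots> = Q *\<^sub>v y" using sb y by (intro eq_vecI) auto
    finally show ?thesis .
  qed
  have Qc: "Q \<in> carrier_mat r r'" by (rule sb(4))
  have RQ: "R' = Q\<^sup>T * R * Q"
  proof (rule eq_matI)
    fix i j assume "i < dim_row (Q\<^sup>T * R * Q)" "j < dim_col (Q\<^sup>T * R * Q)"
    then have ij: "i < r'" "j < r'" using Qc by auto
    let ?e = "unit_vec r' :: nat \<Rightarrow> complex Matrix.vec"
    have Qe: "Q *\<^sub>v ?e i \<in> carrier_vec r" "Q *\<^sub>v ?e j \<in> carrier_vec r" using Qc by (auto intro!: mult_mat_vec_carrier)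
    have w: "R *\<^sub>v (Q *\<^sub>v ?e j) \<in> carrier_vec r" by (rule mult_mat_vec_carrier[OF R Qe(2)])
    have "R' $$ (i, j) = scalar_prod (?e i) (R' *\<^sub>v ?e j)" using ij R' by simp
    also have "\<dots> = scalar_prod (Q *\<^sub>v ?e i) (R *\<^sub>v (Q *\<^sub>v ?e j))"
      using R'form[of "?e i" "?e j"] w2Q by simp
    also have "\<dots> = scalar_prod (R *\<^sub>v (Q *\<^sub>v ?e j)) (Q *\<^sub>v ?e i)" by (rule comm_scalar_prod[OF Qe(1) w])
    also have "\<dots> = scalar_prod (Q\<^sup>T *\<^sub>v (R *\<^sub>v (Q *\<^sub>v ?e j))) (?e i)"
      by (rule transpose_vec_mult_scalar[symmetric, OF Qc _ w]) simp
    also have "Q\<^sup>T *\<^sub>v (R *\<^sub>v (Q *\<^sub>v ?e j)) = (Q\<^sup>T * R * Q) *\<^sub>v ?e j"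
    proof -
      have "(Q\<^sup>T * R * Q) *\<^sub>v ?e j = (Q\<^sup>T * R) *\<^sub>v (Q *\<^sub>v ?e j)"
        using Qc R by (intro assoc_mult_mat_vec[of _ r' r]) auto
      also have "\<dots> = Q\<^sup>T *\<^sub>v (R *\<^sub>v (Q *\<^sub>v ?e j))"
        using Qc R Qe by (intro assoc_mult_mat_vec[of _ r' r]) auto
      finally show ?thesis by simp
    qed
    also have "scalar_prod ((Q\<^sup>T * R * Q) *\<^sub>v ?e j) (?e i) = (Q\<^sup>T * R * Q) $$ (i, j)"
      using ij Qc R by (simp del: index_mult_mat(1))
    finally show "R' $$ (i, j) = (Q\<^sup>T * R * Q) $$ (i, j)" .
  qed (use Qc R' in auto)
  obtain \<mu> where mu: "\<mu> \<notin> F" using F by (metis ex_new_if_finite infinite_UNIV_char_0)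
  have d: "dim_row Q = r" "dim_col Q = r'" "dim_row R = r" "dim_col R = r" using Qc R by auto
  have R'T: "R'\<^sup>T = Q\<^sup>T * R\<^sup>T * Q" unfolding RQ using d by (simp add: mat_transpose_mult mat_assoc)
  have le: "r' \<le> r"
  proof (rule ccontr)
    assume "\<not> r' \<le> r"
    then obtain x where x: "x \<in> carrier_vec r'" "x \<noteq> 0\<^sub>v r'" "Q *\<^sub>v x = 0\<^sub>v r"
      using wide_kernel[OF Qc] by auto
    have z: "(Q\<^sup>T * X * Q) *\<^sub>v x = 0\<^sub>v r'" if X: "X \<in> carrier_mat r r" for X
    proof -
      have "(Q\<^sup>T * X * Q) *\<^sub>v x = (Q\<^sup>T * X) *\<^sub>v (Q *\<^sub>v x)"
        using Qc X x by (intro assoc_mult_mat_vec[of _ r' r]) auto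
      then show ?thesis unfolding x(3) using d X by simp
    qed
    have z1: "R'\<^sup>T *\<^sub>v x = 0\<^sub>v r'" unfolding R'T by (rule z) (use R in simp)
    have z2: "R' *\<^sub>v x = 0\<^sub>v r'" unfolding RQ by (rule z[OF R])
    have "x = 0\<^sub>v r'" by (rule regular_at_kernel[OF reg[OF mu] x(1)], unfold z1 z2) auto
    with x(2) show False by simp
  qed
  moreover have "congr r R R'" if "r' = r"
  proof -
    have "\<exists>Q'. inv_pair r Q Q'"
    proof (rule inv_pair_of_kernel)
      show "Q \<in> carrier_mat r r" using Qc that by simp
      fix x assume x: "x \<in> carrier_vec r" "Q *\<^sub>v x = 0\<^sub>v r"
      have z: "(Q\<^sup>T * X * Q) *\<^sub>v x = 0\<^sub>v r'" if X: "X \<in> carrier_mat r r" for X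
      proof -
        have "(Q\<^sup>T * X * Q) *\<^sub>v x = (Q\<^sup>T * X) *\<^sub>v (Q *\<^sub>v x)"
          using Qc X x \<open>r' = r\<close> by (intro assoc_mult_mat_vec[of _ r' r]) auto
        then show ?thesis unfolding x(2) using d X by simp
      qed
      have z1: "R'\<^sup>T *\<^sub>v x = 0\<^sub>v r'" unfolding R'T by (rule z) (use R in simp)
      have z2: "R' *\<^sub>v x = 0\<^sub>v r'" unfolding RQ by (rule z[OF R])
      have "x = 0\<^sub>v r'" by (rule regular_at_kernel[OF reg[OF mu] x(1)[folded that]], unfold z1 z2) auto
      then show "x = 0\<^sub>v r" unfolding that .
    qed
    then show ?thesis using congrI[OF R _ RQ] by blast
  qed
  ultimately show ?thesis by blast
qed

section \<open>Telling the entries apart\<close>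

definition entry_profile :: "block list \<Rightarrow> nat list" where
  "entry_profile bs = sort (concat (map block_profile bs))"

text \<open>Blocks A leave no trace in the profile, but the sizes that remain up to 7 determine
  them: 3, 5 and 7 belong to one block and 6 to two of size 3. The offsets 10 and 20 exceed every
  block size, so the codes do not overlap.\<close>

lemma distinct_entry_profiles: "distinct (map entry_profile entries)"
  by code_simp

text \<open>Isotropy is stated for every finite exceptional set, so that two entries can be compared
  outside the union of their sets; only the Jordan data bring a set of their own.\<close>

lemma entry_regular_part:
  assumes bs: "bs \<in> set entries" and N: "N \<in> entry_mats bs"
  shows "\<exists>a r H R. a + r = 7 \<and> H \<in> carrier_mat a a \<and> R \<in> carrier_mat r r \<and> congr 7 N (dsum H R) \<and>
    (\<forall>F. finite F \<longrightarrow> perp_isotropic F a H) \<and>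
    (\<exists>F. finite F \<and> (\<forall>\<mu>. \<mu> \<notin> F \<longrightarrow> (\<exists>js. asym_nf \<mu> R js \<and> mset (map (jordan_code \<mu>) js) = mset (entry_profile bs))))"
proof -
  obtain Ns where Ns: "list_all2 (\<in>) Ns (map block_mats bs)" "N = diag_block_mat Ns"
    using N by (auto simp: entry_mats_def listset_iff)
  define ps where "ps = zip bs Ns"
  have len: "length bs = length Ns" using list_all2_lengthD[OF Ns(1)] by simp
  have fst_ps: "map fst ps = bs" "map snd ps = Ns" using len by (simp_all add: ps_def)
  have mem: "snd p \<in> block_mats (fst p)" if "p \<in> set ps" for p
    using that Ns(1) len by (auto simp: ps_def set_zip list_all2_conv_all_nth)
  define p1 where "p1 = filter (\<lambda>p. singular_block (fst p)) ps"
  define p2 where "p2 = filter (\<lambda>p. \<not> singular_block (fst p)) ps"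
  have m: "mset ps = mset (p1 @ p2)" by (simp add: p1_def p2_def)
  have sq: "\<forall>M\<in>set Ns. square_mat M"
  proof
    fix M assume "M \<in> set Ns"
    then obtain p where "p \<in> set ps" "M = snd p" using fst_ps(2) by (metis imageE set_map)
    then show "square_mat M" using mem[of p] block_mats_dim[of M "fst p"] by simp
  qed
  have mN: "mset Ns = mset (map snd p1 @ map snd p2)"
    using m fst_ps(2) by (metis map_append mset_map)
  have size: "sum_list (map dim_row (map snd qs)) = sum_list (map (block_size \<circ> fst) qs)"
    if "set qs \<subseteq> set ps" for qs
    unfolding map_map
  proof (rule arg_cong[where f = sum_list], rule map_cong[OF refl])
    fix p assume "p \<in> set qs"
    then show "(dim_row \<circ> snd) p = (block_size \<circ> fst) p" using mem[of p] that block_mats_dim[of "snd p" "fst p"] by auto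
  qed
  let ?a = "sum_list (map (block_size \<circ> fst) p1)" and ?r = "sum_list (map (block_size \<circ> fst) p2)"
  have sub: "set p1 \<subseteq> set ps" "set p2 \<subseteq> set ps" by (auto simp: p1_def p2_def)
  let ?H = "diag_block_mat (map snd p1)" and ?R = "diag_block_mat (map snd p2)"
  have mset_set: "set Ns = set (map snd p1 @ map snd p2)" using mN by (rule mset_eq_setD)
  have Hc: "?H \<in> carrier_mat ?a ?a"
    using diag_block_carrier[of "map snd p1"] sq unfolding mset_set size[OF sub(1)] by auto
  have Rc: "?R \<in> carrier_mat ?r ?r"
    using diag_block_carrier[of "map snd p2"] sq unfolding mset_set size[OF sub(2)] by auto
  have N7: "N \<in> carrier_mat 7 7" by (rule entry_mats_carrier[OF bs N])
  have s7: "sum_list (map dim_row Ns) = 7" using diag_block_carrier[OF sq] N7 Ns(2) by (metis carrier_matD(1))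
  have "sum_list (map dim_row Ns) = sum_list (map dim_row (map snd p1 @ map snd p2))"
    using mN by (metis mset_map sum_mset_sum_list)
  then have ar: "?a + ?r = 7" using s7 size[OF sub(1)] size[OF sub(2)] by simp
  have "congr 7 N (dsum ?H ?R)"
    using congr_diag_block_mset[OF mN sq] unfolding s7 Ns(2) diag_block_append .
  moreover have "\<forall>F. finite F \<longrightarrow> perp_isotropic F ?a ?H"
    using perp_isotropic_singular_blocks[of _ p1] mem by (auto simp: p1_def)
  moreover have "\<exists>F. finite F \<and> (\<forall>\<mu>. \<mu> \<notin> F \<longrightarrow> (\<exists>js. asym_nf \<mu> ?R js \<and> mset (map (jordan_code \<mu>) js) = mset (entry_profile bs)))"
  proof -
    have "concat (map (block_profile \<circ> fst) p1) = []" 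
    proof -
      have "block_profile b = []" if "singular_block b" for b using that by (cases b) auto
      then show ?thesis by (auto simp: p1_def)
    qed
    then have "mset (concat (map (block_profile \<circ> fst) p2)) = mset (concat (map (block_profile \<circ> fst) (p1 @ p2)))"
      by (simp add: concat_eq_Nil_conv)
    also have "\<dots> = mset (concat (map (block_profile \<circ> fst) ps))"
      using m by (metis mset_concat mset_map sum_mset_sum_list)
    also have "\<dots> = mset (entry_profile bs)"
      using fst_ps(1) by (simp add: entry_profile_def flip: map_map)
    finally have e: "mset (concat (map (block_profile \<circ> fst) p2)) = mset (entry_profile bs)" .
    obtain F where "finite F" "\<forall>\<mu>. \<mu> \<notin> F \<longrightarrow> (\<exists>js. asym_nf \<mu> ?R js \<and>
        map (jordan_code \<mu>) js = concat (map (block_profile \<circ> fst) p2))"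
      using blocks_profile_asym_nf[of p2] mem by (auto simp: p2_def)
    then show ?thesis using e by metis
  qed
  ultimately show ?thesis using ar Hc Rc by blast
qed

text \<open>Reduction in both directions makes the regular parts equally large and hence congruent;
  a single value \<mu> outside both exceptional sets then yields the same Jordan blocks.\<close>

theorem entries_not_congruent:
  assumes bs: "bs \<in> set entries" "N \<in> entry_mats bs" and cs: "cs \<in> set entries" "M \<in> entry_mats cs"
    and c: "congr 7 N M"
  shows "entry_profile bs = entry_profile cs"
proof -
  obtain a r H R F where N: "a + r = 7" "H \<in> carrier_mat a a" "R \<in> carrier_mat r r" "congr 7 N (dsum H R)"
    "\<And>F. finite F \<Longrightarrow> perp_isotropic F a H" "finite F"
    "\<And>\<mu>. \<mu> \<notin> F \<Longrightarrow> \<exists>js. asym_nf \<mu> R js \<and> mset (map (jordan_code \<mu>) js) = mset (entry_profile bs)"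
    using entry_regular_part[OF bs] by (elim exE conjE) metis
  obtain a' r' H' R' F' where M: "a' + r' = 7" "H' \<in> carrier_mat a' a'" "R' \<in> carrier_mat r' r'" "congr 7 M (dsum H' R')"
    "\<And>F. finite F \<Longrightarrow> perp_isotropic F a' H'" "finite F'"
    "\<And>\<mu>. \<mu> \<notin> F' \<Longrightarrow> \<exists>js. asym_nf \<mu> R' js \<and> mset (map (jordan_code \<mu>) js) = mset (entry_profile cs)"
    using entry_regular_part[OF cs] by (elim exE conjE) metis
  define G where "G = F \<union> F'"
  have G: "finite G" using N M by (simp add: G_def)
  have NM: "congr 7 (dsum H R) (dsum H' R')" using congr_trans[OF congr_sym[OF N(4)] congr_trans[OF c M(4)]] .
  have regN: "regular_at \<mu> r R" if "\<mu> \<notin> G" for \<mu> using N(7)[of \<mu>] that regular_at_asym_nf[OF _ N(3)] by (auto simp: G_def)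
  have regM: "regular_at \<mu> r' R'" if "\<mu> \<notin> G" for \<mu> using M(7)[of \<mu>] that regular_at_asym_nf[OF _ M(3)] by (auto simp: G_def)
  have 1: "r' \<le> r \<and> (r' = r \<longrightarrow> congr r R R')"
    by (rule regular_part_reduction[OF N(5)[OF G] M(2) N(3) M(3) N(1) M(1) NM regM G])
  have 2: "r \<le> r' \<and> (r = r' \<longrightarrow> congr r' R' R)"
    by (rule regular_part_reduction[OF M(5)[OF G] N(2) M(3) N(3) M(1) N(1) congr_sym[OF NM] regN G])
  have RR: "congr r R R'" using 1 2 by simp
  obtain \<mu> where mu: "\<mu> \<notin> G" using G by (metis ex_new_if_finite infinite_UNIV_char_0)
  obtain js where js: "asym_nf \<mu> R js" "mset (map (jordan_code \<mu>) js) = mset (entry_profile bs)"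
    using N(7) mu by (auto simp: G_def)
  obtain ks where ks: "asym_nf \<mu> R' ks" "mset (map (jordan_code \<mu>) ks) = mset (entry_profile cs)"
    using M(7) mu by (auto simp: G_def)
  have "mset js = mset ks" by (rule asym_nf_unique[OF asym_nf_congr[OF RR js(1)] ks(1)])
  then have "mset (entry_profile bs) = mset (entry_profile cs)" using js(2) ks(2) by (metis mset_map)
  then show ?thesis unfolding entry_profile_def by (simp add: properties_for_sort)
qed

section \<open>Algebras and bilinear forms\<close>

lemma of_nat_8_surj: "\<exists>i\<in>{1..8}. j = (of_nat i :: 8)"
proof -
  have inj: "inj_on (of_nat :: nat \<Rightarrow> 8) {1..8}" by (rule inj_onI) (simp only: of_nat_8_eq_iff)
  have "of_nat ` {1..8} = (UNIV :: 8 set)"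
    by (rule card_subset_eq) (use card_image[OF inj] in simp_all)
  then show ?thesis by blast
qed

definition head :: "complex ^ 8 \<Rightarrow> complex Matrix.vec" where
  "head u = Matrix.vec 7 (\<lambda>i. vec_nth u (of_nat (Suc i)))"

definition coord8 :: "complex ^ 8 \<Rightarrow> complex" where
  "coord8 u = vec_nth u (of_nat 8)"

definition of_head :: "complex Matrix.vec \<Rightarrow> complex ^ 8" where
  "of_head x = (\<Sum>i<7. x $ i *s x_basis (Suc i))"

lemma head_carrier [simp]: "head u \<in> carrier_vec 7"
  by (simp add: head_def)

lemma head_add: "head (u + v) = head u + head v"
  and head_smult: "head (c *s u) = c \<cdot>\<^sub>v head u"
  and coord8_add: "coord8 (u + v) = coord8 u + coord8 v"
  and coord8_smult: "coord8 (c *s u) = c * coord8 u"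
  by (auto simp: head_def coord8_def)

lemma eq_coords_iff: "u = v \<longleftrightarrow> head u = head v \<and> coord8 u = coord8 v"
proof (intro iffI conjI)
  assume e: "head u = head v \<and> coord8 u = coord8 v"
  have "vec_nth u (of_nat i) = vec_nth v (of_nat i)" if i: "i \<in> {1..8}" for i
  proof (cases "i = 8")
    case True
    then show ?thesis using e by (simp only: coord8_def)
  next
    case False
    then obtain k where "i = Suc k" "k < 7" using i by (cases i) auto
    then have "head u $ k = vec_nth u (of_nat i)" "head v $ k = vec_nth v (of_nat i)"
      by (simp_all add: head_def del: of_nat_Suc)
    then show ?thesis using e by simp
  qed
  then show "u = v" using of_nat_8_surj by (metis vec_eq_iff)
qed auto

lemma head_x_basis:
  assumes "i < 7"
  shows "head (x_basis (Suc i)) = unit_vec 7 i"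
  by (rule eq_vecI) (use assms in \<open>auto simp: head_def x_basis_nth simp del: of_nat_Suc\<close>)

lemma coord8_x_basis:
  assumes "i < 7"
  shows "coord8 (x_basis (Suc i)) = 0"
  unfolding coord8_def by (subst x_basis_nth) (use assms in auto)

lemma head_x8: "head (x_basis 8) = 0\<^sub>v 7"
  by (rule eq_vecI) (auto simp: head_def x_basis_nth simp del: of_nat_Suc)

lemma coord8_x8: "coord8 (x_basis 8) = 1"
  unfolding coord8_def by (subst x_basis_nth) auto

lemma head_of_head:
  assumes "x \<in> carrier_vec 7"
  shows "head (of_head x) = x"
proof (rule eq_vecI)
  fix i assume "i < dim_vec x"
  then have i: "i < 7" using assms by simp
  have "head (of_head x) $ i = (\<Sum>l<7. x $ l * vec_nth (x_basis (Suc l)) (of_nat (Suc i)))"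
    using i by (simp add: head_def of_head_def del: of_nat_Suc)
  also have "\<dots> = (\<Sum>l<7. if l = i then x $ i else 0)"
    using i by (intro sum.cong refl) (subst x_basis_nth, auto)
  finally show "head (of_head x) $ i = x $ i" using i by simp
qed (use assms in \<open>simp add: head_def\<close>)

lemma coord8_of_head: "coord8 (of_head x) = 0"
proof -
  have "coord8 (of_head x) = (\<Sum>l<7. x $ l * coord8 (x_basis (Suc l)))"
    by (simp add: coord8_def of_head_def)
  also have "\<dots> = 0" by (rule sum.neutral) (simp add: coord8_x_basis)
  finally show ?thesis .
qed

lemma coords_expansion: "u = of_head (head u) + coord8 u *s x_basis 8"
  by (subst eq_coords_iff) (simp add: head_add head_smult coord8_add coord8_smult head_of_head coord8_of_head head_x8 coord8_x8)

lemma head_zero: "head 0 = 0\<^sub>v 7" and coord8_zero: "coord8 0 = 0"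
  by (auto simp: head_def coord8_def)

lemma x8_nonzero: "x_basis 8 \<noteq> 0"
  using coord8_x8 coord8_zero by force

lemma alg_prod_eq_form:
  assumes "N \<in> carrier_mat 7 7"
  shows "alg_prod N u v = scalar_prod (head u) (N *\<^sub>v head v) *s x_basis 8"
proof -
  have "(\<Sum>i=1..7. \<Sum>j=1..7. N $$ (i - 1, j - 1) * vec_nth u (of_nat i) * vec_nth v (of_nat j))
     = (\<Sum>i<7. \<Sum>j<7. N $$ (i, j) * head u $ i * head v $ j)"
    unfolding One_nat_def sum.atLeast1_atMost_eq by (intro sum.cong refl) (simp add: head_def del: of_nat_Suc)
  also have "\<dots> = (\<Sum>i<7. head u $ i * (\<Sum>j<7. N $$ (i, j) * head v $ j))"
    by (simp add: sum_distrib_left mult.assoc mult.left_commute)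
  also have "\<dots> = scalar_prod (head u) (N *\<^sub>v head v)"
    using assms by (simp add: scalar_prod_def atLeast0LessThan head_def)
  finally show ?thesis by (simp add: alg_prod_def)
qed

text \<open>Products are multiples of \<open>x_basis 8\<close>, which annihilates everything, so all
  terms of the Leibniz identity are zero.\<close>

lemma leibniz_alg_prod: "leibniz_algebra (*s) (alg_prod N)"
proof -
  have vs: "vector_space ((*s) :: complex \<Rightarrow> complex ^ 8 \<Rightarrow> complex ^ 8)" by (rule vec.vector_space_axioms)
  have z: "alg_prod N (t *s x_basis 8) v = 0" "alg_prod N v (t *s x_basis 8) = 0" for t v
  proof -
    have "vec_nth (x_basis 8) (of_nat i :: 8) = 0" if "i \<in> {1..7}" for i
      using that by (subst x_basis_nth) auto
    then show "alg_prod N (t *s x_basis 8) v = 0" "alg_prod N v (t *s x_basis 8) = 0"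
      by (simp_all add: alg_prod_def)
  qed
  have 1: "Vector_Spaces.linear (*s) (*s) (\<lambda>b. alg_prod N a b)" for a
    unfolding Vector_Spaces.linear_iff
    by (simp add: vs alg_prod_def algebra_simps sum.distrib vec.scale_left_distrib sum_distrib_left)
  have 2: "Vector_Spaces.linear (*s) (*s) (\<lambda>a. alg_prod N a b)" for b
    unfolding Vector_Spaces.linear_iff
    by (simp add: vs alg_prod_def algebra_simps sum.distrib vec.scale_left_distrib sum_distrib_left)
  have 3: "alg_prod N a (alg_prod N b c) = 0" "alg_prod N (alg_prod N a b) c = 0" for a b c
    unfolding alg_prod_def[of N b c] alg_prod_def[of N a b] by (rule z)+
  show ?thesis
    by (intro leibniz_algebra.intro leibniz_algebra_axioms.intro vs 1 2) (simp add: 3)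
qed

text \<open>A nonzero head is outside one of the two kernels, and some basis vector detects this. So
  one multiplication leads from any element that is not a multiple of \<open>x_basis 8\<close> to a
  nonzero multiple of it.\<close>

lemma trivial_radical_pairing:
  assumes N: "N \<in> carrier_mat 7 7" "trivial_radical 7 N" and u: "head u \<noteq> 0\<^sub>v 7"
  shows "\<exists>v t. t \<noteq> 0 \<and> (alg_prod N u v = t *s x_basis 8 \<or> alg_prod N v u = t *s x_basis 8)"
proof -
  consider "N *\<^sub>v head u \<noteq> 0\<^sub>v 7" | "N\<^sup>T *\<^sub>v head u \<noteq> 0\<^sub>v 7"
    using N(2) u unfolding trivial_radical_def by (metis head_carrier)
  then show ?thesis
  proof cases
    case 1
    then obtain i where i: "i < 7" "(N *\<^sub>v head u) $ i \<noteq> 0" using N(1) by (metis carrier_matD(1) dim_mult_mat_vec eq_vecI index_zero_vec)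
    have "alg_prod N (x_basis (Suc i)) u = (N *\<^sub>v head u) $ i *s x_basis 8"
      unfolding alg_prod_eq_form[OF N(1)] head_x_basis[OF i(1)] using i(1) N(1) by simp
    then show ?thesis using i(2) by blast
  next
    case 2
    then obtain i where i: "i < 7" "(N\<^sup>T *\<^sub>v head u) $ i \<noteq> 0"
      using N(1) by (metis carrier_matD(2) dim_mult_mat_vec eq_vecI index_transpose_mat(2) index_zero_vec)
    have "scalar_prod (head u) (N *\<^sub>v unit_vec 7 i) = scalar_prod (N\<^sup>T *\<^sub>v head u) (unit_vec 7 i)"
      using N(1) by (intro transpose_vec_mult_scalar[symmetric]) auto
    then have "alg_prod N u (x_basis (Suc i)) = (N\<^sup>T *\<^sub>v head u) $ i *s x_basis 8"
      unfolding alg_prod_eq_form[OF N(1)] head_x_basis[OF i(1)] using i(1) N(1) by simp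
    then show ?thesis using i(2) by blast
  qed
qed

lemma trivial_radical_target_algebra:
  assumes N: "N \<in> carrier_mat 7 7" "trivial_radical 7 N"
  shows "target_algebra (*s) (alg_prod N)"
proof -
  interpret L: leibniz_algebra "(*s)" "alg_prod N" by (rule leibniz_alg_prod)
  let ?z = "x_basis 8"
  have head_unit: "head (x_basis (Suc 0)) \<noteq> 0\<^sub>v 7" by (subst head_x_basis) auto
  obtain u v t where t: "t \<noteq> 0" "alg_prod N u v = t *s ?z"
    using trivial_radical_pairing[OF N head_unit] by blast
  have A2: "L.alg_power 2 = vec.span {?z}"
  proof -
    have "?z = (1 / t) *s alg_prod N u v" using t by simp
    then have "?z \<in> vec.span {alg_prod N a b | a b. True}"
      by (metis (mono_tags, lifting) mem_Collect_eq vec.span_base vec.span_scale)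
    then have "vec.span {?z} \<subseteq> vec.span {alg_prod N a b | a b. True}" by (intro vec.span_minimal) auto
    moreover have "{alg_prod N a b | a b. True} \<subseteq> vec.span {?z}"
      by (auto simp: alg_prod_def intro: vec.span_base vec.span_scale)
    then have "vec.span {alg_prod N a b | a b. True} \<subseteq> vec.span {?z}" by (intro vec.span_minimal) auto
    ultimately show ?thesis by (simp add: numeral_2_eq_2)
  qed
  have central: "alg_prod N a b = 0" if b: "b \<in> vec.span {?z}" for a b
  proof -
    obtain s where "b = s *s ?z" using b by (auto simp: vec.span_singleton)
    then show ?thesis using N(1) by (simp add: alg_prod_eq_form head_smult head_x8)
  qed
  have nil: "L.is_nilpotent"
  proof -
    have "L.alg_power 3 = vec.span {alg_prod N a b | a b. b \<in> vec.span {?z}}"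
      using A2 by (simp add: numeral_3_eq_3 numeral_2_eq_2)
    also have "\<dots> \<subseteq> vec.span {0}" by (rule vec.span_mono) (auto simp: central)
    finally have "L.alg_power 3 \<subseteq> {0}" by simp
    moreover have "0 \<in> L.alg_power 3" by (simp add: numeral_3_eq_3 vec.span_zero)
    ultimately show ?thesis unfolding L.is_nilpotent_def by (intro exI[of _ 3]) auto
  qed
  have d2: "vec.dim (L.alg_power 2) = 1"
  proof -
    have "vec.independent {?z}" using x8_nonzero by (simp add: vec.dependent_single)
    then show ?thesis unfolding A2 using vec.dim_eq_card_independent[of "{?z}"] by simp
  qed
  have d: "vec.dim (UNIV :: (complex ^ 8) set) = 8"
    by (simp add: vec.dim_UNIV vec.dimension_def card_cart_basis)
  have "\<not> L.is_lie"
  proof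
    assume lie: "L.is_lie"
    have sq: "alg_prod N w w = 0" for w
    proof -
      have "alg_prod N w w \<in> L.Leib" unfolding L.Leib_def by (rule vec.span_base) auto
      then show ?thesis using lie by (simp add: L.is_lie_def)
    qed
    have skew: "alg_prod N a b = - alg_prod N b a" for a b
    proof -
      have l: "alg_prod N (a + b) w = alg_prod N a w + alg_prod N b w"
        "alg_prod N w (a + b) = alg_prod N w a + alg_prod N w b" for w
        using L.linear_left L.linear_right by (simp_all add: Vector_Spaces.linear_iff)
      have "alg_prod N (a + b) (a + b) = 0" by (rule sq)
      then show ?thesis unfolding l by (simp add: sq eq_neg_iff_add_eq_0 add.commute)
    qed
    have NT: "N\<^sup>T = - N"
    proof (rule eq_matI)
      fix i j assume "i < dim_row (- N)" "j < dim_col (- N)"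
      then have ij: "i < 7" "j < 7" using N(1) by auto
      have e: "alg_prod N (x_basis (Suc i)) (x_basis (Suc j)) = N $$ (i, j) *s ?z" if "i < 7" "j < 7" for i j
        using that by (simp add: alg_prod_x_basis)
      have "N $$ (j, i) *s ?z = (- N $$ (i, j)) *s ?z"
        using skew[of "x_basis (Suc j)" "x_basis (Suc i)"] unfolding e[OF ij] e[OF ij(2,1)] by simp
      then have "N $$ (j, i) = - N $$ (i, j)" using x8_nonzero by (simp only: vec.scale_cancel_right) simp
      then show "N\<^sup>T $$ (i, j) = (- N) $$ (i, j)" using ij N(1) by simp
    qed (use N(1) in auto)
    \<comment> \<open>a skew form of odd size is degenerate\<close>
    have "Determinant.det N = Determinant.det (N\<^sup>T)" using N(1) by (simp add: Determinant.det_transpose)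
    also have "\<dots> = Determinant.det ((- 1) \<cdot>\<^sub>m N)" unfolding NT by (rule arg_cong[where f = Determinant.det]) (rule eq_matI, auto)
    also have "\<dots> = - Determinant.det N" using N(1) by (simp add: det_smult)
    finally have "Determinant.det N = 0" by simp
    then obtain x where x: "x \<in> carrier_vec 7" "x \<noteq> 0\<^sub>v 7" "N *\<^sub>v x = 0\<^sub>v 7"
      using det_0_iff_vec_prod_zero_field[OF N(1)] by auto
    have "N\<^sup>T *\<^sub>v x = - (N *\<^sub>v x)" unfolding NT using N(1) x(1) by (intro eq_vecI) auto
    then have "N\<^sup>T *\<^sub>v x = 0\<^sub>v 7" unfolding x(3) by auto
    then show False using N(2) x unfolding trivial_radical_def by blast
  qed
  moreover have "\<not> L.is_split"
  proof
    assume "L.is_split"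
    then obtain I J where IJ: "L.is_ideal I" "L.is_ideal J" "I \<noteq> {0}" "J \<noteq> {0}" "I \<inter> J = {0}"
      unfolding L.is_split_def by blast
    \<comment> \<open>Every nonzero ideal contains \<open>?z\<close>, so two of them cannot meet in
      0 only.\<close>
    have z: "?z \<in> K" if K: "L.is_ideal K" "K \<noteq> {0}" for K
    proof -
      have sub: "vec.subspace K" using K(1) by (simp add: L.is_ideal_def)
      have scale: "?z \<in> K" if "s \<noteq> 0" "s *s ?z \<in> K" for s
        using vec.subspace_scale[OF sub that(2), of "1 / s"] that(1) by simp
      obtain a where a: "a \<in> K" "a \<noteq> 0" using K(2) vec.subspace_0[OF sub] by blast
      show ?thesis
      proof (cases "head a = 0\<^sub>v 7")
        case True
        have "a = coord8 a *s ?z"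
          using True by (simp add: eq_coords_iff head_smult head_x8 coord8_smult coord8_x8)
        then show ?thesis using scale[of "coord8 a"] a by fastforce
      next
        case False
        then show ?thesis
          using trivial_radical_pairing[OF N False] K(1) a(1) scale unfolding L.is_ideal_def by metis
      qed
    qed
    then show False using z[OF IJ(1,3)] z[OF IJ(2,4)] IJ(5) x8_nonzero by blast
  qed
  ultimately show ?thesis unfolding target_algebra_def
    using L.leibniz_algebra_axioms nil d d2 by blast
qed

lemma congr_alg_isomorphic:
  assumes "congr 7 A N"
  shows "alg_isomorphic (*s) (alg_prod A) (*s) (alg_prod N)"
proof -
  obtain P P' where P: "inv_pair 7 P P'" "N = P\<^sup>T * A * P" and A: "A \<in> carrier_mat 7 7"
    using assms by (auto simp: congr_def)
  have N: "N \<in> carrier_mat 7 7" using congr_carrier[OF assms] by simp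
  note Pc = inv_pairD[OF P(1)]
  have canc: "P *\<^sub>v (P' *\<^sub>v x) = x" "P' *\<^sub>v (P *\<^sub>v x) = x" if "x \<in> carrier_vec 7" for x
    using Pc that by (simp_all flip: assoc_mult_mat_vec[of _ 7 7 _ 7])
  \<comment> \<open>Acts by \<open>Q\<close> on the first seven coordinates and fixes the last one.
    From \<open>N = P^T A P\<close> it is the inverse \<open>P'\<close> that turns the product of
    \<open>A\<close> into that of \<open>N\<close>.\<close>
  define f where "f Q u = of_head (Q *\<^sub>v head u) + coord8 u *s x_basis 8" for Q u
  have hf: "head (f Q u) = Q *\<^sub>v head u" "coord8 (f Q u) = coord8 u" if "Q \<in> carrier_mat 7 7" for Q u
  proof -
    have "Q *\<^sub>v head u \<in> carrier_vec 7" by (rule mult_mat_vec_carrier[OF that head_carrier])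
    then show "head (f Q u) = Q *\<^sub>v head u" "coord8 (f Q u) = coord8 u"
      by (simp_all add: f_def head_add coord8_add head_smult coord8_smult head_of_head coord8_of_head head_x8 coord8_x8)
  qed
  have lin: "Vector_Spaces.linear (*s) (*s) (f P')"
    unfolding Vector_Spaces.linear_iff
    using mult_add_distrib_mat_vec[OF Pc(2) head_carrier head_carrier] mult_mat_vec[OF Pc(2) head_carrier]
    by (simp add: vec.vector_space_axioms eq_coords_iff[of "f _ _"] hf[OF Pc(2)] head_add head_smult coord8_add coord8_smult)
  have inv: "f P (f P' u) = u" "f P' (f P u) = u" for u
    by (simp_all add: eq_coords_iff hf[OF Pc(1)] hf[OF Pc(2)] canc)
  have bij: "bij (f P')" by (rule o_bij[of "f P"]) (auto simp: inv)
  have "f P' (alg_prod A u v) = alg_prod N (f P' u) (f P' v)" for u v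
  proof -
    have w: "A *\<^sub>v head v \<in> carrier_vec 7" by (rule mult_mat_vec_carrier[OF A head_carrier])
    have Pv: "P' *\<^sub>v head v \<in> carrier_vec 7" by (rule mult_mat_vec_carrier[OF Pc(2) head_carrier])
    have Pu: "P' *\<^sub>v head u \<in> carrier_vec 7" by (rule mult_mat_vec_carrier[OF Pc(2) head_carrier])
    have "N *\<^sub>v (P' *\<^sub>v head v) = (P\<^sup>T * A) *\<^sub>v (P *\<^sub>v (P' *\<^sub>v head v))"
      unfolding P(2) by (rule assoc_mult_mat_vec[of _ 7 7]) (use Pc A Pv in auto)
    also have "\<dots> = P\<^sup>T *\<^sub>v (A *\<^sub>v head v)"
      unfolding canc(1)[OF head_carrier] by (rule assoc_mult_mat_vec[of _ 7 7]) (use Pc A in auto)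
    finally have "scalar_prod (P' *\<^sub>v head u) (N *\<^sub>v (P' *\<^sub>v head v)) = scalar_prod (P\<^sup>T *\<^sub>v (A *\<^sub>v head v)) (P' *\<^sub>v head u)"
      using Pc Pu w by (simp add: comm_scalar_prod[of _ 7])
    also have "\<dots> = scalar_prod (A *\<^sub>v head v) (P *\<^sub>v (P' *\<^sub>v head u))"
      by (rule transpose_vec_mult_scalar[OF Pc(1) Pu w])
    also have "\<dots> = scalar_prod (head u) (A *\<^sub>v head v)"
      unfolding canc(1)[OF head_carrier] by (rule comm_scalar_prod[OF w head_carrier])
    finally have e: "scalar_prod (P' *\<^sub>v head u) (N *\<^sub>v (P' *\<^sub>v head v)) = scalar_prod (head u) (A *\<^sub>v head v)" .
    have "P' *\<^sub>v 0\<^sub>v 7 = 0\<^sub>v 7" using Pc by auto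
    then have "f P' (s *s x_basis 8) = s *s x_basis 8" for s
      using Pc by (simp add: eq_coords_iff hf[OF Pc(2)] head_smult head_x8)
    then show ?thesis unfolding alg_prod_eq_form[OF A] alg_prod_eq_form[OF N] hf[OF Pc(2)] e .
  qed
  then show ?thesis unfolding alg_isomorphic_def using lin bij by blast
qed

lemma alg_isomorphic_congr:
  assumes N: "N \<in> carrier_mat 7 7" "trivial_radical 7 N" and M: "M \<in> carrier_mat 7 7"
    and iso: "alg_isomorphic (*s) (alg_prod N) (*s) (alg_prod M)"
  shows "congr 7 M N"
proof -
  let ?z = "x_basis 8"
  obtain f where f: "Vector_Spaces.linear (*s) (*s) f" "bij f"
    "\<And>u v. f (alg_prod N u v) = alg_prod M (f u) (f v)"
    using iso unfolding alg_isomorphic_def by blast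
  interpret f: Vector_Spaces.linear "(*s)" "(*s)" f by (rule f(1))
  have head_unit: "head (x_basis (Suc 0)) \<noteq> 0\<^sub>v 7" by (subst head_x_basis) auto
  obtain u v t where t: "t \<noteq> 0" "alg_prod N u v = t *s ?z"
    using trivial_radical_pairing[OF N head_unit] by blast
  \<comment> \<open>\<open>?z\<close> is a multiple of a product, so its image is one as well and
    lies in the line of \<open>?z\<close>.\<close>
  have "t *s f ?z = alg_prod M (f u) (f v)" using f(3)[of u v] t(2) by (simp add: f.scale)
  also have "\<dots> = scalar_prod (head (f u)) (M *\<^sub>v head (f v)) *s ?z" by (rule alg_prod_eq_form[OF M])
  finally have "(1 / t) *s (t *s f ?z) = ((1 / t) * scalar_prod (head (f u)) (M *\<^sub>v head (f v))) *s ?z"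
    by (simp only: vec.scale_scale)
  then obtain l where l: "f ?z = l *s ?z" using t(1) by auto
  have l0: "l \<noteq> 0"
  proof
    assume "l = 0"
    then have "f ?z = f 0" using l by (simp add: f.zero)
    then show False using injD[OF bij_is_inj[OF f(2)]] x8_nonzero by blast
  qed
  \<comment> \<open>The map induced by \<open>f\<close> modulo \<open>?z\<close>; the last
    coordinates of the images do not enter the products.\<close>
  define P where "P = Matrix.mat 7 7 (\<lambda>(i, j). head (f (x_basis (Suc j))) $ i)"
  have Pc: "P \<in> carrier_mat 7 7" by (simp add: P_def)
  have hP: "head (f u) = P *\<^sub>v head u" for u
  proof (rule eq_vecI)
    fix i assume "i < dim_vec (P *\<^sub>v head u)"
    then have i: "i < 7" using Pc by simp
    have "f u = (\<Sum>j<7. head u $ j *s f (x_basis (Suc j))) + (coord8 u * l) *s ?z"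
      by (subst coords_expansion) (simp add: f.add f.sum f.scale of_head_def l)
    then have "head (f u) $ i = (\<Sum>j<7. head u $ j * head (f (x_basis (Suc j))) $ i)"
      using i head_x8 by (simp add: head_add head_smult) (simp add: head_def del: of_nat_Suc)
    also have "\<dots> = (P *\<^sub>v head u) $ i"
      using i by (simp add: P_def scalar_prod_def atLeast0LessThan mult.commute) (simp add: head_def del: of_nat_Suc)
    finally show "head (f u) $ i = (P *\<^sub>v head u) $ i" .
  qed (use Pc in \<open>simp add: head_def\<close>)
  have form: "l * scalar_prod x (N *\<^sub>v y) = scalar_prod (P *\<^sub>v x) (M *\<^sub>v (P *\<^sub>v y))"
    if "x \<in> carrier_vec 7" "y \<in> carrier_vec 7" for x y
  proof -
    have "f (alg_prod N (of_head x) (of_head y)) = (l * scalar_prod x (N *\<^sub>v y)) *s ?z"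
      unfolding alg_prod_eq_form[OF N(1)] head_of_head[OF that(1)] head_of_head[OF that(2)] by (simp add: f.scale l mult.commute)
    moreover have "alg_prod M (f (of_head x)) (f (of_head y)) = scalar_prod (P *\<^sub>v x) (M *\<^sub>v (P *\<^sub>v y)) *s ?z"
      unfolding alg_prod_eq_form[OF M] hP head_of_head[OF that(1)] head_of_head[OF that(2)] ..
    ultimately show ?thesis using f(3)[of "of_head x" "of_head y"] x8_nonzero by (simp add: vec.scale_cancel_right)
  qed
  obtain P' where P': "inv_pair 7 P P'"
  proof -
    have "x = 0\<^sub>v 7" if x: "x \<in> carrier_vec 7" "P *\<^sub>v x = 0\<^sub>v 7" for x
    proof -
      let ?u = "of_head x"
      have "head (f ?u) = 0\<^sub>v 7" using hP[of ?u] x head_of_head[OF x(1)] by simp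
      then have "f ?u = coord8 (f ?u) *s ?z"
        by (simp add: eq_coords_iff head_smult head_x8 coord8_smult coord8_x8)
      also have "\<dots> = f ((coord8 (f ?u) / l) *s ?z)" using l0 by (simp add: f.scale l)
      finally have "?u = (coord8 (f ?u) / l) *s ?z" by (rule injD[OF bij_is_inj[OF f(2)]])
      then have "head ?u = (coord8 (f ?u) / l) \<cdot>\<^sub>v 0\<^sub>v 7" using head_smult head_x8 by metis
      then show ?thesis using head_of_head[OF x(1)] by simp
    qed
    then show ?thesis using inv_pair_of_kernel[OF Pc] that by blast
  qed
  have lN: "l \<cdot>\<^sub>m N = P\<^sup>T * M * P"
  proof (rule eq_matI)
    fix i j assume "i < dim_row (P\<^sup>T * M * P)" "j < dim_col (P\<^sup>T * M * P)"
    then have ij: "i < 7" "j < 7" using Pc by auto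
    let ?e = "unit_vec 7 :: nat \<Rightarrow> complex Matrix.vec"
    have Pe: "P *\<^sub>v ?e j \<in> carrier_vec 7" "P *\<^sub>v ?e i \<in> carrier_vec 7" using Pc by (auto intro!: mult_mat_vec_carrier)
    have w: "M *\<^sub>v (P *\<^sub>v ?e j) \<in> carrier_vec 7" by (rule mult_mat_vec_carrier[OF M Pe(1)])
    have "(l \<cdot>\<^sub>m N) $$ (i, j) = l * scalar_prod (?e i) (N *\<^sub>v ?e j)" using ij N(1) by simp
    also have "\<dots> = scalar_prod (P *\<^sub>v ?e i) (M *\<^sub>v (P *\<^sub>v ?e j))" by (rule form) auto
    also have "\<dots> = scalar_prod (M *\<^sub>v (P *\<^sub>v ?e j)) (P *\<^sub>v ?e i)" by (rule comm_scalar_prod[OF Pe(2) w])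
    also have "\<dots> = scalar_prod (P\<^sup>T *\<^sub>v (M *\<^sub>v (P *\<^sub>v ?e j))) (?e i)"
      by (rule transpose_vec_mult_scalar[symmetric, OF Pc _ w]) simp
    also have "P\<^sup>T *\<^sub>v (M *\<^sub>v (P *\<^sub>v ?e j)) = (P\<^sup>T * M) *\<^sub>v (P *\<^sub>v ?e j)"
      by (rule assoc_mult_mat_vec[symmetric, of _ 7 7]) (use Pc M Pe in auto)
    also have "\<dots> = (P\<^sup>T * M * P) *\<^sub>v ?e j"
      by (rule assoc_mult_mat_vec[symmetric, of _ 7 7]) (use Pc M in auto)
    also have "scalar_prod ((P\<^sup>T * M * P) *\<^sub>v ?e j) (?e i) = (P\<^sup>T * M * P) $$ (i, j)"
      using ij Pc M by (simp del: index_mult_mat(1))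
    finally show "(l \<cdot>\<^sub>m N) $$ (i, j) = (P\<^sup>T * M * P) $$ (i, j)" .
  qed (use Pc N in auto)
  define s where "s = csqrt l"
  have s: "s * s = l" "s \<noteq> 0" using l0 by (auto simp: s_def simp flip: power2_eq_square)
  let ?Q = "(1 / s) \<cdot>\<^sub>m P" and ?Q' = "s \<cdot>\<^sub>m P'"
  have Qp: "inv_pair 7 ?Q ?Q'"
  proof (rule inv_pairI1)
    have "?Q * ?Q' = s \<cdot>\<^sub>m ((1 / s) \<cdot>\<^sub>m (P * P'))"
      using inv_pair_dims[OF P'] by (simp add: mat_smult_left mat_smult_right)
    also have "\<dots> = 1\<^sub>m 7" unfolding inv_pairD(3)[OF P'] by (rule eq_matI) (use s(2) in auto)
    finally show "?Q * ?Q' = 1\<^sub>m 7" .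
  qed (use inv_pairD(1,2)[OF P'] in simp_all)
  define r where "r = (1 / s) * (1 / s)"
  have "r * l = 1" unfolding r_def s(1)[symmetric] using s(2) by simp
  then have "r * (l * c) = c" for c by (metis mult.assoc mult_1)
  then have "N = r \<cdot>\<^sub>m (l \<cdot>\<^sub>m N)" by (intro eq_matI) auto
  also have "\<dots> = ?Q\<^sup>T * M * ?Q"
  proof -
    have "?Q\<^sup>T = (1 / s) \<cdot>\<^sub>m P\<^sup>T" by (rule eq_matI) auto
    moreover have "((1 / s) \<cdot>\<^sub>m P\<^sup>T) * M * ((1 / s) \<cdot>\<^sub>m P) = (1 / s) \<cdot>\<^sub>m ((1 / s) \<cdot>\<^sub>m (P\<^sup>T * M * P))"
      using Pc M by (simp add: mat_smult_left mat_smult_right)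
    moreover have "\<dots> = r \<cdot>\<^sub>m (P\<^sup>T * M * P)" unfolding r_def by (rule eq_matI) auto
    ultimately show ?thesis unfolding lN by simp
  qed
  finally show ?thesis using congrI[OF M Qp] by blast
qed

section \<open>From an abstract algebra to its form\<close>

context leibniz_algebra
begin

lemma br_add_left: "br (a + b) c = br a c + br b c"
  and br_add_right: "br c (a + b) = br c a + br c b"
  and br_scale_left: "br (scl k a) c = scl k (br a c)"
  and br_scale_right: "br c (scl k a) = scl k (br c a)"
  using linear_left linear_right by (auto simp: Vector_Spaces.linear_iff)

lemma br_zero_left: "br 0 c = 0" and br_zero_right: "br c 0 = 0"
  using br_scale_left[of 0 0 c] br_scale_right[of c 0 0] by simp_all

lemma br_sum_left: "br (sum g S) c = (\<Sum>i\<in>S. br (g i) c)"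
  by (induction S rule: infinite_finite_induct) (simp_all add: br_add_left br_zero_left)

lemma br_sum_right: "br c (sum g S) = (\<Sum>i\<in>S. br c (g i))"
  by (induction S rule: infinite_finite_induct) (simp_all add: br_add_right br_zero_right)

lemma alg_power_two: "alg_power 2 = span {br a b | a b. True}"
  by (simp add: numeral_2_eq_2)

text \<open>If \<open>br a z\<close> were a nonzero multiple of \<open>z\<close>, then
  \<open>z\<close> would lie in all powers of the algebra. For the other side, \<open>z\<close> is a
  multiple of some \<open>br b c\<close>, and the Leibniz identity expresses
  \<open>br (br b c) a\<close> through products whose right factor is a multiple of
  \<open>z\<close>.\<close>

lemma central_of_nilpotent:
  assumes nil: "is_nilpotent" and A2: "alg_power 2 = span {z}" and z: "z \<noteq> 0"
  shows "br a z = 0" "br z a = 0"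
proof -
  have in_z: "\<exists>k. br a b = scl k z" for a b
  proof -
    have "br a b \<in> span {z}" unfolding A2[symmetric] alg_power_two by (rule span_base) auto
    then show ?thesis by (auto simp: span_singleton)
  qed
  have right: "br a z = 0" for a
  proof (rule ccontr)
    assume nz: "br a z \<noteq> 0"
    obtain k where k: "br a z = scl k z" using in_z by blast
    then have "k \<noteq> 0" using nz by auto
    then have zk: "z = scl (1 / k) (br a z)" unfolding k by simp
    have "z \<in> alg_power i" for i
    proof (induction i)
      case (Suc i)
      have "scl (1 / k) (br a z) \<in> span {br a b | a b. a \<in> UNIV \<and> b \<in> alg_power i}"
        using Suc by (intro span_scale span_base) blast
      then show ?case using zk by simp
    qed simp
    then show False using nil z unfolding is_nilpotent_def by blast
  qed
  then show "br a z = 0" .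
  have "\<exists>b c. br b c \<noteq> 0"
  proof (rule ccontr)
    assume "\<not> ?thesis"
    then have "{br a b | a b. True} = {0}" by auto
    then have "span {z} = {0}" using A2 unfolding alg_power_two by simp
    then show False using z span_base[of z "{z}"] by simp
  qed
  then obtain b c where bc: "br b c \<noteq> 0" by blast
  obtain k where k: "br b c = scl k z" using in_z by blast
  have "br b (br c a) = 0" "br c (br b a) = 0"
    using in_z[of c a] in_z[of b a] right by (auto simp: br_scale_right)
  then have "scl k (br z a) = 0" using leibniz[of b c a] by (simp add: k br_scale_left)
  then show "br z a = 0" using bc k by auto
qed

text \<open>The line of \<open>a\<close> is an ideal since \<open>a\<close> annihilates everything.
  A linear complement containing \<open>z\<close> is an ideal as well, because all products are
  multiples of \<open>z\<close>.\<close>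

lemma split_of_common_radical:
  assumes A2: "\<And>b c. br b c \<in> span {z}" and z: "z \<noteq> 0" and a: "a \<notin> span {z}"
    and rad: "\<And>b. br a b = 0" "\<And>b. br b a = 0"
  shows "is_split"
proof -
  have "independent {z}" using z by (simp add: dependent_single)
  then have ind: "independent {a, z}" by (rule independent_insertI[OF a])
  define B where "B = extend_basis {a, z}"
  have B: "{a, z} \<subseteq> B" "independent B" "span B = UNIV"
    using ind by (auto simp: B_def independent_extend_basis dest: extend_basis_superset)
  have az: "z \<noteq> a" using a span_base[of z "{z}"] by auto
  let ?J = "span (B - {a})"
  have zJ: "span {z} \<subseteq> ?J" using B(1) az by (intro span_mono) auto
  have "is_ideal (span {a})" unfolding is_ideal_def
  proof (intro conjI allI ballI subspace_span)
    fix b x assume "x \<in> span {a}"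
    then obtain k where "x = scl k a" by (auto simp: span_singleton)
    then show "br b x \<in> span {a}" "br x b \<in> span {a}" using rad by (simp_all add: br_scale_left br_scale_right span_zero)
  qed
  moreover have "is_ideal ?J" unfolding is_ideal_def
    by (intro conjI allI ballI subspace_span subsetD[OF zJ] A2)
  moreover have "a \<noteq> 0" using a span_zero by metis
  then have "span {a} \<noteq> {0}" using span_base[of a "{a}"] by blast
  moreover have "?J \<noteq> {0}" using zJ z span_base[of z "{z}"] by auto
  moreover have "span {a} \<inter> ?J = {0}"
  proof (intro equalityI subsetI)
    fix x assume x: "x \<in> span {a} \<inter> ?J"
    then obtain k where k: "x = scl k a" by (auto simp: span_singleton)
    have "k = 0"
    proof (rule ccontr)
      assume "k \<noteq> 0"
      then have "a = scl (1 / k) x" by (simp add: k)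
      then have "a \<in> ?J" using x span_scale by auto
      then show False using B(1,2) unfolding dependent_def by blast
    qed
    then show "x \<in> {0}" using k by simp
  qed (simp add: span_zero)
  moreover have "{x + y | x y. x \<in> span {a} \<and> y \<in> ?J} = UNIV"
  proof -
    have "insert a (B - {a}) = B" using B(1) by auto
    then show ?thesis using B(3) span_Un[of "{a}" "B - {a}"] by simp
  qed
  ultimately show ?thesis unfolding is_split_def by blast
qed

end

lemma alg_isomorphic_sym:
  assumes "alg_isomorphic scl1 br1 scl2 br2"
  shows "alg_isomorphic scl2 br2 scl1 br1"
proof -
  obtain f where f: "Vector_Spaces.linear scl1 scl2 f" "bij f" "\<And>a b. f (br1 a b) = br2 (f a) (f b)"
    using assms unfolding alg_isomorphic_def by blast
  let ?g = "inv_into UNIV f"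
  have fg: "f (?g x) = x" "?g (f y) = y" for x y
    using f(2) by (simp_all add: bij_is_surj surj_f_inv_f bij_is_inj)
  have e: "?g x = y \<longleftrightarrow> x = f y" for x y using fg by metis
  have "Vector_Spaces.linear scl2 scl1 ?g"
    using f(1) by (simp add: Vector_Spaces.linear_iff e fg)
  moreover have "?g (br2 a b) = br1 (?g a) (?g b)" for a b by (simp add: e f(3) fg)
  ultimately show ?thesis unfolding alg_isomorphic_def using bij_imp_bij_inv[OF f(2)] by blast
qed

lemma alg_isomorphic_trans:
  assumes "alg_isomorphic scl1 br1 scl2 br2" "alg_isomorphic scl2 br2 scl3 br3"
  shows "alg_isomorphic scl1 br1 scl3 br3"
proof -
  obtain f where f: "Vector_Spaces.linear scl1 scl2 f" "bij f" "\<And>a b. f (br1 a b) = br2 (f a) (f b)"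
    using assms(1) unfolding alg_isomorphic_def by blast
  obtain g where g: "Vector_Spaces.linear scl2 scl3 g" "bij g" "\<And>a b. g (br2 a b) = br3 (g a) (g b)"
    using assms(2) unfolding alg_isomorphic_def by blast
  have "Vector_Spaces.linear scl1 scl3 (g \<circ> f)" using f(1) g(1) by (simp add: Vector_Spaces.linear_iff)
  then show ?thesis unfolding alg_isomorphic_def
    using bij_comp[OF f(2) g(2)] f(3) g(3) by (intro exI[of _ "g \<circ> f"]) simp
qed

lemma (in leibniz_algebra) adapted_basis:
  assumes d: "dim UNIV = 8" and z: "z \<noteq> 0"
  shows "\<exists>e :: nat \<Rightarrow> 'a. bij_betw e {..<8} (e ` {..<8}) \<and> independent (e ` {..<8}) \<and> span (e ` {..<8}) = UNIV \<and> e 7 = z"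
proof -
  have ind: "independent {z}" using z by (simp add: dependent_single)
  define B where "B = extend_basis {z}"
  have B: "z \<in> B" "independent B" "span B = UNIV"
    using extend_basis_superset[OF ind] independent_extend_basis[OF ind] span_extend_basis[OF ind] by (auto simp: B_def)
  have card: "card B = 8" using dim_eq_card[of B UNIV] B d by simp
  then have fin: "finite B" by (intro card_ge_0_finite) simp
  obtain e :: "nat \<Rightarrow> 'a" where e: "bij_betw e {0..<7} (B - {z})"
    using ex_bij_betw_nat_finite[of "B - {z}"] fin card B(1) by auto
  let ?e = "e(7 := z)"
  have img: "?e ` {0..<7} = B - {z}" using bij_betw_imp_surj_on[OF e] by auto
  have ins: "{..<8} = insert 7 {0..<7::nat}" by auto
  have im: "?e ` {..<8} = B" unfolding ins image_insert img using B(1) by auto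
  have "card (?e ` {..<8}) = card {..<8::nat}" unfolding im card by simp
  then have "inj_on ?e {..<8}" by (rule eq_card_imp_inj_on[rotated]) simp
  then show ?thesis using B im by (intro exI[of _ ?e]) (simp add: bij_betw_def)
qed

lemma target_algebra_isomorphic_alg_prod:
  fixes scl :: "complex \<Rightarrow> 'a::ab_group_add \<Rightarrow> 'a"
  assumes "target_algebra scl br"
  shows "\<exists>A\<in>carrier_mat 7 7. trivial_radical 7 A \<and> alg_isomorphic scl br (*s) (alg_prod A)"
proof -
  interpret L: leibniz_algebra scl br using assms by (simp add: target_algebra_def)
  have nil: "L.is_nilpotent" and d8: "L.dim UNIV = 8" and d2: "L.dim (L.alg_power 2) = 1" and ns: "\<not> L.is_split"
    using assms by (auto simp: target_algebra_def)
  obtain B2 where B2: "B2 \<subseteq> L.alg_power 2" "L.independent B2" "L.alg_power 2 \<subseteq> L.span B2" "card B2 = 1"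
    using L.basis_exists[of "L.alg_power 2"] d2 by metis
  obtain z where Bz: "B2 = {z}" using B2(4) by (auto simp: card_1_singleton_iff)
  have z: "z \<noteq> 0" using B2(2) unfolding Bz by (simp add: L.dependent_single)
  have A2: "L.alg_power 2 = L.span {z}"
  proof
    show "L.span {z} \<subseteq> L.alg_power 2"
      using B2(1) unfolding Bz L.alg_power_two by (intro L.span_minimal L.subspace_span) auto
  qed (use B2(3) Bz in simp)
  note central = L.central_of_nilpotent[OF nil A2 z]
  have brz: "br a b \<in> L.span {z}" for a b unfolding A2[symmetric] L.alg_power_two by (rule L.span_base) auto
  have "\<forall>a b. \<exists>k. br a b = scl k z" using brz unfolding L.span_singleton by blast
  then obtain \<beta> where \<beta>: "\<And>a b. br a b = scl (\<beta> a b) z" by metis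
  obtain e :: "nat \<Rightarrow> 'a" where e: "bij_betw e {..<8} (e ` {..<8})" "L.independent (e ` {..<8})" "L.span (e ` {..<8}) = UNIV" "e 7 = z"
    using L.adapted_basis[OF d8 z] by blast
  have inj: "inj_on e {..<8}" using e(1) by (rule bij_betw_imp_inj_on)
  \<comment> \<open>The Gram matrix of the form in a basis whose last vector is \<open>z\<close>;
    centrality of \<open>z\<close> makes the seven remaining vectors sufficient.\<close>
  define A where "A = Matrix.mat 7 7 (\<lambda>(i, j). \<beta> (e i) (e j))"
  have A: "A \<in> carrier_mat 7 7" by (simp add: A_def)
  define g where "g u = (\<Sum>i<7. scl (head u $ i) (e i)) + scl (coord8 u) z" for u
  have lin: "Vector_Spaces.linear (*s) scl g"
    unfolding Vector_Spaces.linear_iff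
  proof (intro conjI allI vec.vector_space_axioms L.vector_space_axioms)
    fix u v
    have "(\<Sum>i<7. scl (head (u + v) $ i) (e i)) = (\<Sum>i<7. scl (head u $ i) (e i) + scl (head v $ i) (e i))"
      by (intro sum.cong refl) (simp add: head_def L.scale_left_distrib)
    then show "g (u + v) = g u + g v" by (simp add: g_def coord8_add L.scale_left_distrib sum.distrib)
  next
    fix c u
    have "(\<Sum>i<7. scl (head (c *s u) $ i) (e i)) = (\<Sum>i<7. scl c (scl (head u $ i) (e i)))"
      by (intro sum.cong refl) (simp add: head_def)
    then show "g (c *s u) = scl c (g u)" by (simp add: g_def coord8_smult L.scale_right_distrib L.scale_sum_right)
  qed
  have g_coords: "g u = (\<Sum>i<8. scl (if i < 7 then head u $ i else coord8 u) (e i))" for u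
  proof -
    have "{..<8} = insert 7 {..<7::nat}" by auto
    then show ?thesis by (simp add: g_def e(4))
  qed
  have inj_g: "u = 0" if "g u = 0" for u
  proof -
    let ?c = "\<lambda>i. if i < 7 then head u $ i else coord8 u"
    \<comment> \<open>Linear independence is stated for coefficients indexed by the basis vectors
      themselves, so the coordinates are pulled back along \<open>e\<close>.\<close>
    define c where "c = ?c \<circ> inv_into {..<8} e"
    have c: "c (e i) = ?c i" if "i < 8" for i
    proof -
      have "inv_into {..<8} e (e i) = i" using that by (simp add: inv_into_f_f[OF inj])
      then show ?thesis unfolding c_def o_apply by (rule arg_cong)
    qed
    have "(\<Sum>b\<in>e ` {..<8}. scl (c b) b) = (\<Sum>i<8. scl (?c i) (e i))"
      unfolding sum.reindex[OF inj] by (intro sum.cong refl) (simp add: c)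
    then have 0: "(\<Sum>b\<in>e ` {..<8}. scl (c b) b) = 0" using that g_coords by simp
    have ci: "?c i = 0" if i: "i < 8" for i
      unfolding c[OF i, symmetric] by (rule L.independentD[OF e(2) _ order_refl 0]) (use i in auto)
    have "head u = 0\<^sub>v 7"
    proof (rule eq_vecI)
      fix i assume "i < dim_vec (0\<^sub>v 7 :: complex Matrix.vec)"
      then show "head u $ i = 0\<^sub>v 7 $ i" using ci[of i] by simp
    qed (simp add: head_def)
    moreover have "coord8 u = 0" using ci[of 7] by simp
    ultimately show ?thesis by (simp add: eq_coords_iff head_zero coord8_zero)
  qed
  interpret g: Vector_Spaces.linear "(*s)" scl g by (rule lin)
  have "inj g"
  proof (rule injI)
    fix u v assume "g u = g v"
    then have "g (u - v) = 0" by (simp add: g.diff)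
    then show "u = v" using inj_g[of "u - v"] by simp
  qed
  moreover have "surj g"
  proof -
    have "\<exists>u. a = g u" for a
    proof -
      have "a \<in> L.span (e ` {..<8})" using e(3) by simp
      then obtain c where "a = (\<Sum>b\<in>e ` {..<8}. scl (c b) b)" by (auto simp: L.span_finite)
      then have a: "a = (\<Sum>i<8. scl (c (e i)) (e i))" unfolding sum.reindex[OF inj] by simp
      let ?x = "Matrix.vec 7 (\<lambda>i. c (e i))"
      let ?u = "of_head ?x + c (e 7) *s x_basis 8"
      have "head ?u = ?x" "coord8 ?u = c (e 7)"
        by (auto simp: head_add head_smult coord8_add coord8_smult head_of_head coord8_of_head head_x8 coord8_x8)
      then have "g ?u = (\<Sum>i<8. scl (c (e i)) (e i))"
        unfolding g_def e(4)[symmetric] lessThan_Suc[of 7, simplified] by simp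
      then show ?thesis using a by metis
    qed
    then show ?thesis by (metis surjI)
  qed
  ultimately have bij: "bij g" by (rule bijI)
  have gz: "g (s *s x_basis 8) = scl s z" for s
    by (simp add: g_def head_smult head_x8 coord8_smult coord8_x8)
  have hom: "g (alg_prod A u v) = br (g u) (g v)" for u v
  proof -
    have l: "br (g u) b = (\<Sum>i<7. scl (head u $ i) (br (e i) b))" for b
      by (simp add: g_def L.br_add_left L.br_sum_left L.br_scale_left central)
    have r: "br a (g v) = (\<Sum>j<7. scl (head v $ j) (br a (e j)))" for a
      by (simp add: g_def L.br_add_right L.br_sum_right L.br_scale_right central)
    have "br (g u) (g v) = (\<Sum>i<7. \<Sum>j<7. scl (head u $ i) (scl (head v $ j) (br (e i) (e j))))"
      unfolding l unfolding r L.scale_sum_right ..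
    also have "\<dots> = scl (\<Sum>i<7. head u $ i * (\<Sum>j<7. A $$ (i, j) * head v $ j)) z"
      unfolding L.scale_sum_left sum_distrib_left
      by (intro sum.cong refl) (simp add: A_def \<beta>[of "e _" "e _"] mult.assoc mult.left_commute mult.commute)
    also have "(\<Sum>i<7. head u $ i * (\<Sum>j<7. A $$ (i, j) * head v $ j)) = scalar_prod (head u) (A *\<^sub>v head v)"
      using A by (simp add: scalar_prod_def atLeast0LessThan head_def)
    finally show ?thesis unfolding alg_prod_eq_form[OF A] gz by simp
  qed
  have iso: "alg_isomorphic scl br (*s) (alg_prod A)"
    by (rule alg_isomorphic_sym) (use lin bij hom in \<open>auto simp: alg_isomorphic_def\<close>)
  moreover have "trivial_radical 7 A" unfolding trivial_radical_def
  proof (intro ballI impI, rule ccontr)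
    fix x assume x: "x \<in> carrier_vec 7" "A *\<^sub>v x = 0\<^sub>v 7" "A\<^sup>T *\<^sub>v x = 0\<^sub>v 7" "x \<noteq> 0\<^sub>v 7"
    let ?a = "g (of_head x)"
    have "scalar_prod y (A *\<^sub>v x) = 0" "scalar_prod x (A *\<^sub>v y) = 0" if y: "y \<in> carrier_vec 7" for y
    proof -
      show "scalar_prod y (A *\<^sub>v x) = 0" unfolding x(2) using y by simp
      have "scalar_prod x (A *\<^sub>v y) = scalar_prod (A\<^sup>T *\<^sub>v x) y"
        by (rule transpose_vec_mult_scalar[symmetric, OF A y x(1)])
      then show "scalar_prod x (A *\<^sub>v y) = 0" unfolding x(3) using y by simp
    qed
    then have "alg_prod A v (of_head x) = 0" "alg_prod A (of_head x) v = 0" for v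
      unfolding alg_prod_eq_form[OF A] head_of_head[OF x(1)] by simp_all
    then have r: "br ?a (g v) = 0" "br (g v) ?a = 0" for v using hom g.zero by metis+
    have "br ?a b = 0" "br b ?a = 0" for b
      using r[of "inv_into UNIV g b"] bij by (simp_all add: bij_is_surj surj_f_inv_f)
    moreover have "?a \<notin> L.span {z}"
    proof
      assume "?a \<in> L.span {z}"
      then obtain s where "?a = scl s z" by (auto simp: L.span_singleton)
      then have "of_head x = s *s x_basis 8" using injD[OF \<open>inj g\<close>] gz by metis
      then have "x = s \<cdot>\<^sub>v 0\<^sub>v 7" using head_of_head[OF x(1)] head_smult head_x8 by metis
      then show False using x(4) by simp
    qed
    ultimately show False using L.split_of_common_radical[OF brz z] ns by blast
  qed
  ultimately show ?thesis using A by blast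
qed

section \<open>The entries have trivial radical\<close>

lemma trivial_radical_dsum:
  assumes A: "A \<in> carrier_mat n n" "trivial_radical n A" and B: "B \<in> carrier_mat m m" "trivial_radical m B"
  shows "trivial_radical (n + m) (dsum A B)"
  unfolding trivial_radical_def
proof (intro ballI impI)
  fix x assume x: "x \<in> carrier_vec (n + m)" "dsum A B *\<^sub>v x = 0\<^sub>v (n + m)" "(dsum A B)\<^sup>T *\<^sub>v x = 0\<^sub>v (n + m)"
  obtain u v where uv: "x = u @\<^sub>v v" "u \<in> carrier_vec n" "v \<in> carrier_vec m"
    using vec_first_last_append[of x n m] x(1) by (metis vec_first_carrier vec_last_carrier)
  have z: "C *\<^sub>v u = 0\<^sub>v n \<and> D *\<^sub>v v = 0\<^sub>v m"
    if "C \<in> carrier_mat n n" "D \<in> carrier_mat m m" "dsum C D *\<^sub>v x = 0\<^sub>v (n + m)" for C D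
  proof -
    have "(C *\<^sub>v u) @\<^sub>v (D *\<^sub>v v) = 0\<^sub>v n @\<^sub>v 0\<^sub>v m"
      using that(3) unfolding uv(1) dsum_mult_vec[OF that(1,2) uv(2,3)] append_zero_vec .
    then show ?thesis
      using append_vec_eq[OF mult_mat_vec_carrier[OF that(1) uv(2)], of "0\<^sub>v n"] by simp
  qed
  have "A *\<^sub>v u = 0\<^sub>v n" "B *\<^sub>v v = 0\<^sub>v m" using z[OF A(1) B(1) x(2)] by auto
  moreover have "A\<^sup>T *\<^sub>v u = 0\<^sub>v n" "B\<^sup>T *\<^sub>v v = 0\<^sub>v m"
    using z[of "A\<^sup>T" "B\<^sup>T"] A(1) B(1) x(3) by (auto simp: dsum_transpose)
  ultimately have "u = 0\<^sub>v n" "v = 0\<^sub>v m" using A(2) B(2) uv unfolding trivial_radical_def by blast+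
  then show "x = 0\<^sub>v (n + m)" unfolding uv(1) by (simp add: append_zero_vec)
qed

text \<open>The rows of the matrix read off all coordinates except number 0, and that one is read
  off by row \<open>k + 1\<close> of the transpose, which exists because \<open>k\<close> is
  positive.\<close>

lemma trivial_radical_matA:
  assumes "k > 0"
  shows "trivial_radical (2 * k + 1) (matA k)"
  unfolding trivial_radical_def
proof (intro ballI impI)
  let ?n = "2 * k + 1"
  fix x assume x: "x \<in> carrier_vec ?n" "matA k *\<^sub>v x = 0\<^sub>v ?n" "(matA k)\<^sup>T *\<^sub>v x = 0\<^sub>v ?n"
  have 1: "(if i < k then x $ (k + 1 + i) else if i = k then 0 else x $ (i - k)) = 0" if "i < ?n" for i
    using matA_mult_vec(1)[OF x(1) that] that unfolding x(2) by simp
  have 2: "(if i = 0 then 0 else if i \<le> k then x $ (k + i) else x $ (i - k - 1)) = 0" if "i < ?n" for i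
    using matA_mult_vec(2)[OF x(1) that] that unfolding x(3) by simp
  show "x = 0\<^sub>v ?n"
  proof (rule eq_vecI)
    fix i assume "i < dim_vec (0\<^sub>v ?n :: complex Matrix.vec)"
    then consider "i = 0" | "0 < i" "i \<le> k" | "k < i" "i < ?n" by force
    then have "x $ i = 0"
    proof cases
      case 1
      then show ?thesis using 2[of "k + 1"] assms by simp
    next
      case 2
      then show ?thesis using 1[of "k + i"] by simp
    next
      case 3
      then obtain j where "i = k + 1 + j" "j < k" using less_iff_Suc_add[of k i] by auto
      then show ?thesis using 1[of j] by simp
    qed
    then show "x $ i = 0\<^sub>v ?n $ i" using \<open>i < dim_vec (0\<^sub>v ?n)\<close> by simp
  qed (use x(1) in simp)
qed

text \<open>For blocks other than A, a vector in both kernels is in the kernel of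
  \<open>M^T - \<mu> M\<close> for every \<mu>, in particular for one at which this matrix is
  invertible.\<close>

lemma trivial_radical_block:
  assumes M: "M \<in> block_mats b"
  shows "trivial_radical (block_size b) M"
proof (cases "singular_block b")
  case True
  then show ?thesis
    using M trivial_radical_matA[of 1] trivial_radical_matA[of 2] trivial_radical_matA[of 3] by (cases b) auto
next
  case False
  let ?n = "block_size b"
  have Mc: "M \<in> carrier_mat ?n ?n" using block_mats_dim[OF M] by auto
  obtain F where F: "finite F" "\<forall>\<mu>. \<mu> \<notin> F \<longrightarrow> (\<exists>js. asym_nf \<mu> M js \<and> map (jordan_code \<mu>) js = block_profile b)"
    using block_profile_asym_nf[OF False M] by blast
  obtain \<mu> where "\<mu> \<notin> F" using F(1) by (metis ex_new_if_finite infinite_UNIV_char_0)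
  then have reg: "regular_at \<mu> ?n M" using F(2) regular_at_asym_nf[OF _ Mc] by blast
  show ?thesis unfolding trivial_radical_def
  proof (intro ballI impI)
    fix x assume x: "x \<in> carrier_vec ?n" "M *\<^sub>v x = 0\<^sub>v ?n" "M\<^sup>T *\<^sub>v x = 0\<^sub>v ?n"
    show "x = 0\<^sub>v ?n" by (rule regular_at_kernel[OF reg x(1)], unfold x(2,3)) auto
  qed
qed

lemma trivial_radical_diag_block:
  assumes "list_all2 (\<in>) Ns (map block_mats bs)"
  shows "diag_block_mat Ns \<in> carrier_mat (sum_list (map block_size bs)) (sum_list (map block_size bs)) \<and>
    trivial_radical (sum_list (map block_size bs)) (diag_block_mat Ns)"
  using assms
proof (induction bs arbitrary: Ns)
  case Nil
  then show ?case by (auto simp: trivial_radical_def)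
next
  case (Cons b bs)
  then obtain M Ms where N: "Ns = M # Ms" "M \<in> block_mats b" "list_all2 (\<in>) Ms (map block_mats bs)"
    by (auto simp: list_all2_Cons2)
  have M: "M \<in> carrier_mat (block_size b) (block_size b)" using block_mats_dim[OF N(2)] by auto
  note IH = Cons.IH[OF N(3)]
  show ?case
    using dsum_carrier[OF M conjunct1[OF IH]]
      trivial_radical_dsum[OF M trivial_radical_block[OF N(2)] conjunct1[OF IH] conjunct2[OF IH]]
    by (simp add: N(1) diag_block_Cons)
qed

lemma trivial_radical_entry:
  assumes "bs \<in> set entries" "N \<in> entry_mats bs"
  shows "trivial_radical 7 N"
proof -
  obtain Ns where Ns: "list_all2 (\<in>) Ns (map block_mats bs)" "N = diag_block_mat Ns"
    using assms(2) by (auto simp: entry_mats_def listset_iff)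
  have "sum_list (map block_size bs) = 7"
    using trivial_radical_diag_block[OF Ns(1)] entry_mats_carrier[OF assms] Ns(2) by (metis carrier_matD(1))
  then show ?thesis using trivial_radical_diag_block[OF Ns(1)] Ns(2) by simp
qed

theorem mainTheorem6:
  shows
    "(\<forall>(scl :: complex \<Rightarrow> 'a::ab_group_add \<Rightarrow> 'a) br.
        target_algebra scl br \<longrightarrow>
        (\<exists>bs\<in>set entries. \<exists>N\<in>entry_mats bs. alg_isomorphic scl br (*s) (alg_prod N)))
   \<and> length entries = 74
   \<and> (\<forall>bs\<in>set entries. \<forall>N\<in>entry_mats bs. target_algebra (*s) (alg_prod N))
   \<and> (\<forall>i<length entries. \<forall>j<length entries. i \<noteq> j \<longrightarrow>
        (\<forall>N\<in>entry_mats (entries ! i). \<forall>M\<in>entry_mats (entries ! j).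
           \<not> alg_isomorphic (*s) (alg_prod N) (*s) (alg_prod M)))"
proof (intro conjI allI impI ballI notI)
  fix scl :: "complex \<Rightarrow> 'a \<Rightarrow> 'a" and br
  assume "target_algebra scl br"
  then obtain A where A: "A \<in> carrier_mat 7 7" "trivial_radical 7 A" "alg_isomorphic scl br (*s) (alg_prod A)"
    using target_algebra_isomorphic_alg_prod by blast
  obtain bs N where N: "bs \<in> set entries" "N \<in> entry_mats bs" "congr 7 A N" using entry_form[OF A(1,2)] by blast
  have "alg_isomorphic scl br (*s) (alg_prod N)"
    by (rule alg_isomorphic_trans[OF A(3) congr_alg_isomorphic[OF N(3)]])
  then show "\<exists>bs\<in>set entries. \<exists>N\<in>entry_mats bs. alg_isomorphic scl br (*s) (alg_prod N)" using N(1,2) by blast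
next
  show "length entries = 74" by code_simp
next
  fix bs N assume "bs \<in> set entries" "N \<in> entry_mats bs"
  then show "target_algebra (*s) (alg_prod N)"
    by (intro trivial_radical_target_algebra entry_mats_carrier trivial_radical_entry)
next
  fix i j N M
  assume ij: "i < length entries" "j < length entries" "i \<noteq> j"
    and N: "N \<in> entry_mats (entries ! i)" and M: "M \<in> entry_mats (entries ! j)"
    and iso: "alg_isomorphic (*s) (alg_prod N) (*s) (alg_prod M)"
  have e: "entries ! i \<in> set entries" "entries ! j \<in> set entries" using ij by auto
  have "congr 7 M N"
    by (rule alg_isomorphic_congr[OF entry_mats_carrier[OF e(1) N] trivial_radical_entry[OF e(1) N]
      entry_mats_carrier[OF e(2) M] iso])
  then have "entry_profile (entries ! j) = entry_profile (entries ! i)"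
    by (rule entries_not_congruent[OF e(2) M e(1) N])
  then show False using distinct_entry_profiles ij by (auto simp: distinct_conv_nth)
qed

end
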